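(* Let $M>0$, and let $\phi_M$, $\rho_0(M)$ and $\rho_2'$ be the conformal factor, the inner radius and the radius of the sphere of mean curvature $-2$ of the anti-de Sitter-Schwarzschild metric of parameter $M$. Let $\rho_0(M)<\tau_1<\tau_2<\rho_2'$ and let $\psi=\psi(\rho)$ be a $C^{2,1}$ function on $[0,\infty)$ such that $\psi>1$, $\psi$ is constant on $[0,\tau_1]$, $\psi=\phi_M$ on $[\tau_2,\infty)$, and the metric $\psi^4 ds^2_{\mathbb{H}^3}$ has scalar curvature $>-6$ on $B(\tau_2)$. Put $$f=\Delta_{\mathbb{H}^3}\psi+\tfrac34\psi(1-\psi^4),$$ and for $\epsilon>0$ put $f_\epsilon=f\chi_\epsilon$, where $0\le\chi_\epsilon\le1$ is a cutoff function on $[0,\infty)$ (as a function of $\rho$) with $\chi_\epsilon=1$ on $[0,\tau_2-\epsilon)$ and $\chi_\epsilon=0$ on $[\tau_2-\frac12\epsilon,\infty)$. Then for any $\epsilon$ with $0<\epsilon<\tau_2$ there is a unique function $\phi_\epsilon$ on $\mathbb{H}^3$, depending only on $\rho$, such that: (i) $\Delta_{\mathbb{H}^3}\phi_\epsilon+\frac34\phi_\epsilon(1-\phi_\epsilon^4)=f_\epsilon$, and hence the scalar curvature of the metric $g_\epsilon=\phi_\epsilon^4ds^2_{\mathbb{H}^3}$ is not less than $-6$ in $B(\tau_2)$ and is $-6$ outside $B(\tau_2)$. (ii) $\psi>\phi_\epsilon>1$ and $\lim_{\rho\to\infty}\phi_\epsilon=1$. (iii) $\psi(x)-\phi_\epsilon(x)\le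 C(\epsilon)e^{-3\rho(x)}$ in $\mathbb{H}^3\setminus B(\tau_2)$, where $C(\epsilon)\to0$ as $\epsilon\to0$. (iv) $\phi_\epsilon^4ds^2_{\mathbb{H}^3}$ equals the anti-de Sitter-Schwarzschild metric $g_{\text{AdS-Sch},M_\epsilon}$ for some $M_\epsilon>0$ on $\mathbb{H}^3\setminus B(\tau_2)$. In particular, $g_\epsilon$ is asymptotically hyperbolic. Moreover, if $\epsilon>0$ is small enough, then $\tau_2<\rho_{2,\epsilon}'$, where $\rho=\rho_{2,\epsilon}'$ is the sphere with constant mean curvature $-2$ in the metric $g_{\text{AdS-Sch},M_\epsilon}$. (v) With $M_\epsilon$ as in (iv), $M-M_\epsilon\le C(\epsilon)$, where $C(\epsilon)\to0$ as $\epsilon\to0$.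
   Context: Hyperbolic space $\mathbb{H}^3$ carries the metric $ds^2_{\mathbb{H}^3}=d\rho^2+\sinh^2\rho\,d\sigma^2$, where $d\sigma^2$ is the standard metric on $\mathbb{S}^2$ and $\rho$ is the distance from a fixed origin; in the ball model it is $\frac{4}{(1-\tau^2)^2}(d\tau^2+\tau^2d\sigma^2)$ with $\tau=|x|=\frac{e^\rho-1}{e^\rho+1}$. $B(s)$ denotes the geodesic ball $\{\rho<s\}$. Anti-de Sitter-Schwarzschild metric: for $M>0$ let $a(M)>0$ be the unique positive root of $1+r^2-\frac Mr=0$, and for $r\ge a(M)$ let $h(r)=\int_r^\infty\frac{dt}{\sqrt{t(t+t^3-M)}}$. The relation $\rho=\log\left(\coth\frac{h(r)}2\right)$ defines an increasing bijection $r\mapsto\rho$ from $[a(M),\infty)$ onto $[\rho(M),\infty)$, with $\rho(M)=\log\coth\frac{h(a(M))}{2}>0$; write $r=r(\rho)$ for the inverse. Put $b=b(M)=\frac{e^{\rho(M)}-1}{e^{\rho(M)}+1}$ and $\rho_0(M)=\log\frac{1+b^2}{1-b^2}$. For $b\le\tau<1$ let $\Psi(\tau)=\left(\frac{r(\rho)}{\sinh\rho}\right)^{1/2}$ with $\rho=\log\frac{1+\tau}{1-\tau}$. Define $\phi_M$ on $b^2<\tau<1$ (equivalently $\rho>\rho_0(M)$) by $\phi_M=\Psi(\tau)$ for $b\le\tau<1$ and $\phi_M=b\,\Psi\!\left(\frac{b^2}{\tau}\right)\left(\frac{1-\tau^2}{\tau^2-b^4}\right)^{1/2}$ for $b^2<\tau\le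 b$. It is a smooth positive function, and $g_{\text{AdS-Sch},M}=\phi_M^4\,ds^2_{\mathbb{H}^3}$ on $\{\rho>\rho_0(M)\}$ is the anti-de Sitter-Schwarzschild metric; it has scalar curvature $-6$. There are unique $\rho_2>\rho_1>\rho_2'>\rho_0(M)$ such that in this metric the spheres $\rho=\rho_2,\rho_1,\rho_2'$ have mean curvature $2,0,-2$ respectively with respect to the unit normal in the direction $\frac{\partial}{\partial\rho}$. Asymptotically hyperbolic (AH): a complete noncompact Riemannian 3-manifold $(X,g)$ is AH if there is a compact manifold $(\overline X,\overline g)$ with boundary $\partial X$ and a smooth function $t$ on $\overline X$ such that: $X=\overline X\setminus\partial X$; $t=0$ on $\partial X$ and $t>0$ on $X$; $\overline g=t^2 g$ extends to be $C^3$ up to the boundary; $|dt|_{\overline g}=1$ at $\partial X$; and each component $\Sigma$ of $\partial X$ is the standard two-sphere $(\mathbb{S}^2,g_0)$ with a collar neighborhood where $g=\sinh^{-2}t\,(dt^2+g_t)$, $g_t=g_0+\frac{t^3}{3}h+O(t^4)$, $h$ a $C^2$ symmetric two-tensor on $\mathbb{S}^2$. $C(\epsilon)$ denotes a function of $\epsilon$ with $\lim_{\epsilon\to0}C(\epsilon)=0$ (not necessarily the same at each occurrence). The family of smooth cutoff functions $\chi_\epsilon$ is fixed. *)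

theory Defs
  imports "HOL-Analysis.Analysis"
begin

section \<open>Differentiability classes\<close>

(* Meaningful for open S only; for other sets see smooth_on. *)
primrec Ck_on :: "nat \<Rightarrow> 'a::euclidean_space set \<Rightarrow> ('a \<Rightarrow> 'b::real_normed_vector) \<Rightarrow> bool" where
  "Ck_on 0 S f = continuous_on S f"
| "Ck_on (Suc k) S f =
    ((\<forall>x\<in>S. f differentiable (at x)) \<and>
     (\<forall>v. Ck_on k S (\<lambda>x. frechet_derivative f (at x) v)))"

(* On a set that need not be open (half-spaces, [0,oo)) smoothness means that f has, near every
   point of S, a smooth extension to an open set. *)
definition smooth_on :: "'a::euclidean_space set \<Rightarrow> ('a \<Rightarrow> 'b::real_normed_vector) \<Rightarrow> bool" where
  "smooth_on S f \<longleftrightarrow>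
    (\<forall>x\<in>S. \<exists>W F. open W \<and> x \<in> W \<and> (\<forall>k. Ck_on k W F) \<and> (\<forall>y\<in>S \<inter> W. F y = f y))"

definition C21_halfline :: "(real \<Rightarrow> real) \<Rightarrow> bool" where
  "C21_halfline f \<longleftrightarrow> (\<exists>f1 f2 L.
     (\<forall>s\<ge>0. (f has_real_derivative f1 s) (at s within {0..})) \<and>
     (\<forall>s\<ge>0. (f1 has_real_derivative f2 s) (at s within {0..})) \<and>
     L-lipschitz_on {0..} f2)"


section \<open>Riemannian metrics in coordinates\<close>

(* A metric on an open set of R^n is given by its matrix field, g x $ i $ j = g_ij(x). *)
type_synonym 'n metric_field = "real^'n \<Rightarrow> real^'n^'n"

definition pd :: "'n::finite \<Rightarrow> (real^'n \<Rightarrow> real) \<Rightarrow> real^'n \<Rightarrow> real" where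
  "pd i u x = frechet_derivative u (at x) (axis i 1)"

definition ginv :: "'n::finite metric_field \<Rightarrow> 'n metric_field" where
  "ginv g x = matrix_inv (g x)"

(* christoffel g k i j is Gamma^k_{ij} *)
definition christoffel :: "'n::finite metric_field \<Rightarrow> 'n \<Rightarrow> 'n \<Rightarrow> 'n \<Rightarrow> real^'n \<Rightarrow> real" where
  "christoffel g k i j x = (1/2) * (\<Sum>l\<in>UNIV. ginv g x $ k $ l *
     (pd i (\<lambda>y. g y $ j $ l) x + pd j (\<lambda>y. g y $ i $ l) x - pd l (\<lambda>y. g y $ i $ j) x))"

definition ricci :: "'n::finite metric_field \<Rightarrow> 'n \<Rightarrow> 'n \<Rightarrow> real^'n \<Rightarrow> real" where
  "ricci g i j x = (\<Sum>k\<in>UNIV.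
      pd k (christoffel g k i j) x - pd j (christoffel g k i k) x +
      (\<Sum>l\<in>UNIV. christoffel g k k l x * christoffel g l i j x -
                 christoffel g k j l x * christoffel g l i k x))"

definition scalar_curvature :: "'n::finite metric_field \<Rightarrow> real^'n \<Rightarrow> real" where
  "scalar_curvature g x = (\<Sum>i\<in>UNIV. \<Sum>j\<in>UNIV. ginv g x $ i $ j * ricci g i j x)"

definition laplacian :: "'n::finite metric_field \<Rightarrow> (real^'n \<Rightarrow> real) \<Rightarrow> real^'n \<Rightarrow> real" where
  "laplacian g u x = (\<Sum>i\<in>UNIV. \<Sum>j\<in>UNIV. ginv g x $ i $ j *
     (pd i (pd j u) x - (\<Sum>k\<in>UNIV. christoffel g k i j x * pd k u x)))"

definition gradient :: "'n::finite metric_field \<Rightarrow> (real^'n \<Rightarrow> real) \<Rightarrow> real^'n \<Rightarrow> real^'n" where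
  "gradient g u x = ginv g x *v (\<chi> i. pd i u x)"

(* Unit normal of the level sets of u, pointing towards increasing u. *)
definition unit_normal :: "'n::finite metric_field \<Rightarrow> (real^'n \<Rightarrow> real) \<Rightarrow> real^'n \<Rightarrow> real^'n" where
  "unit_normal g u x =
     (1 / sqrt (gradient g u x \<bullet> (g x *v gradient g u x))) *\<^sub>R gradient g u x"

(* k-th component of the covariant derivative of the vector field N in direction e_i *)
definition cov_deriv ::
    "'n::finite metric_field \<Rightarrow> (real^'n \<Rightarrow> real^'n) \<Rightarrow> 'n \<Rightarrow> 'n \<Rightarrow> real^'n \<Rightarrow> real" where
  "cov_deriv g N i k x = pd i (\<lambda>y. N y $ k) x + (\<Sum>j\<in>UNIV. christoffel g k i j x * N x $ j)"

definition second_fundamental_form ::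
    "'n::finite metric_field \<Rightarrow> (real^'n \<Rightarrow> real) \<Rightarrow> 'n \<Rightarrow> 'n \<Rightarrow> real^'n \<Rightarrow> real" where
  "second_fundamental_form g u i j x =
     (\<Sum>k\<in>UNIV. g x $ j $ k * cov_deriv g (unit_normal g u) i k x)"

(* Mean curvature at x of the level set of u through x: the trace of the second fundamental form
   over the tangent plane, whose inverse induced metric is g^{ij} - N^i N^j.  Sign convention:
   round spheres have positive mean curvature with respect to the outward normal. *)
definition level_mean_curvature ::
    "'n::finite metric_field \<Rightarrow> (real^'n \<Rightarrow> real) \<Rightarrow> real^'n \<Rightarrow> real" where
  "level_mean_curvature g u x = (\<Sum>i\<in>UNIV. \<Sum>j\<in>UNIV.
     (ginv g x $ i $ j - unit_normal g u x $ i * unit_normal g u x $ j) *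
     second_fundamental_form g u i j x)"

definition conformal :: "(real^'n \<Rightarrow> real) \<Rightarrow> 'n::finite metric_field \<Rightarrow> 'n metric_field" where
  "conformal u g x = (u x ^ 4) *\<^sub>R g x"

definition pullback :: "(real^'n \<Rightarrow> real^'n) \<Rightarrow> 'n::finite metric_field \<Rightarrow> 'n metric_field" where
  "pullback F g y = (let J = matrix (frechet_derivative F (at y)) in
     transpose J ** g (F y) ** J)"

definition pos_def_sym :: "real^'n::finite^'n \<Rightarrow> bool" where
  "pos_def_sym A \<longleftrightarrow> transpose A = A \<and> (\<forall>v. v \<noteq> 0 \<longrightarrow> v \<bullet> (A *v v) > 0)"

definition riem_length :: "'n::finite metric_field \<Rightarrow> (real \<Rightarrow> real^'n) \<Rightarrow> real" where
  "riem_length g \<gamma> = integral {0..1} (\<lambda>s.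
     sqrt (vector_derivative \<gamma> (at s) \<bullet> (g (\<gamma> s) *v vector_derivative \<gamma> (at s))))"

(* C^1 curves: for the library's piecewise C^1 curves the derivative may be unbounded, and then the
   length integral can be undefined, that is 0.  The infimum over C^1 curves is the usual one. *)
definition riem_dist :: "(real^'n) set \<Rightarrow> 'n::finite metric_field \<Rightarrow> real^'n \<Rightarrow> real^'n \<Rightarrow> real" where
  "riem_dist X g p q = Inf {riem_length g \<gamma> | \<gamma>.
     \<gamma> C1_differentiable_on {0..1} \<and> \<gamma> ` {0..1} \<subseteq> X \<and> \<gamma> 0 = p \<and> \<gamma> 1 = q}"

definition riem_complete :: "(real^'n) set \<Rightarrow> 'n::finite metric_field \<Rightarrow> bool" where
  "riem_complete X g \<longleftrightarrow> (\<forall>p :: nat \<Rightarrow> real^'n.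
     range p \<subseteq> X \<and>
     (\<forall>e>0. \<exists>N. \<forall>m\<ge>N. \<forall>n\<ge>N. riem_dist X g (p m) (p n) < e) \<longrightarrow>
     (\<exists>q\<in>X. (\<lambda>n. riem_dist X g (p n) q) \<longlonglongrightarrow> 0))"


section \<open>Asymptotically hyperbolic metrics\<close>

definition half_space :: "(real^3) set" where
  "half_space = {y. 0 \<le> y $ 1}"

(* Atlas of a smooth 3-manifold with boundary on the topological space T.
   A chart (U, c) consists of an open set U and a homeomorphism c from U onto a relatively open
   part of the half-space. *)
definition smooth_boundary_atlas ::
    "'p topology \<Rightarrow> ('p set \<times> ('p \<Rightarrow> real^3)) set \<Rightarrow> bool" where
  "smooth_boundary_atlas T A \<longleftrightarrow>
     (\<Union>(U, c)\<in>A. U) = topspace T \<and>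
     (\<forall>(U, c)\<in>A. openin T U \<and> openin (top_of_set half_space) (c ` U) \<and>
        homeomorphic_map (subtopology T U) (top_of_set (c ` U)) c) \<and>
     (\<forall>(U, c)\<in>A. \<forall>(V, d)\<in>A. smooth_on (c ` (U \<inter> V)) (d \<circ> inv_into U c))"

definition manifold_boundary :: "('p set \<times> ('p \<Rightarrow> real^3)) set \<Rightarrow> 'p set" where
  "manifold_boundary A = {p. \<exists>(U, c)\<in>A. p \<in> U \<and> c p $ 1 = 0}"

(* "Xbar is a compact smooth manifold with boundary whose interior is the open set X of R^3".
   Xbar is a set of points of R^3 containing X, but carries an arbitrary topology T and atlas A:
   the points of R^3 outside X only serve as names for boundary points.  As a compact manifold has
   at most continuum many points, this is no restriction. *)
definition smooth_compactification ::
    "(real^3) set \<Rightarrow> (real^3) topology \<Rightarrow> ((real^3) set \<times> (real^3 \<Rightarrow> real^3)) set \<Rightarrow> bool" where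
  "smooth_compactification X T A \<longleftrightarrow>
     compact_space T \<and> Hausdorff_space T \<and> smooth_boundary_atlas T A \<and>
     topspace T - manifold_boundary A = X \<and>
     (\<forall>(U, c)\<in>A. open (U \<inter> X) \<and> smooth_on (U \<inter> X) c \<and>
        smooth_on (c ` (U \<inter> X)) (inv_into U c))"

(* The collar S^2 x [0, t0) is realized as the shell 1 <= |x| < 1 + t0 by (w, s) |-> (1 + s) w. *)
definition shell :: "real \<Rightarrow> (real^3) set" where
  "shell t0 = {x. 1 \<le> norm x \<and> norm x < 1 + t0}"

definition collar_diffeo ::
    "(real^3) topology \<Rightarrow> ((real^3) set \<times> (real^3 \<Rightarrow> real^3)) set \<Rightarrow> (real^3) set \<Rightarrow> real \<Rightarrow>
     (real^3 \<Rightarrow> real^3) \<Rightarrow> bool" where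
  "collar_diffeo T A \<Sigma> t0 \<Phi> \<longleftrightarrow>
     \<Phi> ` sphere 0 1 = \<Sigma> \<and> openin T (\<Phi> ` shell t0) \<and>
     homeomorphic_map (top_of_set (shell t0)) (subtopology T (\<Phi> ` shell t0)) \<Phi> \<and>
     (\<forall>(U, c)\<in>A. smooth_on {x \<in> shell t0. \<Phi> x \<in> U} (c \<circ> \<Phi>) \<and>
        smooth_on (c ` (U \<inter> \<Phi> ` shell t0)) (inv_into (shell t0) \<Phi> \<circ> inv_into U c))"

(* For a metric G on the shell: G = sinh(t)^(-2) (dt^2 + g_t) with g_t = g_0 + t^3/3 h + O(t^4).
   A tangent vector v of S^2 at w, at parameter s, is the vector (1 + s) v of the shell at the
   point (1 + s) w.  A C^2 symmetric 2-tensor h on S^2 is given as the restriction to tangent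
   vectors of a C^2 field of symmetric matrices on R^3 - {0}. *)
definition collar_normal_form :: "real \<Rightarrow> 3 metric_field \<Rightarrow> bool" where
  "collar_normal_form t0 G \<longleftrightarrow> (\<exists>(h :: real^3 \<Rightarrow> real^3^3) K.
     Ck_on 2 (- {0}) h \<and> (\<forall>w. transpose (h w) = h w) \<and>
     (\<forall>s\<in>{0<..<t0}. \<forall>w\<in>sphere 0 1.
        let B = G ((1 + s) *\<^sub>R w);
            gs = (\<lambda>v v'. (sinh s)\<^sup>2 * (((1 + s) *\<^sub>R v) \<bullet> (B *v ((1 + s) *\<^sub>R v'))))
        in w \<bullet> (B *v w) = 1 / (sinh s)\<^sup>2 \<and>
           (\<forall>v. v \<bullet> w = 0 \<longrightarrow> w \<bullet> (B *v v) = 0 \<and> v \<bullet> (B *v w) = 0) \<and>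
           (\<forall>v v'. v \<bullet> w = 0 \<and> v' \<bullet> w = 0 \<longrightarrow>
              \<bar>gs v v' - (v \<bullet> v' + s ^ 3 / 3 * (v \<bullet> (h w *v v')))\<bar> \<le> K * s ^ 4 * norm v * norm v')))"

(* The metric is only asked to be C^2 in the interior; that t^2 g is C^3 up to the boundary is a
   condition near the boundary.  In the chart (U, c) the function k = inv_into U c is the
   parametrization, Gbar is the extension of t^2 g across the boundary point c p and dt is the
   derivative of t there, one-sided in the direction normal to the boundary. *)
definition asymptotically_hyperbolic :: "(real^3) set \<Rightarrow> 3 metric_field \<Rightarrow> bool" where
  "asymptotically_hyperbolic X g \<longleftrightarrow>
     open X \<and> connected X \<and> X \<noteq> {} \<and> \<not> compact X \<and>
     Ck_on 2 X g \<and> (\<forall>x\<in>X. pos_def_sym (g x)) \<and> riem_complete X g \<and>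
     (\<exists>T A (t :: real^3 \<Rightarrow> real).
        smooth_compactification X T A \<and>
        (\<forall>(U, c)\<in>A. smooth_on (c ` U) (t \<circ> inv_into U c)) \<and>
        (\<forall>p\<in>manifold_boundary A. t p = 0) \<and> (\<forall>p\<in>X. t p > 0) \<and>
        (\<forall>(U, c)\<in>A. \<forall>p\<in>U \<inter> manifold_boundary A. \<exists>W Gbar.
           let k = inv_into U c;
               dt = frechet_derivative (t \<circ> k) (at (c p) within half_space)
           in open W \<and> c p \<in> W \<and> Ck_on 3 W Gbar \<and>
              (\<forall>y\<in>W \<inter> c ` U. 0 < y $ 1 \<longrightarrow> Gbar y = (t (k y))\<^sup>2 *\<^sub>R pullback k g y) \<and>
              pos_def_sym (Gbar (c p)) \<and>
              (\<Sum>i\<in>UNIV. \<Sum>j\<in>UNIV. ginv Gbar (c p) $ i $ j * dt (axis i 1) * dt (axis j 1)) = 1) \<and>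
        (\<forall>\<Sigma>\<in>connected_components_of (subtopology T (manifold_boundary A)).
           \<exists>t0>0. \<exists>\<Phi>. collar_diffeo T A \<Sigma> t0 \<Phi> \<and>
             (\<forall>x\<in>shell t0. t (\<Phi> x) = norm x - 1) \<and>
             collar_normal_form t0 (pullback \<Phi> g)))"


section \<open>Hyperbolic space in the ball model\<close>

definition hyp_space :: "(real^3) set" where
  "hyp_space = ball 0 1"

definition hyp_metric :: "3 metric_field" where
  "hyp_metric x = (4 / (1 - (norm x)\<^sup>2)\<^sup>2) *\<^sub>R mat 1"

(* inverse of tau = (e^rho - 1) / (e^rho + 1) *)
definition rho_of_tau :: "real \<Rightarrow> real" where
  "rho_of_tau \<tau> = ln ((1 + \<tau>) / (1 - \<tau>))"

definition tau_of_rho :: "real \<Rightarrow> real" where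
  "tau_of_rho s = (exp s - 1) / (exp s + 1)"

definition hyp_rho :: "real^3 \<Rightarrow> real" where
  "hyp_rho x = rho_of_tau (norm x)"

definition hyp_ball :: "real \<Rightarrow> (real^3) set" where
  "hyp_ball s = {x \<in> hyp_space. hyp_rho x < s}"

definition hyp_infinity :: "(real^3) filter" where
  "hyp_infinity = inf (filtercomap hyp_rho at_top) (principal hyp_space)"

definition depends_only_on_rho :: "(real^3 \<Rightarrow> real) \<Rightarrow> bool" where
  "depends_only_on_rho u \<longleftrightarrow>
     (\<forall>x\<in>hyp_space. \<forall>y\<in>hyp_space. hyp_rho x = hyp_rho y \<longrightarrow> u x = u y)"

definition sphere_has_mean_curvature :: "3 metric_field \<Rightarrow> real \<Rightarrow> real \<Rightarrow> bool" where
  "sphere_has_mean_curvature g s H \<longleftrightarrow>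
     (\<forall>x\<in>hyp_space. hyp_rho x = s \<longrightarrow> level_mean_curvature g hyp_rho x = H)"

definition conformal_op :: "(real^3 \<Rightarrow> real) \<Rightarrow> real^3 \<Rightarrow> real" where
  "conformal_op u x = laplacian hyp_metric u x + 3/4 * u x * (1 - u x ^ 4)"

(* Classical solutions on hyperbolic space of conformal_op u = F that depend only on rho, lie
   strictly between 1 and the upper barrier and tend to 1 at infinity. *)
definition radial_solution :: "(real^3 \<Rightarrow> real) \<Rightarrow> (real^3 \<Rightarrow> real) \<Rightarrow> (real^3 \<Rightarrow> real) \<Rightarrow> bool" where
  "radial_solution upper F u \<longleftrightarrow>
     depends_only_on_rho u \<and> Ck_on 2 hyp_space u \<and>
     (\<forall>x\<in>hyp_space. conformal_op u x = F x) \<and>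
     (\<forall>x\<in>hyp_space. upper x > u x \<and> u x > 1) \<and>
     (u \<longlongrightarrow> 1) hyp_infinity"


section \<open>Anti-de Sitter-Schwarzschild metrics\<close>

definition adss_a :: "real \<Rightarrow> real" where
  "adss_a M = (THE r. r > 0 \<and> 1 + r\<^sup>2 - M / r = 0)"

definition adss_h :: "real \<Rightarrow> real \<Rightarrow> real" where
  "adss_h M r = integral {r..} (\<lambda>t. 1 / sqrt (t * (t + t ^ 3 - M)))"

(* 1 / tanh is coth *)
definition adss_rho :: "real \<Rightarrow> real \<Rightarrow> real" where
  "adss_rho M r = ln (1 / tanh (adss_h M r / 2))"

definition adss_r :: "real \<Rightarrow> real \<Rightarrow> real" where
  "adss_r M = the_inv_into {adss_a M..} (adss_rho M)"

definition adss_b :: "real \<Rightarrow> real" where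
  "adss_b M = tau_of_rho (adss_rho M (adss_a M))"

definition adss_rho0 :: "real \<Rightarrow> real" where
  "adss_rho0 M = ln ((1 + (adss_b M)\<^sup>2) / (1 - (adss_b M)\<^sup>2))"

definition adss_Psi :: "real \<Rightarrow> real \<Rightarrow> real" where
  "adss_Psi M \<tau> = sqrt (adss_r M (rho_of_tau \<tau>) / sinh (rho_of_tau \<tau>))"

definition adss_phi_tau :: "real \<Rightarrow> real \<Rightarrow> real" where
  "adss_phi_tau M \<tau> =
     (if adss_b M \<le> \<tau> then adss_Psi M \<tau>
      else adss_b M * adss_Psi M ((adss_b M)\<^sup>2 / \<tau>) *
        sqrt ((1 - \<tau>\<^sup>2) / (\<tau>\<^sup>2 - (adss_b M) ^ 4)))"

(* phi_M as a function of rho; only relevant for rho > adss_rho0 M *)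
definition adss_phi :: "real \<Rightarrow> real \<Rightarrow> real" where
  "adss_phi M s = adss_phi_tau M (tau_of_rho s)"

definition adss_metric :: "real \<Rightarrow> 3 metric_field" where
  "adss_metric M = conformal (adss_phi M \<circ> hyp_rho) hyp_metric"

(* the radius of the sphere of mean curvature -2 *)
definition adss_rho2' :: "real \<Rightarrow> real" where
  "adss_rho2' M = (THE s. s > adss_rho0 M \<and> sphere_has_mean_curvature (adss_metric M) s (- 2))"

end

theory Submission
  imports Defs "HOL-Real_Asymp.Real_Asymp"
begin

text \<open>On \<open>H\<^sup>3 - {0}\<close>, conformal to the cylinder with coordinate \<open>h = - ln \<tau>\<close>, a radial metric
  \<open>\<phi>\<^sup>4 ds\<^sup>2 = u\<^sup>-\<^sup>2 (dh\<^sup>2 + d\<sigma>\<^sup>2)\<close> has scalar curvature \<open>-6\<close> iff \<open>u'\<^sup>2 = 1 + u\<^sup>2 - M u\<^sup>3\<close> for a constant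
  \<open>M\<close>. The solution vanishing at \<open>h = 0\<close> is \<open>u = 1/r\<close> for the anti-de Sitter-Schwarzschild metric
  of mass \<open>M\<close>; the reflection in its horizon, the zero of \<open>u'\<close>, gives the other branch of \<open>\<phi>\<^sub>M\<close>.
  A radial solution that satisfies the homogeneous equation near infinity and exceeds \<open>1\<close> is
  therefore exactly anti-de Sitter-Schwarzschild there, with a mass read off from its value and
  derivative at a single radius.

  The Dirichlet problem is solved between the subsolution \<open>1\<close> and the supersolution \<open>\<psi>\<close> by
  contraction, inverting \<open>\<kappa> - \<Delta>\<close> explicitly on radial functions; uniqueness follows from the
  maximum principle, the nonlinearity having slope at least \<open>3\<close>. Comparing \<open>\<psi> - \<phi>\<^sub>\<epsilon>\<close> with a multiple
  of \<open>e\<^sup>-\<^sup>3\<^sup>\<rho>\<close> gives the decay, and integrating the flux \<open>sinh\<^sup>2 \<rho> (\<psi> - \<phi>\<^sub>\<epsilon>)'\<close> gives \<open>C\<^sup>1\<close> closeness at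
  \<open>\<tau>\<^sub>2\<close>, hence convergence of the masses and of the mean curvature of the sphere.\<close>

section \<open>Calculus of continuously differentiable functions\<close>

text \<open>Three obstacles shape the development. At the horizon \<open>u'\<close> vanishes and the
  integral for \<open>h\<close> has a singular integrand; at infinity \<open>r\<close> blows up. The
  substitution \<open>z = sqrt (1 - a / r)\<close> removes both: the profile \<open>u\<close>
  becomes smooth on an open interval around h = 0, and regularity of the compactified metric up to
  the boundary becomes regularity on an open set. Second, the constant of integration outside the
  cutoff is a priori any real number, and the outer region might exceed the domain of the model
  metric. It is positive because \<open>\<phi> > 1\<close>: otherwise \<open>u\<close> would
  dominate the profile sinh h of hyperbolic space. The domain suffices because \<open>u\<close> is
  positive while the model profile vanishes at the inner end. Third, the collar normal form needs a
  defining function with dt / sinh t = dh / u exactly; this is solvable by one regular quadrature,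
  and the collar metric is then (sinh t / u)^2 times the round one, with third order coefficient M /
  3.\<close>

lemma Ck_on_subset: "Ck_on k S f \<Longrightarrow> T \<subseteq> S \<Longrightarrow> Ck_on k T f"
  by (induction k arbitrary: f) (auto intro: continuous_on_subset)

lemma Ck_on_cong:
  assumes "open S" "\<And>x. x \<in> S \<Longrightarrow> f x = g x"
  shows "Ck_on k S f \<longleftrightarrow> Ck_on k S g"
  using assms(2)
proof (induction k arbitrary: f g)
  case 0
  then show ?case by (simp cong: continuous_on_cong_simp)
next
  case (Suc k)
  have d: "(f differentiable (at x)) = (g differentiable (at x))" if "x \<in> S" for x
    using that Suc.prems assms(1) differentiable_transform_within
    by (metis (no_types, lifting) differentiable_def has_derivative_transform_within_open)
  have "frechet_derivative f (at x) = frechet_derivative g (at x)"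
    if "x \<in> S" "f differentiable (at x)" for x
    by (rule frechet_derivative_transform_within_open[OF that(2) assms(1) that(1)]) (simp add: Suc.prems)
  then show ?case
    using d Suc.IH by (smt (verit, best) Ck_on.simps(2))
qed

lemma Ck_on_SucI:
  assumes "open S" "\<And>x. x \<in> S \<Longrightarrow> (f has_derivative D x) (at x)" "\<And>v. Ck_on k S (\<lambda>x. D x v)"
  shows "Ck_on (Suc k) S f"
proof -
  have "frechet_derivative f (at x) v = D x v" if "x \<in> S" for x v
    using frechet_derivative_at[OF assms(2)[OF that]] by simp
  then have "Ck_on k S (\<lambda>x. frechet_derivative f (at x) v)" for v
    using Ck_on_cong[OF assms(1), of "\<lambda>x. frechet_derivative f (at x) v" "\<lambda>x. D x v"] assms(3) by auto
  then show ?thesis using assms(2) by (auto simp: differentiable_def)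
qed

lemma Ck_on_SucD:
  assumes "Ck_on (Suc k) S f"
  obtains D where "\<And>x. x \<in> S \<Longrightarrow> (f has_derivative D x) (at x)" "\<And>v. Ck_on k S (\<lambda>x. D x v)"
proof
  show "(f has_derivative (frechet_derivative f (at x))) (at x)" if "x \<in> S" for x
    using assms that by (simp add: frechet_derivative_works)
  show "Ck_on k S (\<lambda>x. frechet_derivative f (at x) v)" for v using assms by simp
qed

lemma Ck_on_Suc_imp: "Ck_on (Suc k) S f \<Longrightarrow> Ck_on k S f"
proof (induction k arbitrary: f)
  case 0
  then show ?case
    by (auto intro!: continuous_at_imp_continuous_on differentiable_imp_continuous_within)
next
  case (Suc k)
  then show ?case by (metis Ck_on.simps(2))
qed

lemma Ck_on_le: "Ck_on k S f \<Longrightarrow> j \<le> k \<Longrightarrow> Ck_on j S f"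
  by (induction k) (auto simp: le_Suc_eq dest: Ck_on_Suc_imp simp del: Ck_on.simps)

lemma Ck_on_imp_continuous_on: "Ck_on k S f \<Longrightarrow> continuous_on S f"
  using Ck_on_le[of k S f 0] by simp

text \<open>Glues functions defined by cases, such as a cutoff continued by a constant: each case is
  smooth on an open set of its own.\<close>

lemma Ck_on_local:
  assumes "\<And>x. x \<in> S \<Longrightarrow> \<exists>W. open W \<and> x \<in> W \<and> Ck_on k W f"
  shows "Ck_on k S f"
  using assms
proof (induction k arbitrary: f)
  case 0
  have "isCont f x" if "x \<in> S" for x
    using 0[OF that] by (auto simp: continuous_on_eq_continuous_at)
  then show ?case by (simp add: continuous_at_imp_continuous_on)
next
  case (Suc k)
  have "f differentiable (at x)" if "x \<in> S" for x using Suc.prems[OF that] by auto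
  moreover have "Ck_on k S (\<lambda>x. frechet_derivative f (at x) v)" for v
  proof (rule Suc.IH)
    fix x assume "x \<in> S"
    then obtain W where "open W" "x \<in> W" "Ck_on (Suc k) W f" using Suc.prems by blast
    then show "\<exists>W. open W \<and> x \<in> W \<and> Ck_on k W (\<lambda>x. frechet_derivative f (at x) v)" by auto
  qed
  ultimately show ?case by simp
qed

lemma Ck_on_const: "Ck_on k S (\<lambda>x. c)"
  by (induction k arbitrary: c) auto

lemma Ck_on_bounded_linear:
  assumes L: "bounded_linear L" and S: "open S" and "Ck_on k S f"
  shows "Ck_on k S (\<lambda>x. L (f x))"
  using assms(3)
proof (induction k arbitrary: f)
  case 0
  then show ?case using L by (simp add: bounded_linear.continuous_on)
next
  case (Suc k)
  obtain D where D: "\<And>x. x \<in> S \<Longrightarrow> (f has_derivative D x) (at x)" "\<And>v. Ck_on k S (\<lambda>x. D x v)"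
    using Ck_on_SucD[OF Suc.prems] by blast
  show ?case
    by (rule Ck_on_SucI[OF S, where D="\<lambda>x v. L (D x v)"])
       (use D Suc.IH L in \<open>auto intro: bounded_linear.has_derivative\<close>)
qed

lemma Ck_on_add:
  assumes S: "open S" and "Ck_on k S f" "Ck_on k S g"
  shows "Ck_on k S (\<lambda>x. f x + g x)"
  using assms(2,3)
proof (induction k arbitrary: f g)
  case 0
  then show ?case by (simp add: continuous_on_add)
next
  case (Suc k)
  obtain D where D: "\<And>x. x \<in> S \<Longrightarrow> (f has_derivative D x) (at x)" "\<And>v. Ck_on k S (\<lambda>x. D x v)"
    using Ck_on_SucD[OF Suc.prems(1)] by blast
  obtain E where E: "\<And>x. x \<in> S \<Longrightarrow> (g has_derivative E x) (at x)" "\<And>v. Ck_on k S (\<lambda>x. E x v)"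
    using Ck_on_SucD[OF Suc.prems(2)] by blast
  show ?case
    by (rule Ck_on_SucI[OF S, where D="\<lambda>x v. D x v + E x v"])
       (use D E Suc.IH in \<open>auto intro: has_derivative_add\<close>)
qed

lemma Ck_on_ident: "open S \<Longrightarrow> Ck_on k S (\<lambda>x. x)"
proof (cases k)
  case (Suc j)
  assume "open S"
  then show ?thesis unfolding Suc by (rule Ck_on_SucI[where D="\<lambda>x v. v"]) (auto intro: Ck_on_const)
qed auto

lemma Ck_on_sum:
  assumes "open S" "\<And>i. i \<in> I \<Longrightarrow> Ck_on k S (f i)"
  shows "Ck_on k S (\<lambda>x. \<Sum>i\<in>I. f i x)"
  using assms(2)
  by (induction I rule: infinite_finite_induct) (auto intro!: Ck_on_const Ck_on_add assms(1))

lemma Ck_on_bilinear: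
  assumes P: "bounded_bilinear P" and S: "open S" and "Ck_on k S f" "Ck_on k S g"
  shows "Ck_on k S (\<lambda>x. P (f x) (g x))"
  using assms(3,4)
proof (induction k arbitrary: f g)
  case 0
  then show ?case using P by (simp add: bounded_bilinear.continuous_on)
next
  case (Suc k)
  obtain D where D: "\<And>x. x \<in> S \<Longrightarrow> (f has_derivative D x) (at x)" "\<And>v. Ck_on k S (\<lambda>x. D x v)"
    using Ck_on_SucD[OF Suc.prems(1)] by blast
  obtain E where E: "\<And>x. x \<in> S \<Longrightarrow> (g has_derivative E x) (at x)" "\<And>v. Ck_on k S (\<lambda>x. E x v)"
    using Ck_on_SucD[OF Suc.prems(2)] by blast
  show ?case
  proof (rule Ck_on_SucI[OF S, where D="\<lambda>x v. P (f x) (E x v) + P (D x v) (g x)"])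
    show "((\<lambda>x. P (f x) (g x)) has_derivative (\<lambda>v. P (f x) (E x v) + P (D x v) (g x))) (at x)"
      if "x \<in> S" for x using D E that by (intro bounded_bilinear.FDERIV[OF P])
    show "Ck_on k S (\<lambda>x. P (f x) (E x v) + P (D x v) (g x))" for v
    proof (intro Ck_on_add S Suc.IH)
      show "Ck_on k S f" "Ck_on k S g" using Suc.prems by (auto intro: Ck_on_Suc_imp simp del: Ck_on.simps)
    qed (use D E in auto)
  qed
qed

lemmas Ck_on_scaleR = Ck_on_bilinear[OF bounded_bilinear_scaleR]
lemmas Ck_on_mult = Ck_on_bilinear[OF bounded_bilinear_mult]
lemmas Ck_on_inner = Ck_on_bilinear[OF bounded_bilinear_inner]
lemma Ck_on_minus: "open S \<Longrightarrow> Ck_on k S f \<Longrightarrow> Ck_on k S (\<lambda>x. - f x)"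
  by (rule Ck_on_bounded_linear[of uminus]) (auto intro: bounded_linear_minus bounded_linear_ident)

lemma Ck_on_diff:
  "open S \<Longrightarrow> Ck_on k S f \<Longrightarrow> Ck_on k S g \<Longrightarrow> Ck_on k S (\<lambda>x. f x - g x)"
  using Ck_on_add[of S k f "\<lambda>x. - g x"] Ck_on_minus[of S k g] by simp

lemma Ck_on_power:
  fixes f :: "'a::euclidean_space \<Rightarrow> real"
  shows "open S \<Longrightarrow> Ck_on k S f \<Longrightarrow> Ck_on k S (\<lambda>x. f x ^ n)"
  by (induction n) (auto intro: Ck_on_const Ck_on_mult)

lemma Ck_on_compose:
  fixes f :: "'b::euclidean_space \<Rightarrow> 'c::real_normed_vector" and g :: "'a::euclidean_space \<Rightarrow> 'b"
  assumes S: "open S" and T: "open T" and "g ` S \<subseteq> T" "Ck_on k T f" "Ck_on k S g"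
  shows "Ck_on k S (\<lambda>x. f (g x))"
  using assms(4,5)
proof (induction k arbitrary: f)
  case 0
  then show ?case using assms(3) by (auto intro: continuous_on_compose2)
next
  case (Suc k)
  obtain D where D: "\<And>x. x \<in> T \<Longrightarrow> (f has_derivative D x) (at x)" "\<And>v. Ck_on k T (\<lambda>x. D x v)"
    using Ck_on_SucD[OF Suc.prems(1)] by blast
  obtain E where E: "\<And>x. x \<in> S \<Longrightarrow> (g has_derivative E x) (at x)" "\<And>v. Ck_on k S (\<lambda>x. E x v)"
    using Ck_on_SucD[OF Suc.prems(2)] by blast
  show ?case
  \<comment> \<open>\<open>Ck_on\<close> controls derivatives in fixed directions only, while the
    chain rule evaluates \<open>D (g x)\<close> in the direction \<open>E x v\<close>, which moves
    with x. Expanding in the basis leaves fixed directions with scalar coefficients.\<close>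
  proof (rule Ck_on_SucI[OF S, where D="\<lambda>x v. \<Sum>b\<in>Basis. (E x v \<bullet> b) *\<^sub>R D (g x) b"])
    fix x assume x: "x \<in> S"
    have l: "linear (D (g x))" using D(1)[of "g x"] x assms(3)
      by (auto dest!: has_derivative_linear)
    have eq: "D (g x) (E x v) = (\<Sum>b\<in>Basis. (E x v \<bullet> b) *\<^sub>R D (g x) b)" for v
      by (subst (1) euclidean_representation[of "E x v", symmetric])
         (simp only: linear_sum[OF l] linear_scale[OF l])
    have "((\<lambda>x. f (g x)) has_derivative (\<lambda>v. D (g x) (E x v))) (at x)"
      using x assms(3) by (intro has_derivative_compose[OF E(1) D(1)]) auto
    then show "((\<lambda>x. f (g x)) has_derivative (\<lambda>v. \<Sum>b\<in>Basis. (E x v \<bullet> b) *\<^sub>R D (g x) b)) (at x)"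
      by (simp add: eq)
  next
    fix v
    have "Ck_on k S g" by (rule Ck_on_Suc_imp[OF Suc.prems(2)])
    then have "Ck_on k S (\<lambda>x. D (g x) b)" for b using Suc.IH[OF D(2)] by simp
    then show "Ck_on k S (\<lambda>x. \<Sum>b\<in>Basis. (E x v \<bullet> b) *\<^sub>R D (g x) b)"
      by (intro Ck_on_sum Ck_on_scaleR Ck_on_inner S E Ck_on_const)
  qed
qed

lemma Ck_on_Suc_real:
  fixes f :: "real \<Rightarrow> real"
  assumes "open S" "\<And>x. x \<in> S \<Longrightarrow> (f has_real_derivative f' x) (at x)" "Ck_on k S f'"
  shows "Ck_on (Suc k) S f"
  by (rule Ck_on_SucI[OF assms(1), where D="\<lambda>x v. f' x * v"])
     (use assms in \<open>auto simp: has_field_derivative_def intro!: Ck_on_mult Ck_on_const\<close>)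

lemma Ck_on_inverse: "Ck_on k (- {0}) (inverse :: real \<Rightarrow> real)"
proof (induction k)
  case 0
  show ?case by (auto intro!: continuous_intros)
next
  case (Suc k)
  show ?case
    by (rule Ck_on_Suc_real[where f'="\<lambda>x. - (inverse x * inverse x)"])
       (auto intro!: derivative_eq_intros Ck_on_minus Ck_on_mult Suc simp: divide_inverse power2_eq_square)
qed

lemma Ck_on_divide:
  fixes f g :: "'a::euclidean_space \<Rightarrow> real"
  assumes S: "open S" "Ck_on k S f" "Ck_on k S g" "\<And>x. x \<in> S \<Longrightarrow> g x \<noteq> 0"
  shows "Ck_on k S (\<lambda>x. f x / g x)"
proof -
  have "Ck_on k S (\<lambda>x. inverse (g x))"
    by (rule Ck_on_compose[OF S(1) _ _ Ck_on_inverse S(3)]) (use S(4) in auto)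
  then show ?thesis using Ck_on_mult[OF S(1,2)] by (simp add: divide_inverse)
qed

lemma Ck_on_exp: "Ck_on k UNIV (exp :: real \<Rightarrow> real)"
proof (induction k)
  case (Suc k)
  show ?case by (rule Ck_on_Suc_real[where f'=exp]) (auto intro!: derivative_eq_intros Suc)
qed (auto intro!: continuous_intros)

lemma Ck_on_ln: "Ck_on k {0<..} (ln :: real \<Rightarrow> real)"
proof (cases k)
  case (Suc j)
  show ?thesis unfolding Suc
    by (rule Ck_on_Suc_real[where f'=inverse])
       (auto intro!: derivative_eq_intros Ck_on_subset[OF Ck_on_inverse] simp: divide_inverse)
qed (auto intro!: continuous_intros)

lemma Ck_on_sqrt: "Ck_on k {0<..} sqrt"
proof (induction k)
  case 0
  show ?case by (auto intro!: continuous_intros)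
next
  case (Suc k)
  show ?case
    by (rule Ck_on_Suc_real[where f'="\<lambda>x. 1 / (2 * sqrt x)"])
       (auto intro!: derivative_eq_intros Ck_on_divide Ck_on_mult Ck_on_const Suc simp: field_simps)
qed

lemma Ck_on_norm: "Ck_on k (- {0}) (norm :: 'a::euclidean_space \<Rightarrow> real)"
proof -
  have "Ck_on k (- {0::'a}) (\<lambda>x. sqrt (x \<bullet> x))"
    by (rule Ck_on_compose[OF _ _ _ Ck_on_sqrt]) (auto intro!: Ck_on_inner Ck_on_ident)
  then show ?thesis by (simp add: norm_eq_sqrt_inner[symmetric])
qed

text \<open>A bootstrap: the derivative of \<open>g\<close> is a smooth function of
  \<open>g\<close>, so k derivatives of \<open>g\<close> give one more.\<close>

lemma Ck_on_inverse_function: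
  fixes f g f' :: "real \<Rightarrow> real"
  assumes S: "open S" and T: "open T" and gT: "g ` T \<subseteq> S"
    and g': "\<And>y. y \<in> T \<Longrightarrow> (g has_real_derivative inverse (f' (g y))) (at y)"
    and nz: "\<And>x. x \<in> S \<Longrightarrow> f' x \<noteq> 0" and f': "\<And>k. Ck_on k S f'"
  shows "Ck_on k T g"
proof (induction k)
  case 0
  show ?case using g' by (auto intro!: continuous_at_imp_continuous_on DERIV_isCont)
next
  case (Suc k)
  have "Ck_on k T (\<lambda>y. f' (g y))" by (rule Ck_on_compose[OF T S gT f' Suc])
  then have "Ck_on k T (\<lambda>y. 1 / f' (g y))"
    using nz gT by (intro Ck_on_divide T Ck_on_const) auto
  then show ?case
    by (intro Ck_on_Suc_real[OF T, where f'="\<lambda>y. 1 / f' (g y)"]) (use g' in \<open>auto simp: divide_inverse\<close>)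
qed

lemma smooth_onI:
  assumes "open W" "S \<subseteq> W" "\<And>k. Ck_on k W F" "\<And>x. x \<in> S \<Longrightarrow> F x = f x"
  shows "smooth_on S f"
  unfolding smooth_on_def using assms by blast

section \<open>The radial coordinates\<close>

text \<open>Compactness of \<open>{l..u}\<close> makes the inverse continuous up to the end points;
  in the interior the positive derivative then makes it differentiable. Used for the profile and
  again for the collar coordinate.\<close>

lemma increasing_inverse:
  fixes f f' :: "real \<Rightarrow> real"
  assumes lu: "l < u" and cont: "continuous_on {l..u} f"
    and d: "\<And>x. x \<in> {l<..<u} \<Longrightarrow> (f has_real_derivative f' x) (at x)"
    and pos: "\<And>x. x \<in> {l<..<u} \<Longrightarrow> f' x > 0"
  shows "\<exists>g. (\<forall>x\<in>{l..u}. g (f x) = x) \<and>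
    (\<forall>y\<in>{f l..f u}. g y \<in> {l..u} \<and> f (g y) = y) \<and>
    (\<forall>y\<in>{f l<..<f u}. g y \<in> {l<..<u}) \<and>
    (\<forall>y\<in>{f l<..<f u}. (g has_real_derivative inverse (f' (g y))) (at y))"
proof -
  have mono: "f x < f y" if "l \<le> x" "x < y" "y \<le> u" for x y
  proof (rule DERIV_pos_imp_increasing_open[OF that(2)])
    show "\<exists>D. (f has_real_derivative D) (at z) \<and> D > 0" if "x < z" "z < y" for z
      using d[of z] pos[of z] that \<open>l \<le> x\<close> \<open>y \<le> u\<close> by auto
    show "continuous_on {x..y} f" using that by (auto intro: continuous_on_subset[OF cont])
  qed
  have inj: "inj_on f {l..u}"
    by (rule inj_onI) (metis atLeastAtMost_iff linorder_neqE_linordered_idom mono order_less_irrefl)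
  have img: "f ` {l..u} = {f l..f u}"
  proof
    show "f ` {l..u} \<subseteq> {f l..f u}" using mono lu by (auto simp: le_less)
    show "{f l..f u} \<subseteq> f ` {l..u}"
    proof
      fix y assume "y \<in> {f l..f u}"
      then obtain x where "l \<le> x" "x \<le> u" "f x = y"
        using IVT'[of f l y u] cont lu by auto
      then show "y \<in> f ` {l..u}" by auto
    qed
  qed
  define g where "g = the_inv_into {l..u} f"
  have gf: "g (f x) = x" if "x \<in> {l..u}" for x
    unfolding g_def by (rule the_inv_into_f_f[OF inj that])
  have fg: "g y \<in> {l..u} \<and> f (g y) = y" if "y \<in> {f l..f u}" for y
    using that img gf by (metis (no_types, lifting) image_iff)
  have gi: "g y \<in> {l<..<u}" if "y \<in> {f l<..<f u}" for y
    using fg[of y] that by (auto simp: le_less)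
  have contg: "continuous_on {f l..f u} g"
    using continuous_on_inv[OF cont, of g] gf img by auto
  have "(g has_real_derivative inverse (f' (g y))) (at y)" if y: "y \<in> {f l<..<f u}" for y
  proof (rule DERIV_inverse_function[where a="f l" and b="f u"])
    show "(f has_real_derivative f' (g y)) (at (g y))" "f' (g y) \<noteq> 0"
      using d[OF gi[OF y]] pos[OF gi[OF y]] by auto
    show "f l < y" "y < f u" using y by auto
    show "\<And>z. f l < z \<Longrightarrow> z < f u \<Longrightarrow> f (g z) = z" using fg by auto
    show "isCont g y"
      using continuous_on_interior[OF contg, of y] y by auto
  qed
  then show ?thesis using gf fg gi by (intro exI[of _ g] conjI ballI) auto
qed

lemma tau_of_rho_less_1: "tau_of_rho s < 1"
  unfolding tau_of_rho_def by (smt (verit) divide_less_eq_1 exp_gt_zero)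

lemma tau_of_rho_pos: "0 < tau_of_rho s \<longleftrightarrow> 0 < s"
  unfolding tau_of_rho_def
  by (smt (verit, best) divide_pos_pos divide_nonpos_pos exp_gt_zero one_less_exp_iff)

lemma tau_of_rho_0 [simp]: "tau_of_rho 0 = 0" by (simp add: tau_of_rho_def)

lemma rho_of_tau_0 [simp]: "rho_of_tau 0 = 0" by (simp add: rho_of_tau_def)

lemma rho_tau [simp]: "rho_of_tau (tau_of_rho s) = s"
proof -
  have "exp s + 1 > 0" by (smt (verit) exp_gt_zero)
  then have "(1 + tau_of_rho s) / (1 - tau_of_rho s) = exp s"
    unfolding tau_of_rho_def by (simp add: field_simps)
  then show ?thesis unfolding rho_of_tau_def by simp
qed

lemma tau_rho: assumes "- 1 < t" "t < 1" shows "tau_of_rho (rho_of_tau t) = t"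
proof -
  have e: "exp (rho_of_tau t) = (1 + t) / (1 - t)"
    unfolding rho_of_tau_def using assms by (intro exp_ln) auto
  show ?thesis unfolding tau_of_rho_def e using assms by (simp add: divide_simps)
qed

lemma tau_of_rho_mono: assumes "s < s'" shows "tau_of_rho s < tau_of_rho s'"
proof -
  have e: "exp s < exp s'" "exp s > 0" "exp s' > 0" using assms by auto
  have "tau_of_rho t = 1 - 2 / (exp t + 1)" for t
    unfolding tau_of_rho_def using exp_gt_zero[of t] by (simp add: divide_simps add_pos_pos less_imp_neq[symmetric])
  moreover have "2 / (exp s' + 1) < 2 / (exp s + 1)" using e by (intro divide_strict_left_mono) (auto intro!: mult_pos_pos add_pos_pos)
  ultimately show ?thesis by simp
qed

lemma rho_of_tau_deriv:
  assumes "- 1 < t" "t < 1"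
  shows "(rho_of_tau has_real_derivative 2 / (1 - t\<^sup>2)) (at t)"
proof -
  have nz: "1 - t \<noteq> 0" "1 + t \<noteq> 0" using assms by auto
  then have nz2: "1 - t\<^sup>2 \<noteq> 0" by (simp add: power2_eq_1_iff)
  have "((\<lambda>t. ln ((1 + t) / (1 - t))) has_real_derivative 2 / (1 - t\<^sup>2)) (at t)"
    using assms nz nz2
    by (auto intro!: derivative_eq_intros simp: divide_simps) (simp add: algebra_simps power2_eq_square)
  then show ?thesis unfolding rho_of_tau_def[abs_def] .
qed

lemma rho_of_tau_less: assumes "- 1 < t" "t < t'" "t' < 1" shows "rho_of_tau t < rho_of_tau t'"
proof (rule ccontr)
  assume "\<not> ?thesis"
  then have "tau_of_rho (rho_of_tau t') \<le> tau_of_rho (rho_of_tau t)"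
    using tau_of_rho_mono by (metis linorder_not_less order_le_less)
  then show False using assms tau_rho by auto
qed

lemma rho_of_tau_nonneg: assumes "0 \<le> t" "t < 1" shows "0 \<le> rho_of_tau t"
  using rho_of_tau_less[of 0 t] assms by (cases "t = 0") auto

lemma rho_of_tau_pos: assumes "0 < t" "t < 1" shows "0 < rho_of_tau t"
  using rho_of_tau_less[of 0 t] assms by auto

text \<open>Hyperbolic space minus the origin is conformal to the cylinder \<open>(0,\<infinity>) \<times> S\<^sup>2\<close>,
  \<open>ds\<^sup>2 = sinh(h)\<^sup>-\<^sup>2 (dh\<^sup>2 + d\<sigma>\<^sup>2)\<close> with \<open>h = - ln \<tau>\<close>; infinity is at \<open>h = 0\<close>.\<close>

definition cyl :: "real \<Rightarrow> real" where "cyl s = - ln (tau_of_rho s)"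

lemma cyl_pos: "0 < s \<Longrightarrow> 0 < cyl s"
  unfolding cyl_def using tau_of_rho_less_1[of s] tau_of_rho_pos[of s] by simp

lemma exp_cyl: "0 < s \<Longrightarrow> exp (- cyl s) = tau_of_rho s"
  unfolding cyl_def using tau_of_rho_pos[of s] by simp

lemma rho_cyl: "0 < s \<Longrightarrow> rho_of_tau (exp (- cyl s)) = s"
  by (simp add: exp_cyl)

lemma cyl_rho: "0 < h \<Longrightarrow> cyl (rho_of_tau (exp (- h))) = h"
  unfolding cyl_def by (subst tau_rho) (auto intro: less_trans[OF _ exp_gt_zero])

lemma rho_exp_pos: "0 < h \<Longrightarrow> 0 < rho_of_tau (exp (- h))"
  by (rule rho_of_tau_pos) auto

lemma cyl_less: "0 < s \<Longrightarrow> s < s' \<Longrightarrow> cyl s' < cyl s"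
  unfolding cyl_def using tau_of_rho_mono[of s s'] tau_of_rho_pos[of s] by simp

lemma cyl_less_iff: "0 < s \<Longrightarrow> 0 < s' \<Longrightarrow> cyl s' < cyl s \<longleftrightarrow> s < s'"
  by (metis cyl_less linorder_neqE_linordered_idom order_less_asym order_less_irrefl)

lemma exp_cyl_expand:
  assumes "0 < s" shows "exp (cyl s) = (exp s + 1) / (exp s - 1)" "exp (- cyl s) = (exp s - 1) / (exp s + 1)"
  using exp_cyl[OF assms] exp_minus[of "cyl s"] unfolding tau_of_rho_def
  by (metis inverse_divide inverse_inverse_eq, simp)

text \<open>Because tau = tanh (rho / 2), both h = ln coth (rho / 2) and rho = ln coth (h / 2): the
  change of coordinate is an involution, and the two hyperbolic sines are reciprocal.\<close>

lemma sinh_cyl: assumes "0 < s" shows "sinh (cyl s) = 1 / sinh s"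
proof -
  have "((E + 1) / (E - 1) - (E - 1) / (E + 1)) / 2 = 1 / ((E - inverse E) / 2)" if "E > 1" for E :: real
  proof -
    have "E * E > 1" using that by (simp add: less_1_mult)
    then show ?thesis using that by (simp add: divide_simps) (simp add: algebra_simps)
  qed
  then show ?thesis
    unfolding sinh_field_def exp_cyl_expand[OF assms] exp_minus[of s] using assms by (metis one_less_exp_iff)
qed

lemma cosh_cyl: assumes "0 < s" shows "cosh (cyl s) = cosh s / sinh s"
proof -
  have "((E + 1) / (E - 1) + (E - 1) / (E + 1)) / 2 = ((E + inverse E) / 2) / ((E - inverse E) / 2)"
    if "E > 1" for E :: real
  proof -
    have "E * E > 1" using that by (simp add: less_1_mult)
    then show ?thesis using that by (simp add: divide_simps) (simp add: algebra_simps)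
  qed
  then show ?thesis
    unfolding sinh_field_def cosh_field_def exp_cyl_expand[OF assms] exp_minus[of s] using assms
    by (metis one_less_exp_iff)
qed

lemma cyl_deriv: assumes "0 < s" shows "(cyl has_real_derivative - 1 / sinh s) (at s)"
proof -
  have e: "exp s > 1" using assms by simp
  then have q: "(exp s - 1) / (exp s + 1) > 0" by (simp add: add_pos_pos)
  have "exp s + 1 \<noteq> 0" by (metis add_pos_pos exp_gt_zero less_irrefl zero_less_one)
  then have "((\<lambda>s. (exp s - 1) / (exp s + 1)) has_real_derivative 2 * exp s / (exp s + 1)\<^sup>2) (at s)"
    by (auto intro!: derivative_eq_intros simp: power2_eq_square) (simp add: algebra_simps)
  then have "((\<lambda>s. - ln ((exp s - 1) / (exp s + 1))) has_real_derivative
      - (1 / ((exp s - 1) / (exp s + 1)) * (2 * exp s / (exp s + 1)\<^sup>2))) (at s)"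
    by (intro DERIV_minus DERIV_chain2[where f=ln] DERIV_ln_divide[OF q])
  moreover have eq: "- (1 / ((E - 1) / (E + 1)) * (2 * E / (E + 1)\<^sup>2)) = - 1 / ((E - inverse E) / 2)"
    if "E > 1" for E :: real
  proof -
    have "E * E > 1" using that by (simp add: less_1_mult)
    then show ?thesis using that by (simp add: divide_simps) (simp add: algebra_simps power2_eq_square)
  qed
  ultimately show ?thesis unfolding cyl_def[abs_def] tau_of_rho_def sinh_field_def exp_minus
    by (simp only: eq[OF e])
qed

lemma rho_exp_deriv:
  assumes "0 < h"
  shows "((\<lambda>h. rho_of_tau (exp (- h))) has_real_derivative - 1 / sinh h) (at h)"
proof -
  have "((\<lambda>h. rho_of_tau (exp (- h))) has_real_derivative
      2 / (1 - (exp (- h))\<^sup>2) * (exp (- h) * - 1)) (at h)"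
    by (rule DERIV_chain2[OF rho_of_tau_deriv])
       (use assms in \<open>auto intro!: derivative_eq_intros intro: less_trans[OF _ exp_gt_zero]\<close>)
  moreover have "2 / (1 - E\<^sup>2) * (E * - 1) = - 1 / ((inverse E - E) / 2)" if "0 < E" "E < 1" for E :: real
  proof -
    have "E * E < 1" using that mult_strict_mono[of E 1 E 1] by simp
    then show ?thesis using that by (simp add: divide_simps power2_eq_square)
  qed
  then have "2 / (1 - (exp (- h))\<^sup>2) * (exp (- h) * - 1) = - 1 / sinh h"
    using assms unfolding sinh_field_def
    by (metis exp_gt_zero exp_minus inverse_inverse_eq neg_less_0_iff_less exp_less_one_iff)
  ultimately show ?thesis by simp
qed

lemma cyl_tendsto_0: "(cyl \<longlongrightarrow> 0) at_top"
  unfolding cyl_def tau_of_rho_def by real_asymp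

section \<open>The anti-de Sitter-Schwarzschild profile\<close>

locale adss =
  fixes a :: real
  assumes a_pos: "0 < a"
begin

definition M where "M = a + a ^ 3"

text \<open>The integrand of \<open>adss_h\<close> becomes \<open>kk z dz\<close> under
  \<open>z = sqrt (1 - a / t)\<close>. The factor 1 - a / t, which makes the integral singular at
  the horizon, is absorbed by dz, and \<open>kq z\<close> is a^2 times the remaining factor 1 + a /
  t + (1 + a^2) / t^2. Horizon: z = 0; infinity: z = 1; negative z: the reflected side.\<close>

definition kq where "kq z = a\<^sup>2 * (2 - z\<^sup>2) + (1 + a\<^sup>2) * (1 - z\<^sup>2)\<^sup>2"

definition kk where "kk z = 2 / sqrt (kq z)"

text \<open>The interval from -2 to 2 contains z = 1 and z = -1 in its interior, so infinity and its
  mirror image are interior points; the second term normalizes the primitive at the horizon.\<close>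

definition KK where "KK z = integral {-2..z} kk - integral {-2..0} kk"

definition hm where "hm = KK 1"

lemma M_pos: "M > 0" using a_pos by (simp add: M_def add_pos_pos)

text \<open>With y = 1 - z^2 this is y^2 + a^2 (1 + y + y^2), and 1 + y + y^2 has no real zero.
  Positivity also for |z| > 1 is what continues the profile past infinity.\<close>

lemma kq_pos: "kq z > 0"
proof -
  define y where "y = 1 - z\<^sup>2"
  have e: "kq z = (y + a\<^sup>2 / 2)\<^sup>2 + a\<^sup>2 * (1 - a\<^sup>2 / 4 + y\<^sup>2)" unfolding kq_def y_def
    by (simp add: power2_eq_square algebra_simps)
  have "a\<^sup>2 * (1 - a\<^sup>2 / 4 + y\<^sup>2) + (y + a\<^sup>2 / 2)\<^sup>2 = a\<^sup>2 * (1 + (y + 1/2)\<^sup>2 - 1/4) + y\<^sup>2"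
    by (simp add: power2_eq_square algebra_simps)
  also have "\<dots> > 0"
    using a_pos by (intro add_pos_nonneg mult_pos_pos) (auto intro: add_nonneg_pos simp: add_pos_nonneg)
  finally show ?thesis using e by linarith
qed

lemma kk_pos: "kk z > 0" unfolding kk_def using kq_pos by simp

lemma kk_even: "kk (- z) = kk z" unfolding kk_def kq_def by simp

lemma kk_cont: "continuous_on S kk"
  unfolding kk_def kq_def using kq_pos[unfolded kq_def]
  by (intro continuous_intros) (metis less_irrefl real_sqrt_eq_zero_cancel_iff)

lemma KK_cont: "continuous_on {-2..2} KK"
  unfolding KK_def
  by (intro continuous_intros indefinite_integral_continuous_1 integrable_continuous_real kk_cont)

lemma KK_deriv: assumes "z \<in> {-2<..<2}" shows "(KK has_real_derivative kk z) (at z)"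
proof -
  have "((\<lambda>z. integral {-2..z} kk) has_real_derivative kk z) (at z within {-2..2})"
    by (rule integral_has_real_derivative[OF kk_cont]) (use assms in auto)
  then have "((\<lambda>z. integral {-2..z} kk) has_real_derivative kk z) (at z)"
    using assms by (simp add: at_within_Icc_at)
  then show ?thesis unfolding KK_def by (auto intro!: derivative_eq_intros)
qed

lemma KK_0 [simp]: "KK 0 = 0" by (simp add: KK_def)

lemma KK_odd: assumes z: "z \<in> {-2<..<2}" shows "KK (- z) = - KK z"
proof -
  have d: "((\<lambda>z. KK (- z) + KK z) has_real_derivative 0) (at z)" if "z \<in> {-2<..<2}" for z
  proof -
    have "((\<lambda>z. KK (- z)) has_real_derivative kk (- z) * - 1) (at z)"
      by (rule DERIV_chain2[OF KK_deriv]) (use that in \<open>auto intro!: derivative_eq_intros\<close>)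
    then show ?thesis using KK_deriv[OF that] kk_even
      by (auto intro!: derivative_eq_intros)
  qed
  have "\<exists>c. \<forall>z\<in>{-2<..<2}. KK (- z) + KK z = c"
    by (rule has_field_derivative_zero_constant) (use d in \<open>auto intro: has_field_derivative_at_within\<close>)
  then obtain c where c: "\<forall>z\<in>{-2<..<2}. KK (- z) + KK z = c" by blast
  have "c = 0" using c[THEN bspec, of 0] by simp
  then show ?thesis using c z by force
qed

lemma KK_less: assumes "-2 \<le> x" "x < y" "y \<le> 2" shows "KK x < KK y"
proof (rule DERIV_pos_imp_increasing_open[OF assms(2)])
  show "\<exists>D. (KK has_real_derivative D) (at z) \<and> D > 0" if "x < z" "z < y" for z
    using KK_deriv[of z] kk_pos[of z] that assms by auto
  show "continuous_on {x..y} KK" using assms by (auto intro: continuous_on_subset[OF KK_cont])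
qed

lemma hm_pos: "hm > 0" using KK_less[of 0 1] by (simp add: hm_def)

definition ZZ where "ZZ = (SOME g.
   (\<forall>x\<in>{-2..2}. g (KK x) = x) \<and>
   (\<forall>y\<in>{KK (-2)..KK 2}. g y \<in> {-2..2} \<and> KK (g y) = y) \<and>
   (\<forall>y\<in>{KK (-2)<..<KK 2}. g y \<in> {-2<..<2}) \<and>
   (\<forall>y\<in>{KK (-2)<..<KK 2}. (g has_real_derivative inverse (kk (g y))) (at y)))"

lemma ZZ:
  "\<And>x. x \<in> {-2..2} \<Longrightarrow> ZZ (KK x) = x"
  "\<And>y. y \<in> {KK (-2)..KK 2} \<Longrightarrow> ZZ y \<in> {-2..2}"
  "\<And>y. y \<in> {KK (-2)..KK 2} \<Longrightarrow> KK (ZZ y) = y"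
  "\<And>y. y \<in> {KK (-2)<..<KK 2} \<Longrightarrow> ZZ y \<in> {-2<..<2}"
  "\<And>y. y \<in> {KK (-2)<..<KK 2} \<Longrightarrow> (ZZ has_real_derivative inverse (kk (ZZ y))) (at y)"
proof -
  have "\<exists>g. (\<forall>x\<in>{-2..2}. g (KK x) = x) \<and>
   (\<forall>y\<in>{KK (-2)..KK 2}. g y \<in> {-2..2} \<and> KK (g y) = y) \<and>
   (\<forall>y\<in>{KK (-2)<..<KK 2}. g y \<in> {-2<..<2}) \<and>
   (\<forall>y\<in>{KK (-2)<..<KK 2}. (g has_real_derivative inverse (kk (g y))) (at y))"
    by (rule increasing_inverse[OF _ KK_cont KK_deriv kk_pos]) simp_all
  note Z = someI_ex[OF this, folded ZZ_def]
  note Z1 = Z[THEN conjunct1] and Z2 = Z[THEN conjunct2, THEN conjunct1]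
    and Z3 = Z[THEN conjunct2, THEN conjunct2, THEN conjunct1]
    and Z4 = Z[THEN conjunct2, THEN conjunct2, THEN conjunct2]
  show "\<And>x. x \<in> {-2..2} \<Longrightarrow> ZZ (KK x) = x"
  "\<And>y. y \<in> {KK (-2)..KK 2} \<Longrightarrow> ZZ y \<in> {-2..2}"
  "\<And>y. y \<in> {KK (-2)..KK 2} \<Longrightarrow> KK (ZZ y) = y"
  "\<And>y. y \<in> {KK (-2)<..<KK 2} \<Longrightarrow> ZZ y \<in> {-2<..<2}"
  "\<And>y. y \<in> {KK (-2)<..<KK 2} \<Longrightarrow> (ZZ has_real_derivative inverse (kk (ZZ y))) (at y)"
    using Z1[THEN bspec] Z2[THEN bspec] Z3[THEN bspec] Z4[THEN bspec] by simp_all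
qed

text \<open>Images of z = 2 and z = -2 under h = hm - KK z. The open interval between them contains
  both infinities, h = 0 and h = 2 hm.\<close>

definition lo where "lo = hm - KK 2"
definition hi where "hi = hm - KK (-2)"

lemma lo_hi: "lo < 0" "2 * hm < hi"
  using KK_less[of 1 2] KK_less[of "-2" "-1"] KK_odd[of 1] by (simp_all add: lo_def hi_def hm_def)

text \<open>\<open>UU\<close> is 1/r for the areal radius r, because 1 - z^2 = a / r, and
  \<open>VV\<close> is its derivative. The shift by \<open>hm\<close> puts infinity at h = 0 and the
  horizon at h = hm; for h < 0 the continued profile is negative.\<close>

definition UU where "UU h = (1 - (ZZ (hm - h))\<^sup>2) / a"
definition VV where "VV h = ZZ (hm - h) * sqrt (kq (ZZ (hm - h))) / a"

lemma ZZ_shift_deriv: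
  assumes "h \<in> {lo<..<hi}"
  shows "((\<lambda>h. ZZ (hm - h)) has_real_derivative - sqrt (kq (ZZ (hm - h))) / 2) (at h)"
proof -
  have "((\<lambda>h. ZZ (hm - h)) has_real_derivative inverse (kk (ZZ (hm - h))) * - 1) (at h)"
    by (rule DERIV_chain2[OF ZZ(5)])
       (use assms in \<open>auto intro!: derivative_eq_intros simp: lo_def hi_def\<close>)
  then show ?thesis by (simp add: kk_def)
qed

lemma UU_deriv:
  assumes "h \<in> {lo<..<hi}"
  shows "(UU has_real_derivative VV h) (at h)"
  unfolding UU_def[abs_def] VV_def using a_pos
  by (auto intro!: derivative_eq_intros ZZ_shift_deriv[OF assms] simp: field_simps)

lemma kq_eq: "z\<^sup>2 * kq z / a\<^sup>2 = 1 + ((1 - z\<^sup>2) / a)\<^sup>2 - M * ((1 - z\<^sup>2) / a) ^ 3"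
  using a_pos unfolding kq_def M_def
  by (simp add: field_simps) (simp add: algebra_simps eval_nat_numeral)

lemma UU_energy: "(VV h)\<^sup>2 = 1 + (UU h)\<^sup>2 - M * UU h ^ 3"
  using kq_eq[of "ZZ (hm - h)"] kq_pos[of "ZZ (hm - h)"]
  unfolding UU_def VV_def by (simp add: power_mult_distrib power_divide)

text \<open>Differentiated from the explicit form. Deriving it from \<open>UU_energy\<close> would
  require division by \<open>VV\<close>, which vanishes at the horizon.\<close>

lemma VV_deriv:
  assumes "h \<in> {lo<..<hi}"
  shows "(VV has_real_derivative UU h - 3/2 * M * (UU h)\<^sup>2) (at h)"
proof -
  define z where "z = ZZ (hm - h)"
  have kqd: "(kq has_real_derivative (- 2 * a\<^sup>2 * x - 4 * (1 + a\<^sup>2) * x * (1 - x\<^sup>2))) (at x)" for x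
    unfolding kq_def[abs_def] by (auto intro!: derivative_eq_intros simp: algebra_simps)
  have "((\<lambda>x. x * sqrt (kq x) / a) has_real_derivative
      (sqrt (kq z) + z * ((- 2 * a\<^sup>2 * z - 4 * (1 + a\<^sup>2) * z * (1 - z\<^sup>2)) / (2 * sqrt (kq z)))) / a) (at z)"
    using kq_pos[of z] a_pos
    by (auto intro!: derivative_eq_intros DERIV_chain2[OF DERIV_real_sqrt kqd] kqd simp: field_simps)
  then have "(VV has_real_derivative
      (sqrt (kq z) + z * ((- 2 * a\<^sup>2 * z - 4 * (1 + a\<^sup>2) * z * (1 - z\<^sup>2)) / (2 * sqrt (kq z)))) / a *
       (- sqrt (kq z) / 2)) (at h)"
    unfolding VV_def[abs_def] z_def
    by (rule DERIV_chain2[OF _ ZZ_shift_deriv[OF assms]])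
  moreover have "(sqrt (kq z) + z * ((- 2 * a\<^sup>2 * z - 4 * (1 + a\<^sup>2) * z * (1 - z\<^sup>2)) / (2 * sqrt (kq z)))) / a *
       (- sqrt (kq z) / 2) = - (kq z + z * (- 2 * a\<^sup>2 * z - 4 * (1 + a\<^sup>2) * z * (1 - z\<^sup>2)) / 2) / (2 * a)"
    using kq_pos[of z] a_pos by (simp add: field_simps)
  moreover have "\<dots> = UU h - 3/2 * M * (UU h)\<^sup>2"
    unfolding UU_def z_def[symmetric] kq_def M_def using a_pos
    by (simp add: field_simps) (simp add: algebra_simps eval_nat_numeral)
  ultimately show ?thesis by simp
qed

lemma ZZ_less_iff:
  assumes "h \<in> {lo<..<hi}" "z \<in> {-2..2}"
  shows "ZZ (hm - h) < z \<longleftrightarrow> hm - KK z < h"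
proof -
  have r: "hm - h \<in> {KK (-2)<..<KK 2}" using assms by (auto simp: lo_def hi_def)
  have z: "ZZ (hm - h) \<in> {-2..2}" "KK (ZZ (hm - h)) = hm - h" using ZZ(2,3)[of "hm - h"] r by auto
  then show ?thesis
    using KK_less[of "ZZ (hm - h)" z] KK_less[of z "ZZ (hm - h)"] assms(2)
    by (smt (verit) atLeastAtMost_iff)
qed

lemma ZZ_greater_iff:
  assumes "h \<in> {lo<..<hi}" "z \<in> {-2..2}"
  shows "z < ZZ (hm - h) \<longleftrightarrow> h < hm - KK z"
proof -
  have r: "hm - h \<in> {KK (-2)<..<KK 2}" using assms by (auto simp: lo_def hi_def)
  have z: "ZZ (hm - h) \<in> {-2..2}" "KK (ZZ (hm - h)) = hm - h" using ZZ(2,3)[of "hm - h"] r by auto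
  then show ?thesis
    using KK_less[of "ZZ (hm - h)" z] KK_less[of z "ZZ (hm - h)"] assms(2)
    by (smt (verit) atLeastAtMost_iff)
qed

lemma KK_m1: "KK (-1) = - hm" using KK_odd[of 1] by (simp add: hm_def)

lemma in_dom: "0 < h \<Longrightarrow> h < 2 * hm \<Longrightarrow> h \<in> {lo<..<hi}" "0 \<in> {lo<..<hi}" "hm \<in> {lo<..<hi}"
  "2 * hm \<in> {lo<..<hi}"
  using lo_hi hm_pos by auto

lemma UU_pos: assumes "0 < h" "h < 2 * hm" shows "UU h > 0"
proof -
  have "-1 < ZZ (hm - h)" "ZZ (hm - h) < 1"
    using ZZ_less_iff[OF in_dom(1)[OF assms], of 1] ZZ_greater_iff[OF in_dom(1)[OF assms], of "-1"] assms
    by (auto simp: KK_m1 hm_def[symmetric])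
  then have "(ZZ (hm - h))\<^sup>2 < 1" by (simp add: abs_square_less_1)
  then show ?thesis unfolding UU_def using a_pos by simp
qed

lemma UU_0 [simp]: "UU 0 = 0" and VV_0 [simp]: "VV 0 = 1" and UU_2hm [simp]: "UU (2 * hm) = 0"
proof -
  have "ZZ hm = 1" using ZZ(1)[of 1] by (simp add: hm_def)
  then show "UU 0 = 0" "VV 0 = 1"
    using a_pos by (simp_all add: UU_def VV_def kq_def)
  have "ZZ (- hm) = -1" using ZZ(1)[of "-1"] by (simp add: KK_m1)
  then show "UU (2 * hm) = 0" by (simp add: UU_def)
qed

lemma VV_pos: assumes "h \<in> {lo<..<hi}" "h < hm" shows "VV h > 0"
  using ZZ_greater_iff[OF assms(1), of 0] assms(2) kq_pos a_pos by (simp add: VV_def)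

lemma VV_neg: assumes "h \<in> {lo<..<hi}" "h > hm" shows "VV h < 0"
  using ZZ_less_iff[OF assms(1), of 0] assms(2) kq_pos a_pos
  by (simp add: VV_def divide_less_0_iff mult_less_0_iff)

lemma UU_le: "UU h \<le> 1 / a" using a_pos by (simp add: UU_def divide_le_cancel)

text \<open>The derivatives are polynomials in the functions themselves, so regularity bootstraps.
  Since 0 lies inside the interval, this is smoothness across infinity.\<close>

lemma Ck_UU_VV: "Ck_on k {lo<..<hi} UU \<and> Ck_on k {lo<..<hi} VV"
proof (induction k)
  case 0
  show ?case using DERIV_isCont[OF UU_deriv] DERIV_isCont[OF VV_deriv]
    by (simp add: continuous_at_imp_continuous_on)
next
  case (Suc k)
  have "Ck_on (Suc k) {lo<..<hi} UU" by (rule Ck_on_Suc_real[OF _ UU_deriv]) (use Suc in auto)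
  moreover have "Ck_on (Suc k) {lo<..<hi} VV"
  proof (rule Ck_on_Suc_real[OF _ VV_deriv])
    show "Ck_on k {lo<..<hi} (\<lambda>h. UU h - 3/2 * M * (UU h)\<^sup>2)"
      using Suc by (intro Ck_on_diff Ck_on_mult Ck_on_const Ck_on_power open_greaterThanLessThan) auto
  qed auto
  ultimately show ?case by blast
qed

section \<open>The profile compared with the defining formulas of the metric\<close>

lemma adss_a: "adss_a M = a"
  unfolding adss_a_def
proof (rule the_equality)
  show "0 < a \<and> 1 + a\<^sup>2 - M / a = 0"
    using a_pos by (simp add: M_def field_simps power2_eq_square power3_eq_cube)
  fix r assume r: "0 < r \<and> 1 + r\<^sup>2 - M / r = 0"
  then have "r * (1 + r\<^sup>2 - M / r) = 0" by simp
  then have e: "r + r ^ 3 = a + a ^ 3"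
    using r unfolding M_def right_diff_distrib distrib_left
    by (auto simp add: power2_eq_square power3_eq_cube)
  show "r = a"
  proof (rule ccontr)
    assume "r \<noteq> a"
    then consider "r < a" | "a < r" by linarith
    then show False
      by cases (use e r a_pos power_strict_mono[of r a 3] power_strict_mono[of a r 3] in auto)
  qed
qed

lemma adss_h: assumes "a \<le> r" shows "adss_h M r = hm - KK (sqrt (1 - a / r))"
proof -
  let ?f = "\<lambda>t. 1 / sqrt (t * (t + t ^ 3 - M))" and ?F = "\<lambda>t. KK (sqrt (1 - a / t))"
  \<comment> \<open>Since M = a + a^3, the number \<open>a\<close> is a root of t + t^3 - M, and t -
    a splits off.\<close>
  have fac: "t * (t + t ^ 3 - M) = (1 - a / t) * (t ^ 4 * (1 + a / t + (1 + a\<^sup>2) / t\<^sup>2))"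
    if "t \<noteq> 0" for t
    unfolding M_def using that
    by (simp add: field_simps) (simp add: algebra_simps eval_nat_numeral)
  have rg: "sqrt (1 - a / t) \<in> {0..<1}" if "a \<le> t" for t
    using that a_pos by (auto simp: field_simps)
  have cont: "continuous_on {r..y} ?F" for y
  proof (rule continuous_on_compose2[OF KK_cont])
    show "continuous_on {r..y} (\<lambda>t. sqrt (1 - a / t))"
      using assms a_pos by (auto intro!: continuous_intros)
    show "(\<lambda>t. sqrt (1 - a / t)) ` {r..y} \<subseteq> {-2..2}"
    proof (rule image_subsetI)
      fix t assume "t \<in> {r..y}"
      then have "a \<le> t" using assms by simp
      from rg[OF this] show "sqrt (1 - a / t) \<in> {-2..2}"
        unfolding atLeastLessThan_iff atLeastAtMost_iff by linarith
    qed
  qed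
  have der: "(?F has_real_derivative ?f t) (at t)" if t: "a < t" for t
  proof -
    define z where "z = sqrt (1 - a / t)"
    define w where "w = 1 + a / t + (1 + a\<^sup>2) / t\<^sup>2"
    have tp: "t > 0" using a_pos t by simp
    have zz: "z > 0" "z\<^sup>2 = 1 - a / t" using t tp by (auto simp: z_def)
    have w: "w > 0" unfolding w_def using tp a_pos by (intro add_pos_pos divide_pos_pos) auto
    have "kq z = a\<^sup>2 * w"
      unfolding kq_def w_def zz(2) using tp
      by (simp add: field_simps)
    then have kz: "kk z = 2 / (a * sqrt w)"
      unfolding kk_def using a_pos by (simp add: real_sqrt_mult)
    have "((\<lambda>t. sqrt (1 - a / t)) has_real_derivative a / t\<^sup>2 / (2 * z)) (at t)"
      unfolding z_def using t tp
      by (auto intro!: derivative_eq_intros simp: field_simps power2_eq_square)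
    then have "(?F has_real_derivative kk z * (a / t\<^sup>2 / (2 * z))) (at t)"
      unfolding z_def
    proof (rule DERIV_chain2[OF KK_deriv, rotated])
      show "sqrt (1 - a / t) \<in> {-2<..<2}"
        using rg[OF less_imp_le[OF t]] unfolding atLeastLessThan_iff greaterThanLessThan_iff by linarith
    qed
    moreover have "kk z * (a / t\<^sup>2 / (2 * z)) = ?f t"
    proof -
      have t4: "sqrt (t ^ 4) = t\<^sup>2" by (rule real_sqrt_unique) (auto simp: power_mult[symmetric])
      have "sqrt (t * (t + t ^ 3 - M)) = z * (t\<^sup>2 * sqrt w)"
        unfolding fac[OF less_imp_neq[OF tp, symmetric]] w_def[symmetric] real_sqrt_mult z_def[symmetric]
        using t4 by simp
      then show ?thesis unfolding kz using a_pos zz w tp by (simp add: field_simps)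
    qed
    ultimately show ?thesis by simp
  qed
  have hi: "(?f has_integral ?F y - ?F r) {r..y}" if "r \<le> y" for y
    by (rule fundamental_theorem_of_calculus_interior[OF that cont])
       (use der assms in \<open>auto simp: has_real_derivative_iff_has_vector_derivative\<close>)
  have "(?f has_integral KK 1 - ?F r) {r..}"
  proof (rule has_integral_to_inf)
    show "?f integrable_on {r..y}" for y
      using hi[of y] by (cases "r \<le> y") (auto intro: integrable_on_empty)
    have "((\<lambda>t. sqrt (1 - a / t)) \<longlongrightarrow> 1) at_top" by real_asymp
    moreover have "isCont KK 1" using KK_deriv[of 1] by (auto intro: DERIV_isCont)
    ultimately have "(?F \<longlongrightarrow> KK 1) at_top" by (rule isCont_tendsto_compose[rotated])
    then have "((\<lambda>y. ?F y - ?F r) \<longlongrightarrow> KK 1 - ?F r) at_top" by (intro tendsto_intros)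
    then show "((\<lambda>y. integral {r..y} ?f) \<longlongrightarrow> KK 1 - ?F r) at_top"
      by (rule Lim_transform_eventually)
         (rule eventually_mono[OF eventually_ge_at_top[of r]], simp add: integral_unique[OF hi])
    show "0 \<le> ?f t" if "r \<le> t" for t
    proof -
      have "t > 0" "a \<le> t" using that assms a_pos by auto
      moreover from this have "a ^ 3 \<le> t ^ 3" using a_pos by (intro power_mono) auto
      ultimately show ?thesis by (simp add: M_def)
    qed
  qed
  then show ?thesis unfolding adss_h_def hm_def by (rule integral_unique)
qed

lemma adss_h_range: assumes "a \<le> r" shows "0 < adss_h M r" "adss_h M r \<le> hm"
proof -
  have s: "0 \<le> sqrt (1 - a / r)" "sqrt (1 - a / r) < 1" using assms a_pos by (auto simp: field_simps)
  show "0 < adss_h M r"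
    using KK_less[of "sqrt (1 - a / r)" 1] s by (simp add: adss_h[OF assms] hm_def)
  have "0 \<le> KK (sqrt (1 - a / r))"
    using KK_less[of 0 "sqrt (1 - a / r)"] s
    by (cases "sqrt (1 - a / r) = 0") (metis KK_0 order_refl, force)
  then show "adss_h M r \<le> hm" unfolding adss_h[OF assms] by simp
qed

lemma coth_half: assumes "0 < h" shows "ln (1 / tanh (h / 2)) = rho_of_tau (exp (- h))"
proof -
  have "1 / tanh (h / 2) = (1 + exp (- h)) / (1 - exp (- h))" by (simp add: tanh_real_altdef)
  then show ?thesis unfolding rho_of_tau_def by simp
qed

lemma adss_rho: assumes "a \<le> r" shows "adss_rho M r = rho_of_tau (exp (- adss_h M r))"
  unfolding adss_rho_def by (rule coth_half[OF adss_h_range(1)[OF assms]])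

lemma adss_rho_inj: "inj_on (adss_rho M) {a..}"
proof (rule inj_onI)
  fix x y assume xy: "x \<in> {a..}" "y \<in> {a..}" "adss_rho M x = adss_rho M y"
  then have "rho_of_tau (exp (- adss_h M x)) = rho_of_tau (exp (- adss_h M y))"
    using adss_rho[of x] adss_rho[of y] by simp
  then have "adss_h M x = adss_h M y"
    by (metis cyl_rho adss_h_range(1) xy(1,2) atLeast_iff)
  then have k: "KK (sqrt (1 - a / x)) = KK (sqrt (1 - a / y))"
    using adss_h[of x] adss_h[of y] xy by simp
  have r: "sqrt (1 - a / t) \<in> {-2..2}" if t: "a \<le> t" for t
  proof -
    have "0 \<le> 1 - a / t" "1 - a / t \<le> 1" using t a_pos by (auto simp: field_simps)
    then have "0 \<le> sqrt (1 - a / t)" "sqrt (1 - a / t) \<le> 1" by auto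
    then show ?thesis unfolding atLeastAtMost_iff by linarith
  qed
  have "sqrt (1 - a / x) = ZZ (KK (sqrt (1 - a / x)))"
    by (rule ZZ(1)[symmetric, OF r]) (use xy in simp)
  also have "\<dots> = ZZ (KK (sqrt (1 - a / y)))" by (simp only: k)
  also have "\<dots> = sqrt (1 - a / y)" by (rule ZZ(1)[OF r]) (use xy in simp)
  finally have "a / x = a / y" by simp
  then show "x = y" using a_pos xy(1,2) by (simp add: frac_eq_eq)
qed

lemma adss_r: assumes "0 < h" "h \<le> hm" shows "adss_r M (rho_of_tau (exp (- h))) = 1 / UU h"
  unfolding adss_r_def
proof (rule the_inv_into_f_eq)
  have dom: "h \<in> {lo<..<hi}" "h < 2 * hm" using assms in_dom(1)[of h] hm_pos by auto
  have U: "UU h > 0" using UU_pos assms dom by auto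
  then show r: "1 / UU h \<in> {adss_a M..}"
    using UU_le[of h] a_pos by (simp add: adss_a field_simps)
  \<comment> \<open>Here \<open>h \<le> hm\<close> enters: z is nonnegative on this side of the
    horizon only, and just then it is the square root appearing in \<open>adss_h\<close>.\<close>
  have z: "ZZ (hm - h) \<ge> 0" using ZZ_less_iff[OF dom(1), of 0] assms by auto
  have "1 - a / (1 / UU h) = (ZZ (hm - h))\<^sup>2" using a_pos by (simp add: UU_def field_simps)
  then have "sqrt (1 - a / (1 / UU h)) = ZZ (hm - h)" using z by simp
  then have "adss_h M (1 / UU h) = h"
    using adss_h[of "1 / UU h"] r ZZ(3)[of "hm - h"] dom by (simp add: adss_a lo_def hi_def)
  then show "adss_rho M (1 / UU h) = rho_of_tau (exp (- h))"
    using adss_rho[of "1 / UU h"] r by (simp add: adss_a)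
  show "inj_on (adss_rho M) {adss_a M..}" using adss_rho_inj by (simp add: adss_a)
qed

lemma adss_b: "adss_b M = exp (- hm)"
proof -
  have "adss_h M a = hm" using adss_h[of a] a_pos by simp
  then have "adss_rho M (adss_a M) = rho_of_tau (exp (- hm))" using adss_rho[of a] by (simp add: adss_a)
  then show ?thesis unfolding adss_b_def
    using tau_rho[of "exp (- hm)"] hm_pos by (simp add: less_trans[OF _ exp_gt_zero])
qed

lemma adss_rho0: "adss_rho0 M = rho_of_tau (exp (- (2 * hm)))"
  unfolding adss_rho0_def adss_b rho_of_tau_def by (simp add: exp_double[symmetric])

lemma adss_rho0_pos: "adss_rho0 M > 0"
  unfolding adss_rho0 using hm_pos by (intro rho_exp_pos) auto

lemma adss_rho0_less: assumes "0 < s" shows "adss_rho0 M < s \<longleftrightarrow> cyl s < 2 * hm"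
  using cyl_less_iff[OF adss_rho0_pos assms] cyl_rho[of "2 * hm"] hm_pos by (simp add: adss_rho0)

lemma adss_Psi: assumes "0 < h" "h \<le> hm" shows "adss_Psi M (exp (- h)) = sqrt (sinh h / UU h)"
proof -
  have "sinh (rho_of_tau (exp (- h))) = 1 / sinh h"
    using sinh_cyl[OF rho_exp_pos[OF assms(1)]] cyl_rho[OF assms(1)] assms by (simp add: field_simps)
  then show ?thesis unfolding adss_Psi_def adss_r[OF assms] by simp
qed

text \<open>Reflection in the horizon is z to -z: \<open>KK\<close> is odd and \<open>UU\<close>
  depends on z^2 only.\<close>

lemma UU_symm: "UU (2 * hm - h) = UU h" if "h \<in> {0<..<2 * hm}"
proof -
  have z: "ZZ (hm - h) \<in> {-2<..<2}" "KK (ZZ (hm - h)) = hm - h"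
    using ZZ(3,4)[of "hm - h"] in_dom(1)[of h] that by (auto simp: lo_def hi_def)
  then have "KK (- ZZ (hm - h)) = h - hm" using KK_odd by simp
  then have "ZZ (h - hm) = - ZZ (hm - h)" using ZZ(1)[of "- ZZ (hm - h)"] z by auto
  then show ?thesis by (simp add: UU_def)
qed

text \<open>The two cases in the definition of \<open>adss_phi_tau\<close> are one formula in h.
  With tau = exp (- h) and b = exp (- hm), the inversion of tau to b^2 / tau is the reflection of h
  to 2 hm - h, under which \<open>UU\<close> is invariant; the extra factors only exchange the
  hyperbolic sines.\<close>

lemma adss_phi_tau:
  assumes "0 < h" "h < 2 * hm" shows "adss_phi_tau M (exp (- h)) = sqrt (sinh h / UU h)"
proof (cases "h \<le> hm")
  case True
  then show ?thesis unfolding adss_phi_tau_def using adss_Psi assms by (simp add: adss_b)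
next
  case False
  define g where "g = 2 * hm - h"
  define b where "b = exp (- hm)"
  define t where "t = exp (- h)"
  have g: "0 < g" "g \<le> hm" using assms False by (auto simp: g_def)
  have bt: "b > 0" "t > 0" by (auto simp: b_def t_def)
  have "b\<^sup>2 / t = exp (- g)"
    unfolding b_def t_def g_def by (simp add: exp_double[symmetric] exp_diff[symmetric])
  then have P: "adss_Psi M (b\<^sup>2 / t) = sqrt (sinh g / UU h)"
    using adss_Psi[OF g] UU_symm[of h] assms by (simp add: g_def)
  have sg: "sinh g = (t / b\<^sup>2 - b\<^sup>2 / t) / 2"
    unfolding sinh_field_def b_def t_def g_def
    by (simp add: exp_double[symmetric] exp_diff[symmetric])
  have sh: "sinh h = (1 / t - t) / 2"
    unfolding sinh_field_def t_def by (simp only: exp_minus divide_inverse inverse_inverse_eq mult_1)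
  have sgp: "sinh g > 0" using g by simp
  have fac: "t\<^sup>2 - b ^ 4 = 2 * sinh g * b\<^sup>2 * t"
  proof -
    have "t\<^sup>2 - c\<^sup>2 = 2 * ((t / c - c / t) / 2) * c * t" if "c > 0" for c :: real
      using that bt by (simp add: field_simps power2_eq_square)
    from this[of "b\<^sup>2"] show ?thesis unfolding sg using bt by (simp add: power_mult[symmetric])
  qed
  then have tb: "t\<^sup>2 - b ^ 4 > 0" using sgp bt by simp
  have nb: "\<not> b \<le> t" using False by (simp add: b_def t_def)
  have "adss_phi_tau M t = b * sqrt (sinh g / UU h) * sqrt ((1 - t\<^sup>2) / (t\<^sup>2 - b ^ 4))"
    unfolding adss_phi_tau_def adss_b b_def[symmetric] P using nb by simp
  also have "\<dots> = sqrt (b\<^sup>2 * (sinh g / UU h) * ((1 - t\<^sup>2) / (t\<^sup>2 - b ^ 4)))"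
    using bt by (simp only: real_sqrt_mult real_sqrt_abs abs_of_pos)
  also have "b\<^sup>2 * (sinh g / UU h) * ((1 - t\<^sup>2) / (t\<^sup>2 - b ^ 4)) = sinh h / UU h"
  proof -
    have t2: "1 - t\<^sup>2 = 2 * sinh h * t" unfolding sh using bt by (simp add: field_simps power2_eq_square)
    show ?thesis unfolding fac t2 using sgp bt UU_pos[OF assms] by simp
  qed
  finally show ?thesis by (simp add: t_def)
qed

lemma adss_phi:
  assumes "0 < s" "cyl s < 2 * hm" shows "adss_phi M s = sqrt (sinh (cyl s) / UU (cyl s))"
  unfolding adss_phi_def using adss_phi_tau[OF cyl_pos[OF assms(1)] assms(2)] exp_cyl[OF assms(1)]
  by simp

end

lemma mass_radius_exists: assumes "M > 0" shows "\<exists>a. adss a \<and> adss.M a = M"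
proof -
  have "\<exists>a. 0 \<le> a \<and> a \<le> M \<and> a + a ^ 3 = M"
    by (rule IVT') (use assms in \<open>auto intro!: continuous_intros\<close>)
  then obtain a where a: "0 \<le> a" "a + a ^ 3 = M" by blast
  then have "0 < a" using assms by (cases "a = 0") auto
  then show ?thesis using a by (auto simp: adss_def adss.M_def)
qed

section \<open>Conformally flat metrics\<close>

lemma pd_has_derivative: "(u has_derivative D) (at x) \<Longrightarrow> pd i u x = D (axis i 1)"
  unfolding pd_def by (simp add: frechet_derivative_at[symmetric])

lemma pd_cong:
  assumes "open S" "x \<in> S" "\<And>y. y \<in> S \<Longrightarrow> u y = v y"
  shows "pd i u x = pd i v x"
proof (cases "u differentiable (at x)")
  case True
  then show ?thesis unfolding pd_def
    by (subst frechet_derivative_transform_within_open[OF True assms]) auto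
next
  \<comment> \<open>\<open>frechet_derivative\<close> is then an arbitrary choice, but one made from
    the same predicate for both functions.\<close>
  case False
  have "(u has_derivative D) (at x) \<longleftrightarrow> (v has_derivative D) (at x)" for D
    using has_derivative_transform_within_open[OF _ assms(1,2)] assms(3) by metis
  then show ?thesis unfolding pd_def frechet_derivative_def by simp
qed

lemma pd_const [simp]: "pd i (\<lambda>x. c) x = 0"
  unfolding pd_def by simp

lemma pd_mult:
  assumes "u differentiable (at x)" "v differentiable (at x)"
  shows "pd i (\<lambda>x. u x * v x) x = pd i u x * v x + u x * pd i v x"
  using pd_has_derivative[OF has_derivative_mult[OF assms[unfolded frechet_derivative_works]]]
  by (simp add: pd_def)

lemma pd_cmult:
  assumes "u differentiable (at x)"
  shows "pd i (\<lambda>x. c * u x) x = c * pd i u x"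
  using pd_mult[of "\<lambda>x. c", OF _ assms] by simp

lemma pd_add:
  assumes "u differentiable (at x)" "v differentiable (at x)"
  shows "pd i (\<lambda>x. u x + v x) x = pd i u x + pd i v x"
  using pd_has_derivative[OF has_derivative_add[OF assms[unfolded frechet_derivative_works]]]
  by (simp add: pd_def)

lemma pd_diff:
  assumes "u differentiable (at x)" "v differentiable (at x)"
  shows "pd i (\<lambda>x. u x - v x) x = pd i u x - pd i v x"
  using pd_has_derivative[OF has_derivative_diff[OF assms[unfolded frechet_derivative_works]]]
  by (simp add: pd_def)

lemma pd_chain:
  fixes f :: "real \<Rightarrow> real"
  assumes "u differentiable (at x)" "(f has_real_derivative f') (at (u x))"
  shows "pd i (\<lambda>x. f (u x)) x = f' * pd i u x"
  using pd_has_derivative[OF has_derivative_compose[OF assms(1)[unfolded frechet_derivative_works]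
      assms(2)[unfolded has_field_derivative_def]]]
  by (simp add: pd_def)

lemma differentiable_chain_real:
  fixes f :: "real \<Rightarrow> real"
  assumes "u differentiable (at x)" "(f has_real_derivative f') (at (u x))"
  shows "(\<lambda>x. f (u x)) differentiable (at x)"
  using has_derivative_compose[OF assms(1)[unfolded frechet_derivative_works]
      assms(2)[unfolded has_field_derivative_def]] by (auto simp: differentiable_def)

lemma Ck_on_pd: "Ck_on (Suc k) S u \<Longrightarrow> Ck_on k S (pd i u)"
  unfolding pd_def[abs_def] by simp

lemma Ck_on_differentiable: "Ck_on (Suc k) S u \<Longrightarrow> x \<in> S \<Longrightarrow> u differentiable (at x)"
  by simp

lemma matrix_inv_scaleR_mat:
  assumes "c \<noteq> 0" shows "matrix_inv (c *\<^sub>R mat 1 :: real^'n::finite^'n) = (1 / c) *\<^sub>R mat 1"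
proof -
  let ?A = "c *\<^sub>R mat 1 :: real^'n^'n" and ?B = "(1 / c) *\<^sub>R mat 1 :: real^'n^'n"
  have B: "?A ** ?B = mat 1" "?B ** ?A = mat 1"
    using assms by (simp_all add: matrix_scalar_ac scalar_matrix_assoc[symmetric])
  then have "\<exists>B. ?A ** B = mat 1 \<and> B ** ?A = mat 1" by blast
  from someI_ex[OF this] have "?A ** matrix_inv ?A = mat 1" unfolding matrix_inv_def by blast
  then have "?B ** (?A ** matrix_inv ?A) = ?B" by (simp add: matrix_mul_rid)
  then show ?thesis using B by (simp add: matrix_mul_assoc matrix_mul_lid)
qed

lemma mat_1_nth: "(c *\<^sub>R mat 1 :: real^'n::finite^'n) $ i $ j = (if i = j then c else 0)"
  by (simp add: mat_def)

lemma mat_1_mult: "(c *\<^sub>R mat 1 :: real^'n::finite^'n) *v x = c *\<^sub>R x"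
  by (simp add: scaleR_matrix_vector_assoc[symmetric])

lemma sum_3_real: "(\<Sum>i\<in>(UNIV :: 3 set). f i) = f 1 + f 2 + (f 3 :: real)"
  by (rule sum_3)

text \<open>An exponential factor makes the Christoffel symbols linear in the gradient of
  \<open>w\<close>. The locale is instantiated for the hyperbolic metric, for its conformal
  multiples, where the exponents add, and for radial metrics.\<close>

locale conf_flat =
  fixes g :: "3 metric_field" and w :: "real^3 \<Rightarrow> real" and S :: "(real^3) set"
  assumes S: "open S" and g: "\<And>x. x \<in> S \<Longrightarrow> g x = exp (w x) *\<^sub>R mat 1"
begin

lemma ginv: "x \<in> S \<Longrightarrow> ginv g x $ i $ j = (if i = j then exp (- w x) else 0)"
  unfolding ginv_def by (simp add: g matrix_inv_scaleR_mat exp_minus inverse_eq_divide) (simp add: mat_def)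

lemma pd_g:
  assumes x: "x \<in> S" and d: "w differentiable (at x)"
  shows "pd m (\<lambda>y. g y $ i $ j) x = (if i = j then exp (w x) * pd m w x else 0)"
proof -
  have "pd m (\<lambda>y. g y $ i $ j) x = pd m (\<lambda>y. if i = j then exp (w y) else 0) x"
    by (rule pd_cong[OF S x]) (simp add: g mat_def)
  also have "\<dots> = (if i = j then exp (w x) * pd m w x else 0)"
    using pd_chain[OF d DERIV_exp] by simp
  finally show ?thesis .
qed

lemma christoffel:
  assumes x: "x \<in> S" and d: "w differentiable (at x)"
  shows "christoffel g k i j x =
    ((if j = k then pd i w x else 0) + (if i = k then pd j w x else 0) - (if i = j then pd k w x else 0)) / 2"
proof -
  have "christoffel g k i j x = 1/2 * (exp (- w x) * (pd i (\<lambda>y. g y $ j $ k) x + pd j (\<lambda>y. g y $ i $ k) x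
      - pd k (\<lambda>y. g y $ i $ j) x))"
    unfolding christoffel_def ginv[OF x] by (simp add: if_distrib[of "\<lambda>x. x * _"] cong: if_cong)
  also have "\<dots> = ((if j = k then pd i w x else 0) + (if i = k then pd j w x else 0)
      - (if i = j then pd k w x else 0)) / 2"
    unfolding pd_g[OF x d] by (simp add: exp_minus algebra_simps)
  finally show ?thesis .
qed

lemma laplacian:
  assumes x: "x \<in> S" and d: "w differentiable (at x)"
  shows "laplacian g u x = exp (- w x) * (\<Sum>i\<in>UNIV. pd i (pd i u) x + pd i w x * pd i u x / 2)"
  unfolding laplacian_def ginv[OF x] christoffel[OF x d] sum_3_real
  by (simp add: algebra_simps)

lemma scalar_curvature:
  assumes C: "Ck_on 2 S w" and x: "x \<in> S"
  shows "scalar_curvature g x = - exp (- w x) * (\<Sum>i\<in>UNIV. 2 * pd i (pd i w) x + (pd i w x)\<^sup>2 / 2)"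
proof -
  have C1: "Ck_on (Suc (Suc 0)) S w" using C by (simp add: numeral_2_eq_2)
  have d: "w differentiable (at y)" if "y \<in> S" for y using Ck_on_differentiable[OF C1 that] .
  have d2: "pd i w differentiable (at x)" for i
    using Ck_on_differentiable[OF Ck_on_pd[OF C1] x] .
  have ch: "pd m (christoffel g k i j) x =
    ((if j = k then pd m (pd i w) x else 0) + (if i = k then pd m (pd j w) x else 0)
      - (if i = j then pd m (pd k w) x else 0)) / 2" for m k i j
  proof -
    have "pd m (christoffel g k i j) x = pd m (\<lambda>y. ((if j = k then 1/2 else 0) * pd i w y
        + (if i = k then 1/2 else 0) * pd j w y) - (if i = j then 1/2 else 0) * pd k w y) x"
      by (rule pd_cong[OF S x]) (simp add: christoffel[OF _ d] field_simps)
    also have "\<dots> = (if j = k then 1/2 else 0) * pd m (pd i w) x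
        + (if i = k then 1/2 else 0) * pd m (pd j w) x - (if i = j then 1/2 else 0) * pd m (pd k w) x"
      by (subst pd_diff pd_add pd_cmult | intro differentiable_diff differentiable_add
          differentiable_mult differentiable_const d2 | rule refl)+
    finally show ?thesis by simp
  qed
  have "scalar_curvature g x = exp (- w x) * (\<Sum>i\<in>UNIV. ricci g i i x)"
    unfolding scalar_curvature_def ginv[OF x] sum_3_real by (simp add: algebra_simps)
  also have "(\<Sum>i\<in>UNIV. ricci g i i x) = - (\<Sum>i\<in>UNIV. 2 * pd i (pd i w) x + (pd i w x)\<^sup>2 / 2)"
    unfolding ricci_def ch christoffel[OF x d[OF x]] sum_3_real
    by (simp add: field_simps power2_eq_square)
  finally show ?thesis by simp
qed

end

section \<open>The hyperbolic metric\<close>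

definition hyp_w :: "real^3 \<Rightarrow> real" where
  "hyp_w x = ln 4 - 2 * ln (1 - x \<bullet> x)"

lemma open_hyp_space: "open hyp_space" by (simp add: hyp_space_def)

lemma hyp_space_iff: "x \<in> hyp_space \<longleftrightarrow> x \<bullet> x < 1"
  by (simp add: hyp_space_def norm_eq_sqrt_inner)

lemma hyp_space_norm: "x \<in> hyp_space \<longleftrightarrow> norm x < 1"
  by (simp add: hyp_space_def)

lemma exp_hyp_w: "x \<in> hyp_space \<Longrightarrow> exp (hyp_w x) = 4 / (1 - x \<bullet> x)\<^sup>2"
  unfolding hyp_space_iff hyp_w_def by (simp add: exp_diff exp_double)

lemma hyp_metric_eq: "x \<in> hyp_space \<Longrightarrow> hyp_metric x = exp (hyp_w x) *\<^sub>R mat 1"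
  unfolding hyp_metric_def exp_hyp_w by (simp add: power2_norm_eq_inner)

interpretation hyp: conf_flat hyp_metric hyp_w hyp_space
  by unfold_locales (auto simp: open_hyp_space hyp_metric_eq)

lemma Ck_hyp_w: "Ck_on k hyp_space hyp_w"
  unfolding hyp_w_def[abs_def]
  by (intro Ck_on_diff Ck_on_mult Ck_on_const open_hyp_space
      Ck_on_compose[OF open_hyp_space _ _ Ck_on_ln] Ck_on_inner Ck_on_ident)
     (auto simp: hyp_space_iff)

lemma has_derivative_dot: "((\<lambda>x::real^3. x \<bullet> x) has_derivative (\<lambda>v. 2 * (x \<bullet> v))) (at x)"
  by (auto intro!: derivative_eq_intros simp: inner_commute)

lemma pd_dot: "pd i (\<lambda>x::real^3. x \<bullet> x) x = 2 * x $ i"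
  using pd_has_derivative[OF has_derivative_dot] by (simp add: inner_axis)

lemma diff_dot: "(\<lambda>x::real^3. x \<bullet> x) differentiable (at x)"
  using has_derivative_dot by (auto simp: differentiable_def)

lemma pd_nth: "pd i (\<lambda>x::real^3. x $ j) x = (if i = j then 1 else 0)"
proof -
  have "((\<lambda>x::real^3. x $ j) has_derivative (\<lambda>v. v $ j)) (at x)"
    by (rule bounded_linear_imp_has_derivative[OF bounded_linear_vec_nth])
  from pd_has_derivative[OF this] show ?thesis by (simp add: axis_def)
qed

lemma diff_nth: "(\<lambda>x::real^3. x $ j) differentiable (at x)"
  by (rule differentiableI[OF bounded_linear_imp_has_derivative[OF bounded_linear_vec_nth]])

lemma pd_fun_dot:
  fixes f :: "real \<Rightarrow> real"
  assumes "(f has_real_derivative f') (at (x \<bullet> x))"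
  shows "pd i (\<lambda>x::real^3. f (x \<bullet> x)) x = 2 * f' * x $ i"
  using pd_chain[OF diff_dot assms] by (simp add: pd_dot)

lemma pd_hyp_w: assumes "x \<in> hyp_space" shows "pd i hyp_w x = 4 * x $ i / (1 - x \<bullet> x)"
proof -
  have "((\<lambda>s. ln 4 - 2 * ln (1 - s)) has_real_derivative 2 / (1 - x \<bullet> x)) (at (x \<bullet> x))"
    using assms by (auto simp: hyp_space_iff intro!: derivative_eq_intros)
  from pd_fun_dot[OF this] show ?thesis unfolding hyp_w_def[abs_def] by simp
qed

lemma pd_pd_hyp_w:
  assumes x: "x \<in> hyp_space"
  shows "pd i (pd i hyp_w) x = 4 / (1 - x \<bullet> x) + 8 * (x $ i)\<^sup>2 / (1 - x \<bullet> x)\<^sup>2"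
proof -
  have d: "((\<lambda>s. 4 / (1 - s)) has_real_derivative 4 / (1 - x \<bullet> x)\<^sup>2) (at (x \<bullet> x))"
    using x by (auto simp: hyp_space_iff power2_eq_square intro!: derivative_eq_intros)
  have "pd i (pd i hyp_w) x = pd i (\<lambda>x. x $ i * (4 / (1 - x \<bullet> x))) x"
    by (rule pd_cong[OF open_hyp_space x]) (simp add: pd_hyp_w)
  also have "\<dots> = 4 / (1 - x \<bullet> x) + x $ i * (2 * (4 / (1 - x \<bullet> x)\<^sup>2) * x $ i)"
    by (subst pd_mult[OF diff_nth differentiable_chain_real[OF diff_dot d]])
       (simp add: pd_nth pd_fun_dot[OF d])
  finally show ?thesis by (simp add: power2_eq_square)
qed

lemma hyp_laplacian:
  assumes x: "x \<in> hyp_space"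
  shows "laplacian hyp_metric u x =
    (1 - x \<bullet> x)\<^sup>2 / 4 * (\<Sum>i\<in>UNIV. pd i (pd i u) x + 2 * x $ i * pd i u x / (1 - x \<bullet> x))"
proof -
  have d: "hyp_w differentiable (at x)" by (rule Ck_on_differentiable[OF Ck_hyp_w x])
  have "exp (- hyp_w x) = (1 - x \<bullet> x)\<^sup>2 / 4" by (simp add: exp_minus exp_hyp_w[OF x])
  moreover have "4 * a / b * c / 2 = 2 * a * c / b" for a b c :: real by simp
  ultimately show ?thesis unfolding hyp.laplacian[OF x d] pd_hyp_w[OF x] by presburger
qed

text \<open>This is the conformal transformation law u^-5 (- 6 u - 8 Lap u), centred at -6. It is
  obtained by viewing the product as a single conformally flat metric with exponent 4 ln u +
  \<open>hyp_w\<close>; the terms quadratic in the gradient of u cancel, which singles out the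
  fourth power.\<close>

lemma scalar_curvature_conformal:
  assumes C: "Ck_on 2 hyp_space u" and pos: "\<And>x. x \<in> hyp_space \<Longrightarrow> u x > 0" and x: "x \<in> hyp_space"
  shows "scalar_curvature (conformal u hyp_metric) x = - 6 - 8 * conformal_op u x / u x ^ 5"
proof -
  define w where "w = (\<lambda>x. 4 * ln (u x) + hyp_w x)"
  interpret W: conf_flat "conformal u hyp_metric" w hyp_space
  proof
    fix x assume x: "x \<in> hyp_space"
    have "exp (4 * ln (u x)) = u x ^ 4" using pos[OF x] exp_of_nat_mult[of 4 "ln (u x)"] by simp
    then show "conformal u hyp_metric x = exp (w x) *\<^sub>R mat 1"
      unfolding conformal_def w_def by (simp add: hyp_metric_eq[OF x] exp_add)
  qed (rule open_hyp_space)
  have Cln: "Ck_on 2 hyp_space (\<lambda>x. ln (u x))"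
    by (rule Ck_on_compose[OF open_hyp_space _ _ Ck_on_ln C]) (use pos in auto)
  have Cw: "Ck_on 2 hyp_space w"
    unfolding w_def by (intro Ck_on_add Ck_on_mult Ck_on_const open_hyp_space Ck_hyp_w Cln)
  have C1: "Ck_on (Suc (Suc 0)) hyp_space u" using C by (simp add: numeral_2_eq_2)
  have du: "u differentiable (at y)" if "y \<in> hyp_space" for y using Ck_on_differentiable[OF C1 that] .
  have d2: "pd i u differentiable (at x)" for i using Ck_on_differentiable[OF Ck_on_pd[OF C1] x] .
  have Cv: "Ck_on (Suc (Suc 0)) hyp_space hyp_w" by (rule Ck_hyp_w)
  have dv: "hyp_w differentiable (at y)" if "y \<in> hyp_space" for y using Ck_on_differentiable[OF Cv that] .
  have dv2: "pd i hyp_w differentiable (at x)" for i using Ck_on_differentiable[OF Ck_on_pd[OF Cv] x] .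
  have w1: "pd i w y = 4 * (inverse (u y) * pd i u y) + pd i hyp_w y" if y: "y \<in> hyp_space" for i y
  proof -
    have l: "(ln has_real_derivative inverse (u y)) (at (u y))" by (rule DERIV_ln[OF pos[OF y]])
    show ?thesis unfolding w_def
      using pd_add[OF differentiable_mult[OF differentiable_const differentiable_chain_real[OF du[OF y] l]] dv[OF y]]
        pd_cmult[OF differentiable_chain_real[OF du[OF y] l]] pd_chain[OF du[OF y] l] by simp
  qed
  have w2: "pd i (pd i w) x = 4 * (pd i (pd i u) x / u x - (pd i u x)\<^sup>2 / (u x)\<^sup>2) + pd i (pd i hyp_w) x" for i
  proof -
    have l: "(inverse has_real_derivative - (inverse (u x) * inverse (u x))) (at (u x))"
      using DERIV_inverse'[OF DERIV_ident, of "u x"] pos[OF x] by simp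
    note li = differentiable_chain_real[OF du[OF x] l]
    have "pd i (pd i w) x = pd i (\<lambda>y. 4 * (inverse (u y) * pd i u y) + pd i hyp_w y) x"
      by (rule pd_cong[OF open_hyp_space x]) (rule w1)
    also have "\<dots> = 4 * pd i (\<lambda>y. inverse (u y) * pd i u y) x + pd i (pd i hyp_w) x"
      using pd_add[OF differentiable_mult[OF differentiable_const differentiable_mult[OF li d2]] dv2]
        pd_cmult[OF differentiable_mult[OF li d2]] by simp
    also have "pd i (\<lambda>y. inverse (u y) * pd i u y) x =
        - (inverse (u x) * inverse (u x)) * pd i u x * pd i u x + inverse (u x) * pd i (pd i u) x"
      using pd_mult[OF li d2] pd_chain[OF du[OF x] l] by simp
    finally show ?thesis by (simp add: divide_inverse power2_eq_square algebra_simps)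
  qed
  have ux: "u x > 0" by (rule pos[OF x])
  define q where "q = 1 - x \<bullet> x"
  have q: "q > 0" using x by (simp add: q_def hyp_space_iff)
  have xx: "(x $ 3)\<^sup>2 = 1 - q - (x $ 1)\<^sup>2 - (x $ 2)\<^sup>2"
    unfolding q_def inner_vec_def sum_3_real by (simp add: power2_eq_square)
  have ew: "exp (- w x) = q\<^sup>2 / (4 * u x ^ 4)"
  proof -
    have "exp (4 * ln (u x)) = u x ^ 4" using ux exp_of_nat_mult[of 4 "ln (u x)"] by simp
    then show ?thesis unfolding w_def exp_minus exp_add exp_hyp_w[OF x] q_def[symmetric]
      by (simp add: field_simps)
  qed
  have lap: "conformal_op u x = q\<^sup>2 / 4 * (\<Sum>i\<in>UNIV. pd i (pd i u) x + 2 * x $ i * pd i u x / q)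
      + 3/4 * u x * (1 - u x ^ 4)"
    unfolding conformal_op_def hyp_laplacian[OF x] q_def ..
  \<comment> \<open>The curvature of hyperbolic space itself: multiplied by - exp (- hyp_w) = - q^2
    / 4 this is -6.\<close>
  have hw: "(\<Sum>i\<in>UNIV. 2 * pd i (pd i hyp_w) x + (pd i hyp_w x)\<^sup>2 / 2) = 24 / q\<^sup>2"
  proof -
    have "(\<Sum>i\<in>UNIV. 2 * pd i (pd i hyp_w) x + (pd i hyp_w x)\<^sup>2 / 2)
        = 24 / q + 24 * ((x $ 1)\<^sup>2 + (x $ 2)\<^sup>2 + (x $ 3)\<^sup>2) / q\<^sup>2"
      unfolding pd_pd_hyp_w[OF x] pd_hyp_w[OF x] q_def[symmetric] sum_3_real
      by (simp add: power_divide power_mult_distrib add_divide_distrib distrib_left)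
    also have "\<dots> = 24 / q\<^sup>2" using q xx by (simp add: field_simps power2_eq_square)
    finally show ?thesis .
  qed
  have "(\<Sum>i\<in>UNIV. 2 * pd i (pd i w) x + (pd i w x)\<^sup>2 / 2) =
      (\<Sum>i\<in>UNIV. 8 * pd i (pd i u) x / u x + 4 * pd i u x * pd i hyp_w x / u x
        + (2 * pd i (pd i hyp_w) x + (pd i hyp_w x)\<^sup>2 / 2))"
    unfolding w2 w1[OF x] using ux by (intro sum.cong refl) (simp add: field_simps power2_eq_square)
  also have "\<dots> = 8 / u x * (\<Sum>i\<in>UNIV. pd i (pd i u) x + 2 * x $ i * pd i u x / q) + 24 / q\<^sup>2"
  proof -
    have "(\<Sum>i\<in>UNIV. 8 * pd i (pd i u) x / u x + 4 * pd i u x * pd i hyp_w x / u x)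
        = 8 / u x * (\<Sum>i\<in>UNIV. pd i (pd i u) x + 2 * x $ i * pd i u x / q)"
      unfolding sum_distrib_left pd_hyp_w[OF x] q_def[symmetric]
      using ux q by (intro sum.cong refl) (simp add: field_simps)
    then show ?thesis unfolding sum.distrib[of "\<lambda>i. 8 * pd i (pd i u) x / u x + 4 * pd i u x * pd i hyp_w x / u x"] hw
      by simp
  qed
  finally have s: "(\<Sum>i\<in>UNIV. 2 * pd i (pd i w) x + (pd i w x)\<^sup>2 / 2) = 
     8 / u x * (\<Sum>i\<in>UNIV. pd i (pd i u) x + 2 * x $ i * pd i u x / q) + 24 / q\<^sup>2" .
  define L where "L = (\<Sum>i\<in>UNIV. pd i (pd i u) x + 2 * x $ i * pd i u x / q)"
  have "scalar_curvature (conformal u hyp_metric) x = - (q\<^sup>2 / (4 * u x ^ 4)) * (8 / u x * L + 24 / q\<^sup>2)"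
    unfolding W.scalar_curvature[OF Cw x] s ew L_def ..
  also have "\<dots> = - 6 - 8 * (q\<^sup>2 / 4 * L + 3/4 * u x * (1 - u x ^ 4)) / u x ^ 5"
    using ux q by (simp add: field_simps eval_nat_numeral)
  finally show ?thesis unfolding lap L_def .
qed

section \<open>Radial functions\<close>

lemma norm_has_derivative_real:
  fixes x :: "real^3" assumes "x \<noteq> 0"
  shows "(norm has_derivative (\<lambda>v. (x \<bullet> v) / norm x)) (at x)"
  using has_derivative_norm[OF assms] by (simp add: sgn_div_norm divide_inverse mult.commute inner_commute)

lemma pd_norm: "x \<noteq> 0 \<Longrightarrow> pd i (norm :: real^3 \<Rightarrow> real) x = x $ i / norm x"
  using pd_has_derivative[OF norm_has_derivative_real] by (simp add: inner_axis)

lemma diff_norm: "x \<noteq> 0 \<Longrightarrow> (norm :: real^3 \<Rightarrow> real) differentiable (at x)"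
  using norm_has_derivative_real by (auto simp: differentiable_def)

lemma pd_radial:
  fixes P :: "real \<Rightarrow> real"
  assumes "x \<noteq> 0" "(P has_real_derivative P') (at (norm x))"
  shows "pd i (\<lambda>x::real^3. P (norm x)) x = P' * x $ i / norm x"
  using pd_chain[OF diff_norm assms(2)] assms(1) by (simp add: pd_norm)

lemma diff_radial:
  fixes P :: "real \<Rightarrow> real"
  assumes "x \<noteq> 0" "(P has_real_derivative P') (at (norm x))"
  shows "(\<lambda>x::real^3. P (norm x)) differentiable (at x)"
  by (rule differentiable_chain_real[OF diff_norm[OF assms(1)] assms(2)])

lemma pd_pd_radial:
  fixes P P1 :: "real \<Rightarrow> real" and x :: "real^3"
  assumes S: "open S" "norm x \<in> S" "0 \<notin> S"
    and d1: "\<And>r. r \<in> S \<Longrightarrow> (P has_real_derivative P1 r) (at r)"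
    and d2: "(P1 has_real_derivative P2) (at (norm x))"
  shows "pd i (pd j (\<lambda>x. P (norm x))) x =
    (if i = j then P1 (norm x) / norm x else 0) + (P2 - P1 (norm x) / norm x) * (x $ i * x $ j) / (norm x)\<^sup>2"
proof -
  have nz: "x \<noteq> 0" using S by auto
  then have n: "norm x > 0" by simp
  have opn: "open {y::real^3. norm y \<in> S}"
    using open_vimage[OF S(1), of "norm :: real^3 \<Rightarrow> real"] by (simp add: vimage_def continuous_on_norm_id)
  have "((\<lambda>r. P1 r / r) has_real_derivative (P2 * norm x - P1 (norm x)) / (norm x * norm x)) (at (norm x))"
    using n d2 by (auto intro!: derivative_eq_intros)
  note q = this
  have "pd i (pd j (\<lambda>x. P (norm x))) x = pd i (\<lambda>y. (P1 (norm y) / norm y) * y $ j) x"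
  proof (rule pd_cong[OF opn])
    fix y :: "real^3" assume "y \<in> {y. norm y \<in> S}"
    then have "y \<noteq> 0" "norm y \<in> S" using S(3) by auto
    then show "pd j (\<lambda>x. P (norm x)) y = (P1 (norm y) / norm y) * y $ j"
      using pd_radial[OF _ d1, of y j] by simp
  qed (use S in simp)
  also have "\<dots> = (P2 * norm x - P1 (norm x)) / (norm x * norm x) * x $ i / norm x * x $ j
      + (P1 (norm x) / norm x) * (if i = j then 1 else 0)"
    using pd_mult[OF diff_radial[OF nz q] diff_nth] pd_radial[OF nz q] pd_nth by simp
  finally show ?thesis using n by (simp add: field_simps power2_eq_square)
qed

lemma norm_sq_3: "(x $ 1)\<^sup>2 + (x $ 2)\<^sup>2 + (x $ 3)\<^sup>2 = (norm (x :: real^3))\<^sup>2"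
  unfolding power2_norm_eq_inner inner_vec_def sum_3_real by (simp add: power2_eq_square)

lemma sinh_rho_of_tau: assumes "0 < t" "t < 1" shows "sinh (rho_of_tau t) = 2 * t / (1 - t\<^sup>2)"
  "cosh (rho_of_tau t) = (1 + t\<^sup>2) / (1 - t\<^sup>2)"
proof -
  have e: "exp (rho_of_tau t) = (1 + t) / (1 - t)" "exp (- rho_of_tau t) = (1 - t) / (1 + t)"
    unfolding rho_of_tau_def exp_minus using assms by simp_all
  have "1 - t\<^sup>2 = (1 - t) * (1 + t)" by (simp add: power2_eq_square algebra_simps)
  then show "sinh (rho_of_tau t) = 2 * t / (1 - t\<^sup>2)" "cosh (rho_of_tau t) = (1 + t\<^sup>2) / (1 - t\<^sup>2)"
    unfolding sinh_field_def cosh_field_def e using assms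
    by (simp_all add: divide_simps) (simp_all add: algebra_simps power2_eq_square)
qed

lemma hyp_rho_pos: "x \<in> hyp_space \<Longrightarrow> x \<noteq> 0 \<Longrightarrow> hyp_rho x > 0"
  unfolding hyp_rho_def hyp_space_norm by (intro rho_of_tau_pos) auto

lemma hyp_rho_nonneg: "x \<in> hyp_space \<Longrightarrow> hyp_rho x \<ge> 0"
  unfolding hyp_rho_def hyp_space_norm by (intro rho_of_tau_nonneg) auto

text \<open>The chain rule through \<open>rho_of_tau\<close> reduces this to the Euclidean Hessian
  of a radial function; the conformal factor (1 - r^2)^2 / 4 cancels the square of d rho / dr = 2 /
  (1 - r^2). The origin is excluded because the norm is not differentiable there.\<close>

lemma radial_laplacian:
  fixes p p1 :: "real \<Rightarrow> real"
  assumes x: "x \<in> hyp_space" "x \<noteq> 0" and S: "open S" "hyp_rho x \<in> S"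
    and d1: "\<And>s. s \<in> S \<Longrightarrow> (p has_real_derivative p1 s) (at s)"
    and d2: "(p1 has_real_derivative p2) (at (hyp_rho x))"
  shows "laplacian hyp_metric (p \<circ> hyp_rho) x = p2 + 2 * (cosh (hyp_rho x) / sinh (hyp_rho x)) * p1 (hyp_rho x)"
proof -
  define r where "r = norm x"
  have r: "0 < r" "r < 1" using x by (auto simp: r_def hyp_space_norm)
  define T where "T = {0<..<1} \<inter> rho_of_tau -` S"
  have cont: "continuous_on {0<..<1} rho_of_tau"
    by (intro continuous_at_imp_continuous_on ballI DERIV_isCont[OF rho_of_tau_deriv]) auto
  have T: "open T" "norm x \<in> T" "0 \<notin> T"
    unfolding T_def using continuous_open_preimage[OF cont _ S(1)] r S(2)
    by (auto simp: hyp_rho_def r_def)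
  have D1: "((\<lambda>t. p (rho_of_tau t)) has_real_derivative p1 (rho_of_tau t) * (2 / (1 - t\<^sup>2))) (at t)"
    if "t \<in> T" for t
    by (rule DERIV_chain2[OF d1 rho_of_tau_deriv]) (use that in \<open>auto simp: T_def\<close>)
  have r2: "1 - r\<^sup>2 > 0" using r by (simp add: power_less_one_iff)
  have D2: "((\<lambda>t. p1 (rho_of_tau t) * (2 / (1 - t\<^sup>2))) has_real_derivative
      p2 * (2 / (1 - r\<^sup>2)) * (2 / (1 - r\<^sup>2)) + p1 (rho_of_tau r) * (4 * r / (1 - r\<^sup>2)\<^sup>2)) (at (norm x))"
  proof -
    have a: "((\<lambda>t. p1 (rho_of_tau t)) has_real_derivative p2 * (2 / (1 - r\<^sup>2))) (at r)"
      by (rule DERIV_chain2[OF _ rho_of_tau_deriv]) (use d2 r in \<open>auto simp: hyp_rho_def r_def intro: less_le_trans[OF _ norm_ge_zero]\<close>)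
    have b: "((\<lambda>t. 2 / (1 - t\<^sup>2)) has_real_derivative 4 * r / (1 - r\<^sup>2)\<^sup>2) (at r)"
      using r2 by (auto intro!: derivative_eq_intros simp: power2_eq_square)
    show ?thesis using DERIV_mult[OF a b] unfolding r_def by (simp add: algebra_simps)
  qed
  have eq: "p \<circ> hyp_rho = (\<lambda>x. p (rho_of_tau (norm x)))" by (auto simp: hyp_rho_def)
  have r2x: "x \<bullet> x = r\<^sup>2" by (simp add: r_def power2_norm_eq_inner)
  define A where "A = p1 (rho_of_tau r)"
  define Q where "Q = 1 - r\<^sup>2"
  have Q: "Q > 0" "r\<^sup>2 = 1 - Q" using r2 by (auto simp: Q_def)
  have p1': "pd i (p \<circ> hyp_rho) x = A * (2 / Q) * x $ i / r" for i
    unfolding eq using pd_radial[OF x(2) D1[OF T(2)]] by (simp add: A_def Q_def r_def)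
  have p2': "pd i (pd i (p \<circ> hyp_rho)) x = A * (2 / Q) / r +
      (p2 * (2 / Q) * (2 / Q) + A * (4 * r / Q\<^sup>2) - A * (2 / Q) / r) * (x $ i)\<^sup>2 / r\<^sup>2" for i
    unfolding eq using pd_pd_radial[OF T, of "\<lambda>t. p (rho_of_tau t)", OF D1 D2, of i i]
    by (simp add: A_def Q_def r_def power2_eq_square)
  have alg: "(a + b * x1 / s + 2 * y1 * (c * y1 / r) / Q) + (a + b * x2 / s + 2 * y2 * (c * y2 / r) / Q)
       + (a + b * x3 / s + 2 * y3 * (c * y3 / r) / Q)
       = 3 * a + b * ((x1 + x2 + x3) / s) + 2 / Q * (c * (y1\<^sup>2 + y2\<^sup>2 + y3\<^sup>2) / r)"
      for a b c s x1 x2 x3 y1 y2 y3 :: real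
      by (simp add: power2_eq_square add_divide_distrib distrib_left mult_ac)
  have "laplacian hyp_metric (p \<circ> hyp_rho) x = Q\<^sup>2 / 4 * (3 * (A * (2 / Q) / r) +
      (p2 * (2 / Q) * (2 / Q) + A * (4 * r / Q\<^sup>2) - A * (2 / Q) / r) * (((x $ 1)\<^sup>2 + (x $ 2)\<^sup>2 + (x $ 3)\<^sup>2) / r\<^sup>2)
      + 2 / Q * (A * (2 / Q) * ((x $ 1)\<^sup>2 + (x $ 2)\<^sup>2 + (x $ 3)\<^sup>2) / r))"
    unfolding hyp_laplacian[OF x(1)] r2x Q_def[symmetric] p1' p2' sum_3_real
    by (simp only: alg)
  also have "\<dots> = Q\<^sup>2 / 4 * (3 * (A * (2 / Q) / r) +
      (p2 * (2 / Q) * (2 / Q) + A * (4 * r / Q\<^sup>2) - A * (2 / Q) / r) + 2 / Q * (A * (2 / Q) * r))"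
    unfolding norm_sq_3 r_def[symmetric] using r by (simp add: power2_eq_square)
  also have "\<dots> = p2 + A * ((Q + 2 * (r * r)) / r)"
    using Q(1) r by (simp add: field_simps power2_eq_square)
  also have "(Q + 2 * (r * r)) / r = 2 * (((1 + r\<^sup>2) / (1 - r\<^sup>2)) / (2 * r / (1 - r\<^sup>2)))"
    using r r2 by (simp add: Q_def field_simps power2_eq_square)
  finally have *: "laplacian hyp_metric (p \<circ> hyp_rho) x = p2 + A * (2 * (((1 + r\<^sup>2) / (1 - r\<^sup>2)) / (2 * r / (1 - r\<^sup>2))))" .
  have hr: "hyp_rho x = rho_of_tau r" by (simp add: hyp_rho_def r_def)
  show ?thesis unfolding * hr sinh_rho_of_tau[OF r] A_def by (simp only: mult_ac)
qed

text \<open>The unit normal is exp (- W / 2) x / |x|. The conformal change adds the radial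
  derivative of W to the Euclidean mean curvature 2 / |x| and rescales the sum.\<close>

lemma mean_curvature_radial:
  fixes W :: "real \<Rightarrow> real"
  assumes x: "x \<in> hyp_space" "x \<noteq> 0" and S: "open S" "x \<in> S"
    and g: "\<And>y. y \<in> S \<Longrightarrow> g y = exp (W (norm y)) *\<^sub>R mat 1"
    and W: "(W has_real_derivative W') (at (norm x))"
  shows "level_mean_curvature g hyp_rho x = exp (- W (norm x) / 2) * (2 / norm x + W')"
proof -
  define S' where "S' = S \<inter> hyp_space - {0}"
  have S': "open S'" "x \<in> S'" unfolding S'_def using S x open_hyp_space by auto
  interpret G: conf_flat g "\<lambda>y. W (norm y)" S' by unfold_locales (use S' g in \<open>auto simp: S'_def\<close>)
  have pdr: "pd i hyp_rho y = 2 / (1 - (norm y)\<^sup>2) * y $ i / norm y" if "y \<in> S'" for y i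
    unfolding hyp_rho_def[abs_def]
    by (rule pd_radial[OF _ rho_of_tau_deriv])
       (use that norm_ge_zero[of y] in \<open>auto simp: S'_def hyp_space_norm simp del: norm_ge_zero\<close>)
  have un: "unit_normal g hyp_rho y = (exp (- W (norm y) / 2) / norm y) *\<^sub>R y" if y: "y \<in> S'" for y
  proof -
    define c where "c = 2 / (1 - (norm y)\<^sup>2) / norm y"
    have ny: "norm y > 0" "norm y < 1" using y by (auto simp: S'_def hyp_space_norm)
    then have c: "c > 0" by (simp add: c_def power_less_one_iff)
    have "(\<chi> i. pd i hyp_rho y) = c *\<^sub>R y" by (simp add: vec_eq_iff pdr[OF y] c_def)
    moreover have "ginv g y = exp (- W (norm y)) *\<^sub>R mat 1"
      by (simp add: vec_eq_iff G.ginv[OF y] mat_def)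
    ultimately have gr: "gradient g hyp_rho y = (exp (- W (norm y)) * c) *\<^sub>R y"
      unfolding gradient_def by (simp add: mat_1_mult)
    have "gradient g hyp_rho y \<bullet> (g y *v gradient g hyp_rho y) = exp (- W (norm y)) * (c * norm y)\<^sup>2"
      unfolding gr G.g[OF y] mat_1_mult
      by (simp add: exp_minus power2_eq_square dot_square_norm field_simps)
    also have "\<dots> = (exp (- W (norm y) / 2) * (c * norm y))\<^sup>2"
      by (simp add: power_mult_distrib exp_double[symmetric])
    finally have s: "sqrt (gradient g hyp_rho y \<bullet> (g y *v gradient g hyp_rho y)) = exp (- W (norm y) / 2) * (c * norm y)"
      using c ny by simp
    have "exp (- W (norm y)) = exp (- W (norm y) / 2) * exp (- W (norm y) / 2)"
      by (simp add: exp_add[symmetric])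
    then have "1 / (exp (- W (norm y) / 2) * (c * norm y)) * (exp (- W (norm y)) * c)
        = exp (- W (norm y) / 2) / norm y" using c ny by simp
    then show ?thesis unfolding unit_normal_def s unfolding gr scaleR_scaleR by (simp only:)
  qed
  define r where "r = norm x"
  define e where "e = exp (- W r / 2)"
  have r: "r > 0" using x by (simp add: r_def)
  define n where "n i = x $ i / r" for i
  have nn: "n 1 * n 1 + n 2 * n 2 + n 3 * n 3 = 1"
  proof -
    have "n 1 * n 1 + n 2 * n 2 + n 3 * n 3 = ((x $ 1)\<^sup>2 + (x $ 2)\<^sup>2 + (x $ 3)\<^sup>2) / r\<^sup>2"
      by (simp add: n_def power2_eq_square add_divide_distrib)
    then show ?thesis using r by (simp add: norm_sq_3 r_def[symmetric])
  qed
  have N: "unit_normal g hyp_rho x $ i = e * n i" for i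
    by (simp add: un[OF S'(2)] e_def n_def r_def)
  have wd: "(\<lambda>y. W (norm y)) differentiable (at x)" by (rule diff_radial[OF x(2) W])
  have w1: "pd i (\<lambda>y. W (norm y)) x = W' * n i" for i
    using pd_radial[OF x(2) W] by (simp add: n_def r_def)
  have pdN: "pd i (\<lambda>y. unit_normal g hyp_rho y $ k) x
      = e * ((if i = k then 1 / r else 0) - (W' / 2 + 1 / r) * (n i * n k))" for i k
  proof -
    have d: "((\<lambda>s. exp (- W s / 2) / s) has_real_derivative
       (exp (- W r / 2) * (- W' / 2) * r - exp (- W r / 2)) / (r * r)) (at (norm x))"
      using r W unfolding r_def by (auto intro!: derivative_eq_intros)
    have "pd i (\<lambda>y. unit_normal g hyp_rho y $ k) x = pd i (\<lambda>y. (exp (- W (norm y) / 2) / norm y) * y $ k) x"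
      by (rule pd_cong[OF S']) (simp add: un)
    also have "\<dots> = (e * (- W' / 2) * r - e) / (r * r) * x $ i / r * x $ k
        + e / r * (if i = k then 1 else 0)"
      using pd_mult[OF diff_radial[OF x(2) d] diff_nth] pd_radial[OF x(2) d] pd_nth
      by (simp add: e_def r_def)
    finally show ?thesis using r by (simp add: n_def field_simps)
  qed
  have cov: "cov_deriv g (unit_normal g hyp_rho) i k x =
      e * ((W' / 2 + 1 / r) * ((if i = k then 1 else 0) - n i * n k))" for i k
  proof -
    have "(\<Sum>j\<in>UNIV. christoffel g k i j x * unit_normal g hyp_rho x $ j) =
       e * W' / 2 * (\<Sum>j\<in>UNIV. (if j = k then n i * n j else 0) + (if i = k then n j * n j else 0)
         - (if i = j then n k * n j else 0))"
      unfolding G.christoffel[OF S'(2) wd] N w1 sum_distrib_left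
      by (intro sum.cong refl) (simp add: algebra_simps)
    also have "(\<Sum>j\<in>UNIV. (if j = k then n i * n j else 0) + (if i = k then n j * n j else 0)
         - (if i = j then n k * n j else 0)) = (if i = k then 1 else 0)"
    proof -
      have "(\<Sum>j\<in>UNIV. n j * n j) = 1" using nn by (simp add: sum_3_real)
      then show ?thesis by (cases "i = k") (simp_all add: sum.distrib sum_subtractf)
    qed
    finally have *: "(\<Sum>j\<in>UNIV. christoffel g k i j x * unit_normal g hyp_rho x $ j) =
       e * W' / 2 * (if i = k then 1 else 0)" .
    show ?thesis unfolding cov_deriv_def pdN * by (simp add: algebra_simps)
  qed
  have ee: "exp (W r) * (e * e) = 1" by (simp add: e_def exp_add[symmetric])
  have II: "second_fundamental_form g hyp_rho i j x =
      exp (W r) * (e * ((W' / 2 + 1 / r) * ((if i = j then 1 else 0) - n i * n j)))" for i j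
    unfolding second_fundamental_form_def cov G.g[OF S'(2)] r_def[symmetric] mat_1_nth
    by (simp add: if_distrib[of "\<lambda>x. x * _"] cong: if_cong)
  have gi: "ginv g x $ i $ j = (if i = j then e * e else 0)" for i j
    using G.ginv[OF S'(2)] by (simp add: e_def r_def exp_add[symmetric])
  \<comment> \<open>The spheres are umbilic: the second fundamental form is a multiple of the
    projection to the tangent plane, and the trace of its square is the dimension 2.\<close>
  have tr: "(\<Sum>i\<in>UNIV. \<Sum>j\<in>UNIV. ((if i = j then 1 else 0) - n i * n j) * ((if i = j then 1 else 0) - n i * n j)) = 2"
  proof -
    have "(\<Sum>i\<in>UNIV. \<Sum>j\<in>UNIV. ((if i = j then 1 else 0) - n i * n j) * ((if i = j then 1 else 0) - n i * n j))
      = 3 - 2 * (n 1 * n 1 + n 2 * n 2 + n 3 * n 3) + (n 1 * n 1 + n 2 * n 2 + n 3 * n 3) * (n 1 * n 1 + n 2 * n 2 + n 3 * n 3)"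
      unfolding sum_3_real by (simp add: algebra_simps)
    then show ?thesis unfolding nn by simp
  qed
  have "level_mean_curvature g hyp_rho x = (\<Sum>i\<in>UNIV. \<Sum>j\<in>UNIV. (exp (W r) * (e * e)) * e * (W' / 2 + 1 / r) *
     (((if i = j then 1 else 0) - n i * n j) * ((if i = j then 1 else 0) - n i * n j)))"
  proof -
    have *: "(if i = j then e * e else 0) - e * n i * (e * n j) = (e * e) * ((if i = j then 1 else 0) - n i * n j)"
      for i j by (simp add: algebra_simps)
    show ?thesis unfolding level_mean_curvature_def gi N II * by (intro sum.cong refl) (simp only: mult_ac)
  qed
  also have "\<dots> = e * (W' / 2 + 1 / r) * 2"
    unfolding sum_distrib_left[symmetric] tr ee by simp
  finally show ?thesis by (simp add: e_def r_def algebra_simps)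
qed

section \<open>Radial solutions on hyperbolic space\<close>

text \<open>Smallness at infinity makes a positive supremum a maximum. At an interior maximum the
  first derivative vanishes, so the second is positive and \<open>d\<close> would increase to the
  right. At the origin, where the equation is singular, the flux sinh^2 d' takes over: it starts at
  0 and increases, so d' is positive and the origin is no maximum either.\<close>

lemma radial_max_principle:
  fixes d d1 d2 :: "real \<Rightarrow> real"
  assumes a: "0 \<le> a" and cont: "continuous_on {a..} d"
    and d1: "\<And>s. a < s \<Longrightarrow> (d has_real_derivative d1 s) (at s)"
    and d2: "\<And>s. a < s \<Longrightarrow> (d1 has_real_derivative d2 s) (at s)"
    and pos: "\<And>s. a < s \<Longrightarrow> d s > 0 \<Longrightarrow> d2 s + 2 * (cosh s / sinh s) * d1 s > 0"
    and lim: "\<And>e. e > 0 \<Longrightarrow> \<forall>\<^sub>F s in at_top. d s < e"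
    and bdry: "d a \<le> 0 \<or> a = 0 \<and> ((\<lambda>s. (sinh s)\<^sup>2 * d1 s) \<longlongrightarrow> 0) (at_right 0)"
    and s: "a \<le> s"
  shows "d s \<le> 0"
proof (rule ccontr)
  assume "\<not> d s \<le> 0"
  then have ds: "d s > 0" by simp
  obtain B where B: "\<And>t. t \<ge> B \<Longrightarrow> d t < d s"
    using lim[OF ds] unfolding eventually_at_top_linorder by blast
  have sB: "s < B" using B[of s] by force
  obtain m where m: "m \<in> {a..B}" "\<And>t. t \<in> {a..B} \<Longrightarrow> d t \<le> d m"
    using continuous_attains_sup[of "{a..B}" d] continuous_on_subset[OF cont, of "{a..B}"] s sB by fastforce
  have dm: "d s \<le> d m" using m(2)[of s] s sB by simp
  have max: "d t \<le> d m" if "a \<le> t" for t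
    using m(2)[of t] B[of t] dm that by (cases "t \<le> B") auto
  show False
  proof (cases "a < m")
    case True
    have z: "d1 m = 0"
    proof (rule DERIV_local_max[OF d1[OF True]])
      show "m - a > 0" using True by simp
      show "\<forall>y. \<bar>m - y\<bar> < m - a \<longrightarrow> d y \<le> d m" by (auto intro!: max)
    qed
    then have "d2 m > 0" using pos[OF True] dm ds by simp
    then obtain \<delta> where \<delta>: "\<delta> > 0" "\<And>h. 0 < h \<Longrightarrow> h < \<delta> \<Longrightarrow> d1 m < d1 (m + h)"
      using DERIV_pos_inc_right[OF d2[OF True]] by auto
    have "d m < d (m + \<delta> / 2)"
    proof (rule DERIV_pos_imp_increasing_open[where f=d])
      show "m < m + \<delta> / 2" using \<delta> by simp
      show "\<exists>y. (d has_real_derivative y) (at x) \<and> 0 < y" if "m < x" "x < m + \<delta> / 2" for x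
        using d1[of x] \<delta>(2)[of "x - m"] that True z \<delta>(1) by auto
      show "continuous_on {m..m + \<delta> / 2} d" by (rule continuous_on_subset[OF cont]) (use True in auto)
    qed
    then show False using max[of "m + \<delta> / 2"] True \<delta> by simp
  next
    case False
    then have ma: "m = a" using m by auto
    then have a0: "a = 0" and sl: "((\<lambda>s. (sinh s)\<^sup>2 * d1 s) \<longlongrightarrow> 0) (at_right 0)"
      using bdry dm ds by auto
    have "(d \<longlongrightarrow> d 0) (at_right 0)"
      using cont a0 continuous_on_subset[OF cont, of "{0<..}"] unfolding continuous_on_def
      by (auto intro: tendsto_within_subset)
    from order_tendstoD(1)[OF this, of 0] have "\<forall>\<^sub>F s in at_right 0. d s > 0" using dm ds ma a0 by simp
    then obtain \<delta> where \<delta>: "\<delta> > 0" "\<And>t. 0 < t \<Longrightarrow> t < \<delta> \<Longrightarrow> d t > 0"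
      unfolding eventually_at_right_field by auto
    have inc: "(sinh x)\<^sup>2 * d1 x < (sinh y)\<^sup>2 * d1 y" if "0 < x" "x < y" "y < \<delta>" for x y
    proof (rule DERIV_pos_imp_increasing[OF that(2), where f="\<lambda>s. (sinh s)\<^sup>2 * d1 s"])
      fix z assume z: "x \<le> z" "z \<le> y"
      then have z0: "0 < z" "sinh z > 0" using that by auto
      have "((\<lambda>s. (sinh s)\<^sup>2 * d1 s) has_real_derivative
          2 * sinh z * cosh z * d1 z + (sinh z)\<^sup>2 * d2 z) (at z)"
        using d2[of z] z0 a0 by (auto intro!: derivative_eq_intros)
      moreover have "2 * sinh z * cosh z * d1 z + (sinh z)\<^sup>2 * d2 z
          = (sinh z)\<^sup>2 * (d2 z + 2 * (cosh z / sinh z) * d1 z)"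
        using z0 by (simp add: field_simps power2_eq_square)
      moreover have "\<dots> > 0" using pos[of z] \<delta>(2)[of z] z z0 that a0 by simp
      ultimately show "\<exists>y. ((\<lambda>s. (sinh s)\<^sup>2 * d1 s) has_real_derivative y) (at z) \<and> 0 < y" by auto
    qed
    have pos1: "d1 x > 0" if x: "0 < x" "x < \<delta>" for x
    proof -
      have "0 \<le> (sinh (x / 2))\<^sup>2 * d1 (x / 2)"
      proof (rule tendsto_upperbound[OF sl])
        show "\<forall>\<^sub>F s in at_right 0. (sinh s)\<^sup>2 * d1 s \<le> (sinh (x / 2))\<^sup>2 * d1 (x / 2)"
          unfolding eventually_at_right_field using x inc[of _ "x / 2"]
          by (intro exI[of _ "x / 2"]) (auto intro: less_imp_le)
      qed simp
      also have "\<dots> < (sinh x)\<^sup>2 * d1 x" by (rule inc) (use x in auto)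
      finally show ?thesis by (simp add: zero_less_mult_iff)
    qed
    have "d 0 < d (\<delta> / 2)"
    proof (rule DERIV_pos_imp_increasing_open[where f=d])
      show "\<exists>y. (d has_real_derivative y) (at x) \<and> 0 < y" if "0 < x" "x < \<delta> / 2" for x
        using d1[of x] pos1[of x] that a0 by auto
      show "continuous_on {0..\<delta> / 2} d" by (rule continuous_on_subset[OF cont]) (use a0 in auto)
    qed (use \<delta> in simp)
    then show False using max[of "\<delta> / 2"] ma a0 \<delta> by simp
  qed
qed

text \<open>With \<open>u = e sinh \<rho>\<close> the radial equation \<open>\<Delta>e - \<kappa>e = - n\<close>, \<open>\<kappa> = k\<^sup>2 - 1\<close>, becomes
  \<open>u'' - k\<^sup>2 u = - n sinh \<rho>\<close>, \<open>u(0) = 0\<close>; \<open>LS\<close> is its Green's function solution.\<close>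

locale radial_green =
  fixes k :: real
  assumes k: "k > 1"
begin

text \<open>Variation of constants with the homogeneous solutions sinh (k r), vanishing at the
  origin, and exp (- k r), decaying at infinity; their Wronskian is -k, whence the division by k in
  \<open>LS\<close>.\<close>

definition LA :: "(real \<Rightarrow> real) \<Rightarrow> real \<Rightarrow> real" where
  "LA n r = integral {0..r} (\<lambda>s. sinh (k * s) * (sinh s * n s))"

definition LB :: "(real \<Rightarrow> real) \<Rightarrow> real \<Rightarrow> real" where
  "LB n r = integral {r..} (\<lambda>s. exp (- k * s) * (sinh s * n s))"

definition LS :: "(real \<Rightarrow> real) \<Rightarrow> real \<Rightarrow> real" where
  "LS n r = (exp (- k * r) * LA n r + sinh (k * r) * LB n r) / k"

definition LS1 :: "(real \<Rightarrow> real) \<Rightarrow> real \<Rightarrow> real" where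
  "LS1 n r = cosh (k * r) * LB n r - exp (- k * r) * LA n r"

text \<open>The inverse of \<kappa> - Lap on bounded radial functions. At the origin the quotient is
  replaced by its limit, the derivative \<open>LS1 n 0\<close>.\<close>

definition Q :: "(real \<Rightarrow> real) \<Rightarrow> real \<Rightarrow> real" where
  "Q n r = (if r = 0 then LB n 0 else LS n r / sinh r)"

definition adm :: "(real \<Rightarrow> real) \<Rightarrow> bool" where
  "adm n \<longleftrightarrow> continuous_on {0..} n \<and> (\<exists>C. \<forall>s\<ge>0. \<bar>n s\<bar> \<le> C)"

lemma adm_const: "adm (\<lambda>_. c)" by (auto simp: adm_def)

lemma adm_diff: assumes "adm n" "adm m" shows "adm (\<lambda>s. n s - m s)"
proof -
  obtain C D where "\<forall>s\<ge>0. \<bar>n s\<bar> \<le> C" "\<forall>s\<ge>0. \<bar>m s\<bar> \<le> D" using assms by (auto simp: adm_def)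
  then have "\<forall>s\<ge>0. \<bar>n s - m s\<bar> \<le> C + D" by (smt (verit))
  then show ?thesis using assms by (auto simp: adm_def intro!: continuous_intros)
qed

text \<open>The weight sinh s is at most exp s, and k > 1 leaves decay at rate k - 1.\<close>

lemma tail_bound:
  assumes n: "continuous_on {0..} n" "\<And>s. 0 \<le> s \<Longrightarrow> \<bar>n s\<bar> \<le> C" and r: "0 \<le> r"
  shows "(\<lambda>s. exp (- k * s) * (sinh s * n s)) integrable_on {r..}"
    and "\<bar>LB n r\<bar> \<le> C * exp (- (k - 1) * r) / (k - 1)"
proof -
  have C: "C \<ge> 0" using n(2)[of 0] by simp
  have g: "((\<lambda>s. C * exp (- (k - 1) * s)) has_integral C * (exp (- (k - 1) * r) / (k - 1))) {r..}"
    by (intro has_integral_mult_right has_integral_exp_minus_to_infinity) (use k in simp)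
  have b: "\<bar>exp (- k * s) * (sinh s * n s)\<bar> \<le> C * exp (- (k - 1) * s)" if "s \<in> {r..}" for s
  proof -
    have s: "0 \<le> s" using that r by simp
    have "(A - B) / 2 \<le> A" if "A > 0" "B > 0" for A B :: real using that by simp
    then have "sinh s \<le> exp s" unfolding sinh_field_def using exp_gt_zero by blast
    then have "\<bar>sinh s\<bar> \<le> exp s" using s by simp
    then have "\<bar>sinh s * n s\<bar> \<le> exp s * C" unfolding abs_mult by (intro mult_mono n(2) s) auto
    then have "exp (- k * s) * \<bar>sinh s * n s\<bar> \<le> exp (- k * s) * (exp s * C)" by (intro mult_left_mono) auto
    also have "\<dots> = C * exp (- (k - 1) * s)" by (simp add: exp_add[symmetric] algebra_simps)
    finally show ?thesis by (simp add: abs_mult)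
  qed
  have meas: "(\<lambda>s. exp (- k * s) * (sinh s * n s)) \<in> borel_measurable (lebesgue_on {r..})"
    by (rule continuous_imp_measurable_on_sets_lebesgue)
       (use r in \<open>auto intro!: continuous_intros continuous_on_subset[OF n(1)]\<close>)
  show i: "(\<lambda>s. exp (- k * s) * (sinh s * n s)) integrable_on {r..}"
    by (rule measurable_bounded_by_integrable_imp_integrable_real[OF meas has_integral_integrable[OF g] b]) auto
  have "norm (LB n r) \<le> integral {r..} (\<lambda>s. C * exp (- (k - 1) * s))"
    unfolding LB_def by (rule integral_norm_bound_integral[OF i has_integral_integrable[OF g]]) (use b in auto)
  then show "\<bar>LB n r\<bar> \<le> C * exp (- (k - 1) * r) / (k - 1)" using integral_unique[OF g] by simp
qed

lemma LB_integrable: "adm n \<Longrightarrow> 0 \<le> r \<Longrightarrow> (\<lambda>s. exp (- k * s) * (sinh s * n s)) integrable_on {r..}"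
  using tail_bound(1) unfolding adm_def by blast

lemma LA_integrable: "adm n \<Longrightarrow> 0 \<le> r \<Longrightarrow> (\<lambda>s. sinh (k * s) * (sinh s * n s)) integrable_on {0..r}"
  unfolding adm_def
  by (intro integrable_continuous_interval continuous_intros) (auto intro: continuous_on_subset)

lemma LB_split:
  assumes n: "adm n" and r: "0 \<le> r"
  shows "LB n r = LB n 0 - integral {0..r} (\<lambda>s. exp (- k * s) * (sinh s * n s))"
proof -
  let ?f = "\<lambda>s. exp (- k * s) * (sinh s * n s)"
  have i: "?f integrable_on {0..r}"
    using n unfolding adm_def
    by (intro integrable_continuous_interval continuous_intros) (auto intro: continuous_on_subset)
  have "{0..r} \<inter> {r..} = {r}" using r by auto
  then have "integral ({0..r} \<union> {r..}) ?f = integral {0..r} ?f + integral {r..} ?f"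
    using i LB_integrable[OF n r] by (intro integral_Un) auto
  moreover have "{0..r} \<union> {r..} = {0..}" using r by auto
  ultimately show ?thesis unfolding LB_def by simp
qed

lemma deriv_integral_0:
  assumes "continuous_on {0..} f" "0 \<le> r"
  shows "((\<lambda>x. integral {0..x} f) has_real_derivative f r) (at r within {0..})"
proof -
  have "((\<lambda>x. integral {0..x} f) has_real_derivative f r) (at r within {0..r + 1})"
    by (rule integral_has_real_derivative) (use assms in \<open>auto intro: continuous_on_subset\<close>)
  moreover have "at r within {0..r + 1} = at r within {0..}"
    by (rule at_within_nhd[of _ "{..<r + 1}"]) auto
  ultimately show ?thesis by simp
qed

lemma LA_deriv:
  assumes "adm n" "0 \<le> r"
  shows "(LA n has_real_derivative sinh (k * r) * (sinh r * n r)) (at r within {0..})"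
  unfolding LA_def[abs_def]
  by (rule deriv_integral_0) (use assms in \<open>auto simp: adm_def intro!: continuous_intros\<close>)

lemma LB_deriv:
  assumes "adm n" "0 \<le> r"
  shows "(LB n has_real_derivative - (exp (- k * r) * (sinh r * n r))) (at r within {0..})"
proof -
  have "((\<lambda>r. LB n 0 - integral {0..r} (\<lambda>s. exp (- k * s) * (sinh s * n s))) has_real_derivative
      0 - exp (- k * r) * (sinh r * n r)) (at r within {0..})"
    by (intro DERIV_diff DERIV_const deriv_integral_0)
       (use assms in \<open>auto simp: adm_def intro!: continuous_intros\<close>)
  then have "((\<lambda>r. LB n 0 - integral {0..r} (\<lambda>s. exp (- k * s) * (sinh s * n s))) has_real_derivative
      - (exp (- k * r) * (sinh r * n r))) (at r within {0..})" by simp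
  then show ?thesis
  proof (rule has_field_derivative_transform_within[where d=1])
    show "LB n 0 - integral {0..x} (\<lambda>s. exp (- k * s) * (sinh s * n s)) = LB n x" if "x \<in> {0..}" for x
      using LB_split[OF assms(1), of x, symmetric] that by (metis atLeast_iff)
  qed (use assms in auto)
qed

lemma LS_deriv:
  assumes "adm n" "0 \<le> r"
  shows "(LS n has_real_derivative LS1 n r) (at r within {0..})"
    and "(LS1 n has_real_derivative k\<^sup>2 * LS n r - sinh r * n r) (at r within {0..})"
proof -
  note D = LA_deriv[OF assms] LB_deriv[OF assms]
  have k0: "k \<noteq> 0" using k by simp
  have "((\<lambda>r. exp (- k * r) * LA n r + sinh (k * r) * LB n r) has_real_derivative
     ((exp (- k * r) * - k * LA n r + exp (- k * r) * (sinh (k * r) * (sinh r * n r)))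
      + (cosh (k * r) * k * LB n r + sinh (k * r) * - (exp (- k * r) * (sinh r * n r)))))
     (at r within {0..})"
    by (rule derivative_eq_intros D | simp)+
  from DERIV_cdivide[OF this, of k] have "((\<lambda>r. (exp (- k * r) * LA n r + sinh (k * r) * LB n r) / k) has_real_derivative
     ((exp (- k * r) * - k * LA n r + exp (- k * r) * (sinh (k * r) * (sinh r * n r)))
      + (cosh (k * r) * k * LB n r + sinh (k * r) * - (exp (- k * r) * (sinh r * n r)))) / k)
     (at r within {0..})" .
  moreover have "(x * - k * y + x * (z * w) + (v * k * b + z * - (x * w))) / k = v * b - x * y" for x y z w v b
    using k0 by (simp add: field_simps)
  ultimately show "(LS n has_real_derivative LS1 n r) (at r within {0..})"
    unfolding LS_def[abs_def] LS1_def by (simp only:)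
  have "((\<lambda>r. cosh (k * r) * LB n r - exp (- k * r) * LA n r) has_real_derivative
     (sinh (k * r) * k * LB n r + cosh (k * r) * - (exp (- k * r) * (sinh r * n r)))
     - (exp (- k * r) * - k * LA n r + exp (- k * r) * (sinh (k * r) * (sinh r * n r)))) (at r within {0..})"
    by (rule derivative_eq_intros D | simp)+
  moreover have "(sinh (k * r) * k * LB n r + cosh (k * r) * - (exp (- k * r) * (sinh r * n r)))
     - (exp (- k * r) * - k * LA n r + exp (- k * r) * (sinh (k * r) * (sinh r * n r)))
     = k\<^sup>2 * LS n r - sinh r * n r"
  proof -
    \<comment> \<open>The Wronskian of the two homogeneous solutions, up to the factor -k; it makes
      the source enter with coefficient exactly - sinh r.\<close>
    have E: "exp (- k * r) * (cosh (k * r) + sinh (k * r)) = 1"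
      by (simp add: cosh_plus_sinh exp_add[symmetric])
    have L: "k\<^sup>2 * LS n r = k * (exp (- k * r) * LA n r + sinh (k * r) * LB n r)"
      using k0 by (simp add: LS_def power2_eq_square)
    have "(S * k * b + c * - (x * w)) - (x * - k * y + x * (S * w)) = k * (x * y + S * b) - x * (c + S) * w"
      for S b c x w y by (simp add: algebra_simps)
    then show ?thesis unfolding L E by (simp only: E mult_1)
  qed
  ultimately show "(LS1 n has_real_derivative k\<^sup>2 * LS n r - sinh r * n r) (at r within {0..})"
    unfolding LS1_def[abs_def] by simp
qed

lemma LA_0 [simp]: "LA n 0 = 0" by (simp add: LA_def)

lemma LS_0 [simp]: "LS n 0 = 0" by (simp add: LS_def)

lemma LS1_0 [simp]: "LS1 n 0 = LB n 0" by (simp add: LS1_def)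

text \<open>Uniqueness for the linear problem among functions growing more slowly than exp (k s):
  both integrands are exact derivatives, and the boundary terms at infinity vanish. It evaluates
  \<open>Q\<close> where the solution is known beforehand, on constants and on the right-hand side
  belonging to the supersolution.\<close>

lemma representation:
  assumes u1: "\<And>s. 0 \<le> s \<Longrightarrow> (u has_real_derivative u1 s) (at s within {0..})"
    and u2: "\<And>s. 0 \<le> s \<Longrightarrow> (u1 has_real_derivative u2 s) (at s within {0..})"
    and n: "adm n" and eq: "\<And>s. 0 \<le> s \<Longrightarrow> sinh s * n s = k\<^sup>2 * u s - u2 s"
    and u0: "u 0 = 0"
    and lim: "((\<lambda>s. exp (- k * s) * u s) \<longlongrightarrow> 0) at_top" "((\<lambda>s. exp (- k * s) * u1 s) \<longlongrightarrow> 0) at_top"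
    and r: "0 \<le> r"
  shows "LS n r = u r" "LB n 0 = u1 0"
proof -
  obtain C where C: "\<And>s. 0 \<le> s \<Longrightarrow> \<bar>n s\<bar> \<le> C" using n by (auto simp: adm_def)
  have LA: "LA n r = k * cosh (k * r) * u r - sinh (k * r) * u1 r"
  proof -
    have "((\<lambda>s. sinh (k * s) * (sinh s * n s)) has_integral
        (k * cosh (k * r) * u r - sinh (k * r) * u1 r) - (k * cosh (k * 0) * u 0 - sinh (k * 0) * u1 0)) {0..r}"
    proof (rule fundamental_theorem_of_calculus[OF r])
      fix s assume s: "s \<in> {0..r}"
      have "((\<lambda>s. k * cosh (k * s) * u s - sinh (k * s) * u1 s) has_real_derivative
          (k * (sinh (k * s) * k) * u s + k * cosh (k * s) * u1 s) - (cosh (k * s) * k * u1 s + sinh (k * s) * u2 s))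
          (at s within {0..})"
        by (rule derivative_eq_intros u1 u2 | use s in simp)+
      moreover have "(k * (sinh (k * s) * k) * u s + k * cosh (k * s) * u1 s)
          - (cosh (k * s) * k * u1 s + sinh (k * s) * u2 s) = sinh (k * s) * (sinh s * n s)"
      proof -
        have e: "sinh s * n s = k\<^sup>2 * u s - u2 s" using eq[of s] s by simp
        show ?thesis unfolding e by (simp add: algebra_simps power2_eq_square)
      qed
      ultimately show "((\<lambda>s. k * cosh (k * s) * u s - sinh (k * s) * u1 s) has_vector_derivative
          sinh (k * s) * (sinh s * n s)) (at s within {0..r})"
        by (auto simp: has_real_derivative_iff_has_vector_derivative[symmetric] intro: DERIV_subset)
    qed
    then show ?thesis unfolding LA_def using u0 by (simp add: integral_unique)
  qed
  have LB: "LB n r = exp (- k * r) * (k * u r + u1 r)" if r: "0 \<le> r" for r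
  proof -
    let ?H = "\<lambda>s. - exp (- k * s) * (k * u s + u1 s)"
    let ?f = "\<lambda>s. exp (- k * s) * (sinh s * n s)"
    have fin: "integral {0..y} ?f = ?H y - ?H 0" if "0 \<le> y" for y
    proof (rule integral_unique, rule fundamental_theorem_of_calculus[OF that])
      fix s assume s: "s \<in> {0..y}"
      have "(?H has_real_derivative
          (- (exp (- k * s) * - k)) * (k * u s + u1 s) + - exp (- k * s) * (k * u1 s + u2 s))
          (at s within {0..})"
        by (rule derivative_eq_intros u1 u2 | use s in simp)+
      moreover have "(- (exp (- k * s) * - k)) * (k * u s + u1 s) + - exp (- k * s) * (k * u1 s + u2 s) = ?f s"
      proof -
        have e: "sinh s * n s = k\<^sup>2 * u s - u2 s" using eq[of s] s by simp
        show ?thesis unfolding e by (simp add: algebra_simps power2_eq_square)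
      qed
      ultimately show "(?H has_vector_derivative ?f s) (at s within {0..y})"
        by (auto simp: has_real_derivative_iff_has_vector_derivative[symmetric] intro: DERIV_subset)
    qed
    have e: "LB n y = LB n r + (?H r - ?H y)" if "r \<le> y" for y
      using LB_split[OF n, of y] LB_split[OF n r] fin[of y] fin[OF r] r that by simp
    have "((\<lambda>y. C * exp (- (k - 1) * y) / (k - 1)) \<longlongrightarrow> 0) at_top"
      using k by real_asymp
    then have "(LB n \<longlongrightarrow> 0) at_top"
      by (rule Lim_null_comparison[rotated])
         (use tail_bound(2)[OF _ C] n in \<open>auto simp: adm_def eventually_at_top_linorder intro!: exI[of _ 0]\<close>)
    moreover have "((\<lambda>y. LB n r + (?H r - ?H y)) \<longlongrightarrow> LB n r + (?H r - - (k * 0 + 0))) at_top"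
    proof -
      have "((\<lambda>y. - (k * (exp (- k * y) * u y) + exp (- k * y) * u1 y)) \<longlongrightarrow> - (k * 0 + 0)) at_top"
        by (intro tendsto_intros lim)
      then have "(?H \<longlongrightarrow> - (k * 0 + 0)) at_top" by (simp add: algebra_simps)
      then show ?thesis by (intro tendsto_intros)
    qed
    then have "(LB n \<longlongrightarrow> LB n r + (?H r - - (k * 0 + 0))) at_top"
      by (rule Lim_transform_eventually)
         (rule eventually_mono[OF eventually_ge_at_top[of r]], erule e[symmetric])
    ultimately have "LB n r + (?H r - - (k * 0 + 0)) = 0"
      using tendsto_unique[OF trivial_limit_at_top_linorder] by blast
    then show ?thesis by simp
  qed
  have E: "exp (- k * r) * (cosh (k * r) + sinh (k * r)) = 1"
    by (simp add: cosh_plus_sinh exp_add[symmetric])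
  have alg: "x * (k * c * v - S * w) + S * (x * (k * v + w)) = x * (c + S) * (k * v)" for x c v S w
    by (simp add: algebra_simps)
  have "k * LS n r = exp (- k * r) * LA n r + sinh (k * r) * LB n r"
    using k by (simp add: LS_def)
  then have "k * LS n r = k * u r"
    unfolding LA LB[OF r] alg E by simp
  then show "LS n r = u r" using k by simp
  show "LB n 0 = u1 0" using LB[of 0] u0 by simp
qed

lemma Q_diff:
  assumes "adm n" "adm m" "0 \<le> r"
  shows "Q (\<lambda>s. n s - m s) r = Q n r - Q m r"
proof -
  have B: "LB (\<lambda>s. n s - m s) t = LB n t - LB m t" if "0 \<le> t" for t
    unfolding LB_def
    using integral_diff[OF LB_integrable[OF assms(1) that] LB_integrable[OF assms(2) that]]
    by (simp add: right_diff_distrib)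
  have "LA (\<lambda>s. n s - m s) r = LA n r - LA m r"
    unfolding LA_def
    using integral_diff[OF LA_integrable[OF assms(1,3)] LA_integrable[OF assms(2,3)]]
    by (simp add: right_diff_distrib)
  then show ?thesis unfolding Q_def LS_def using B[of r] B[of 0] assms(3)
    by (simp add: right_diff_distrib diff_divide_distrib add_divide_distrib)
qed

lemma Q_nonneg:
  assumes n: "adm n" "\<And>s. 0 \<le> s \<Longrightarrow> 0 \<le> n s" and r: "0 \<le> r"
  shows "0 \<le> Q n r" "0 \<le> LA n r" "0 \<le> LB n r"
proof -
  show A: "0 \<le> LA n r" unfolding LA_def
    using n(2) k by (intro integral_nonneg LA_integrable n r) auto
  have B: "0 \<le> LB n t" if "0 \<le> t" for t unfolding LB_def
    using n(2) that by (intro integral_nonneg LB_integrable n) auto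
  show "0 \<le> LB n r" using B r .
  show "0 \<le> Q n r" unfolding Q_def LS_def using A B[of r] B[of 0] r k by auto
qed

lemma Q_mono:
  assumes "adm n" "adm m" "\<And>s. 0 \<le> s \<Longrightarrow> n s \<le> m s" and r: "0 \<le> r"
  shows "Q n r \<le> Q m r"
  using Q_nonneg(1)[OF adm_diff[OF assms(2,1)] _ r] Q_diff[OF assms(2,1) r] assms(3) by simp

text \<open>With k^2 - 1 = \<kappa> this is the norm 1 / \<kappa> of the positive operator
  \<open>Q\<close> in the sup norm, hence the denominator in the contraction factor.\<close>

lemma Q_const: assumes "0 \<le> r" shows "Q (\<lambda>_. c) r = c / (k\<^sup>2 - 1)"
proof -
  have k2: "k\<^sup>2 - 1 > 0" using k by (simp add: less_1_mult power2_eq_square)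
  note rep = representation[where u="\<lambda>s. c / (k\<^sup>2 - 1) * sinh s" and ?u1.0="\<lambda>s. c / (k\<^sup>2 - 1) * cosh s"
      and ?u2.0="\<lambda>s. c / (k\<^sup>2 - 1) * sinh s" and n="\<lambda>_. c", OF _ _ adm_const]
  have *: "LS (\<lambda>_. c) r = c / (k\<^sup>2 - 1) * sinh r" "LB (\<lambda>_. c) 0 = c / (k\<^sup>2 - 1) * cosh 0"
  proof -
    have l: "((\<lambda>s. exp (- k * s) * (c / (k\<^sup>2 - 1) * sinh s)) \<longlongrightarrow> 0) at_top"
      "((\<lambda>s. exp (- k * s) * (c / (k\<^sup>2 - 1) * cosh s)) \<longlongrightarrow> 0) at_top"
    proof -
      define b where "b = c / (k\<^sup>2 - 1)"
      show "((\<lambda>s. exp (- k * s) * (c / (k\<^sup>2 - 1) * sinh s)) \<longlongrightarrow> 0) at_top"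
        unfolding b_def[symmetric] sinh_field_def using k by real_asymp
      show "((\<lambda>s. exp (- k * s) * (c / (k\<^sup>2 - 1) * cosh s)) \<longlongrightarrow> 0) at_top"
        unfolding b_def[symmetric] cosh_field_def using k by real_asymp
    qed
    have e: "sinh s * c = k\<^sup>2 * (c / (k\<^sup>2 - 1) * sinh s) - c / (k\<^sup>2 - 1) * sinh s" for s
    proof -
      have "k\<^sup>2 * (b * sinh s) - b * sinh s = (k\<^sup>2 - 1) * b * sinh s" for b
        by (simp add: algebra_simps)
      from this[of "c / (k\<^sup>2 - 1)"] show ?thesis using k2 by simp
    qed
    show "LS (\<lambda>_. c) r = c / (k\<^sup>2 - 1) * sinh r" "LB (\<lambda>_. c) 0 = c / (k\<^sup>2 - 1) * cosh 0"
      by (rule rep(1)[OF _ _ e _ l assms]; use k2 in \<open>auto intro!: derivative_eq_intros\<close>)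
         (rule rep(2)[OF _ _ e _ l assms]; use k2 in \<open>auto intro!: derivative_eq_intros\<close>)
  qed
  then show ?thesis unfolding Q_def using assms by auto
qed

lemma Q_cont: assumes "adm n" shows "continuous_on {0..} (Q n)"
proof -
  have c: "(Q n \<longlongrightarrow> Q n r) (at r within {0..})" if r: "0 \<le> r" for r
  proof (cases "r = 0")
    case False
    have "((\<lambda>r. LS n r / sinh r) \<longlongrightarrow> LS n r / sinh r) (at r within {0..})"
      using DERIV_continuous[OF LS_deriv(1)[OF assms r]] False
      by (intro tendsto_intros) (auto simp: continuous_within intro!: tendsto_intros)
    moreover have "\<forall>\<^sub>F s in at r within {0..}. LS n s / sinh s = Q n s"
      using False r by (auto simp: eventually_at Q_def intro!: exI[of _ r])
    ultimately show ?thesis using False by (auto simp: Q_def intro: Lim_transform_eventually)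
  next
    case True
    have "((\<lambda>s. (LS n s - LS n 0) / (s - 0)) \<longlongrightarrow> LS1 n 0) (at 0 within {0..})"
      using LS_deriv(1)[OF assms, of 0] by (simp add: has_field_derivative_iff)
    moreover have "((\<lambda>s. s / sinh s) \<longlongrightarrow> 1) (at (0::real) within {0..})"
    proof (rule tendsto_within_subset)
      show "((\<lambda>s::real. s / sinh s) \<longlongrightarrow> 1) (at 0)" by real_asymp
    qed simp
    ultimately have "((\<lambda>s. (LS n s - LS n 0) / (s - 0) * (s / sinh s)) \<longlongrightarrow> LS1 n 0 * 1) (at 0 within {0..})"
      by (rule tendsto_mult)
    moreover have "\<forall>\<^sub>F s in at 0 within {0..}. (LS n s - LS n 0) / (s - 0) * (s / sinh s) = Q n s"
      by (auto simp: eventually_at Q_def intro!: exI[of _ 1])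
    ultimately show ?thesis using True by (auto simp: Q_def intro: Lim_transform_eventually)
  qed
  then show ?thesis by (simp add: continuous_on_def)
qed

text \<open>A strong maximum principle: the Green's function is positive, so a source at the single
  point t is felt everywhere, through \<open>LB\<close> to the left of t and through
  \<open>LA\<close> to the right. It yields the strict inequalities between 1, the solution and the
  supersolution.\<close>

lemma Q_pos:
  assumes n: "adm n" "\<And>s. 0 \<le> s \<Longrightarrow> 0 \<le> n s" and t: "0 < t" "0 < n t" and r: "0 \<le> r"
  shows "0 < Q n r"
proof -
  have cont: "continuous_on {0..} n" using n by (simp add: adm_def)
  have B: "0 < LB n r" if r: "0 \<le> r" "r < t" for r
  proof (rule ccontr)
    let ?f = "\<lambda>s. exp (- k * s) * (sinh s * n s)"
    assume "\<not> ?thesis"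
    moreover have "integral {r..t} ?f \<le> LB n r"
      unfolding LB_def
      by (rule integral_subset_le) (use r n LB_integrable[OF n(1)] cont in
          \<open>auto intro!: integrable_continuous_interval continuous_intros intro: continuous_on_subset\<close>)
    moreover have "0 \<le> integral {r..t} ?f"
      by (rule integral_nonneg) (use r n cont in
          \<open>auto intro!: integrable_continuous_interval continuous_intros intro: continuous_on_subset\<close>)
    ultimately have "integral {r..t} ?f = 0" by simp
    moreover have "(integral {r..t} ?f = 0) = (\<forall>x\<in>{r..t}. ?f x = 0)"
      by (rule integral_eq_0_iff) (use r n cont in \<open>auto intro!: continuous_intros intro: continuous_on_subset\<close>)
    ultimately have "\<forall>x\<in>{r..t}. ?f x = 0" by blast
    then have "?f t = 0" using r by (meson atLeastAtMost_iff less_imp_le order_refl)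
    then show False using t by simp
  qed
  have A: "0 < LA n r" if r: "t \<le> r" for r
  proof (rule ccontr)
    let ?f = "\<lambda>s. sinh (k * s) * (sinh s * n s)"
    assume "\<not> ?thesis"
    then have "integral {0..r} ?f = 0" using Q_nonneg(2)[OF n, of r] t r by (simp add: LA_def)
    moreover have "(integral {0..r} ?f = 0) = (\<forall>x\<in>{0..r}. ?f x = 0)"
      by (rule integral_eq_0_iff)
         (use t r n k cont in \<open>auto intro!: continuous_intros intro: continuous_on_subset\<close>)
    ultimately have "\<forall>x\<in>{0..r}. ?f x = 0" by blast
    then have "?f t = 0" using r t by (meson atLeastAtMost_iff less_imp_le)
    then show False using t k by simp
  qed
  show ?thesis
  proof (cases "r = 0")
    case True
    then show ?thesis using B[of 0] t by (simp add: Q_def)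
  next
    case False
    then have "0 < exp (- k * r) * LA n r + sinh (k * r) * LB n r"
      using A[of r] B[of r] r k Q_nonneg(2,3)[OF n r]
      by (cases "r < t") (auto intro: add_nonneg_pos add_pos_nonneg)
    then show ?thesis using False r k by (simp add: Q_def LS_def)
  qed
qed

lemma Q_deriv:
  assumes n: "adm n"
  defines "q1 \<equiv> \<lambda>s. (LS1 n s * sinh s - LS n s * cosh s) / (sinh s)\<^sup>2"
  defines "q2 \<equiv> \<lambda>s. (k\<^sup>2 - 1) * Q n s - n s - 2 * (cosh s / sinh s) * q1 s"
  shows "\<And>s. 0 < s \<Longrightarrow> (Q n has_real_derivative q1 s) (at s)"
    and "\<And>s. 0 < s \<Longrightarrow> (q1 has_real_derivative q2 s) (at s)"
    and "((\<lambda>s. (sinh s)\<^sup>2 * q1 s) \<longlongrightarrow> 0) (at_right 0)"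
proof -
  have at: "at s within {0..} = at s" if "0 < s" for s :: real
    using that by (intro at_within_interior) auto
  have u1: "(LS n has_real_derivative LS1 n s) (at s)" if "0 < s" for s
    using LS_deriv(1)[OF n, of s] that at[OF that] by simp
  have u2: "(LS1 n has_real_derivative k\<^sup>2 * LS n s - sinh s * n s) (at s)" if "0 < s" for s
    using LS_deriv(2)[OF n, of s] that at[OF that] by simp
  show "(Q n has_real_derivative q1 s) (at s)" if s: "0 < s" for s
  proof (rule has_field_derivative_transform_within_open[where S="{0<..}"])
    show "((\<lambda>s. LS n s / sinh s) has_real_derivative q1 s) (at s)"
      unfolding q1_def power2_eq_square
      by (rule derivative_eq_intros u1 | use s in simp)+
  qed (use s in \<open>auto simp: Q_def\<close>)
  show "(q1 has_real_derivative q2 s) (at s)" if s: "0 < s" for s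
  proof -
    have sh: "sinh s > 0" using s by simp
    have "(q1 has_real_derivative
      (((k\<^sup>2 * LS n s - sinh s * n s) * sinh s + LS1 n s * cosh s - (LS1 n s * cosh s + LS n s * sinh s)) * (sinh s)\<^sup>2
       - (LS1 n s * sinh s - LS n s * cosh s) * (2 * sinh s * cosh s)) / ((sinh s)\<^sup>2 * (sinh s)\<^sup>2)) (at s)"
      unfolding q1_def by (rule derivative_eq_intros u1 u2 | use s in simp)+
    moreover have "(((k\<^sup>2 * LS n s - sinh s * n s) * sinh s + LS1 n s * cosh s - (LS1 n s * cosh s + LS n s * sinh s)) * (sinh s)\<^sup>2
       - (LS1 n s * sinh s - LS n s * cosh s) * (2 * sinh s * cosh s)) / ((sinh s)\<^sup>2 * (sinh s)\<^sup>2) = q2 s"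
      unfolding q2_def q1_def Q_def using s sh by (simp add: field_simps power2_eq_square)
    ultimately show ?thesis by simp
  qed
  show "((\<lambda>s. (sinh s)\<^sup>2 * q1 s) \<longlongrightarrow> 0) (at_right 0)"
  proof -
    have l: "(LS n \<longlongrightarrow> LS n 0) (at_right 0)" "(LS1 n \<longlongrightarrow> LS1 n 0) (at_right 0)"
      using DERIV_continuous[OF LS_deriv(1)[OF n, of 0]] DERIV_continuous[OF LS_deriv(2)[OF n, of 0]]
      by (auto simp: continuous_within intro: tendsto_within_subset)
    have "((\<lambda>s. LS1 n s * sinh s - LS n s * cosh s) \<longlongrightarrow> LS1 n 0 * sinh 0 - LS n 0 * cosh 0) (at_right 0)"
      by (intro tendsto_intros l)
    then have "((\<lambda>s. LS1 n s * sinh s - LS n s * cosh s) \<longlongrightarrow> 0) (at_right 0)" by simp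
    then show ?thesis
      by (rule Lim_transform_eventually)
         (auto simp: q1_def eventually_at_filter)
  qed
qed

end

text \<open>L'Hopital for the flux: the derivative of sinh^2 e1 is sinh^2 m, compared with s^3. The
  common limit is e''(0), as the Laplacian at the centre is three times the radial second
  derivative. The agreement of both limits is what makes the function twice continuously
  differentiable at the origin.\<close>

lemma radial_origin_limits:
  fixes e1 m :: "real \<Rightarrow> real"
  assumes d: "\<And>s. 0 < s \<Longrightarrow> (e1 has_real_derivative m s - 2 * (cosh s / sinh s) * e1 s) (at s)"
    and l0: "((\<lambda>s. (sinh s)\<^sup>2 * e1 s) \<longlongrightarrow> 0) (at_right 0)" and m: "(m \<longlongrightarrow> m0) (at_right 0)"
  shows "((\<lambda>s. e1 s / s) \<longlongrightarrow> m0 / 3) (at_right 0)"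
    and "((\<lambda>s. m s - 2 * (cosh s / sinh s) * e1 s) \<longlongrightarrow> m0 / 3) (at_right 0)"
proof -
  have pos: "\<forall>\<^sub>F s::real in at_right 0. 0 < s" by (simp add: eventually_at_filter)
  have "((\<lambda>s. ((sinh s)\<^sup>2 * e1 s) / s ^ 3) \<longlongrightarrow> 1 / 3 * m0) (at_right 0)"
  proof (rule lhopital_right_0[OF l0])
    show "((\<lambda>s::real. s ^ 3) \<longlongrightarrow> 0) (at_right 0)" by real_asymp
    show "\<forall>\<^sub>F s::real in at_right 0. s ^ 3 \<noteq> 0" "\<forall>\<^sub>F s::real in at_right 0. 3 * s\<^sup>2 \<noteq> 0"
      using pos by (auto elim!: eventually_mono)
    show "\<forall>\<^sub>F s in at_right 0. ((\<lambda>s. (sinh s)\<^sup>2 * e1 s) has_real_derivative (sinh s)\<^sup>2 * m s) (at s)"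
      using pos
    proof eventually_elim
      case (elim s)
      have "((\<lambda>s. (sinh s)\<^sup>2 * e1 s) has_real_derivative
        2 * sinh s * cosh s * e1 s + (sinh s)\<^sup>2 * (m s - 2 * (cosh s / sinh s) * e1 s)) (at s)"
        using d[OF elim] by (auto intro!: derivative_eq_intros)
      moreover have "2 * sinh s * cosh s * e1 s + (sinh s)\<^sup>2 * (m s - 2 * (cosh s / sinh s) * e1 s) = (sinh s)\<^sup>2 * m s"
        using elim by (simp add: field_simps power2_eq_square)
      ultimately show ?case by simp
    qed
    show "\<forall>\<^sub>F s in at_right 0. ((\<lambda>s::real. s ^ 3) has_real_derivative 3 * s\<^sup>2) (at s)"
      by (auto intro!: always_eventually derivative_eq_intros)
    have "((\<lambda>s::real. (sinh s)\<^sup>2 / (3 * s\<^sup>2)) \<longlongrightarrow> 1 / 3) (at_right 0)" by real_asymp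
    from tendsto_mult[OF this m]
    show "((\<lambda>s. (sinh s)\<^sup>2 * m s / (3 * s\<^sup>2)) \<longlongrightarrow> 1 / 3 * m0) (at_right 0)" by simp
  qed
  moreover have "((\<lambda>s::real. (s / sinh s)\<^sup>2) \<longlongrightarrow> 1) (at_right 0)" by real_asymp
  ultimately have "((\<lambda>s. ((sinh s)\<^sup>2 * e1 s) / s ^ 3 * (s / sinh s)\<^sup>2) \<longlongrightarrow> 1 / 3 * m0 * 1) (at_right 0)"
    by (rule tendsto_mult)
  then have "((\<lambda>s. ((sinh s)\<^sup>2 * e1 s) / s ^ 3 * (s / sinh s)\<^sup>2) \<longlongrightarrow> m0 / 3) (at_right 0)" by simp
  then show l1: "((\<lambda>s. e1 s / s) \<longlongrightarrow> m0 / 3) (at_right 0)"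
    by (rule Lim_transform_eventually)
       (use pos in \<open>auto elim!: eventually_mono simp: field_simps power2_eq_square power3_eq_cube\<close>)
  have "((\<lambda>s::real. s * cosh s / sinh s) \<longlongrightarrow> 1) (at_right 0)" by real_asymp
  from tendsto_diff[OF m tendsto_mult[OF tendsto_mult[OF tendsto_const[of 2] this] l1]]
  have "((\<lambda>s. m s - 2 * (s * cosh s / sinh s) * (e1 s / s)) \<longlongrightarrow> m0 - 2 * 1 * (m0 / 3)) (at_right 0)" .
  then have "((\<lambda>s. m s - 2 * (s * cosh s / sinh s) * (e1 s / s)) \<longlongrightarrow> m0 / 3) (at_right 0)" by simp
  then show "((\<lambda>s. m s - 2 * (cosh s / sinh s) * e1 s) \<longlongrightarrow> m0 / 3) (at_right 0)"
    by (rule Lim_transform_eventually) (use pos in \<open>auto elim!: eventually_mono\<close>)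
qed

section \<open>The nonlinearity and the nonlinear radial problem\<close>

definition GG :: "real \<Rightarrow> real" where "GG x = 3/4 * x * (x ^ 4 - 1)"

lemma GG_1 [simp]: "GG 1 = 0" by (simp add: GG_def)

lemma GG_cont [continuous_intros]: "continuous_on S f \<Longrightarrow> continuous_on S (\<lambda>x. GG (f x))"
  unfolding GG_def by (intro continuous_intros)

lemma GG_tendsto [tendsto_intros]: "(f \<longlongrightarrow> l) A \<Longrightarrow> ((\<lambda>x. GG (f x)) \<longlongrightarrow> GG l) A"
  unfolding GG_def by (intro tendsto_intros)

text \<open>The difference quotient is 3/4 (q - 1) for a sum \<open>q\<close> of five monomials,
  each between 1 and C^4. So the slope is at least 3/4 (5 - 1) = 3 and at most 3/4 (5 C^4 - 1),
  which is below 4 C^4.\<close>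

lemma GG_bounds:
  assumes "1 \<le> x" "x \<le> y" "y \<le> C"
  shows "3 * (y - x) \<le> GG y - GG x" "GG y - GG x \<le> 4 * C ^ 4 * (y - x)"
proof -
  define q where "q = y ^ 4 + y ^ 3 * x + y\<^sup>2 * x\<^sup>2 + y * x ^ 3 + x ^ 4"
  have e: "GG y - GG x = 3/4 * (q - 1) * (y - x)"
    unfolding GG_def q_def by (simp add: field_simps eval_nat_numeral)
  have m: "1 \<le> a * b" "a * b \<le> C ^ (i + j)" if "1 \<le> a" "1 \<le> b" "a \<le> C ^ i" "b \<le> C ^ j" for a b :: real and i j
  proof -
    show "1 \<le> a * b" using mult_mono[of 1 a 1 b] that by simp
    show "a * b \<le> C ^ (i + j)" unfolding power_add by (rule mult_mono) (use that in auto)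
  qed
  have pw: "1 \<le> z ^ i" "z ^ i \<le> C ^ i" if "1 \<le> z" "z \<le> C" for z i
    using that by (auto intro: power_mono)
  have x: "1 \<le> x" "x \<le> C" and y: "1 \<le> y" "y \<le> C" using assms by auto
  have "5 \<le> q" unfolding q_def
    using pw(1)[OF y, of 4] pw(1)[OF x, of 4]
      m(1)[OF pw(1)[OF y, of 3] pw(1)[OF x, of 1] pw(2)[OF y] pw(2)[OF x]]
      m(1)[OF pw(1)[OF y, of 2] pw(1)[OF x, of 2] pw(2)[OF y] pw(2)[OF x]]
      m(1)[OF pw(1)[OF y, of 1] pw(1)[OF x, of 3] pw(2)[OF y] pw(2)[OF x]] by simp
  then have "3 * (y - x) \<le> 3/4 * (q - 1) * (y - x)" using assms by (intro mult_right_mono) auto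
  then show "3 * (y - x) \<le> GG y - GG x" using e by simp
  have "q \<le> 5 * C ^ 4" unfolding q_def
    using pw(2)[OF y, of 4] pw(2)[OF x, of 4]
      m(2)[OF pw(1)[OF y, of 3] pw(1)[OF x, of 1] pw(2)[OF y] pw(2)[OF x]]
      m(2)[OF pw(1)[OF y, of 2] pw(1)[OF x, of 2] pw(2)[OF y] pw(2)[OF x]]
      m(2)[OF pw(1)[OF y, of 1] pw(1)[OF x, of 3] pw(2)[OF y] pw(2)[OF x]] by simp
  moreover have "C ^ 4 \<ge> 1" using x by (intro one_le_power) simp
  moreover have "3/4 * (q - 1) \<le> 4 * c" if "q \<le> 5 * c" "c \<ge> 1" for c using that by simp
  ultimately have "3/4 * (q - 1) \<le> 4 * C ^ 4" by blast
  then have "3/4 * (q - 1) * (y - x) \<le> 4 * C ^ 4 * (y - x)" using assms by (intro mult_right_mono) auto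
  then show "GG y - GG x \<le> 4 * C ^ 4 * (y - x)" using e by simp
qed

lemma halfline_bounded:
  fixes f :: "real \<Rightarrow> real"
  assumes "continuous_on {0..} f" "(f \<longlongrightarrow> l) at_top"
  shows "\<exists>C. \<forall>s\<ge>0. \<bar>f s\<bar> \<le> C"
proof -
  have "\<forall>\<^sub>F s in at_top. dist (f s) l < 1" using assms(2) by (simp add: tendstoD)
  then obtain B where B: "\<And>s. s \<ge> B \<Longrightarrow> dist (f s) l < 1" unfolding eventually_at_top_linorder by blast
  have "bounded (f ` {0..B})"
    by (intro compact_imp_bounded compact_continuous_image continuous_on_subset[OF assms(1)]) auto
  then obtain D where D: "\<And>s. s \<in> {0..B} \<Longrightarrow> \<bar>f s\<bar> \<le> D"
    unfolding bounded_iff by (metis image_eqI real_norm_def)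
  have "\<bar>f s\<bar> \<le> max D (\<bar>l\<bar> + 1)" if "s \<ge> 0" for s
  proof (cases "s \<le> B")
    case True then show ?thesis using D[of s] that by auto
  next
    case False
    then have "\<bar>f s - l\<bar> < 1" using B[of s] by (simp add: dist_real_def)
    then show ?thesis by linarith
  qed
  then show ?thesis by blast
qed

text \<open>The nonlinearity is increasing with slope between \<open>3\<close> and \<open>\<kappa>\<close> on the range of \<open>p\<close>,
  so that \<open>e \<mapsto> (\<kappa> - \<Delta>)\<^sup>-\<^sup>1(\<kappa> e - G(1 + e) - F)\<close> is a contraction with factor \<open>1 - 3/\<kappa>\<close>; it
  maps \<open>{0 \<le> e \<le> p - 1}\<close> to itself because \<open>p\<close> is a supersolution.\<close>

lemma radial_exists:
  fixes p p1 p2 f0 F :: "real \<Rightarrow> real"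
  assumes p1: "\<And>s. 0 \<le> s \<Longrightarrow> (p has_real_derivative p1 s) (at s within {0..})"
    and p2: "\<And>s. 0 \<le> s \<Longrightarrow> (p1 has_real_derivative p2 s) (at s within {0..})"
    and p10: "p1 0 = 0" and p_gt: "\<And>s. 0 \<le> s \<Longrightarrow> p s > 1" and p_lim: "(p \<longlongrightarrow> 1) at_top"
    and p1_lim: "(p1 \<longlongrightarrow> 0) at_top"
    and f0_cont: "continuous_on {0..} f0" and f0_lim: "(f0 \<longlongrightarrow> 0) at_top"
    and f0: "\<And>s. 0 < s \<Longrightarrow> f0 s = p2 s + 2 * (cosh s / sinh s) * p1 s - GG (p s)"
    and F_cont: "continuous_on {0..} F"
    and F: "\<And>s. 0 \<le> s \<Longrightarrow> f0 s \<le> F s" "\<And>s. 0 \<le> s \<Longrightarrow> F s \<le> 0"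
    and F_neg: "0 < s1" "F s1 < 0" and F_gt: "0 < s2" "f0 s2 < F s2"
  shows "\<exists>\<phi> \<phi>1 c. continuous_on {0..} \<phi> \<and> (\<forall>s>0. (\<phi> has_real_derivative \<phi>1 s) (at s)) \<and>
     (\<forall>s>0. (\<phi>1 has_real_derivative GG (\<phi> s) + F s - 2 * (cosh s / sinh s) * \<phi>1 s) (at s)) \<and>
     (\<forall>s\<ge>0. 1 < \<phi> s \<and> \<phi> s < p s) \<and> ((\<lambda>s. (sinh s)\<^sup>2 * \<phi>1 s) \<longlongrightarrow> 0) (at_right 0) \<and>
     ((\<lambda>s. \<phi>1 s / s) \<longlongrightarrow> c) (at_right 0) \<and>
     ((\<lambda>s. GG (\<phi> s) + F s - 2 * (cosh s / sinh s) * \<phi>1 s) \<longlongrightarrow> c) (at_right 0)"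
proof -
  have p_cont: "continuous_on {0..} p"
    using DERIV_continuous[OF p1] by (auto simp: continuous_on_eq_continuous_within)
  have p1_cont: "continuous_on {0..} p1"
    using DERIV_continuous[OF p2] by (auto simp: continuous_on_eq_continuous_within)
  obtain C where C: "\<And>s. 0 \<le> s \<Longrightarrow> \<bar>p s\<bar> \<le> C" using halfline_bounded[OF p_cont p_lim] by blast
  obtain B where B: "\<And>s. 0 \<le> s \<Longrightarrow> \<bar>p1 s\<bar> \<le> B" using halfline_bounded[OF p1_cont p1_lim] by blast
  obtain D where D: "\<And>s. 0 \<le> s \<Longrightarrow> \<bar>f0 s\<bar> \<le> D" using halfline_bounded[OF f0_cont f0_lim] by blast
  have pC: "p s \<le> C" if "0 \<le> s" for s using C[OF that] by simp
  have C1: "C > 1" using pC[of 0] p_gt[of 0] by simp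
  have FD: "\<bar>F s\<bar> \<le> D" if "0 \<le> s" for s using D[OF that] F[OF that] by linarith
  \<comment> \<open>The slope of \<open>GG\<close> on the interval from 1 to \<open>C\<close> is at
    most \<kappa>, so \<kappa> e - GG (1 + e) is increasing in e; then k is chosen with k^2 - 1 =
    \<kappa>.\<close>
  define \<kappa> where "\<kappa> = 4 * C ^ 4"
  have "1 \<le> C ^ 4" using C1 by (intro one_le_power) simp
  moreover have "4 * c > 3" if "1 \<le> c" for c :: real using that by simp
  ultimately have \<kappa>: "\<kappa> > 3" unfolding \<kappa>_def by blast
  define k where "k = sqrt (1 + \<kappa>)"
  have k2: "k\<^sup>2 - 1 = \<kappa>" using \<kappa> by (simp add: k_def)
  have k1: "k > 1" using \<kappa> by (simp add: k_def)
  interpret radial_green k by unfold_locales (rule k1)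
  define n where "n e = (\<lambda>s. \<kappa> * e s - GG (1 + e s) - F s)" for e :: "real \<Rightarrow> real"
  have slope: "3 * (y - x) \<le> GG (1 + y) - GG (1 + x)" "GG (1 + y) - GG (1 + x) \<le> \<kappa> * (y - x)"
    if "0 \<le> x" "x \<le> y" "y \<le> C - 1" for x y
    using GG_bounds[of "1 + x" "1 + y" C] that by (simp_all add: \<kappa>_def)
  define ok where "ok e \<longleftrightarrow> continuous_on {0..} e \<and> (\<forall>s\<ge>0. 0 \<le> e s \<and> e s \<le> p s - 1)" for e :: "real \<Rightarrow> real"
  have okC: "0 \<le> e s" "e s \<le> p s - 1" "e s \<le> C - 1" if "ok e" "0 \<le> s" for e s
  proof -
    have b: "0 \<le> e s" "e s \<le> p s - 1" using that unfolding ok_def by blast+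
    show "0 \<le> e s" "e s \<le> p s - 1" by (fact b)+
    show "e s \<le> C - 1" using b(2) pC[OF that(2)] by linarith
  qed
  have n_nonneg: "- F s \<le> n e s" if "ok e" "0 \<le> s" for e s
    using slope(2)[of 0 "e s"] okC[OF that] by (simp add: n_def)
  have n_adm: "adm (n e)" if e: "ok e" for e
    unfolding adm_def
  proof (intro conjI exI[of _ "\<kappa> * (C - 1) + D"] allI impI)
    show "continuous_on {0..} (n e)" unfolding n_def using e F_cont
      by (intro continuous_intros) (auto simp: ok_def)
    fix s :: real assume s: "0 \<le> s"
    have "\<kappa> * e s \<le> \<kappa> * (C - 1)" using okC[OF e s] \<kappa> by (intro mult_left_mono) auto
    moreover have "0 \<le> GG (1 + e s)" using slope(1)[of 0 "e s"] okC[OF e s] by simp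
    ultimately show "\<bar>n e s\<bar> \<le> \<kappa> * (C - 1) + D"
      using n_nonneg[OF e s] F(2)[OF s] FD[OF s] unfolding n_def by linarith
  qed
  \<comment> \<open>The right-hand side for which \<open>p - 1\<close> solves the linear problem
    exactly. Knowing \<open>Q np = p - 1\<close> turns the barrier property into monotonicity of
    \<open>Q\<close>.\<close>
  define np where "np = (\<lambda>s. \<kappa> * (p s - 1) - GG (p s) - f0 s)"
  have np_le: "0 \<le> np s" "np s \<le> \<kappa> * (C - 1) + D" if s: "0 \<le> s" for s
  proof -
    have "\<kappa> * (p s - 1) \<le> \<kappa> * (C - 1)" using pC[OF s] \<kappa> by (intro mult_left_mono) auto
    moreover have "0 \<le> GG (p s)" "GG (p s) \<le> \<kappa> * (p s - 1)"
      using slope[of 0 "p s - 1"] pC[OF s] p_gt[OF s] by auto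
    ultimately show "0 \<le> np s" "np s \<le> \<kappa> * (C - 1) + D"
      using D[OF s] F[OF s] unfolding np_def by linarith+
  qed
  have np_adm: "adm np"
    unfolding adm_def
  proof (intro conjI exI[of _ "\<kappa> * (C - 1) + D"] allI impI)
    show "continuous_on {0..} np" unfolding np_def by (intro continuous_intros p_cont f0_cont)
    show "\<bar>np s\<bar> \<le> \<kappa> * (C - 1) + D" if "0 \<le> s" for s using np_le[OF that] by simp
  qed
  have Qp: "Q np r = p r - 1" if r: "0 \<le> r" for r
  proof -
    let ?u = "\<lambda>s. sinh s * (p s - 1)" and ?u1 = "\<lambda>s. cosh s * (p s - 1) + sinh s * p1 s"
    let ?u2 = "\<lambda>s. sinh s * (p s - 1) + 2 * cosh s * p1 s + sinh s * p2 s"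
    have d1: "(?u has_real_derivative ?u1 s) (at s within {0..})" if "0 \<le> s" for s
      using p1[OF that] by (auto intro!: derivative_eq_intros)
    have d2: "(?u1 has_real_derivative ?u2 s) (at s within {0..})" if "0 \<le> s" for s
      using p1[OF that] p2[OF that] by (auto intro!: derivative_eq_intros)
    have eq: "sinh s * np s = k\<^sup>2 * ?u s - ?u2 s" if "0 \<le> s" for s
    proof (cases "s = 0")
      case True
      then show ?thesis by (simp add: p10)
    next
      case False
      then have "s > 0" using that by simp
      have "sinh s * np s = sinh s * (\<kappa> * (p s - 1) - p2 s) - 2 * cosh s * p1 s"
        unfolding np_def f0[OF \<open>s > 0\<close>] using \<open>s > 0\<close> by (simp add: field_simps)
      moreover have "k\<^sup>2 = \<kappa> + 1" using k2 by simp
      ultimately show ?thesis by (simp add: algebra_simps)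
    qed
    have ex: "((\<lambda>s. A * exp (- (k - 1) * s)) \<longlongrightarrow> 0) at_top" for A :: real using k1 by real_asymp
    have hyp: "sinh s \<ge> 0" "sinh s \<le> exp s" "cosh s \<ge> 0" "cosh s \<le> exp s" if "0 \<le> s" for s :: real
    proof -
      have "exp (- s) \<le> exp s" using that by simp
      moreover have "exp s > 0" "exp (- s) > 0" by simp_all
      ultimately show "sinh s \<le> exp s" "cosh s \<le> exp s"
        unfolding sinh_field_def cosh_field_def by (auto simp: field_simps)
    qed (use that in auto)
    have b: "\<bar>exp (- k * s) * v\<bar> \<le> A * exp (- (k - 1) * s)" if "\<bar>v\<bar> \<le> A * exp s" for v A s
    proof -
      have "exp (- k * s) * \<bar>v\<bar> \<le> exp (- k * s) * (A * exp s)" using that by (intro mult_left_mono) auto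
      also have "\<dots> = A * exp (- (k - 1) * s)" by (simp add: exp_add[symmetric] algebra_simps)
      finally show ?thesis by (simp add: abs_mult)
    qed
    have bu: "\<bar>?u s\<bar> \<le> C * exp s" and bu1: "\<bar>?u1 s\<bar> \<le> (C + B) * exp s" if s: "0 \<le> s" for s
    proof -
      have p: "\<bar>p s - 1\<bar> \<le> C" using pC[OF s] p_gt[OF s] by simp
      have "\<bar>sinh s\<bar> * \<bar>p s - 1\<bar> \<le> exp s * C" "\<bar>cosh s\<bar> * \<bar>p s - 1\<bar> \<le> exp s * C"
        "\<bar>sinh s\<bar> * \<bar>p1 s\<bar> \<le> exp s * B"
        using hyp[OF s] p B[OF s] by (auto intro!: mult_mono)
      then show "\<bar>?u s\<bar> \<le> C * exp s" "\<bar>?u1 s\<bar> \<le> (C + B) * exp s"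
        unfolding abs_mult[symmetric] by (auto simp: algebra_simps intro: order_trans[OF abs_triangle_ineq])
    qed
    have l: "((\<lambda>s. exp (- k * s) * ?u s) \<longlongrightarrow> 0) at_top" "((\<lambda>s. exp (- k * s) * ?u1 s) \<longlongrightarrow> 0) at_top"
      by (rule Lim_null_comparison[OF _ ex[of C]], use b[OF bu] in \<open>auto simp: eventually_at_top_linorder intro!: exI[of _ 0]\<close>)
         (rule Lim_null_comparison[OF _ ex[of "C + B"]], use b[OF bu1] in \<open>auto simp: eventually_at_top_linorder intro!: exI[of _ 0]\<close>)
    note rep = representation[OF d1 d2 np_adm eq _ l r]
    have "LS np r = ?u r" "LB np 0 = ?u1 0" using rep by simp_all
    then show ?thesis using r by (auto simp: Q_def p10)
  qed
  \<comment> \<open>The supersolution property, with the gap \<open>F - f0\<close> recorded; its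
    positivity at \<open>s2\<close> later makes the upper bound strict.\<close>
  have n_le_np: "n e s \<le> np s - (F s - f0 s)" if e: "ok e" "0 \<le> s" for e s
    using slope(2)[of "e s" "p s - 1"] okC[OF e] pC[OF e(2)]
    by (simp add: n_def np_def algebra_simps)
  have Q_ok: "ok (\<lambda>s. Q (n e) \<bar>s\<bar>)" if e: "ok e" for e
  proof -
    have "continuous_on {0..} (\<lambda>s. Q (n e) \<bar>s\<bar>)"
      by (rule continuous_on_compose2[OF Q_cont[OF n_adm[OF e]]]) (auto intro!: continuous_intros)
    moreover have "0 \<le> Q (n e) \<bar>s\<bar>" for s
      by (rule Q_nonneg(1)[OF n_adm[OF e]]) (use n_nonneg[OF e] F(2) in \<open>force+\<close>)
    moreover have "Q (n e) \<bar>s\<bar> \<le> Q np \<bar>s\<bar>" for s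
    proof (rule Q_mono[OF n_adm[OF e] np_adm])
      show "n e s \<le> np s" if "0 \<le> s" for s using n_le_np[OF e that] F(1)[OF that] by simp
    qed simp
    ultimately show ?thesis unfolding ok_def using Qp by (metis abs_ge_zero abs_of_nonneg)
  qed
  \<comment> \<open>Evaluation at |s| turns functions on the half-line into bounded continuous
    functions on the line, a complete metric space in which the order interval \<open>X\<close> is
    closed.\<close>
  define T :: "(real \<Rightarrow>\<^sub>C real) \<Rightarrow> (real \<Rightarrow>\<^sub>C real)" where "T e = Bcontfun (\<lambda>s. Q (n e) \<bar>s\<bar>)" for e
  define X :: "(real \<Rightarrow>\<^sub>C real) set" where "X = PiC UNIV (\<lambda>s. {0..p \<bar>s\<bar> - 1})"
  have X: "ok e" if "e \<in> X" for e :: "real \<Rightarrow>\<^sub>C real"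
    using mem_PiCD[OF that[unfolded X_def]] unfolding ok_def
    by (auto simp: Pi_iff) (metis abs_of_nonneg)
  have T: "apply_bcontfun (T e) = (\<lambda>s. Q (n e) \<bar>s\<bar>)" if "e \<in> X" for e
    unfolding T_def
  proof (rule Bcontfun_inverse, rule bcontfun_normI)
    have "ok e" by (rule X[OF that])
    show "continuous_on UNIV (\<lambda>s. Q (n e) \<bar>s\<bar>)"
      by (rule continuous_on_compose2[OF Q_cont[OF n_adm[OF \<open>ok e\<close>]]]) (auto intro!: continuous_intros)
    show "norm (Q (n e) \<bar>s\<bar>) \<le> C - 1" for s
      using okC[OF Q_ok[OF \<open>ok e\<close>], of "\<bar>s\<bar>"] by simp
  qed
  have "\<exists>!e\<in>X. T e = e"
  proof (rule Banach_fix)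
    show "complete X" unfolding X_def complete_eq_closed by (rule closed_PiC) auto
    have "const_bcontfun 0 \<in> X" unfolding X_def by (rule mem_PiCI) (use p_gt in \<open>auto simp: less_imp_le\<close>)
    then show "X \<noteq> {}" by blast
    show "0 \<le> (\<kappa> - 3) / \<kappa>" "(\<kappa> - 3) / \<kappa> < 1" using \<kappa> by auto
    show "T ` X \<subseteq> X"
    proof (rule image_subsetI)
      fix e assume e: "e \<in> X"
      show "T e \<in> X" unfolding X_def
        by (rule mem_PiCI) (use okC(1,2)[OF Q_ok[OF X[OF e]], of "\<bar>_\<bar>"] in \<open>auto simp: T[OF e]\<close>)
    qed
    fix e e' assume e: "e \<in> X" "e' \<in> X"
    \<comment> \<open>A sup norm bound by positivity alone: n e is at most n e' plus the constant b,
      and \<open>Q\<close> is monotone and sends b to b / \<kappa>. Exchanging e and e' gives the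
      other side.\<close>
    have half: "Q (n e) \<bar>s\<bar> - Q (n e') \<bar>s\<bar> \<le> (\<kappa> - 3) / \<kappa> * dist e e'" if e: "e \<in> X" "e' \<in> X"
      for e e' :: "real \<Rightarrow>\<^sub>C real" and s
    proof -
      have ok: "ok e" "ok e'" using X e by auto
      define b where "b = (\<kappa> - 3) * dist e e'"
      have "Q (n e) \<bar>s\<bar> \<le> Q (\<lambda>s. n e' s - - b) \<bar>s\<bar>"
      proof (rule Q_mono[OF n_adm[OF ok(1)] adm_diff[OF n_adm[OF ok(2)] adm_const]])
        fix s :: real assume s: "0 \<le> s"
        have dd: "\<bar>e s - e' s\<bar> \<le> dist e e'" using dist_bounded[of e s e'] by (simp add: dist_real_def)
        have "n e s - n e' s \<le> (\<kappa> - 3) * \<bar>e s - e' s\<bar>"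
        proof (cases "e' s \<le> e s")
          case True
          then show ?thesis using slope(1)[of "e' s" "e s"] okC[OF ok(1) s] okC[OF ok(2) s]
            by (simp add: n_def algebra_simps)
        next
          case False
          then have "n e s - n e' s \<le> 0" using slope(2)[of "e s" "e' s"] okC[OF ok(1) s] okC[OF ok(2) s]
            by (simp add: n_def algebra_simps)
          then show ?thesis using \<kappa> by (smt (verit) mult_nonneg_nonneg)
        qed
        also have "\<dots> \<le> b" unfolding b_def using dd \<kappa> by (intro mult_left_mono) auto
        finally show "n e s \<le> n e' s - - b" by simp
      qed simp
      also have "\<dots> = Q (n e') \<bar>s\<bar> + b / \<kappa>"
        using Q_diff[OF n_adm[OF ok(2)] adm_const, of "\<bar>s\<bar>" "- b"] Q_const[of "\<bar>s\<bar>" "- b"] k2 by simp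
      finally show ?thesis by (simp add: b_def)
    qed
    show "dist (T e) (T e') \<le> (\<kappa> - 3) / \<kappa> * dist e e'"
    proof (rule dist_bound)
      fix s
      show "dist (T e s) (T e' s) \<le> (\<kappa> - 3) / \<kappa> * dist e e'"
        unfolding T[OF e(1)] T[OF e(2)] dist_real_def
        using half[OF e, of s] half[OF e(2,1), of s] by (simp add: dist_commute abs_le_iff)
    qed
  qed
  then obtain e0 where e0: "e0 \<in> X" "T e0 = e0" by blast
  define e where "e = apply_bcontfun e0"
  have ok: "ok e" unfolding e_def by (rule X[OF e0(1)])
  have fixpt: "e s = Q (n e) s" if "0 \<le> s" for s
    using fun_cong[OF T[OF e0(1)], of s] e0(2) that by (simp add: e_def)
  note adm = n_adm[OF ok]
  define e1 where "e1 = (\<lambda>s. (LS1 (n e) s * sinh s - LS (n e) s * cosh s) / (sinh s)\<^sup>2)"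
  have Dq: "(Q (n e) has_real_derivative e1 s) (at s)" if "0 < s" for s
    unfolding e1_def by (rule Q_deriv(1)[OF adm that])
  have De: "(e has_real_derivative e1 s) (at s)" if s: "0 < s" for s
    by (rule has_field_derivative_transform_within_open[OF Dq[OF s], of "{0<..}"]) (use s fixpt in auto)
  have m_eq: "\<kappa> * Q (n e) s - n e s = GG (1 + e s) + F s" if "0 \<le> s" for s
    using fixpt[OF that] by (simp add: n_def)
  have De1: "(e1 has_real_derivative (GG (1 + e s) + F s) - 2 * (cosh s / sinh s) * e1 s) (at s)"
    if s: "0 < s" for s
    using Q_deriv(2)[OF adm s] m_eq[of s] s unfolding k2 e1_def by simp
  have l0: "((\<lambda>s. (sinh s)\<^sup>2 * e1 s) \<longlongrightarrow> 0) (at_right 0)"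
    unfolding e1_def by (rule Q_deriv(3)[OF adm])
  have e_cont: "continuous_on {0..} e" using ok by (simp add: ok_def)
  have "continuous_on {0..} (\<lambda>s. GG (1 + e s) + F s)" by (intro continuous_intros e_cont F_cont)
  then have m0: "((\<lambda>s. GG (1 + e s) + F s) \<longlongrightarrow> GG (1 + e 0) + F 0) (at_right 0)"
    unfolding continuous_on_def by (auto intro: tendsto_within_subset)
  note lims = radial_origin_limits[where m="\<lambda>s. GG (1 + e s) + F s", OF De1 l0 m0]
  have pos: "0 < e s" if "0 \<le> s" for s
  proof -
    have "0 < Q (n e) s"
    proof (rule Q_pos[OF adm _ F_neg(1) _ that])
      show "0 \<le> n e t" if "0 \<le> t" for t using n_nonneg[OF ok that] F(2)[OF that] by linarith
      show "0 < n e s1" using n_nonneg[OF ok, of s1] F_neg by linarith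
    qed
    then show ?thesis using fixpt[OF that] by simp
  qed
  have lt: "e s < p s - 1" if s: "0 \<le> s" for s
  proof -
    have "0 < Q (\<lambda>s. np s - n e s) s"
    proof (rule Q_pos[OF adm_diff[OF np_adm adm] _ F_gt(1) _ s])
      show "0 \<le> np t - n e t" if "0 \<le> t" for t using n_le_np[OF ok that] F(1)[OF that] by linarith
      show "0 < np s2 - n e s2" using n_le_np[OF ok, of s2] F_gt by linarith
    qed
    then show ?thesis using Q_diff[OF np_adm adm s] Qp[OF s] fixpt[OF s] by simp
  qed
  show ?thesis
  proof (rule exI[of _ "\<lambda>s. 1 + e s"], rule exI[of _ e1], rule exI[of _ "(GG (1 + e 0) + F 0) / 3"],
      intro conjI allI impI)
    show "continuous_on {0..} (\<lambda>s. 1 + e s)" by (intro continuous_intros e_cont)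
    show "((\<lambda>s. 1 + e s) has_real_derivative e1 s) (at s)" if "0 < s" for s
      using De[OF that] by (auto intro!: derivative_eq_intros)
    show "(e1 has_real_derivative GG (1 + e s) + F s - 2 * (cosh s / sinh s) * e1 s) (at s)" if "0 < s" for s
      using De1[OF that] .
    show "1 < 1 + e s" "1 + e s < p s" if "0 \<le> s" for s using pos[OF that] lt[OF that] by auto
    show "((\<lambda>s. (sinh s)\<^sup>2 * e1 s) \<longlongrightarrow> 0) (at_right 0)" by (rule l0)
    show "((\<lambda>s. e1 s / s) \<longlongrightarrow> (GG (1 + e 0) + F 0) / 3) (at_right 0)"
      "((\<lambda>s. GG (1 + e s) + F s - 2 * (cosh s / sinh s) * e1 s) \<longlongrightarrow> (GG (1 + e 0) + F 0) / 3) (at_right 0)"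
      using lims by simp_all
  qed
qed

section \<open>Exterior solutions\<close>

context adss
begin

definition PP1 :: "real \<Rightarrow> real" where
  "PP1 s = adss_phi M s / 2 * ((VV (cyl s) / UU (cyl s) - cosh s) / sinh s)"

text \<open>The radii beyond \<open>adss_rho0 M\<close>, expressed by the condition on h under which
  \<open>UU\<close> is positive.\<close>

definition dom :: "real \<Rightarrow> bool" where "dom s \<longleftrightarrow> 0 < s \<and> cyl s < 2 * hm"

lemma dom_mono: "dom s \<Longrightarrow> s \<le> s' \<Longrightarrow> dom s'"
  unfolding dom_def using cyl_less[of s s'] by (cases "s = s'") auto

lemma dom_pos: assumes "dom s" shows "0 < s" "0 < UU (cyl s)" "cyl s \<in> {lo<..<hi}" "0 < cyl s" "cyl s < 2 * hm"
  using assms UU_pos cyl_pos in_dom(1) unfolding dom_def by auto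

lemma phi_eq: assumes "dom s" shows "adss_phi M s = 1 / sqrt (sinh s * UU (cyl s))"
  using adss_phi[of s] assms unfolding dom_def by (simp add: sinh_cyl real_sqrt_divide real_sqrt_mult)

lemma phi_pos: "dom s \<Longrightarrow> adss_phi M s > 0"
  using dom_pos[of s] by (simp add: phi_eq)

lemma phi_sq: assumes "dom s" shows "(adss_phi M s)\<^sup>2 * (sinh s * UU (cyl s)) = 1"
  using dom_pos[OF assms] by (simp add: phi_eq[OF assms] power_divide)

lemma open_dom: "open {s. dom s}"
proof -
  have "{s. dom s} = {0<..} \<inter> cyl -` {..<2 * hm}" by (auto simp: dom_def)
  moreover have "open \<dots>"
    by (rule continuous_open_preimage)
       (auto intro!: continuous_at_imp_continuous_on DERIV_isCont[OF cyl_deriv])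
  ultimately show ?thesis by simp
qed

lemma phi_deriv: assumes s: "dom s" shows "(adss_phi M has_real_derivative PP1 s) (at s)"
proof -
  define q where "q s = sinh s * UU (cyl s)" for s
  have q: "q s > 0" using dom_pos[OF s] by (simp add: q_def)
  have U: "((\<lambda>s. UU (cyl s)) has_real_derivative VV (cyl s) * (- 1 / sinh s)) (at s)"
    by (rule DERIV_chain2[OF UU_deriv cyl_deriv]) (use dom_pos[OF s] in auto)
  have dq: "(q has_real_derivative cosh s * UU (cyl s) - VV (cyl s)) (at s)"
    unfolding q_def using dom_pos[OF s] by (auto intro!: derivative_eq_intros U)
  have "((\<lambda>s. 1 / sqrt (q s)) has_real_derivative
      - ((cosh s * UU (cyl s) - VV (cyl s)) / (2 * sqrt (q s))) / (q s)) (at s)"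
    using q by (auto intro!: derivative_eq_intros DERIV_chain2[OF DERIV_real_sqrt dq] dq simp: field_simps)
  moreover have "- ((cosh s * UU (cyl s) - VV (cyl s)) / (2 * sqrt (q s))) / (q s) = PP1 s"
    unfolding PP1_def phi_eq[OF s] q_def[symmetric] using dom_pos[OF s] q by (simp add: q_def field_simps)
  ultimately have "((\<lambda>s. 1 / sqrt (q s)) has_real_derivative PP1 s) (at s)" by simp
  then show ?thesis
    by (rule has_field_derivative_transform_within_open[OF _ open_dom])
       (use s in \<open>auto simp: phi_eq q_def\<close>)
qed

text \<open>Scalar curvature -6 as an equation for the conformal factor. The first integral
  \<open>UU_energy\<close> replaces the square of VV / UU, the terms with the mass cancel, and 1 /
  (S w)^2 is the fourth power of the conformal factor.\<close>

lemma phi_deriv2: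
  assumes s: "dom s"
  shows "(PP1 has_real_derivative GG (adss_phi M s) - 2 * (cosh s / sinh s) * PP1 s) (at s)"
proof -
  define P where "P = adss_phi M s"
  define S where "S = sinh s"
  define c where "c = cosh s"
  define w where "w = UU (cyl s)"
  define v where "v = VV (cyl s)"
  have pos: "S > 0" "w > 0" "P > 0" using dom_pos[OF s] phi_pos[OF s] by (auto simp: S_def w_def P_def)
  have c2: "c\<^sup>2 = 1 + S\<^sup>2" using cosh_square_eq[of s] by (simp add: c_def S_def)
  have v2: "v\<^sup>2 = 1 + w\<^sup>2 - M * w ^ 3" unfolding v_def w_def by (rule UU_energy)
  have U: "((\<lambda>s. UU (cyl s)) has_real_derivative v * (- 1 / S)) (at s)"
    unfolding v_def S_def by (rule DERIV_chain2[OF UU_deriv cyl_deriv]) (use dom_pos[OF s] in auto)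
  have V: "((\<lambda>s. VV (cyl s)) has_real_derivative (w - 3/2 * M * w\<^sup>2) * (- 1 / S)) (at s)"
    unfolding w_def S_def by (rule DERIV_chain2[OF VV_deriv cyl_deriv]) (use dom_pos[OF s] in auto)
  have VU: "((\<lambda>s. VV (cyl s) / UU (cyl s)) has_real_derivative
      ((w - 3/2 * M * w\<^sup>2) * (- 1 / S) * w - v * (v * (- 1 / S))) / (w * w)) (at s)"
    using DERIV_divide[OF V U] pos by (simp add: w_def v_def)
  have dA: "((\<lambda>s. (VV (cyl s) / UU (cyl s) - cosh s) / sinh s) has_real_derivative
     ((((w - 3/2 * M * w\<^sup>2) * (- 1 / S) * w - v * (v * (- 1 / S))) / (w * w) - S) * S - (v / w - c) * c) / (S * S)) (at s)"
    using DERIV_divide[OF DERIV_diff[OF VU has_field_derivative_cosh[OF DERIV_ident]] has_field_derivative_sinh[OF DERIV_ident]] pos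
    by (simp add: S_def c_def w_def v_def)
  have PP: "PP1 s = P / 2 * ((v / w - c) / S)" by (simp add: PP1_def P_def S_def c_def w_def v_def)
  define A' where "A' = ((((w - 3/2 * M * w\<^sup>2) * (- 1 / S) * w - v * (v * (- 1 / S))) / (w * w) - S) * S - (v / w - c) * c) / (S * S)"
  have "(PP1 has_real_derivative PP1 s / 2 * ((v / w - c) / S) + A' * (P / 2)) (at s)"
    using DERIV_mult[OF DERIV_cdivide[OF phi_deriv[OF s], of 2] dA] unfolding PP1_def[abs_def] A'_def
    by (simp add: P_def S_def c_def w_def v_def PP1_def)
  moreover have "PP1 s / 2 * ((v / w - c) / S) + A' * (P / 2) = GG P - 2 * (c / S) * PP1 s"
  proof -
    define x where "x = v / w"
    have x2: "x * x = 1 / w\<^sup>2 + 1 - M * w"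
      unfolding x_def using pos v2 by (simp add: field_simps power2_eq_square power3_eq_cube)
    have A: "A' = (x * x - x * c - (1 - 3/2 * M * w) + 1) / (S * S)"
    proof -
      have "((w - 3/2 * M * w\<^sup>2) * (- 1 / S) * w - v * (v * (- 1 / S))) / (w * w) * S = x * x - (1 - 3/2 * M * w)"
        unfolding x_def using pos by (simp add: field_simps power2_eq_square)
      moreover have "(y - S) * S - (x - c) * c = y * S - x * c + 1" for y
        using c2 by (simp add: algebra_simps power2_eq_square)
      ultimately show ?thesis unfolding A'_def x_def[symmetric] by simp
    qed
    have P4: "P ^ 4 * (S * S * (w * w)) = 1"
    proof -
      have "P\<^sup>2 * (S * w) = 1" using phi_sq[OF s] by (simp add: P_def S_def w_def)
      moreover have "P ^ 4 * (S * S * (w * w)) = (P\<^sup>2 * (S * w)) * (P\<^sup>2 * (S * w))"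
        by (simp add: eval_nat_numeral)
      ultimately show ?thesis by simp
    qed
    then have P4': "P ^ 4 = 1 / (S * S * (w * w))" using pos by (simp add: field_simps)
    have "PP1 s / 2 * (x - c) / S + A' * (P / 2) + 2 * (c / S) * PP1 s
       = P / (S * S) * (3/4 * (x * x) - 3/4 * c\<^sup>2 + 3/4 * M * w)"
      unfolding PP A x_def[symmetric] using pos by (simp add: field_simps power2_eq_square)
    also have "\<dots> = P / (S * S) * (3/4 * (1 / w\<^sup>2 - S\<^sup>2))" unfolding x2 c2 by (simp add: algebra_simps)
    also have "\<dots> = GG P" unfolding GG_def P4' using pos by (simp add: field_simps power2_eq_square)
    finally show ?thesis unfolding x_def by simp
  qed
  ultimately show ?thesis by (simp add: P_def c_def S_def)
qed

text \<open>\<open>UU\<close> has value 0 and derivative 1 at h = 0, hence agrees with the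
  hyperbolic profile sinh h to first order.\<close>

lemma sinh_UU_lim: "((\<lambda>h. sinh h / UU h) \<longlongrightarrow> 1) (at_right 0)"
proof -
  have U: "((\<lambda>h. UU h / h) \<longlongrightarrow> 1) (at 0)"
    using UU_deriv[OF in_dom(2)] by (simp add: has_field_derivative_iff)
  have S: "((\<lambda>h::real. sinh h / h) \<longlongrightarrow> 1) (at_right 0)" by real_asymp
  have "((\<lambda>h. (sinh h / h) / (UU h / h)) \<longlongrightarrow> 1 / 1) (at_right 0)"
    by (intro tendsto_divide S tendsto_within_subset[OF U]) auto
  then have "((\<lambda>h. (sinh h / h) / (UU h / h)) \<longlongrightarrow> 1) (at_right 0)" by simp
  then show ?thesis
    by (rule Lim_transform_eventually) (auto simp: eventually_at_filter)
qed

lemma cyl_at_right: "filterlim cyl (at_right 0) at_top"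
  unfolding filterlim_at using cyl_tendsto_0
  by (auto simp: eventually_at_top_linorder intro!: exI[of _ 1] cyl_pos less_imp_neq[symmetric])

lemma eventually_dom: "\<forall>\<^sub>F s in at_top. dom s"
proof -
  have "\<forall>\<^sub>F s in at_top. cyl s < 2 * hm" using order_tendstoD(2)[OF cyl_tendsto_0, of "2 * hm"] hm_pos by simp
  with eventually_gt_at_top[of 0] show ?thesis by eventually_elim (simp add: dom_def)
qed

lemma phi_lim: "(adss_phi M \<longlongrightarrow> 1) at_top"
proof -
  have "((\<lambda>s. sqrt (sinh (cyl s) / UU (cyl s))) \<longlongrightarrow> sqrt 1) at_top"
    by (intro tendsto_real_sqrt filterlim_compose[OF sinh_UU_lim cyl_at_right])
  then have "((\<lambda>s. sqrt (sinh (cyl s) / UU (cyl s))) \<longlongrightarrow> 1) at_top" by simp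
  then show ?thesis
    by (rule Lim_transform_eventually) (rule eventually_mono[OF eventually_dom], simp add: adss_phi dom_def)
qed

lemma PP1_lim: "(PP1 \<longlongrightarrow> 0) at_top"
proof -
  have V: "(VV \<longlongrightarrow> 1) (at_right 0)"
    using DERIV_isCont[OF VV_deriv[OF in_dom(2)]] by (auto simp: isCont_def intro: tendsto_within_subset)
  have c: "((\<lambda>h::real. cosh h) \<longlongrightarrow> 1) (at_right 0)" by real_asymp
  have "((\<lambda>h. (sinh h / UU h) * VV h - cosh h) \<longlongrightarrow> 1 * 1 - 1) (at_right 0)"
    by (intro tendsto_intros sinh_UU_lim V c)
  from filterlim_compose[OF this cyl_at_right]
  have "((\<lambda>s. adss_phi M s / 2 * ((sinh (cyl s) / UU (cyl s)) * VV (cyl s) - cosh (cyl s))) \<longlongrightarrow> 1 / 2 * (1 * 1 - 1)) at_top"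
    by (intro tendsto_mult tendsto_divide tendsto_const phi_lim; simp)
  then have "((\<lambda>s. adss_phi M s / 2 * ((sinh (cyl s) / UU (cyl s)) * VV (cyl s) - cosh (cyl s))) \<longlongrightarrow> 0) at_top" by simp
  then show ?thesis
  proof (rule Lim_transform_eventually)
    show "\<forall>\<^sub>F s in at_top. adss_phi M s / 2 * ((sinh (cyl s) / UU (cyl s)) * VV (cyl s) - cosh (cyl s)) = PP1 s"
      using eventually_gt_at_top[of 0]
    proof eventually_elim
      case (elim s)
      then show ?case unfolding PP1_def sinh_cyl[OF elim] cosh_cyl[OF elim]
        by (simp add: diff_divide_distrib)
    qed
  qed
qed

text \<open>The Euclidean metric is r^2 times the cylinder metric in h = - ln r, so the metric UU^-2
  (dh^2 + d\<sigma>^2) has Euclidean conformal factor 1 / (UU r)^2.\<close>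

lemma phi4:
  assumes r: "0 < r" "r < 1" and d: "dom (rho_of_tau r)"
  shows "adss_phi M (rho_of_tau r) ^ 4 * (4 / (1 - r\<^sup>2)\<^sup>2) = 1 / (UU (- ln r) * r)\<^sup>2"
proof -
  have c: "cyl (rho_of_tau r) = - ln r" using tau_rho[of r] r by (simp add: cyl_def)
  have U: "UU (- ln r) > 0" using dom_pos(2)[OF d] c by simp
  have sh: "sinh (rho_of_tau r) = 2 * r / (1 - r\<^sup>2)" by (rule sinh_rho_of_tau(1)[OF r])
  have r2: "1 - r\<^sup>2 > 0" using r by (simp add: power_less_one_iff)
  have "adss_phi M (rho_of_tau r) ^ 4 = ((adss_phi M (rho_of_tau r))\<^sup>2)\<^sup>2" by simp
  also have "(adss_phi M (rho_of_tau r))\<^sup>2 = (1 - r\<^sup>2) / (2 * r * UU (- ln r))"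
    using phi_sq[OF d] r r2 U unfolding sh c by (simp add: field_simps)
  finally show ?thesis using r r2 U by (simp add: power_divide power_mult_distrib)
qed

text \<open>The mean curvature of the coordinate sphere at \<open>h\<close> in \<open>u\<^sup>-\<^sup>2(dh\<^sup>2 + d\<sigma>\<^sup>2)\<close> is \<open>2 u'(h)\<close>.\<close>

lemma mean_curvature:
  assumes x: "x \<in> hyp_space" and s: "dom (hyp_rho x)"
  shows "level_mean_curvature (adss_metric M) hyp_rho x = 2 * VV (cyl (hyp_rho x))"
proof -
  have cy: "cyl (hyp_rho y) = - ln (norm y)" if "y \<in> hyp_space" for y
    using that tau_rho[of "norm y"] less_le_trans[OF _ norm_ge_zero[of y], of "-1"]
    by (simp add: cyl_def hyp_rho_def hyp_space_norm)
  have x0: "x \<noteq> 0" using dom_pos(1)[OF s] by (auto simp: hyp_rho_def)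
  define S where "S = {y. dom (hyp_rho y)} \<inter> (hyp_space - {0})"
  have "open S"
  proof -
    have "S = (ball 0 1 - {0}) \<inter> (\<lambda>y. - ln (norm y)) -` {..<2 * hm}"
      using cy hyp_rho_pos by (auto simp: S_def dom_def hyp_space_def)
    moreover have "open \<dots>" by (rule continuous_open_preimage) (auto intro!: continuous_intros)
    ultimately show ?thesis by simp
  qed
  have g: "adss_metric M y = exp (- 2 * ln (UU (- ln (norm y))) - 2 * ln (norm y)) *\<^sub>R mat 1" if "y \<in> S" for y
  proof -
    define r where "r = norm y"
    have yS: "y \<in> hyp_space" "y \<noteq> 0" "dom (hyp_rho y)" using that by (auto simp: S_def)
    have r: "0 < r" "r < 1" using yS by (auto simp: r_def hyp_space_norm)
    have c: "cyl (hyp_rho y) = - ln r" using cy[OF yS(1)] by (simp add: r_def)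
    have U: "UU (- ln r) > 0" using dom_pos(2)[OF yS(3)] c by simp
    have "adss_phi M (hyp_rho y) ^ 4 * (4 / (1 - r\<^sup>2)\<^sup>2) = 1 / (UU (- ln r) * r)\<^sup>2"
      using phi4[OF r] yS(3) by (simp add: hyp_rho_def r_def)
    also have "\<dots> = exp (- 2 * ln (UU (- ln r)) - 2 * ln r)"
      using U r by (simp add: exp_diff exp_minus exp_double power_mult_distrib divide_inverse)
    finally show ?thesis
      unfolding adss_metric_def conformal_def hyp_metric_def r_def by simp
  qed
  define r where "r = norm x"
  have r: "0 < r" using x0 by (simp add: r_def)
  have c: "cyl (hyp_rho x) = - ln r" using cy[OF x] by (simp add: r_def)
  have U: "UU (- ln r) > 0" "- ln r \<in> {lo<..<hi}" using dom_pos(2,3)[OF s] c by auto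
  have "((\<lambda>r. UU (- ln r)) has_real_derivative VV (- ln r) * (- (1 / r))) (at r)"
    by (rule DERIV_chain2[where f=UU and g="\<lambda>r. - ln r", OF UU_deriv[OF U(2)]]) (use r in \<open>auto intro!: derivative_eq_intros\<close>)
  from DERIV_chain2[where f=ln and g="\<lambda>r. UU (- ln r)", OF DERIV_ln_divide[OF U(1)] this]
  have lnU: "((\<lambda>r. ln (UU (- ln r))) has_real_derivative 1 / UU (- ln r) * (VV (- ln r) * (- (1 / r)))) (at r)" .
  have "((\<lambda>r. - 2 * ln (UU (- ln r)) - 2 * ln r) has_real_derivative
     - 2 * (1 / UU (- ln r) * (VV (- ln r) * (- (1 / r)))) - 2 * (1 / r)) (at r)"
    by (intro DERIV_diff DERIV_cmult lnU DERIV_ln_divide r)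
  note D = this[unfolded r_def]
  have "x \<in> S" using x x0 s by (simp add: S_def)
  from mean_curvature_radial[OF x x0 \<open>open S\<close> this g D]
  have "level_mean_curvature (adss_metric M) hyp_rho x = exp (- (- 2 * ln (UU (- ln r)) - 2 * ln r) / 2) *
     (2 / r + (- 2 * (1 / UU (- ln r) * (VV (- ln r) * (- (1 / r)))) - 2 * (1 / r)))"
    by (simp only: r_def)
  also have "exp (- (- 2 * ln (UU (- ln r)) - 2 * ln r) / 2) = UU (- ln r) * r"
    using U(1) r by (simp add: exp_add add_divide_distrib)
  also have "UU (- ln r) * r * (2 / r + (- 2 * (1 / UU (- ln r) * (VV (- ln r) * (- (1 / r)))) - 2 * (1 / r)))
      = 2 * VV (- ln r)"
    using U(1) r by simp
  finally show ?thesis unfolding c .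
qed

lemma sphere_mean_curvature:
  assumes s: "dom s"
  shows "sphere_has_mean_curvature (adss_metric M) s H \<longleftrightarrow> 2 * VV (cyl s) = H"
proof -
  define x :: "real^3" where "x = tau_of_rho s *\<^sub>R axis 1 1"
  have t: "0 < tau_of_rho s" "tau_of_rho s < 1"
    using dom_pos(1)[OF s] tau_of_rho_pos tau_of_rho_less_1 by auto
  then have "x \<in> hyp_space" "hyp_rho x = s" by (auto simp: x_def hyp_space_norm hyp_rho_def norm_axis_1)
  then show ?thesis unfolding sphere_has_mean_curvature_def using mean_curvature s by metis
qed

lemma UU_decreasing: assumes "hm \<le> x" "x < y" "y \<le> 2 * hm" shows "UU y < UU x"
proof (rule DERIV_neg_imp_decreasing_open[OF assms(2)])
  show "\<exists>D. (UU has_real_derivative D) (at z) \<and> D < 0" if "x < z" "z < y" for z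
    using UU_deriv[of z] VV_neg[of z] in_dom(1)[of z] that assms hm_pos by auto
  show "continuous_on {x..y} UU"
    using assms in_dom(3,4) by (intro continuous_at_imp_continuous_on ballI DERIV_isCont[OF UU_deriv]) auto
qed

text \<open>Mean curvature -2 means \<open>VV = - 1\<close>, and the first integral turns this into
  UU^2 (1 - M UU) = 0 on the branch where \<open>VV\<close> is negative, that is beyond the horizon.
  There \<open>UU\<close> decreases from 1 / a to 0 and takes the value 1 / M, which is below 1 / a,
  exactly once. Larger h means smaller radius, so a radius below that of this sphere is one with
  \<open>VV < - 1\<close>, a condition stable under perturbation.\<close>

lemma rho2':
  assumes s: "dom s" shows "s < adss_rho2' M \<longleftrightarrow> VV (cyl s) < - 1"
proof -
  have "ZZ 0 = 0" using ZZ(1)[of 0] by simp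
  then have Uhm: "UU hm = 1 / a" by (simp add: UU_def)
  have aM: "a < M" using a_pos by (simp add: M_def)
  have "\<exists>h. hm \<le> h \<and> h \<le> 2 * hm \<and> UU h = 1 / M"
  proof (rule IVT2')
    show "UU (2 * hm) \<le> 1 / M" "1 / M \<le> UU hm" using M_pos a_pos aM by (auto simp: Uhm frac_le)
    show "continuous_on {hm..2 * hm} UU"
      using in_dom(3,4) by (intro continuous_at_imp_continuous_on ballI DERIV_isCont[OF UU_deriv]) auto
  qed (use hm_pos in simp)
  then obtain h0 where h0: "hm \<le> h0" "h0 \<le> 2 * hm" "UU h0 = 1 / M" by blast
  have h0': "hm < h0" "h0 < 2 * hm"
    using h0 Uhm aM M_pos a_pos by (auto simp: le_less)
  have V1: "VV h < 0 \<Longrightarrow> VV h = - 1 \<longleftrightarrow> (UU h)\<^sup>2 * (1 - M * UU h) = 0"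
    "VV h < 0 \<Longrightarrow> VV h < - 1 \<longleftrightarrow> (UU h)\<^sup>2 * (1 - M * UU h) > 0" for h
  proof -
    assume n: "VV h < 0"
    have e: "(VV h)\<^sup>2 = 1 + (UU h)\<^sup>2 * (1 - M * UU h)"
      unfolding UU_energy by (simp add: algebra_simps power2_eq_square power3_eq_cube)
    have "VV h = - 1 \<longleftrightarrow> (VV h)\<^sup>2 = 1" using n by (auto simp: power2_eq_1_iff)
    then show "VV h = - 1 \<longleftrightarrow> (UU h)\<^sup>2 * (1 - M * UU h) = 0" using e by simp
    have "VV h < - 1 \<longleftrightarrow> 1 < (VV h)\<^sup>2"
      using n abs_square_le_1[of "VV h"] by (auto simp: abs_if not_le[symmetric])
    then show "VV h < - 1 \<longleftrightarrow> (UU h)\<^sup>2 * (1 - M * UU h) > 0" using e by simp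
  qed
  have neg: "hm < h" if "0 < h" "h < 2 * hm" "VV h < 0" for h
  proof (rule ccontr)
    assume "\<not> ?thesis"
    then have "h = hm \<or> VV h > 0" using VV_pos[OF in_dom(1)[OF that(1,2)]] by linarith
    then show False using that \<open>ZZ 0 = 0\<close> by (auto simp: VV_def)
  qed
  have Ueq: "UU h = 1 / M \<longleftrightarrow> h = h0" "UU h < 1 / M \<longleftrightarrow> h0 < h" if "hm < h" "h < 2 * hm" for h
    using UU_decreasing[of h h0] UU_decreasing[of h0 h] h0 h0' that
    by (metis less_imp_le linorder_neqE_linordered_idom order_less_asym order_less_irrefl)+
  have key1: "VV h = - 1 \<longleftrightarrow> h = h0" if h: "0 < h" "h < 2 * hm" for h
  proof
    assume v: "VV h = - 1"
    have "UU h > 0" by (rule UU_pos[OF h])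
    then have "UU h = 1 / M" using V1(1)[of h] v M_pos by (simp add: field_simps)
    then show "h = h0" using Ueq(1) neg[OF h] h v by simp
  next
    assume "h = h0"
    then show "VV h = - 1" using V1(1)[of h] VV_neg[OF in_dom(1)[OF h]] h0 h0' M_pos by simp
  qed
  have key2: "VV h < - 1 \<longleftrightarrow> h0 < h" if h: "0 < h" "h < 2 * hm" for h
  proof -
    have U: "UU h > 0" by (rule UU_pos[OF h])
    have e: "(UU h)\<^sup>2 * (1 - M * UU h) > 0 \<longleftrightarrow> UU h < 1 / M"
      using U M_pos by (simp add: zero_less_mult_iff field_simps)
    show ?thesis
    proof
      assume v: "VV h < - 1"
      then have "hm < h" using neg[OF h] by simp
      then show "h0 < h" using V1(2)[of h] v e Ueq(2)[of h] h by simp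
    next
      assume "h0 < h"
      then show "VV h < - 1" using V1(2)[of h] VV_neg[OF in_dom(1)[OF h]] e Ueq(2)[of h] h0' h by simp
    qed
  qed
  define s0 where "s0 = rho_of_tau (exp (- h0))"
  have h0p: "0 < h0" using h0' hm_pos by simp
  have s0: "0 < s0" "cyl s0 = h0" unfolding s0_def using rho_exp_pos[OF h0p] cyl_rho[OF h0p] by auto
  have ds0: "dom s0" using s0 h0' by (simp add: dom_def)
  have dom_iff: "adss_rho0 M < t \<longleftrightarrow> dom t" for t
    using adss_rho0_less[of t] adss_rho0_pos unfolding dom_def by fastforce
  have "adss_rho2' M = s0"
    unfolding adss_rho2'_def
  proof (rule the_equality)
    show "adss_rho0 M < s0 \<and> sphere_has_mean_curvature (adss_metric M) s0 (- 2)"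
      using ds0 key1[of h0] h0p h0' by (simp add: dom_iff sphere_mean_curvature s0)
    fix t assume t: "adss_rho0 M < t \<and> sphere_has_mean_curvature (adss_metric M) t (- 2)"
    then have dt: "dom t" by (simp add: dom_iff)
    then have "VV (cyl t) = - 1" using t by (simp add: sphere_mean_curvature)
    then have "cyl t = h0" using key1 dom_pos(4,5)[OF dt] by simp
    then show "t = s0" using rho_cyl[OF dom_pos(1)[OF dt]] by (simp add: s0_def)
  qed
  then show ?thesis
    using cyl_less_iff[OF dom_pos(1)[OF s] s0(1)] key2[OF dom_pos(4,5)[OF s]] s0(2) by simp
qed

end

section \<open>Rotationally symmetric metrics of scalar curvature -6 near infinity\<close>

definition ext_w :: "(real \<Rightarrow> real) \<Rightarrow> real \<Rightarrow> real" where
  "ext_w \<phi> s = 1 / (sinh s * (\<phi> s)\<^sup>2)"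

text \<open>For an arbitrary conformal factor, \<open>ext_w\<close> is the cylinder profile u and
  \<open>ext_v\<close> its derivative in h, both written in the coordinate rho; for the model metric
  they are \<open>UU\<close> and \<open>VV\<close>.\<close>

definition ext_v :: "(real \<Rightarrow> real) \<Rightarrow> (real \<Rightarrow> real) \<Rightarrow> real \<Rightarrow> real" where
  "ext_v \<phi> \<phi>1 s = cosh s / (sinh s * (\<phi> s)\<^sup>2) + 2 * \<phi>1 s / \<phi> s ^ 3"

text \<open>The conserved quantity of \<open>w'\<^sup>2 = 1 + w\<^sup>2 - M w\<^sup>3\<close>: the mass.\<close>

definition ext_mass :: "(real \<Rightarrow> real) \<Rightarrow> (real \<Rightarrow> real) \<Rightarrow> real \<Rightarrow> real" where
  "ext_mass \<phi> \<phi>1 s = (1 + (ext_w \<phi> s)\<^sup>2 - (ext_v \<phi> \<phi>1 s)\<^sup>2) / ext_w \<phi> s ^ 3"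

lemma ext_w_deriv:
  assumes s: "0 < s" and d1: "(\<phi> has_real_derivative \<phi>1 s) (at s)" and pos: "\<phi> s > 0"
  shows "(ext_w \<phi> has_real_derivative - ext_v \<phi> \<phi>1 s / sinh s) (at s)"
proof -
  have sp: "sinh s > 0" using s by simp
  have "(ext_w \<phi> has_real_derivative
     - (cosh s * (\<phi> s)\<^sup>2 + sinh s * (2 * \<phi> s * \<phi>1 s)) / (sinh s * (\<phi> s)\<^sup>2)\<^sup>2) (at s)"
    unfolding ext_w_def[abs_def] using sp pos
    by (auto intro!: derivative_eq_intros d1 simp: power2_eq_square algebra_simps)
  moreover have "- (cosh s * (\<phi> s)\<^sup>2 + sinh s * (2 * \<phi> s * \<phi>1 s)) / (sinh s * (\<phi> s)\<^sup>2)\<^sup>2 = - ext_v \<phi> \<phi>1 s / sinh s"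
    unfolding ext_v_def using sp pos by (simp add: field_simps eval_nat_numeral)
  ultimately show ?thesis by simp
qed

text \<open>The second order equation for the profile with the mass eliminated: from w'' = w - 3/2 M
  w^2 and M w^3 = 1 + w^2 - w'^2. In this form it can be verified before any constant of integration
  is known.\<close>

lemma ext_v_deriv:
  assumes s: "0 < s" and d1: "(\<phi> has_real_derivative \<phi>1 s) (at s)" and pos: "\<phi> s > 0"
    and d2: "(\<phi>1 has_real_derivative GG (\<phi> s) - 2 * (cosh s / sinh s) * \<phi>1 s) (at s)"
  shows "(ext_v \<phi> \<phi>1 has_real_derivative
    - ((3 * (ext_v \<phi> \<phi>1 s)\<^sup>2 - 3 - (ext_w \<phi> s)\<^sup>2) / (2 * ext_w \<phi> s)) / sinh s) (at s)"
proof -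
  define S where "S = sinh s"
  define c where "c = cosh s"
  define p where "p = \<phi> s"
  define q where "q = \<phi>1 s"
  have sp: "S > 0" "p > 0" using s pos by (auto simp: S_def p_def)
  have c2: "c * c = 1 + S * S" using cosh_square_eq[of s] by (simp add: c_def S_def power2_eq_square)
  have a: "((\<lambda>s. cosh s / (sinh s * (\<phi> s)\<^sup>2)) has_real_derivative
     (S * (S * p\<^sup>2) - c * (c * p\<^sup>2 + S * (2 * p * q))) / (S * p\<^sup>2)\<^sup>2) (at s)"
    using sp unfolding S_def c_def p_def q_def
    by (auto intro!: derivative_eq_intros d1 simp: power2_eq_square algebra_simps)
  have b: "((\<lambda>s. 2 * \<phi>1 s / \<phi> s ^ 3) has_real_derivative
     (2 * (GG p - 2 * (c / S) * q) * p ^ 3 - 2 * q * (3 * p\<^sup>2 * q)) / (p ^ 3)\<^sup>2) (at s)"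
    using sp unfolding S_def c_def p_def q_def
    by (auto intro!: derivative_eq_intros d1 d2 simp: power2_eq_square)
  have "(ext_v \<phi> \<phi>1 has_real_derivative (S * (S * p\<^sup>2) - c * (c * p\<^sup>2 + S * (2 * p * q))) / (S * p\<^sup>2)\<^sup>2
     + (2 * (GG p - 2 * (c / S) * q) * p ^ 3 - 2 * q * (3 * p\<^sup>2 * q)) / (p ^ 3)\<^sup>2) (at s)"
    unfolding ext_v_def[abs_def] by (rule DERIV_add[OF a b])
  moreover have "(S * (S * p\<^sup>2) - c * (c * p\<^sup>2 + S * (2 * p * q))) / (S * p\<^sup>2)\<^sup>2
     + (2 * (GG p - 2 * (c / S) * q) * p ^ 3 - 2 * q * (3 * p\<^sup>2 * q)) / (p ^ 3)\<^sup>2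
     = - 1 / (S * S * p\<^sup>2) - 6 * c * q / (S * p ^ 3) + 3/2 * (p ^ 4 - 1) / p\<^sup>2 - 6 * q\<^sup>2 / p ^ 4"
  proof -
    have e1: "(S * (S * p\<^sup>2) - c * (c * p\<^sup>2 + S * (2 * p * q))) / (S * p\<^sup>2)\<^sup>2
       = (S * S - c * c) / (S * S * p\<^sup>2) - 2 * c * q / (S * p ^ 3)"
      using sp by (simp add: field_simps eval_nat_numeral)
    have e2: "(2 * (GG p - 2 * (c / S) * q) * p ^ 3 - 2 * q * (3 * p\<^sup>2 * q)) / (p ^ 3)\<^sup>2
       = 3/2 * (p ^ 4 - 1) / p\<^sup>2 - 4 * c * q / (S * p ^ 3) - 6 * q\<^sup>2 / p ^ 4"
      unfolding GG_def using sp by (simp add: field_simps eval_nat_numeral)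
    have e3: "S * S - (1 + S * S) = - 1" by simp
    show ?thesis unfolding e1 e2 c2 e3 by simp
  qed
  moreover have "- ((3 * (ext_v \<phi> \<phi>1 s)\<^sup>2 - 3 - (ext_w \<phi> s)\<^sup>2) / (2 * ext_w \<phi> s)) / S
     = - 1 / (S * S * p\<^sup>2) - 6 * c * q / (S * p ^ 3) + 3/2 * (p ^ 4 - 1) / p\<^sup>2 - 6 * q\<^sup>2 / p ^ 4"
  proof -
    have v2: "(ext_v \<phi> \<phi>1 s)\<^sup>2 = (c * c) / (S * S * p ^ 4) + 4 * c * q / (S * p ^ 5) + 4 * q\<^sup>2 / p ^ 6"
      unfolding ext_v_def S_def[symmetric] c_def[symmetric] p_def[symmetric] q_def[symmetric] using sp
      by (simp add: field_simps eval_nat_numeral)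
    have w: "ext_w \<phi> s = 1 / (S * p\<^sup>2)" by (simp add: ext_w_def S_def p_def)
    have r: "- ((3 * v - 3 - (1 / (S * p\<^sup>2))\<^sup>2) / (2 * (1 / (S * p\<^sup>2)))) / S = 1 / (2 * (S * S * p\<^sup>2)) + 3 * p\<^sup>2 / 2 - 3 * p\<^sup>2 * v / 2" for v
      using sp by (simp add: field_simps eval_nat_numeral)
    show ?thesis unfolding w r v2 c2 using sp by (simp add: field_simps eval_nat_numeral)
  qed
  ultimately show ?thesis unfolding S_def by simp
qed

lemma (in adss) ext_phi:
  assumes s: "dom s"
  shows "ext_w (adss_phi M) s = UU (cyl s)" "ext_v (adss_phi M) PP1 s = VV (cyl s)"
    "ext_mass (adss_phi M) PP1 s = M"
proof -
  have sp: "sinh s > 0" "UU (cyl s) > 0" using dom_pos[OF s] by auto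
  have p2: "(adss_phi M s)\<^sup>2 = 1 / (sinh s * UU (cyl s))" using phi_sq[OF s] sp by (simp add: field_simps)
  show w: "ext_w (adss_phi M) s = UU (cyl s)" unfolding ext_w_def p2 using sp by simp
  have t: "2 * PP1 s / adss_phi M s ^ 3 = (VV (cyl s) / UU (cyl s) - cosh s) / sinh s / (adss_phi M s)\<^sup>2"
    unfolding PP1_def using phi_pos[OF s] by (simp add: power2_eq_square power3_eq_cube)
  show v: "ext_v (adss_phi M) PP1 s = VV (cyl s)"
    unfolding ext_v_def t unfolding p2 using sp by (simp add: field_simps)
  show "ext_mass (adss_phi M) PP1 s = M"
    unfolding ext_mass_def w v UU_energy using sp by (simp add: power3_eq_cube)
qed

lemma constant_of_deriv_0:
  fixes f :: "real \<Rightarrow> real"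
  assumes "\<And>x. x \<in> {l<..<u} \<Longrightarrow> (f has_real_derivative 0) (at x)" "x \<in> {l<..<u}" "y \<in> {l<..<u}"
  shows "f x = f y"
proof -
  have "\<exists>c. \<forall>x\<in>{l<..<u}. f x = c"
    by (rule has_field_derivative_zero_constant) (use assms(1) in \<open>auto intro: has_field_derivative_at_within\<close>)
  then show ?thesis using assms(2,3) by auto
qed

text \<open>Passing to h moves infinity to the finite point h = 0, where the profile and its slope
  have the limits 0 and 1. Once the mass is known to be positive, this is an initial value problem
  that the model solves too, and a Gronwall estimate identifies the two.\<close>

lemma exterior:
  fixes \<phi> \<phi>1 :: "real \<Rightarrow> real"
  assumes t: "0 < t0" "t0 < t"
    and d1: "\<And>s. t0 < s \<Longrightarrow> (\<phi> has_real_derivative \<phi>1 s) (at s)"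
    and d2: "\<And>s. t0 < s \<Longrightarrow> (\<phi>1 has_real_derivative GG (\<phi> s) - 2 * (cosh s / sinh s) * \<phi>1 s) (at s)"
    and gt: "\<And>s. t0 < s \<Longrightarrow> \<phi> s > 1"
  shows "\<exists>a. adss a \<and> adss.M a = ext_mass \<phi> \<phi>1 t \<and> adss.dom a t \<and>
     (\<forall>s\<ge>t. \<phi> s = adss_phi (adss.M a) s) \<and> adss.VV a (cyl t) = ext_v \<phi> \<phi>1 t"
proof -
  define H' where "H' = cyl t0"
  define r where "r h = rho_of_tau (exp (- h))" for h
  have r: "t0 < r h" "cyl (r h) = h" if "0 < h" "h < H'" for h
  proof -
    show c: "cyl (r h) = h" unfolding r_def by (rule cyl_rho[OF that(1)])
    have "0 < r h" unfolding r_def by (rule rho_exp_pos[OF that(1)])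
    then show "t0 < r h" using cyl_less_iff[of t0 "r h"] t that c by (simp add: H'_def)
  qed
  have r0: "0 < r h" if "0 < h" "h < H'" for h using r[OF that] t by simp
  have rd: "(r has_real_derivative - sinh (r h)) (at h)" if "0 < h" "h < H'" for h
  proof -
    have "sinh h = 1 / sinh (r h)" using sinh_cyl[OF r0[OF that]] r(2)[OF that] by simp
    then have e: "- 1 / sinh h = - sinh (r h)" by simp
    show ?thesis using rho_exp_deriv[OF that(1)] unfolding e unfolding r_def .
  qed
  define w where "w h = ext_w \<phi> (r h)" for h
  define v where "v h = ext_v \<phi> \<phi>1 (r h)" for h
  have wd: "(w has_real_derivative v h) (at h)" if h: "0 < h" "h < H'" for h
  proof -
    have "(w has_real_derivative - ext_v \<phi> \<phi>1 (r h) / sinh (r h) * - sinh (r h)) (at h)"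
      unfolding w_def
      by (rule DERIV_chain2[OF ext_w_deriv rd]) (use r0[OF h] d1[OF r(1)[OF h]] gt[OF r(1)[OF h]] h in auto)
    then show ?thesis using r0[OF h] by (simp add: v_def)
  qed
  have vd: "(v has_real_derivative (3 * (v h)\<^sup>2 - 3 - (w h)\<^sup>2) / (2 * w h)) (at h)" if h: "0 < h" "h < H'" for h
  proof -
    have "(v has_real_derivative
       - ((3 * (ext_v \<phi> \<phi>1 (r h))\<^sup>2 - 3 - (ext_w \<phi> (r h))\<^sup>2) / (2 * ext_w \<phi> (r h))) / sinh (r h) * - sinh (r h)) (at h)"
      unfolding v_def
      by (rule DERIV_chain2[OF ext_v_deriv rd])
         (use r0[OF h] d1[OF r(1)[OF h]] d2[OF r(1)[OF h]] gt[OF r(1)[OF h]] h in auto)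
    then show ?thesis using r0[OF h] by (simp add: v_def w_def)
  qed
  \<comment> \<open>The hypothesis \<open>\<phi> > 1\<close> in the new variables: the profile stays
    below that of hyperbolic space.\<close>
  have wpos: "0 < w h" "w h < sinh h" if h: "0 < h" "h < H'" for h
  proof -
    have g: "\<phi> (r h) > 1" by (rule gt[OF r(1)[OF h]])
    then have g2: "(\<phi> (r h))\<^sup>2 > 1" by simp
    have s: "sinh (r h) > 0" using r0[OF h] by simp
    then show "0 < w h" using g by (simp add: w_def ext_w_def)
    have "w h < 1 / sinh (r h)" unfolding w_def ext_w_def using s g2
      by (intro divide_strict_left_mono) (auto intro!: mult_pos_pos)
    then show "w h < sinh h" using sinh_cyl[OF r0[OF h]] r(2)[OF h] by simp
  qed
  define M where "M = ext_mass \<phi> \<phi>1 t"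
  define H where "H = cyl t"
  have H: "0 < H" "H < H'" using t cyl_pos[of t] cyl_less[of t0 t] by (auto simp: H_def H'_def)
  have rH: "r H = t" unfolding r_def H_def using rho_cyl[of t] t by simp
  have md: "((\<lambda>h. (1 + (w h)\<^sup>2 - (v h)\<^sup>2) / w h ^ 3) has_real_derivative 0) (at h)" if h: "0 < h" "h < H'" for h
  proof -
    define v' where "v' = (3 * (v h)\<^sup>2 - 3 - (w h)\<^sup>2) / (2 * w h)"
    have vd': "(v has_real_derivative v') (at h)" unfolding v'_def by (rule vd[OF h])
    have "((\<lambda>h. (1 + (w h)\<^sup>2 - (v h)\<^sup>2) / w h ^ 3) has_real_derivative
      ((2 * w h * v h - 2 * v h * v') * w h ^ 3 - (1 + (w h)\<^sup>2 - (v h)\<^sup>2) * (3 * (w h)\<^sup>2 * v h)) / (w h ^ 3 * w h ^ 3)) (at h)"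
      using wpos[OF h] by (auto intro!: derivative_eq_intros wd[OF h] vd')
    moreover have "(2 * w h * v h - 2 * v h * v') * w h ^ 3 - (1 + (w h)\<^sup>2 - (v h)\<^sup>2) * (3 * (w h)\<^sup>2 * v h) = 0"
    proof -
      have "2 * w h * v' = 3 * (v h)\<^sup>2 - 3 - (w h)\<^sup>2" unfolding v'_def using wpos[OF h] by simp
      then have "(w h)\<^sup>2 * v h * (2 * w h * v') = (w h)\<^sup>2 * v h * (3 * (v h)\<^sup>2 - 3 - (w h)\<^sup>2)" by simp
      then show ?thesis by (simp add: algebra_simps eval_nat_numeral)
    qed
    ultimately show ?thesis by simp
  qed
  have mass: "(1 + (w h)\<^sup>2 - (v h)\<^sup>2) / w h ^ 3 = M" if h: "0 < h" "h < H'" for h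
  proof -
    have "(1 + (w h)\<^sup>2 - (v h)\<^sup>2) / w h ^ 3 = (1 + (w H)\<^sup>2 - (v H)\<^sup>2) / w H ^ 3"
      by (rule constant_of_deriv_0[where l=0 and u=H']) (use md h H in auto)
    then show ?thesis by (simp add: M_def ext_mass_def w_def v_def rH)
  qed
  have v2: "(v h)\<^sup>2 = 1 + (w h)\<^sup>2 - M * w h ^ 3" if h: "0 < h" "h < H'" for h
    using mass[OF h] wpos[OF h] by (simp add: field_simps)
  have vd2: "(v has_real_derivative w h - 3/2 * M * (w h)\<^sup>2) (at h)" if h: "0 < h" "h < H'" for h
  proof -
    have "(3 * (v h)\<^sup>2 - 3 - (w h)\<^sup>2) / (2 * w h) = w h - 3/2 * M * (w h)\<^sup>2"
      unfolding v2[OF h] using wpos[OF h] by (simp add: field_simps eval_nat_numeral)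
    then show ?thesis using vd[OF h] by simp
  qed
  have H'pos: "0 < H'" using H by simp
  have ev: "\<forall>\<^sub>F h in at_right 0. 0 < h \<and> h < H'"
    unfolding eventually_at_right_field using H'pos by auto
  have w0: "(w \<longlongrightarrow> 0) (at_right 0)"
  proof (rule tendsto_sandwich[where f="\<lambda>_. 0" and h=sinh])
    show "\<forall>\<^sub>F h in at_right 0. 0 \<le> w h" "\<forall>\<^sub>F h in at_right 0. w h \<le> sinh h"
      using ev by (eventually_elim, use wpos in \<open>auto intro: less_imp_le\<close>)+
    show "(sinh \<longlongrightarrow> 0) (at_right (0::real))" by real_asymp
  qed simp
  have v20: "((\<lambda>h. (v h)\<^sup>2) \<longlongrightarrow> 1) (at_right 0)"
  proof (rule Lim_transform_eventually)
    show "((\<lambda>h. 1 + (w h)\<^sup>2 - M * w h ^ 3) \<longlongrightarrow> 1) (at_right 0)"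
      using tendsto_diff[OF tendsto_add[OF tendsto_const tendsto_power[OF w0, of 2]]
          tendsto_mult[OF tendsto_const tendsto_power[OF w0, of 3]], of 1 M] by simp
    show "\<forall>\<^sub>F h in at_right 0. 1 + (w h)\<^sup>2 - M * w h ^ 3 = (v h)\<^sup>2"
      using ev by eventually_elim (simp add: v2)
  qed
  have contv: "continuous_on {x..y} v" if "0 < x" "y < H'" for x y
    using that by (intro continuous_at_imp_continuous_on ballI DERIV_isCont[OF vd]) auto
  have contw: "continuous_on {x..y} w" if "0 < x" "y < H'" for x y
    using that by (intro continuous_at_imp_continuous_on ballI DERIV_isCont[OF wd]) auto
  have IVTv: "v x * v y > 0" if xy: "0 < x" "x \<le> y" "y < H'" "\<And>z. x \<le> z \<Longrightarrow> z \<le> y \<Longrightarrow> v z \<noteq> 0" for x y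
  proof (rule ccontr)
    assume "\<not> ?thesis"
    then have "v x \<le> 0 \<and> 0 \<le> v y \<or> v y \<le> 0 \<and> 0 \<le> v x" by (auto simp: not_less mult_le_0_iff)
    then show False
      using IVT'[of v x 0 y] IVT2'[of v y 0 x] contv[of x y] xy by blast
  qed
  obtain \<delta> where \<delta>: "0 < \<delta>" "\<delta> \<le> H'" "\<And>h. 0 < h \<Longrightarrow> h < \<delta> \<Longrightarrow> (v h)\<^sup>2 > 1/4"
  proof -
    have "\<forall>\<^sub>F h in at_right 0. (v h)\<^sup>2 > 1/4" by (rule order_tendstoD(1)[OF v20]) simp
    then obtain b where "b > 0" "\<And>h. 0 < h \<Longrightarrow> h < b \<Longrightarrow> (v h)\<^sup>2 > 1/4"
      unfolding eventually_at_right_field by auto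
    then show ?thesis using that[of "min b H'"] H'pos by simp
  qed
  \<comment> \<open>Only v^2 is known to tend to 1. A negative sign would make the positive function
    \<open>w\<close> decrease in h, which is incompatible with its limit 0 at h = 0.\<close>
  have vpos: "v h > 0" if h: "0 < h" "h < \<delta>" for h
  proof (rule ccontr)
    assume n: "\<not> v h > 0"
    have neg: "v z < 0" if z: "0 < z" "z \<le> h" for z
    proof -
      have nz: "v x \<noteq> 0" if "z \<le> x" "x \<le> h" for x using \<delta>(3)[of x] that z h by auto
      have "v z * v h > 0" using IVTv[OF z(1,2) _ nz] h \<delta> by simp
      then show ?thesis using n by (auto simp: zero_less_mult_iff)
    qed
    have "w h \<le> w x" if x: "0 < x" "x < h" for x
    proof (rule DERIV_nonpos_imp_nonincreasing[OF less_imp_le[OF x(2)]])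
      fix z assume "x \<le> z" "z \<le> h"
      then show "\<exists>y. (w has_real_derivative y) (at z) \<and> y \<le> 0"
        using wd[of z] neg[of z] x h \<delta> by (intro exI[of _ "v z"]) auto
    qed
    then have "\<forall>\<^sub>F x in at_right 0. w h \<le> w x"
      unfolding eventually_at_right_field using h by (intro exI[of _ h]) auto
    then have "w h \<le> 0" by (rule tendsto_lowerbound[OF w0]) simp
    then show False using wpos[of h] h \<delta> by simp
  qed
  have v1: "(v \<longlongrightarrow> 1) (at_right 0)"
  proof (rule Lim_transform_eventually)
    show "((\<lambda>h. sqrt ((v h)\<^sup>2)) \<longlongrightarrow> 1) (at_right 0)" using tendsto_real_sqrt[OF v20] by simp
    show "\<forall>\<^sub>F h in at_right 0. sqrt ((v h)\<^sup>2) = v h"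
      unfolding eventually_at_right_field using vpos \<delta> by (intro exI[of _ \<delta>]) (auto simp: less_imp_le)
  qed
  \<comment> \<open>If M were at most 0, then v^2 would be at least 1 + w^2, so \<open>v\<close>
    keeps its sign and arsinh w - h is nondecreasing. Starting from 0 it forces w to be at least
    sinh h, against \<open>wpos\<close>.\<close>
  have Mpos: "M > 0"
  proof (rule ccontr)
    assume "\<not> M > 0"
    then have v2g: "(v h)\<^sup>2 \<ge> 1 + (w h)\<^sup>2" if "0 < h" "h < H'" for h
      using v2[OF that] wpos[OF that] by (simp add: mult_le_0_iff)
    have vp: "v h > 0" if h: "0 < h" "h < H'" for h
    proof -
      define z where "z = min h (\<delta> / 2)"
      have z: "0 < z" "z \<le> h" "z < \<delta>" using h \<delta> by (auto simp: z_def)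
      have nz: "v x \<noteq> 0" if "z \<le> x" "x \<le> h" for x
      proof -
        have "0 < 1 + (w x)\<^sup>2" by (simp add: add_pos_nonneg)
        also have "\<dots> \<le> (v x)\<^sup>2" using v2g[of x] that z h by simp
        finally show ?thesis by auto
      qed
      have "v z * v h > 0" by (rule IVTv[OF z(1,2) h(2) nz])
      then show ?thesis using vpos[OF z(1,3)] by (simp add: zero_less_mult_iff)
    qed
    have inc: "arsinh (w x) - x \<le> arsinh (w y) - y" if xy: "0 < x" "x \<le> y" "y < H'" for x y
    proof (rule DERIV_nonneg_imp_nondecreasing[OF xy(2)])
      fix z assume "x \<le> z" "z \<le> y"
      then have z: "0 < z" "z < H'" using xy by auto
      have "sqrt ((w z)\<^sup>2 + 1) \<le> v z"
        by (rule real_le_lsqrt) (use v2g[OF z] vp[OF z] in \<open>auto simp: add.commute\<close>)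
      moreover have s: "sqrt ((w z)\<^sup>2 + 1) > 0" by (simp add: add_nonneg_pos)
      ultimately have "1 / sqrt ((w z)\<^sup>2 + 1) * v z - 1 \<ge> 0" by (simp add: field_simps)
      moreover have "((\<lambda>h. arsinh (w h) - h) has_real_derivative 1 / sqrt ((w z)\<^sup>2 + 1) * v z - 1) (at z)"
        by (intro DERIV_diff DERIV_ident DERIV_chain2[OF arsinh_real_has_field_derivative wd[OF z]])
      ultimately show "\<exists>D. ((\<lambda>h. arsinh (w h) - h) has_real_derivative D) (at z) \<and> 0 \<le> D" by blast
    qed
    have "((\<lambda>h. arsinh (w h) - h) \<longlongrightarrow> arsinh 0 - 0) (at_right 0)"
    proof (intro tendsto_diff isCont_tendsto_compose[OF _ w0])
      show "isCont arsinh (0::real)" by (rule DERIV_isCont[OF arsinh_real_has_field_derivative])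
      show "((\<lambda>h::real. h) \<longlongrightarrow> 0) (at_right 0)" by real_asymp
    qed
    then have l: "((\<lambda>h. arsinh (w h) - h) \<longlongrightarrow> 0) (at_right 0)" by simp
    have "0 \<le> arsinh (w H) - H"
      by (rule tendsto_upperbound[OF l])
         (use inc[of _ H] H in \<open>auto simp: eventually_at_right_field intro!: exI[of _ H]\<close>)
    then have "sinh H \<le> w H" by (metis diff_ge_0_iff_ge sinh_arsinh_real sinh_real_le_iff)
    then show False using wpos[OF H] by simp
  qed
  obtain a where a: "adss a" "adss.M a = M" using mass_radius_exists[OF Mpos] by blast
  interpret A: adss a by (rule a(1))
  note AM = a(2)
  define B where "B = min H' (2 * A.hm)"
  have B: "B > 0" using H'pos A.hm_pos by (simp add: B_def)
  have eq: "w h = A.UU h \<and> v h = A.VV h" if h: "0 < h" "h < B" for h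
  proof -
    \<comment> \<open>Gronwall constant: the squared distance \<open>y\<close> has derivative 2 d e
      (2 - 3/2 M (w + UU)), where w is below sinh H' and UU is at most 1 / a.\<close>
    define L where "L = 2 + 3/2 * M * (sinh H' + 1 / a)"
    define y where "y h = (w h - A.UU h)\<^sup>2 + (v h - A.VV h)\<^sup>2" for h
    have dec: "exp (- L * z) * y z \<le> exp (- L * x) * y x" if xz: "0 < x" "x \<le> z" "z < B" for x z
    proof (rule DERIV_nonpos_imp_nonincreasing[OF xz(2)])
      fix h assume "x \<le> h" "h \<le> z"
      then have h: "0 < h" "h < H'" "h < 2 * A.hm" using xz by (auto simp: B_def)
      have dm: "h \<in> {A.lo<..<A.hi}" using A.in_dom(1) h by auto
      define d where "d = w h - A.UU h"
      define e where "e = v h - A.VV h"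
      define c where "c = 2 - 3/2 * M * (w h + A.UU h)"
      have yd: "(y has_real_derivative 2 * d * e + 2 * e * ((w h - 3/2 * M * (w h)\<^sup>2) - (A.UU h - 3/2 * M * (A.UU h)\<^sup>2))) (at h)"
        unfolding y_def d_def e_def
        by (auto intro!: derivative_eq_intros wd[OF h(1,2)] vd2[OF h(1,2)] A.UU_deriv[OF dm] A.VV_deriv[OF dm, unfolded AM])
           (simp add: algebra_simps)
      have e1: "2 * d * e + 2 * e * ((w h - 3/2 * M * (w h)\<^sup>2) - (A.UU h - 3/2 * M * (A.UU h)\<^sup>2)) = 2 * (d * e) * c"
        unfolding d_def c_def by (simp add: field_simps power2_eq_square)
      have "0 \<le> w h + A.UU h" "w h + A.UU h \<le> sinh H' + 1 / a"
        using wpos[OF h(1,2)] A.UU_pos[OF h(1,3)] A.UU_le[of h] h(2) sinh_real_le_iff[of h H'] by linarith+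
      then have "0 \<le> M * (w h + A.UU h)" "M * (w h + A.UU h) \<le> M * (sinh H' + 1 / a)"
        using Mpos by (auto intro: mult_left_mono)
      then have "\<bar>c\<bar> \<le> L" unfolding c_def L_def by (simp add: abs_le_iff)
      moreover have "\<bar>2 * (d * e)\<bar> \<le> y h"
        using sum_squares_bound[of d e] sum_squares_bound[of d "- e"]
        by (simp add: y_def d_def[symmetric] e_def[symmetric] abs_le_iff)
      ultimately have "\<bar>2 * (d * e)\<bar> * \<bar>c\<bar> \<le> y h * L" by (intro mult_mono) auto
      then have le: "2 * (d * e) * c \<le> L * y h" unfolding abs_mult[symmetric] by (simp add: mult.commute)
      have "((\<lambda>z. exp (- L * z) * y z) has_real_derivative
          exp (- L * h) * - L * y h + exp (- L * h) * (2 * (d * e) * c)) (at h)"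
        using yd unfolding e1 by (auto intro!: derivative_eq_intros)
      moreover have "exp (- L * h) * - L * y h + exp (- L * h) * (2 * (d * e) * c) = exp (- L * h) * (2 * (d * e) * c - L * y h)"
        by (simp add: algebra_simps)
      moreover have "\<dots> \<le> 0" using le by (simp add: mult_le_0_iff)
      ultimately show "\<exists>D. ((\<lambda>z. exp (- L * z) * y z) has_real_derivative D) (at h) \<and> D \<le> 0" by auto
    qed
    have U0: "(A.UU \<longlongrightarrow> 0) (at_right 0)" "(A.VV \<longlongrightarrow> 1) (at_right 0)"
      using DERIV_isCont[OF A.UU_deriv[OF A.in_dom(2)]] DERIV_isCont[OF A.VV_deriv[OF A.in_dom(2)]]
      by (auto simp: isCont_def intro: tendsto_within_subset)
    have "((\<lambda>z. exp (- L * z) * y z) \<longlongrightarrow> exp (- L * 0) * ((0 - 0)\<^sup>2 + (1 - 1)\<^sup>2)) (at_right 0)"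
      unfolding y_def by (intro tendsto_intros w0 v1 U0)
    then have l: "((\<lambda>z. exp (- L * z) * y z) \<longlongrightarrow> 0) (at_right 0)" by simp
    have "exp (- L * h) * y h \<le> 0"
      by (rule tendsto_lowerbound[OF l])
         (use dec[of _ h] h in \<open>auto simp: eventually_at_right_field intro!: exI[of _ h]\<close>)
    then have "y h \<le> 0" by (simp add: mult_le_0_iff)
    then show ?thesis unfolding y_def
      by (metis add_nonneg_eq_0_iff antisym eq_iff_diff_eq_0 power2_eq_iff_nonneg sum_power2_le_zero_iff)
  qed
  \<comment> \<open>The model exists only up to h = 2 hm. If \<open>H\<close> lay beyond,
    \<open>w\<close> would agree with \<open>UU\<close> up to there and vanish in the limit, but it
    is positive.\<close>
  have HB: "H < B"
  proof (rule ccontr)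
    assume "\<not> H < B"
    then have h: "2 * A.hm \<le> H" "B = 2 * A.hm" using H by (auto simp: B_def)
    have "(w \<longlongrightarrow> w (2 * A.hm)) (at_left (2 * A.hm))"
      using DERIV_isCont[OF wd[of "2 * A.hm"]] h H A.hm_pos by (auto simp: isCont_def intro: tendsto_within_subset)
    moreover have "(A.UU \<longlongrightarrow> 0) (at_left (2 * A.hm))"
      using DERIV_isCont[OF A.UU_deriv[OF A.in_dom(4)]] by (auto simp: isCont_def intro: tendsto_within_subset)
    moreover have "\<forall>\<^sub>F h in at_left (2 * A.hm). A.UU h = w h"
      unfolding eventually_at_left_field using eq h B by (intro exI[of _ 0]) auto
    ultimately have "w (2 * A.hm) = 0"
      using tendsto_unique[OF trivial_limit_at_left_real _ Lim_transform_eventually] by blast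
    then show False using wpos[of "2 * A.hm"] h H A.hm_pos by simp
  qed
  have domt: "A.dom t" unfolding A.dom_def using t HB by (simp add: B_def H_def)
  have "\<phi> s = adss_phi M s" if s: "t \<le> s" for s
  proof -
    have s0: "0 < s" "t0 < s" using s t by auto
    have ds: "A.dom s" by (rule A.dom_mono[OF domt s])
    have c: "0 < cyl s" "cyl s \<le> H" "cyl s < B"
      using cyl_pos[OF s0(1)] cyl_less[of t s] s t HB by (auto simp: H_def le_less)
    have "w (cyl s) = ext_w \<phi> s" unfolding w_def r_def using rho_cyl[OF s0(1)] by simp
    then have U: "A.UU (cyl s) = 1 / (sinh s * (\<phi> s)\<^sup>2)" using eq[OF c(1,3)] by (simp add: ext_w_def)
    have "adss_phi M s = 1 / sqrt (sinh s * (1 / (sinh s * (\<phi> s)\<^sup>2)))"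
      using A.phi_eq[OF ds] unfolding AM U .
    also have "\<dots> = \<phi> s" using s0 gt[OF s0(2)] by (simp add: real_sqrt_divide)
    finally show ?thesis by simp
  qed
  moreover have "A.VV H = ext_v \<phi> \<phi>1 t" using eq[OF H(1) HB] by (simp add: v_def rH)
  ultimately show ?thesis using a domt by (intro exI[of _ a]) (simp add: M_def[symmetric] H_def[symmetric])
qed

section \<open>Completeness\<close>

lemma lnorm_deriv:
  assumes "x \<in> hyp_space"
  shows "((\<lambda>x. - ln (1 - x \<bullet> x)) has_derivative (\<lambda>v. 2 * (x \<bullet> v) / (1 - x \<bullet> x))) (at x)"
proof -
  have d: "((\<lambda>s. - ln (1 - s)) has_real_derivative 1 / (1 - x \<bullet> x)) (at (x \<bullet> x))"
    using assms by (auto simp: hyp_space_iff intro!: derivative_eq_intros)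
  from has_derivative_compose[OF has_derivative_dot d[unfolded has_field_derivative_def]]
  show ?thesis by (simp add: mult.commute)
qed

text \<open>A conformal metric dominating the hyperbolic one. Both - ln (1 - |x|^2), which is proper
  on the ball, and the linear functions with unit coefficient vector are then 1-Lipschitz. A Cauchy
  sequence therefore stays in a smaller closed ball and converges there in the Euclidean sense;
  straight segments in that ball bound the Riemannian distance to the limit.\<close>

locale conf_complete =
  fixes g :: "3 metric_field" and F :: "real^3 \<Rightarrow> real"
  assumes g: "\<And>x. x \<in> hyp_space \<Longrightarrow> g x = F x *\<^sub>R mat 1"
    and F_cont: "continuous_on hyp_space F"
    and F_ge: "\<And>x. x \<in> hyp_space \<Longrightarrow> 4 / (1 - x \<bullet> x)\<^sup>2 \<le> F x"
begin

lemma F_ge4: assumes "x \<in> hyp_space" shows "4 \<le> F x"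
proof -
  have "0 < 1 - x \<bullet> x" "1 - x \<bullet> x \<le> 1" using assms by (auto simp: hyp_space_iff)
  then have "(1 - x \<bullet> x)\<^sup>2 \<le> 1" "0 < (1 - x \<bullet> x)\<^sup>2" by (auto simp: power_le_one)
  then have "4 \<le> 4 / (1 - x \<bullet> x)\<^sup>2" by (simp add: field_simps)
  then show ?thesis using F_ge[OF assms] by simp
qed

lemma length_eq:
  assumes "\<gamma> ` {0..1} \<subseteq> hyp_space" "\<And>s. s \<in> {0..1} \<Longrightarrow> (\<gamma> has_vector_derivative D s) (at s)"
  shows "riem_length g \<gamma> = integral {0..1} (\<lambda>s. sqrt (F (\<gamma> s)) * norm (D s))"
  unfolding riem_length_def
proof (rule integral_cong)
  fix s :: real assume s: "s \<in> {0..1}"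
  then have "\<gamma> s \<in> hyp_space" using assms(1) by auto
  then have "vector_derivative \<gamma> (at s) \<bullet> (g (\<gamma> s) *v vector_derivative \<gamma> (at s)) = F (\<gamma> s) * (norm (D s))\<^sup>2"
    unfolding vector_derivative_at[OF assms(2)[OF s]] by (simp add: g mat_1_mult power2_norm_eq_inner)
  then show "sqrt (vector_derivative \<gamma> (at s) \<bullet> (g (\<gamma> s) *v vector_derivative \<gamma> (at s))) = sqrt (F (\<gamma> s)) * norm (D s)"
    by (simp add: real_sqrt_mult)
qed

text \<open>A function whose gradient has length at most 1 changes along a curve by no more than the
  length of the curve.\<close>

lemma length_lower:
  fixes f :: "real^3 \<Rightarrow> real"
  assumes C: "\<gamma> C1_differentiable_on {0..1}" and X: "\<gamma> ` {0..1} \<subseteq> hyp_space"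
    and f: "\<And>x. x \<in> hyp_space \<Longrightarrow> (f has_derivative f' x) (at x)"
    and le: "\<And>x v. x \<in> hyp_space \<Longrightarrow> \<bar>f' x v\<bar> \<le> sqrt (F x) * norm v"
  shows "\<bar>f (\<gamma> 1) - f (\<gamma> 0)\<bar> \<le> riem_length g \<gamma>"
proof -
  obtain D where D: "\<And>s. s \<in> {0..1} \<Longrightarrow> (\<gamma> has_vector_derivative D s) (at s)" and Dc: "continuous_on {0..1} D"
    using C unfolding C1_differentiable_on_def by blast
  have \<gamma>c: "continuous_on {0..1} \<gamma>"
    by (intro continuous_at_imp_continuous_on ballI has_vector_derivative_continuous[OF D])
  have int: "(\<lambda>s. sqrt (F (\<gamma> s)) * norm (D s)) integrable_on {0..1}"
    using X by (intro integrable_continuous_interval continuous_intros Dc continuous_on_compose2[OF F_cont \<gamma>c])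
  have ftc: "((\<lambda>s. f' (\<gamma> s) (D s)) has_integral f (\<gamma> 1) - f (\<gamma> 0)) {0..1}"
  proof (rule fundamental_theorem_of_calculus)
    fix s :: real assume s: "s \<in> {0..1}"
    then have x: "\<gamma> s \<in> hyp_space" using X by auto
    have "((\<lambda>s. f (\<gamma> s)) has_derivative (\<lambda>r. f' (\<gamma> s) (r *\<^sub>R D s))) (at s)"
      using has_derivative_compose[OF D[OF s, unfolded has_vector_derivative_def] f[OF x]] .
    moreover have "f' (\<gamma> s) (r *\<^sub>R D s) = r *\<^sub>R f' (\<gamma> s) (D s)" for r
      using has_derivative_linear[OF f[OF x]] by (rule linear_scale)
    ultimately show "((\<lambda>s. f (\<gamma> s)) has_vector_derivative f' (\<gamma> s) (D s)) (at s within {0..1})"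
      unfolding has_vector_derivative_def by (auto intro: has_derivative_at_withinI)
  qed simp
  have "norm (integral {0..1} (\<lambda>s. f' (\<gamma> s) (D s))) \<le> integral {0..1} (\<lambda>s. sqrt (F (\<gamma> s)) * norm (D s))"
    by (rule integral_norm_bound_integral[OF has_integral_integrable[OF ftc] int])
       (use le[OF subsetD[OF X imageI]] in auto)
  moreover have "riem_length g \<gamma> = integral {0..1} (\<lambda>s. sqrt (F (\<gamma> s)) * norm (D s))"
    by (rule length_eq[OF X]) (rule D)
  ultimately show ?thesis unfolding integral_unique[OF ftc] by simp
qed

lemma lnorm_lower:
  assumes "\<gamma> C1_differentiable_on {0..1}" "\<gamma> ` {0..1} \<subseteq> hyp_space"
  shows "\<bar>ln (1 - \<gamma> 0 \<bullet> \<gamma> 0) - ln (1 - \<gamma> 1 \<bullet> \<gamma> 1)\<bar> \<le> riem_length g \<gamma>"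
proof -
  have le: "\<bar>2 * (x \<bullet> v) / (1 - x \<bullet> x)\<bar> \<le> sqrt (F x) * norm v" if x: "x \<in> hyp_space" for x v
  proof -
    have p: "0 < 1 - x \<bullet> x" and n: "norm x \<le> 1" using x hyp_space_iff[of x] hyp_space_norm[of x] by auto
    have "\<bar>x \<bullet> v\<bar> \<le> 1 * norm v"
      using Cauchy_Schwarz_ineq2[of x v] n by (meson mult_right_mono norm_ge_zero order_trans)
    then have "2 * \<bar>x \<bullet> v\<bar> / (1 - x \<bullet> x) \<le> 2 * norm v / (1 - x \<bullet> x)" using p by (intro divide_right_mono) auto
    also have "\<dots> = sqrt (4 / (1 - x \<bullet> x)\<^sup>2) * norm v" using p by (simp add: real_sqrt_divide)
    also have "\<dots> \<le> sqrt (F x) * norm v" using F_ge[OF x] by (intro mult_right_mono) auto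
    finally show ?thesis using p by (simp add: abs_mult)
  qed
  show ?thesis using length_lower[OF assms lnorm_deriv le] by simp
qed

lemma norm_lower:
  assumes "\<gamma> C1_differentiable_on {0..1}" "\<gamma> ` {0..1} \<subseteq> hyp_space"
  shows "norm (\<gamma> 1 - \<gamma> 0) \<le> riem_length g \<gamma>"
proof (cases "\<gamma> 1 = \<gamma> 0")
  case False
  define u where "u = (\<gamma> 1 - \<gamma> 0) /\<^sub>R norm (\<gamma> 1 - \<gamma> 0)"
  have u: "norm u = 1" using False by (simp add: u_def)
  have d: "((\<lambda>x. u \<bullet> x) has_derivative (\<lambda>v. u \<bullet> v)) (at x)" for x by (auto intro!: derivative_eq_intros)
  have le: "\<bar>u \<bullet> v\<bar> \<le> sqrt (F x) * norm v" if x: "x \<in> hyp_space" for x v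
  proof -
    have "\<bar>u \<bullet> v\<bar> \<le> 1 * norm v" using Cauchy_Schwarz_ineq2[of u v] u by simp
    also have "\<dots> \<le> sqrt (F x) * norm v" using F_ge4[OF x] by (intro mult_right_mono) auto
    finally show ?thesis .
  qed
  have "u \<bullet> \<gamma> 1 - u \<bullet> \<gamma> 0 = norm (\<gamma> 1 - \<gamma> 0)"
    unfolding inner_diff_right[symmetric] u_def using False by (simp add: dot_square_norm power2_eq_square)
  then show ?thesis using length_lower[OF assms d le] by simp
next
  case True
  then show ?thesis using lnorm_lower[OF assms] by simp
qed

definition curves where
  "curves p q = {\<gamma>. \<gamma> C1_differentiable_on {0..1} \<and> \<gamma> ` {0..1} \<subseteq> hyp_space \<and> \<gamma> 0 = p \<and> \<gamma> 1 = q}"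

lemma dist_eq: "riem_dist hyp_space g p q = Inf (riem_length g ` curves p q)"
  unfolding riem_dist_def curves_def by (rule arg_cong[where f=Inf]) blast

lemma segment:
  assumes "p \<in> cball 0 R" "q \<in> cball 0 R" "R < 1"
  shows "(\<lambda>s. p + s *\<^sub>R (q - p)) \<in> curves p q"
    and "(\<And>x. x \<in> cball 0 R \<Longrightarrow> F x \<le> B) \<Longrightarrow> riem_length g (\<lambda>s. p + s *\<^sub>R (q - p)) \<le> sqrt B * norm (q - p)"
proof -
  let ?\<gamma> = "\<lambda>s. p + s *\<^sub>R (q - p)"
  have D: "(?\<gamma> has_vector_derivative (q - p)) (at s)" for s
    by (auto intro!: derivative_eq_intros simp: has_vector_derivative_def)
  have C: "?\<gamma> C1_differentiable_on {0..1}"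
    unfolding C1_differentiable_on_def by (rule exI[of _ "\<lambda>_. q - p"]) (use D in auto)
  have R: "?\<gamma> s \<in> cball 0 R" if "s \<in> {0..1}" for s
  proof -
    have "(1 - s) *\<^sub>R p + s *\<^sub>R q \<in> cball 0 R"
      by (rule convexD[OF convex_cball assms(1,2)]) (use that in auto)
    moreover have "(1 - s) *\<^sub>R p + s *\<^sub>R q = ?\<gamma> s" by (simp add: algebra_simps)
    ultimately show ?thesis by simp
  qed
  then have X: "?\<gamma> ` {0..1} \<subseteq> hyp_space" using assms(3) by (force simp: hyp_space_def)
  show "?\<gamma> \<in> curves p q" unfolding curves_def using C X by simp
  assume B: "\<And>x. x \<in> cball 0 R \<Longrightarrow> F x \<le> B"
  have int: "(\<lambda>s. sqrt (F (?\<gamma> s)) * norm (q - p)) integrable_on {0..1}"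
    using X by (intro integrable_continuous_interval continuous_intros continuous_on_compose2[OF F_cont]) auto
  have "riem_length g ?\<gamma> = integral {0..1} (\<lambda>s. sqrt (F (?\<gamma> s)) * norm (q - p))" by (rule length_eq[OF X D])
  also have "\<dots> \<le> integral {0..1} (\<lambda>s::real. sqrt B * norm (q - p))"
    by (rule integral_le[OF int]) (use B R in \<open>auto intro!: mult_right_mono\<close>)
  finally show "riem_length g ?\<gamma> \<le> sqrt B * norm (q - p)" by simp
qed

lemma curves_nonempty: assumes "p \<in> hyp_space" "q \<in> hyp_space" shows "curves p q \<noteq> {}"
  using segment(1)[of p "max (norm p) (norm q)" q] assms by (auto simp: hyp_space_norm)

lemma length_nonneg: "\<gamma> \<in> curves p q \<Longrightarrow> 0 \<le> riem_length g \<gamma>"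
  using norm_lower[of \<gamma>] norm_ge_zero unfolding curves_def by (blast intro: order_trans)

lemma dist_lower:
  assumes "p \<in> hyp_space" "q \<in> hyp_space"
  shows "norm (q - p) \<le> riem_dist hyp_space g p q"
    and "\<bar>ln (1 - p \<bullet> p) - ln (1 - q \<bullet> q)\<bar> \<le> riem_dist hyp_space g p q"
proof -
  have "norm (q - p) \<le> riem_length g \<gamma>" "\<bar>ln (1 - p \<bullet> p) - ln (1 - q \<bullet> q)\<bar> \<le> riem_length g \<gamma>"
    if "\<gamma> \<in> curves p q" for \<gamma>
    using norm_lower[of \<gamma>] lnorm_lower[of \<gamma>] that by (simp_all add: curves_def)
  then show "norm (q - p) \<le> riem_dist hyp_space g p q"
    "\<bar>ln (1 - p \<bullet> p) - ln (1 - q \<bullet> q)\<bar> \<le> riem_dist hyp_space g p q"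
    unfolding dist_eq using curves_nonempty[OF assms] by (auto intro!: cInf_greatest)
qed

lemma dist_upper: assumes "\<gamma> \<in> curves p q" shows "riem_dist hyp_space g p q \<le> riem_length g \<gamma>"
  unfolding dist_eq
  by (rule cInf_lower) (use assms length_nonneg in \<open>auto intro!: bdd_belowI[of _ 0]\<close>)

lemma complete: "riem_complete hyp_space g"
  unfolding riem_complete_def
proof (intro allI impI, elim conjE)
  fix p :: "nat \<Rightarrow> real^3"
  assume X: "range p \<subseteq> hyp_space"
    and C: "\<forall>e>0. \<exists>N. \<forall>m\<ge>N. \<forall>n\<ge>N. riem_dist hyp_space g (p m) (p n) < e"
  have pX: "p n \<in> hyp_space" for n using X by auto
  have "Cauchy p"
    unfolding Cauchy_def dist_norm
    using C dist_lower(1)[OF pX pX] by (metis norm_minus_commute order_le_less_trans)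
  then obtain q where q: "p \<longlonglongrightarrow> q" using Cauchy_convergent_iff convergent_def by blast
  obtain N where N: "\<And>n. n \<ge> N \<Longrightarrow> riem_dist hyp_space g (p N) (p n) < 1"
    using C[THEN spec, of 1] by auto
  \<comment> \<open>Distance below 1 from \<open>p N\<close> changes ln (1 - |x|^2) by less than 1,
    so 1 - |x|^2 stays above 1/e of its value at \<open>p N\<close>.\<close>
  define c where "c = exp (ln (1 - p N \<bullet> p N) - 1)"
  have c: "0 < c" by (simp add: c_def)
  have bd: "p n \<bullet> p n \<le> 1 - c" if "n \<ge> N" for n
  proof -
    have "ln (1 - p N \<bullet> p N) - 1 \<le> ln (1 - p n \<bullet> p n)"
      using N[OF that] dist_lower(2)[OF pX[of N] pX[of n]] by linarith
    then have "c \<le> exp (ln (1 - p n \<bullet> p n))" unfolding c_def by simp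
    then show ?thesis using pX[of n] by (simp add: hyp_space_iff)
  qed
  define R where "R = sqrt (1 - c)"
  have c1: "c \<le> 1" using bd[of N] inner_ge_zero[of "p N"] by linarith
  then have R: "R < 1" "0 \<le> R" using c by (auto simp: R_def)
  have pR: "p n \<in> cball 0 R" if "n \<ge> N" for n
    using bd[OF that] by (simp add: R_def norm_eq_sqrt_inner)
  have qR: "q \<in> cball 0 R"
    by (rule Lim_in_closed_set[OF closed_cball _ _ q]) (use pR in \<open>auto simp: eventually_sequentially\<close>)
  have "compact (F ` cball 0 R)"
    by (intro compact_continuous_image continuous_on_subset[OF F_cont]) (use R in \<open>auto simp: hyp_space_def\<close>)
  then obtain B where B: "\<And>x. x \<in> cball 0 R \<Longrightarrow> F x \<le> B"
    using compact_imp_bounded bounded_imp_bdd_above bdd_above_def by (metis image_eqI)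
  have qX: "q \<in> hyp_space" using qR R by (auto simp: hyp_space_norm)
  have "(\<lambda>n. riem_dist hyp_space g (p n) q) \<longlonglongrightarrow> 0"
  proof (rule tendsto_sandwich[where f="\<lambda>_. 0" and h="\<lambda>n. sqrt B * norm (q - p n)"])
    show "\<forall>\<^sub>F n in sequentially. 0 \<le> riem_dist hyp_space g (p n) q"
      using dist_lower(1)[OF pX qX] by (auto intro!: always_eventually intro: order_trans[OF norm_ge_zero])
    show "\<forall>\<^sub>F n in sequentially. riem_dist hyp_space g (p n) q \<le> sqrt B * norm (q - p n)"
      unfolding eventually_sequentially
      using segment[OF pR qR R(1)] B dist_upper by (meson order_trans)
    have "(\<lambda>n. sqrt B * norm (q - p n)) \<longlonglongrightarrow> sqrt B * norm (q - q)" by (intro tendsto_intros q)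
    then show "(\<lambda>n. sqrt B * norm (q - p n)) \<longlonglongrightarrow> 0" by simp
  qed simp
  then show "\<exists>q\<in>hyp_space. (\<lambda>n. riem_dist hyp_space g (p n) q) \<longlonglongrightarrow> 0" using qX by blast
qed

end

section \<open>Charts of the closed ball\<close>

text \<open>The inversion at the sphere of radius \<open>\<surd>2\<close> around the boundary point \<open>pole\<close>, composed with
  the reflection at \<open>pole\<^sup>\<bottom>\<close>, exchanges the ball and the half-space (Cayley transform). Together
  with its mirror image it gives an atlas of the closed ball by two conformal charts.\<close>

definition pole :: "real^3" where "pole = - axis 1 1"

definition cay :: "real^3 \<Rightarrow> real^3" where
  "cay x = pole + (2 / ((x - pole) \<bullet> (x - pole))) *\<^sub>R (x - pole)"

definition mirror :: "bool \<Rightarrow> real^3 \<Rightarrow> real^3" where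
  "mirror b x = (if b then x - (2 * x $ 1) *\<^sub>R axis 1 1 else x)"

lemma pole_dot [simp]: "pole \<bullet> pole = 1" "x \<bullet> pole = - x $ 1" "pole \<bullet> x = - x $ 1" "norm pole = 1" "pole $ 1 = - 1"
  by (simp_all add: pole_def inner_axis inner_axis')

lemma mirror_mirror [simp]: "mirror b (mirror b x) = x"
  by (simp add: mirror_def axis_def)

lemma mirror_linear: "bounded_linear (mirror b)"
proof -
  have "linear (mirror b)"
  proof (rule linearI)
    show "mirror b (x + y) = mirror b x + mirror b y" for x y
      by (cases b) (simp_all add: mirror_def vec_eq_iff algebra_simps)
    show "mirror b (c *\<^sub>R x) = c *\<^sub>R mirror b x" for c x
      by (cases b) (simp_all add: mirror_def vec_eq_iff algebra_simps)
  qed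
  then show ?thesis by (simp add: linear_conv_bounded_linear)
qed

lemma mirror_inner: "mirror b x \<bullet> mirror b y = x \<bullet> y"
  by (simp add: mirror_def inner_diff_left inner_diff_right inner_axis inner_axis' algebra_simps)

lemma mirror_inner': "mirror b x \<bullet> y = x \<bullet> mirror b y"
  by (simp add: mirror_def inner_diff_left inner_diff_right inner_axis inner_axis' algebra_simps)

lemma norm_mirror [simp]: "norm (mirror b x) = norm x"
  by (simp add: norm_eq_sqrt_inner mirror_inner)

text \<open>An inversion is an involution, so \<open>cay\<close> serves as chart and as
  parametrization.\<close>

lemma cay_cay: assumes "x \<noteq> pole" shows "cay (cay x) = x"
proof -
  define r where "r = (x - pole) \<bullet> (x - pole)"
  have r: "r > 0" using assms by (simp add: r_def)
  have "cay x - pole = (2 / r) *\<^sub>R (x - pole)" by (simp add: cay_def r_def)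
  moreover from this have "(cay x - pole) \<bullet> (cay x - pole) = 4 / r"
    using r by (simp add: r_def[symmetric] power2_eq_square)
  ultimately show ?thesis unfolding cay_def[of "cay x"] using r by simp
qed

lemma cay_neq: assumes "x \<noteq> pole" shows "cay x \<noteq> pole"
  using assms by (simp add: cay_def)

text \<open>The height in the half-space is 1 - |x|^2 up to a positive factor, so inside, boundary
  and outside of the ball correspond to the sign of the first coordinate.\<close>

lemma cay_1: assumes "x \<noteq> pole" shows "cay x $ 1 = (1 - x \<bullet> x) / ((x - pole) \<bullet> (x - pole))"
proof -
  have r: "(x - pole) \<bullet> (x - pole) \<noteq> 0" using assms by simp
  have "(x - pole) \<bullet> (x - pole) = x \<bullet> x + 2 * x $ 1 + 1" by (simp add: inner_diff_left inner_diff_right)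
  then show ?thesis using r by (simp add: cay_def field_simps)
qed

lemma cay_dot: assumes "y \<noteq> pole" shows "1 - cay y \<bullet> cay y = y $ 1 * (4 / ((y - pole) \<bullet> (y - pole)))"
proof -
  define r where "r = (y - pole) \<bullet> (y - pole)"
  have r: "r > 0" using assms by (simp add: r_def)
  have rr: "r = y \<bullet> y + 2 * y $ 1 + 1" by (simp add: r_def inner_diff_left inner_diff_right)
  define d where "d = y - pole"
  have d: "d $ 1 = y $ 1 + 1" "d \<bullet> d = r" by (simp_all add: d_def r_def)
  have "cay y = pole + (2 / r) *\<^sub>R d" by (simp add: cay_def d_def r_def)
  then have "cay y \<bullet> cay y = 1 - 2 * ((2 / r) * d $ 1) + (2 / r) * ((2 / r) * (d \<bullet> d))"
    by (simp add: inner_add_left inner_add_right diff_divide_distrib)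
  then show ?thesis unfolding d r_def[symmetric] using r by (simp add: field_simps)
qed

lemma half_space_neq_pole: "y \<in> half_space \<Longrightarrow> y \<noteq> pole"
  by (auto simp: half_space_def)

lemma Ck_cay: "Ck_on k (- {pole}) cay"
  unfolding cay_def[abs_def]
  by (intro Ck_on_add Ck_on_scaleR Ck_on_divide Ck_on_inner Ck_on_diff Ck_on_const Ck_on_ident) auto

lemma cay_deriv:
  assumes "y \<noteq> pole"
  shows "(cay has_derivative (\<lambda>v. (2 / ((y - pole) \<bullet> (y - pole))) *\<^sub>R
     (v - (2 * ((y - pole) \<bullet> v) / ((y - pole) \<bullet> (y - pole))) *\<^sub>R (y - pole)))) (at y)"
proof -
  define n where "n = y - pole"
  have n: "n \<bullet> n \<noteq> 0" using assms by (simp add: n_def)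
  have i: "((\<lambda>x. (x - pole) \<bullet> (x - pole)) has_derivative (\<lambda>v. 2 * (n \<bullet> v))) (at y)"
    by (auto intro!: derivative_eq_intros simp: n_def inner_commute)
  have d: "((\<lambda>s. 2 / s) has_real_derivative - 2 / (n \<bullet> n)\<^sup>2) (at ((y - pole) \<bullet> (y - pole)))"
    using n unfolding n_def by (auto intro!: derivative_eq_intros simp: power2_eq_square)
  have e: "((\<lambda>x. 2 / ((x - pole) \<bullet> (x - pole))) has_derivative (\<lambda>v. - 2 / (n \<bullet> n)\<^sup>2 * (2 * (n \<bullet> v)))) (at y)"
    using has_derivative_compose[OF i d[unfolded has_field_derivative_def]] .
  have "(cay has_derivative (\<lambda>v. 0 + ((2 / (n \<bullet> n)) *\<^sub>R (v - 0) + (- 2 / (n \<bullet> n)\<^sup>2 * (2 * (n \<bullet> v))) *\<^sub>R n))) (at y)"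
    unfolding cay_def[abs_def] n_def
    by (intro has_derivative_add has_derivative_const has_derivative_scaleR e[unfolded n_def]
        has_derivative_diff has_derivative_ident)
  moreover have "0 + ((2 / (n \<bullet> n)) *\<^sub>R (v - 0) + (- 2 / (n \<bullet> n)\<^sup>2 * (2 * (n \<bullet> v))) *\<^sub>R n)
     = (2 / (n \<bullet> n)) *\<^sub>R (v - (2 * (n \<bullet> v) / (n \<bullet> n)) *\<^sub>R n)" for v
    using n by (simp add: scaleR_right_diff_distrib power2_eq_square)
  ultimately show ?thesis unfolding n_def by simp
qed

definition chart :: "bool \<Rightarrow> real^3 \<Rightarrow> real^3" where "chart b x = cay (mirror b x)"
definition param :: "bool \<Rightarrow> real^3 \<Rightarrow> real^3" where "param b y = mirror b (cay y)"
definition chart_dom :: "bool \<Rightarrow> (real^3) set" where "chart_dom b = cball 0 1 - {mirror b pole}"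
definition ball_atlas :: "((real^3) set \<times> (real^3 \<Rightarrow> real^3)) set" where
  "ball_atlas = (\<lambda>b. (chart_dom b, chart b)) ` UNIV"

lemma mirror_eq_iff: "mirror b x = y \<longleftrightarrow> x = mirror b y" by (metis mirror_mirror)

lemma param_chart: "x \<in> chart_dom b \<Longrightarrow> param b (chart b x) = x"
  unfolding param_def chart_def chart_dom_def by (subst cay_cay) (auto simp: mirror_eq_iff)

lemma chart_half_space: assumes "x \<in> chart_dom b" shows "chart b x \<in> half_space"
proof -
  have "mirror b x \<noteq> pole" using assms by (auto simp: chart_dom_def mirror_eq_iff)
  moreover have "mirror b x \<bullet> mirror b x \<le> 1" using assms
    by (simp add: chart_dom_def mirror_inner norm_eq_sqrt_inner)
  ultimately show ?thesis unfolding half_space_def chart_def by (simp add: cay_1)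
qed

lemma chart_1: assumes "x \<in> chart_dom b" shows "chart b x $ 1 = 0 \<longleftrightarrow> norm x = 1"
proof -
  have "mirror b x \<noteq> pole" using assms by (auto simp: chart_dom_def mirror_eq_iff)
  then show ?thesis unfolding chart_def by (simp add: cay_1 mirror_inner norm_eq_sqrt_inner)
qed

lemma chart_param: "y \<noteq> pole \<Longrightarrow> chart b (param b y) = y"
  unfolding param_def chart_def by (simp add: cay_cay)

lemma param_neq: "y \<noteq> pole \<Longrightarrow> param b y \<noteq> mirror b pole"
  unfolding param_def using cay_neq mirror_eq_iff by metis

lemma param_dot: assumes "y \<noteq> pole" shows "1 - param b y \<bullet> param b y = y $ 1 * (4 / ((y - pole) \<bullet> (y - pole)))"
  unfolding param_def mirror_inner by (rule cay_dot[OF assms])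

lemma param_norm_less: assumes "y \<noteq> pole" shows "norm (param b y) < 1 \<longleftrightarrow> 0 < y $ 1" "norm (param b y) \<le> 1 \<longleftrightarrow> 0 \<le> y $ 1"
proof -
  define c where "c = 4 / ((y - pole) \<bullet> (y - pole))"
  have c: "c > 0" using assms by (simp add: c_def)
  have e: "param b y \<bullet> param b y = 1 - y $ 1 * c" using param_dot[OF assms, of b] by (simp add: c_def)
  have "norm (param b y) < 1 \<longleftrightarrow> 0 < y $ 1 * c" "norm (param b y) \<le> 1 \<longleftrightarrow> 0 \<le> y $ 1 * c"
    unfolding norm_eq_sqrt_inner e by simp_all
  then show "norm (param b y) < 1 \<longleftrightarrow> 0 < y $ 1" "norm (param b y) \<le> 1 \<longleftrightarrow> 0 \<le> y $ 1"
    using c by (simp_all add: zero_less_mult_iff zero_le_mult_iff)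
qed

lemma param_dom: "y \<in> half_space \<Longrightarrow> param b y \<in> chart_dom b"
  using param_norm_less(2)[OF half_space_neq_pole, of y b] param_neq[OF half_space_neq_pole, of y b]
  by (auto simp: chart_dom_def half_space_def)

lemma chart_image: "chart b ` chart_dom b = half_space"
proof
  show "chart b ` chart_dom b \<subseteq> half_space" using chart_half_space by auto
  show "half_space \<subseteq> chart b ` chart_dom b"
    using param_dom chart_param half_space_neq_pole by (metis image_eqI subsetI)
qed

lemma chart_inj: "inj_on (chart b) (chart_dom b)"
  by (rule inj_on_inverseI[where g="param b"]) (rule param_chart)

lemma inv_chart: "y \<in> half_space \<Longrightarrow> inv_into (chart_dom b) (chart b) y = param b y"
  by (rule inv_into_f_eq[OF chart_inj param_dom chart_param[OF half_space_neq_pole]])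

lemma Ck_mirror: "open S \<Longrightarrow> Ck_on k S f \<Longrightarrow> Ck_on k S (\<lambda>x. mirror b (f x))"
  by (rule Ck_on_bounded_linear[OF mirror_linear])

lemma Ck_param: "Ck_on k (- {pole}) (param b)"
  unfolding param_def[abs_def] by (rule Ck_mirror[OF _ Ck_cay]) auto

lemma Ck_chart: "Ck_on k (- {mirror b pole}) (chart b)"
  unfolding chart_def[abs_def]
proof (rule Ck_on_compose[OF _ _ _ Ck_cay])
  show "mirror b ` (- {mirror b pole}) \<subseteq> - {pole}" by auto (metis mirror_mirror)
qed (auto intro!: Ck_mirror Ck_on_ident)

text \<open>Inversions are conformal: the derivative is a reflection, here \<open>L\<close>, scaled
  by 2 / |y - pole|^2. The sum over the images of the axes is the same statement for the transposed
  map; it computes the length of a differential in the chart.\<close>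

lemma param_deriv:
  assumes "y \<noteq> pole"
  obtains D where "(param b has_derivative D) (at y)"
    "\<And>v v'. D v \<bullet> D v' = (2 / ((y - pole) \<bullet> (y - pole)))\<^sup>2 * (v \<bullet> v')"
    "\<And>z. norm z = 1 \<Longrightarrow> (\<Sum>i\<in>UNIV. (z \<bullet> D (axis i 1))\<^sup>2) = (2 / ((y - pole) \<bullet> (y - pole)))\<^sup>2"
proof -
  define n where "n = y - pole"
  define m where "m = n \<bullet> n"
  have m: "m > 0" using assms by (simp add: m_def n_def)
  define L where "L v = v - (2 * (n \<bullet> v) / m) *\<^sub>R n" for v
  define D where "D v = mirror b ((2 / m) *\<^sub>R L v)" for v
  have "(param b has_derivative D) (at y)"
    unfolding param_def[abs_def] D_def[abs_def] L_def n_def m_def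
    by (rule bounded_linear.has_derivative[OF mirror_linear cay_deriv[OF assms]])
  moreover have LL: "L v \<bullet> L v' = v \<bullet> v'" for v v'
    unfolding L_def using m by (simp add: inner_diff_left inner_diff_right m_def[symmetric] inner_commute)
  then have "D v \<bullet> D v' = (2 / m)\<^sup>2 * (v \<bullet> v')" for v v'
    unfolding D_def mirror_inner by (simp add: power2_eq_square)
  moreover have "(\<Sum>i\<in>UNIV. (z \<bullet> D (axis i 1))\<^sup>2) = (2 / m)\<^sup>2" if z: "norm z = 1" for z
  proof -
    have Ls: "u \<bullet> L v = L u \<bullet> v" for u v
      unfolding L_def by (simp add: inner_diff_left inner_diff_right inner_commute)
    have "z \<bullet> D (axis i 1) = 2 / m * (L (mirror b z)) $ i" for i
      unfolding D_def mirror_inner'[symmetric] by (simp add: Ls inner_axis)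
    then have "(\<Sum>i\<in>UNIV. (z \<bullet> D (axis i 1))\<^sup>2) = (2 / m)\<^sup>2 * (L (mirror b z) \<bullet> L (mirror b z))"
      by (simp add: inner_vec_def power_mult_distrib sum_distrib_left power2_eq_square mult_ac)
    also have "L (mirror b z) \<bullet> L (mirror b z) = 1" unfolding LL mirror_inner using z by (simp add: dot_square_norm)
    finally show ?thesis by simp
  qed
  ultimately show ?thesis using that unfolding m_def n_def by blast
qed

section \<open>The closed ball as a compact manifold with boundary\<close>

abbreviation ball_top :: "(real^3) topology" where "ball_top \<equiv> top_of_set (cball 0 1)"

lemma atlas_iff: "(\<forall>(U, c)\<in>ball_atlas. P U c) \<longleftrightarrow> (\<forall>b. P (chart_dom b) (chart b))"
  by (auto simp: ball_atlas_def)

lemma chart_dom_cball: "chart_dom b \<subseteq> cball 0 1" by (auto simp: chart_dom_def)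

lemma mirror_pole_norm: "norm (mirror b pole) = 1" by simp

lemma chart_dom_Un: "chart_dom True \<union> chart_dom False = cball 0 1"
proof -
  have "mirror True pole $ 1 = 1" "mirror False pole $ 1 = - 1" by (auto simp: mirror_def axis_def)
  then have "mirror True pole \<noteq> mirror False pole" by auto
  then show ?thesis by (auto simp: chart_dom_def)
qed

lemma manifold_boundary_ball: "manifold_boundary ball_atlas = sphere 0 1"
proof -
  have "manifold_boundary ball_atlas = {p. \<exists>b. p \<in> chart_dom b \<and> chart b p $ 1 = 0}"
    unfolding manifold_boundary_def ball_atlas_def by auto
  also have "\<dots> = {p. \<exists>b. p \<in> chart_dom b \<and> norm p = 1}" using chart_1 by auto
  also have "\<dots> = sphere 0 1" using chart_dom_Un by (auto simp: set_eq_iff)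
  finally show ?thesis .
qed

lemma chart_cont: "continuous_on (chart_dom b) (chart b)"
  by (rule continuous_on_subset[OF Ck_on_imp_continuous_on[OF Ck_chart[of 0]]]) (auto simp: chart_dom_def)

lemma param_cont: "continuous_on half_space (param b)"
  by (rule continuous_on_subset[OF Ck_on_imp_continuous_on[OF Ck_param[of 0]]]) (use half_space_neq_pole in auto)

lemma homeomorphic_map_top_of_set:
  assumes "continuous_on S f" "continuous_on T g" "f ` S = T" "\<And>x. x \<in> S \<Longrightarrow> g (f x) = x"
  shows "homeomorphic_map (top_of_set S) (top_of_set T) f"
proof -
  have "homeomorphic_maps (top_of_set S) (top_of_set T) f g"
    unfolding homeomorphic_maps_def using assms by auto
  then show ?thesis using homeomorphic_map_maps by blast
qed

lemma smooth_ball_atlas: "smooth_boundary_atlas ball_top ball_atlas"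
  unfolding smooth_boundary_atlas_def
proof (intro conjI)
  show "(\<Union>(U, c)\<in>ball_atlas. U) = topspace ball_top"
    using chart_dom_Un by (auto simp: ball_atlas_def UNIV_bool)
  show "\<forall>(U, c)\<in>ball_atlas. openin ball_top U \<and> openin (top_of_set half_space) (c ` U) \<and>
        homeomorphic_map (subtopology ball_top U) (top_of_set (c ` U)) c"
    unfolding atlas_iff
  proof (intro allI conjI)
    fix b
    show "openin ball_top (chart_dom b)"
      unfolding openin_open by (rule exI[of _ "- {mirror b pole}"]) (auto simp: chart_dom_def)
    show "openin (top_of_set half_space) (chart b ` chart_dom b)" by (simp add: chart_image)
    have "subtopology ball_top (chart_dom b) = top_of_set (chart_dom b)"
      using chart_dom_cball[of b] by (simp add: subtopology_subtopology inf.absorb2)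
    then show "homeomorphic_map (subtopology ball_top (chart_dom b)) (top_of_set (chart b ` chart_dom b)) (chart b)"
      using homeomorphic_map_top_of_set[OF chart_cont param_cont chart_image param_chart]
      by (simp add: chart_image)
  qed
  show "\<forall>(U, c)\<in>ball_atlas. \<forall>(V, d)\<in>ball_atlas. smooth_on (c ` (U \<inter> V)) (d \<circ> inv_into U c)"
    unfolding atlas_iff
  proof (intro allI)
    fix b b'
    show "smooth_on (chart b ` (chart_dom b \<inter> chart_dom b')) (chart b' \<circ> inv_into (chart_dom b) (chart b))"
    proof (rule smooth_onI)
      \<comment> \<open>Chart and parametrization are smooth off one point each, so the transition
        map extends smoothly to an open set around its relatively open domain.\<close>
      let ?W = "- {pole} \<inter> param b -` (- {mirror b' pole})"
      show W: "open ?W"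
        by (rule continuous_open_preimage[OF Ck_on_imp_continuous_on[OF Ck_param[of 0]]]) auto
      show "chart b ` (chart_dom b \<inter> chart_dom b') \<subseteq> ?W"
        using chart_half_space half_space_neq_pole param_chart by (fastforce simp: chart_dom_def)
      show "Ck_on k ?W (\<lambda>y. chart b' (param b y))" for k
        by (rule Ck_on_compose[OF W _ _ Ck_chart Ck_on_subset[OF Ck_param]]) auto
      show "chart b' (param b y) = (chart b' \<circ> inv_into (chart_dom b) (chart b)) y"
        if "y \<in> chart b ` (chart_dom b \<inter> chart_dom b')" for y
        using that chart_half_space inv_chart by auto
    qed
  qed
qed

lemma smooth_compactification_ball: "smooth_compactification hyp_space ball_top ball_atlas"
  unfolding smooth_compactification_def
proof (intro conjI)
  show "compact_space ball_top" by (simp add: compact_space_subtopology)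
  show "Hausdorff_space ball_top" by (simp add: Hausdorff_space_subtopology)
  show "topspace ball_top - manifold_boundary ball_atlas = hyp_space"
    unfolding manifold_boundary_ball by (auto simp: hyp_space_def)
  show "\<forall>(U, c)\<in>ball_atlas. open (U \<inter> hyp_space) \<and> smooth_on (U \<inter> hyp_space) c \<and>
        smooth_on (c ` (U \<inter> hyp_space)) (inv_into U c)"
    unfolding atlas_iff
  proof (intro allI conjI)
    fix b
    have U: "chart_dom b \<inter> hyp_space = hyp_space"
      using mirror_pole_norm[of b] by (auto simp: chart_dom_def hyp_space_def)
    show "open (chart_dom b \<inter> hyp_space)" unfolding U by (rule open_hyp_space)
    show "smooth_on (chart_dom b \<inter> hyp_space) (chart b)" unfolding U
      by (rule smooth_onI[OF _ _ Ck_chart]) (use mirror_pole_norm[of b] in \<open>auto simp: hyp_space_def\<close>)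
    show "smooth_on (chart b ` (chart_dom b \<inter> hyp_space)) (inv_into (chart_dom b) (chart b))"
    proof (rule smooth_onI[OF _ _ Ck_param])
      show "chart b ` (chart_dom b \<inter> hyp_space) \<subseteq> - {pole}"
        using half_space_neq_pole[OF chart_half_space] by (metis ComplI IntE imageE singletonD subsetI)
      show "param b y = inv_into (chart_dom b) (chart b) y" if "y \<in> chart b ` (chart_dom b \<inter> hyp_space)" for y
        using inv_chart[OF chart_half_space] that by auto
    qed auto
  qed
qed (rule smooth_ball_atlas)

text \<open>The first part serves the collar map, which scales radial and tangential directions
  differently; the second serves the charts, which are conformal.\<close>

lemma pullback_conf:
  fixes g :: "3 metric_field"
  assumes "(\<Phi> has_derivative D) (at y)" "g (\<Phi> y) = c *\<^sub>R mat 1"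
  shows "v \<bullet> (pullback \<Phi> g y *v v') = c * (D v \<bullet> D v')"
    and "(\<And>v v'. D v \<bullet> D v' = m * (v \<bullet> v')) \<Longrightarrow> pullback \<Phi> g y = (c * m) *\<^sub>R mat 1"
proof -
  have D: "frechet_derivative \<Phi> (at y) = D" using frechet_derivative_at[OF assms(1)] by simp
  have l: "linear D" using assms(1) by (rule has_derivative_linear)
  have mw: "matrix D *v x = D x" for x using matrix_vector_mul(2)[OF l] by metis
  have *: "v \<bullet> (pullback \<Phi> g y *v v') = c * (D v \<bullet> D v')" for v v'
  proof -
    have "pullback \<Phi> g y *v v' = c *\<^sub>R (transpose (matrix D) *v D v')"
      unfolding pullback_def Let_def D assms(2)
      by (simp add: matrix_vector_mul_assoc[symmetric] mat_1_mult matrix_vector_mult_scaleR mw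
          scaleR_matrix_vector_assoc[symmetric] matrix_scalar_ac scalar_matrix_assoc[symmetric]
          del: transpose_matrix_vector)
    then have "v \<bullet> (pullback \<Phi> g y *v v') = c * ((D v' v* matrix D) \<bullet> v)" by (simp add: inner_commute)
    also have "(D v' v* matrix D) \<bullet> v = D v' \<bullet> (matrix D *v v)" by (rule dot_lmul_matrix)
    finally show ?thesis by (simp add: mw inner_commute)
  qed
  then show "v \<bullet> (pullback \<Phi> g y *v v') = c * (D v \<bullet> D v')" .
  assume m: "\<And>v v'. D v \<bullet> D v' = m * (v \<bullet> v')"
  have "pullback \<Phi> g y *v v' = ((c * m) *\<^sub>R mat 1) *v v'" for v'
    by (rule vector_eq_rdot[THEN iffD1]) (auto simp: mat_1_mult * m inner_commute[of _ v'] inner_commute[of "_ *v _"])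
  then show "pullback \<Phi> g y = (c * m) *\<^sub>R mat 1" by (simp add: matrix_eq)
qed

section \<open>The geodesic defining function\<close>

lemma Ck_on_power_series:
  fixes c :: "nat \<Rightarrow> real"
  assumes "\<And>x. \<bar>x\<bar> < R \<Longrightarrow> summable (\<lambda>n. c n * x ^ n)"
  shows "Ck_on k {-R<..<R} (\<lambda>x. \<Sum>n. c n * x ^ n)"
  using assms
proof (induction k arbitrary: c)
  case 0
  have "isCont (\<lambda>x. \<Sum>n. c n * x ^ n) x" if "\<bar>x\<bar> < R" for x
    using DERIV_isCont[OF termdiffs_strong'[of R c x]] 0 that by simp
  then show ?case by (auto intro!: continuous_at_imp_continuous_on)
next
  case (Suc k)
  have "Ck_on k {-R<..<R} (\<lambda>x. \<Sum>n. diffs c n * x ^ n)"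
    by (rule Suc.IH) (use termdiff_converges[of _ R c] Suc.prems in auto)
  moreover have "((\<lambda>x. \<Sum>n. c n * x ^ n) has_real_derivative (\<Sum>n. diffs c n * x ^ n)) (at x)"
    if "x \<in> {-R<..<R}" for x
    by (rule termdiffs_strong'[of R]) (use Suc.prems that in auto)
  ultimately show ?case by (intro Ck_on_Suc_real) auto
qed

text \<open>A smooth version of artanh y / y, obtained from the power series of ln. It divides by
  the zero at y = 0 before the compactified metric is formed.\<close>

lemma artanh_quotient:
  "\<exists>A. (\<forall>k. Ck_on k {-1<..<1} A) \<and> A 0 = 1 \<and> (\<forall>y\<in>{-1<..<1}. rho_of_tau y = 2 * y * A y)"
proof -
  define c where "c n = (-1) ^ n * (1 / real (n + 1))" for n
  define B where "B y = (\<Sum>n. c n * y ^ n)" for y :: real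
  have sm: "summable (\<lambda>n. c n * y ^ n)" if "\<bar>y\<bar> < 1" for y :: real
  proof (rule summable_comparison_test'[where N=0])
    show "summable (\<lambda>n. \<bar>y\<bar> ^ n)" by (rule summable_geometric) (use that in simp)
    show "norm (c n * y ^ n) \<le> \<bar>y\<bar> ^ n" for n
      unfolding c_def by (simp add: abs_mult power_abs field_simps)
  qed
  have CB: "Ck_on k {-1<..<1} B" for k
    unfolding B_def[abs_def] by (rule Ck_on_power_series) (rule sm)
  have ln: "ln (1 + y) = y * B y" if y: "\<bar>y\<bar> < 1" for y
  proof -
    have "ln (1 + y) = (\<Sum>n. (-1) ^ n * (1 / real (n + 1)) * (1 + y - 1) ^ Suc n)"
      by (rule ln_series) (use y in auto)
    also have "\<dots> = (\<Sum>n. y * (c n * y ^ n))" by (simp add: c_def mult_ac)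
    also have "\<dots> = y * B y" unfolding B_def by (rule suminf_mult[OF sm[OF y]])
    finally show ?thesis .
  qed
  define A where "A y = (B y + B (- y)) / 2" for y
  have "Ck_on k {-1<..<1} (\<lambda>y. B (- y))" for k
    by (rule Ck_on_compose[OF _ _ _ CB]) (auto intro!: Ck_on_minus Ck_on_ident)
  then have "Ck_on k {-1<..<1} (\<lambda>y. (B y + B (- y)) * (1 / 2))" for k
    by (intro Ck_on_mult Ck_on_add CB Ck_on_const) auto
  then have "Ck_on k {-1<..<1} A" for k by (simp add: A_def[abs_def])
  moreover have "B 0 = 1" unfolding B_def using powser_zero[of c] by (simp add: c_def)
  then have "A 0 = 1" by (simp add: A_def)
  moreover have "rho_of_tau y = 2 * y * A y" if "y \<in> {-1<..<1}" for y
    using that ln[of y] ln[of "- y"] unfolding rho_of_tau_def A_def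
    by (subst ln_div) (auto simp: algebra_simps)
  ultimately show ?thesis by blast
qed

lemma C1_lipschitz:
  fixes f f' :: "real \<Rightarrow> real"
  assumes d: "\<And>s. s \<in> {0..b} \<Longrightarrow> (f has_real_derivative f' s) (at s)" and c: "continuous_on {0..b} f'"
  shows "\<exists>C\<ge>0. \<forall>s\<in>{0..b}. \<bar>f s - f 0\<bar> \<le> C * s"
proof -
  have "bounded (f' ` {0..b})" by (intro compact_imp_bounded compact_continuous_image c) auto
  then obtain C where C: "\<And>s. s \<in> {0..b} \<Longrightarrow> \<bar>f' s\<bar> \<le> C" unfolding bounded_iff by (metis image_eqI real_norm_def)
  have "\<bar>f s - f 0\<bar> \<le> \<bar>C\<bar> * s" if s: "s \<in> {0..b}" for s
  proof (cases "s = 0")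
    case False
    then obtain z where "0 < z" "z < s" "f s - f 0 = (s - 0) * f' z"
      using MVT2[of 0 s f f'] d s by auto
    moreover from this have "\<bar>f' z\<bar> \<le> \<bar>C\<bar>" using C[of z] s by auto
    ultimately show ?thesis using s by (simp add: abs_mult mult_left_mono mult.commute)
  qed simp
  then show ?thesis by (intro exI[of _ "\<bar>C\<bar>"]) simp
qed

text \<open>Gains one order of vanishing. The mean value theorem keeps the constant \<open>C\<close>
  and asks for the derivative only in the open interval, where the equation for \<open>EE\<close> is
  regular.\<close>

lemma integrate_bound:
  fixes f f' :: "real \<Rightarrow> real"
  assumes c: "continuous_on {0..s} f"
    and d: "\<And>z. z \<in> {0<..<s} \<Longrightarrow> (f has_real_derivative f' z) (at z)" and f0: "f 0 = 0"
    and b: "\<And>z. z \<in> {0<..<s} \<Longrightarrow> \<bar>f' z\<bar> \<le> C * z ^ n" and s: "0 < s" and C: "0 \<le> C"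
  shows "\<bar>f s\<bar> \<le> C * s ^ Suc n"
proof -
  obtain l z where lz: "0 < z" "z < s" "(f has_real_derivative l) (at z)" "f s - f 0 = (s - 0) * l"
    using MVT[OF s c] d by (metis greaterThanLessThan_iff real_differentiable_def)
  then have "l = f' z" using d[of z] DERIV_unique by auto
  then have z: "0 < z" "z < s" "f s - f 0 = (s - 0) * f' z" using lz by auto
  have "\<bar>f' z\<bar> \<le> C * z ^ n" using b z by auto
  also have "\<dots> \<le> C * s ^ n" using z C by (intro mult_left_mono power_mono) auto
  finally have "s * \<bar>f' z\<bar> \<le> s * (C * s ^ n)" using s by (intro mult_left_mono) auto
  then show ?thesis using z f0 s by (simp add: abs_mult mult_ac)
qed

section \<open>The defining function in the cylinder coordinate\<close>

context adss
begin

text \<open>The defining function t has to satisfy dt / sinh t = dh / UU. With y = tanh (t / 2) the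
  left side is dy / y, and dh = dUU / sqrt (qq UU), so ln y - ln UU is a primitive of (1 / sqrt (qq
  s) - 1) / s. Rationalized, this integrand is \<open>kh\<close>, which is regular at s = 0, that is
  at infinity. Up to s = 1 / M the root is at least 1.\<close>

definition qq where "qq s = 1 + s\<^sup>2 - M * s ^ 3"
definition kh where "kh s = - (s * (1 - M * s)) / (sqrt (qq s) * (1 + sqrt (qq s)))"
definition KH where "KH s = integral {-(1/M)..s} kh - integral {-(1/M)..0} kh"

lemma qq_ge: assumes "s \<le> 1 / M" shows "1 \<le> qq s"
proof -
  have "0 \<le> s\<^sup>2 * (1 - M * s)" using assms M_pos by (intro mult_nonneg_nonneg) (auto simp: field_simps)
  then show ?thesis unfolding qq_def by (simp add: algebra_simps power2_eq_square power3_eq_cube)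
qed

lemma kh_key: assumes "s \<le> 1 / M" shows "1 + s * kh s = 1 / sqrt (qq s)"
proof -
  define r where "r = sqrt (qq s)"
  have r: "r > 0" "r * r = qq s" using qq_ge[OF assms] by (auto simp: r_def)
  have e: "s * (s * (1 - M * s)) = r * r - 1" unfolding r qq_def by (simp add: algebra_simps power2_eq_square power3_eq_cube)
  have "s * kh s = - (s * (s * (1 - M * s))) / (r * (1 + r))" unfolding kh_def r_def[symmetric] by simp
  also have "\<dots> = - (r * r - 1) / (r * (1 + r))" unfolding e ..
  also have "- (r * r - 1) = (1 - r) * (1 + r)" by (simp add: algebra_simps)
  also have "(1 - r) * (1 + r) / (r * (1 + r)) = 1 / r - 1"
    using r(1) by (simp add: diff_divide_distrib add_pos_pos less_imp_neq[symmetric])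
  finally show ?thesis by (simp add: r_def)
qed

lemma kh_cont: "continuous_on {-(1/M)..1/M} kh"
proof -
  have c: "continuous_on {-(1/M)..1/M} qq" unfolding qq_def by (intro continuous_intros)
  have "sqrt (qq s) * (1 + sqrt (qq s)) \<noteq> 0" if "s \<in> {-(1/M)..1/M}" for s
  proof -
    have "0 < sqrt (qq s)" using qq_ge[of s] that by auto
    then have "0 < sqrt (qq s) * (1 + sqrt (qq s))" by (intro mult_pos_pos add_pos_pos) auto
    then show ?thesis by linarith
  qed
  then show ?thesis unfolding kh_def by (intro continuous_intros c ballI)
qed

lemma KH_deriv: assumes "s \<in> {-(1/M)<..<1/M}" shows "(KH has_real_derivative kh s) (at s)"
proof -
  have "((\<lambda>z. integral {-(1/M)..z} kh) has_real_derivative kh s) (at s within {-(1/M)..1/M})"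
    by (rule integral_has_real_derivative[OF kh_cont]) (use assms in auto)
  then have "((\<lambda>z. integral {-(1/M)..z} kh) has_real_derivative kh s) (at s)"
    using assms by (simp add: at_within_Icc_at)
  then show ?thesis unfolding KH_def by (auto intro!: derivative_eq_intros)
qed

lemma KH_0 [simp]: "KH 0 = 0" by (simp add: KH_def)

lemma Ck_kh: "Ck_on k {-(1/M)<..<1/M} kh"
proof -
  have q: "0 < qq s" if "s \<in> {-(1/M)<..<1/M}" for s using qq_ge[of s] that by auto
  have "Ck_on k {-(1/M)<..<1/M} (\<lambda>s. sqrt (qq s))"
    by (rule Ck_on_compose[OF _ _ _ Ck_on_sqrt])
       (use q in \<open>auto simp: qq_def[abs_def] intro!: Ck_on_diff Ck_on_add Ck_on_mult Ck_on_const Ck_on_power Ck_on_ident\<close>)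
  then show ?thesis unfolding kh_def[abs_def]
    by (intro Ck_on_divide Ck_on_mult Ck_on_add Ck_on_minus Ck_on_diff Ck_on_const Ck_on_ident)
       (use q in \<open>auto simp: add_pos_pos less_imp_neq[symmetric] add_pos_nonneg\<close>)
qed

lemma Ck_KH: "Ck_on k {-(1/M)<..<1/M} KH"
  by (rule Ck_on_Suc_imp, rule Ck_on_Suc_real[OF _ KH_deriv]) (auto intro: Ck_kh)

text \<open>\<open>YY\<close> is tanh (tt / 2); the constant of integration 1/2 gives tt derivative
  1 at h = 0. \<open>EE\<close> is the derivative of \<open>tt\<close> and equals sinh tt / UU,
  written without the division so that it makes sense at h = 0.\<close>

definition YY where "YY h = UU h / 2 * exp (KH (UU h))"
definition EE where "EE h = exp (KH (UU h)) / (1 - (YY h)\<^sup>2)"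
definition tt where "tt h = rho_of_tau (YY h)"

definition good :: "real \<Rightarrow> bool" where
  "good d \<longleftrightarrow> 0 < d \<and> d < hm \<and> (\<forall>h\<in>{-d..d}. h \<in> {lo<..<hi} \<and> UU h \<in> {-(1/M)<..<1/M} \<and> YY h \<in> {-1<..<1})"

lemma good_exists: "\<exists>d. good d"
proof -
  have UUc: "isCont UU 0" by (rule DERIV_isCont[OF UU_deriv[OF in_dom(2)]])
  have "isCont KH (UU 0)" using M_pos by (intro DERIV_isCont[OF KH_deriv]) auto
  then have YYc: "isCont YY 0" unfolding YY_def[abs_def]
    by (intro continuous_intros UUc isCont_o2[OF UUc]) auto
  have Y0: "YY 0 = 0" by (simp add: YY_def)
  have "\<forall>\<^sub>F h in nhds 0. UU h \<in> {-(1/M)<..<1/M}"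
    by (rule topological_tendstoD[OF UUc[unfolded isCont_def tendsto_at_iff_tendsto_nhds]])
       (use M_pos in auto)
  moreover have "\<forall>\<^sub>F h in nhds 0. YY h \<in> {-1<..<1}"
    by (rule topological_tendstoD[OF YYc[unfolded isCont_def tendsto_at_iff_tendsto_nhds]])
       (use Y0 in auto)
  moreover have "\<forall>\<^sub>F h in nhds 0. h \<in> {lo<..<hi}" using in_dom(2) by (intro eventually_nhds_in_open) auto
  ultimately have "\<forall>\<^sub>F h in nhds 0. h \<in> {lo<..<hi} \<and> UU h \<in> {-(1/M)<..<1/M} \<and> YY h \<in> {-1<..<1}"
    by eventually_elim auto
  then obtain e where e: "e > 0" "\<And>h. dist h 0 < e \<Longrightarrow> h \<in> {lo<..<hi} \<and> UU h \<in> {-(1/M)<..<1/M} \<and> YY h \<in> {-1<..<1}"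
    unfolding eventually_nhds_metric by blast
  have "dist h 0 < e" if "h \<in> {- min (e / 2) (hm / 2)..min (e / 2) (hm / 2)}" for h
    using that e(1) unfolding dist_real_def by (simp add: abs_less_iff) linarith
  then have "good (min (e / 2) (hm / 2))"
    unfolding good_def using e hm_pos by auto
  then show ?thesis by blast
qed

end

locale adss_collar = adss +
  fixes d :: real
  assumes good: "good d"
begin

lemma goodD: assumes "h \<in> {-d..d}"
  shows "h \<in> {lo<..<hi}" "UU h \<in> {-(1/M)<..<1/M}" "-1 < YY h" "YY h < 1" "h < hm" "0 < VV h" "0 < d"
proof -
  show a: "h \<in> {lo<..<hi}" "UU h \<in> {-(1/M)<..<1/M}" "-1 < YY h" "YY h < 1" "0 < d" "h < hm"
    using good assms unfolding good_def by auto
  show "0 < VV h" using VV_pos[OF a(1,6)] .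
qed

lemma YY_sq: "h \<in> {-d..d} \<Longrightarrow> (YY h)\<^sup>2 < 1"
  using goodD(3,4)[of h] by (simp add: abs_square_less_1)

lemma EE_pos: "h \<in> {-d..d} \<Longrightarrow> 0 < EE h"
  unfolding EE_def using YY_sq by simp

lemma Ck_YY: "Ck_on k {-d<..<d} YY"
proof -
  have U: "Ck_on k {-d<..<d} UU" by (rule Ck_on_subset[OF Ck_UU_VV[THEN conjunct1]]) (use goodD(1) in auto)
  have "Ck_on k {-d<..<d} (\<lambda>h. KH (UU h))"
    by (rule Ck_on_compose[OF _ _ _ Ck_KH U]) (use goodD(2) in auto)
  then have "Ck_on k {-d<..<d} (\<lambda>h. UU h * (1/2) * exp (KH (UU h)))"
    by (intro Ck_on_mult U Ck_on_const Ck_on_compose[OF _ _ _ Ck_on_exp]) auto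
  then show ?thesis by (simp add: YY_def[abs_def])
qed

lemma Ck_eKH: "Ck_on k {-d<..<d} (\<lambda>h. exp (KH (UU h)))"
proof -
  have U: "Ck_on k {-d<..<d} UU" by (rule Ck_on_subset[OF Ck_UU_VV[THEN conjunct1]]) (use goodD(1) in auto)
  have "Ck_on k {-d<..<d} (\<lambda>h. KH (UU h))"
    by (rule Ck_on_compose[OF _ _ _ Ck_KH U]) (use goodD(2) in auto)
  then show ?thesis by (intro Ck_on_compose[OF _ _ _ Ck_on_exp]) auto
qed

lemma Ck_EE: "Ck_on k {-d<..<d} EE"
proof -
  have "1 - (YY h)\<^sup>2 \<noteq> 0" if "h \<in> {-d<..<d}" for h using YY_sq[of h] that by auto
  then show ?thesis unfolding EE_def[abs_def]
    by (intro Ck_on_divide Ck_eKH Ck_on_diff Ck_on_const Ck_on_power Ck_YY open_greaterThanLessThan)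
qed

lemma YY_deriv: assumes h: "h \<in> {-d..d}" shows "(YY has_real_derivative exp (KH (UU h)) / 2) (at h)"
proof -
  have K: "((\<lambda>h. KH (UU h)) has_real_derivative kh (UU h) * VV h) (at h)"
    by (rule DERIV_chain2[OF KH_deriv UU_deriv]) (use goodD[OF h] in auto)
  have "(YY has_real_derivative VV h / 2 * exp (KH (UU h)) + exp (KH (UU h)) * (kh (UU h) * VV h) * (UU h / 2)) (at h)"
    unfolding YY_def[abs_def]
    by (intro DERIV_mult DERIV_cdivide UU_deriv goodD(1)[OF h] DERIV_chain2[OF DERIV_exp K])
  moreover have e1: "VV h / 2 * exp (KH (UU h)) + exp (KH (UU h)) * (kh (UU h) * VV h) * (UU h / 2)
     = exp (KH (UU h)) / 2 * (VV h * (1 + UU h * kh (UU h)))" by (simp add: algebra_simps)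
  moreover have e2: "VV h * (1 + UU h * kh (UU h)) = 1"
  proof -
    have "qq (UU h) = (VV h)\<^sup>2" by (simp add: qq_def UU_energy)
    then have "1 + UU h * kh (UU h) = 1 / VV h" using kh_key[of "UU h"] goodD(2,6)[OF h] by simp
    then show ?thesis using goodD(6)[OF h] by simp
  qed
  ultimately show ?thesis unfolding e1 e2 by simp
qed

lemma tt_deriv: assumes h: "h \<in> {-d..d}" shows "(tt has_real_derivative EE h) (at h)"
proof -
  have "(tt has_real_derivative 2 / (1 - (YY h)\<^sup>2) * (exp (KH (UU h)) / 2)) (at h)"
    unfolding tt_def[abs_def] by (rule DERIV_chain2[OF rho_of_tau_deriv YY_deriv[OF h]]) (use goodD[OF h] in auto)
  moreover have "2 / (1 - y) * (e / 2) = e / (1 - y)" for y e :: real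
    by (cases "y = 1") (simp_all add: field_simps)
  ultimately show ?thesis unfolding EE_def by (simp only:)
qed

lemma sinh_tt: assumes h: "h \<in> {0<..d}" shows "sinh (tt h) = UU h * EE h"
proof -
  have hd: "h \<in> {-d..d}" using h by auto
  have "0 < UU h" using UU_pos[of h] h goodD(5)[OF hd] hm_pos by auto
  then have "0 < YY h" by (simp add: YY_def)
  from sinh_rho_of_tau(1)[OF this goodD(4)[OF hd]] show ?thesis
    by (simp add: tt_def EE_def YY_def)
qed

lemma at_0: "UU 0 = 0" "YY 0 = 0" "EE 0 = 1" "tt 0 = 0" by (simp_all add: YY_def EE_def tt_def)

lemma tt_mono: assumes "x \<in> {-d..d}" "y \<in> {-d..d}" "x < y" shows "tt x < tt y"
proof (rule DERIV_pos_imp_increasing[OF assms(3), where f=tt])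
  fix z assume "x \<le> z" "z \<le> y"
  then have "z \<in> {-d..d}" using assms by auto
  then show "\<exists>D. (tt has_real_derivative D) (at z) \<and> 0 < D" using tt_deriv EE_pos by blast
qed

lemma tt_0_iff: "h \<in> {-d..d} \<Longrightarrow> 0 < tt h \<longleftrightarrow> 0 < h" "h \<in> {-d..d} \<Longrightarrow> 0 \<le> tt h \<longleftrightarrow> 0 \<le> h"
  using tt_mono[of 0 h] tt_mono[of h 0] at_0(4) goodD(7)[of h]
  by (auto simp: not_less[symmetric]) (metis less_irrefl linorder_neqE_linordered_idom)+

lemma Ck_tt: "Ck_on k {-d<..<d} tt"
  by (rule Ck_on_Suc_imp, rule Ck_on_Suc_real[OF _ tt_deriv]) (auto intro: Ck_EE)

text \<open>The compactified metric contains tt / UU squared. Both vanish at h = 0, and their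
  quotient must extend smoothly across it, with boundary value 1.\<close>

lemma quotient:
  obtains D where "\<And>k. Ck_on k {-d<..<d} D" "D 0 = 1" "\<And>h. h \<in> {-d<..<d} \<Longrightarrow> tt h = UU h * D h"
proof -
  obtain A where A: "\<And>k. Ck_on k {-1<..<1} A" "A 0 = 1" "\<And>y. y \<in> {-1<..<1} \<Longrightarrow> rho_of_tau y = 2 * y * A y"
    using artanh_quotient by blast
  show ?thesis
  proof (rule that[of "\<lambda>h. exp (KH (UU h)) * A (YY h)"])
    show "Ck_on k {-d<..<d} (\<lambda>h. exp (KH (UU h)) * A (YY h))" for k
      by (intro Ck_on_mult Ck_eKH Ck_on_compose[OF _ _ _ A(1) Ck_YY]) (use goodD(3,4) in auto)
    show "exp (KH (UU 0)) * A (YY 0) = 1" by (simp add: at_0 A)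
    show "tt h = UU h * (exp (KH (UU h)) * A (YY h))" if "h \<in> {-d<..<d}" for h
      using A(3)[of "YY h"] goodD(3,4)[of h] that by (simp add: tt_def) (simp add: YY_def)
  qed
qed

definition t1 where "t1 = min (tt d) (- tt (- d))"

lemma t1_pos: "0 < t1"
  using tt_mono[of 0 d] tt_mono[of "- d" 0] good at_0(4) unfolding t1_def good_def by auto

lemma inverse:
  obtains \<eta> where "\<And>h. h \<in> {-d..d} \<Longrightarrow> \<eta> (tt h) = h"
    "\<And>s. s \<in> {-t1<..<t1} \<Longrightarrow> \<eta> s \<in> {-d<..<d}" "\<And>s. s \<in> {-t1<..<t1} \<Longrightarrow> tt (\<eta> s) = s"
    "\<And>s. s \<in> {-t1<..<t1} \<Longrightarrow> (\<eta> has_real_derivative 1 / EE (\<eta> s)) (at s)"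
    "\<And>k. Ck_on k {-t1<..<t1} \<eta>"
proof -
  have d0: "-d < d" using goodD(7)[of 0] good by (auto simp: good_def)
  have ct: "continuous_on {-d..d} tt"
    by (intro continuous_at_imp_continuous_on ballI DERIV_isCont[OF tt_deriv])
  have "\<exists>g. (\<forall>x\<in>{-d..d}. g (tt x) = x) \<and> (\<forall>y\<in>{tt (-d)..tt d}. g y \<in> {-d..d} \<and> tt (g y) = y) \<and>
    (\<forall>y\<in>{tt (-d)<..<tt d}. g y \<in> {-d<..<d}) \<and>
    (\<forall>y\<in>{tt (-d)<..<tt d}. (g has_real_derivative inverse (EE (g y))) (at y))"
    by (rule increasing_inverse[OF d0 ct]) (use tt_deriv EE_pos in auto)
  then obtain g where g: "\<forall>x\<in>{-d..d}. g (tt x) = x" "\<forall>y\<in>{tt (-d)..tt d}. g y \<in> {-d..d} \<and> tt (g y) = y"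
    "\<forall>y\<in>{tt (-d)<..<tt d}. g y \<in> {-d<..<d}"
    "\<forall>y\<in>{tt (-d)<..<tt d}. (g has_real_derivative inverse (EE (g y))) (at y)" by blast
  have sub: "s \<in> {tt (-d)<..<tt d}" "s \<in> {tt (-d)..tt d}" if "s \<in> {-t1<..<t1}" for s
    using that unfolding t1_def by auto
  show ?thesis
  proof (rule that[of g])
    show "g (tt h) = h" if "h \<in> {-d..d}" for h using g(1) that by blast
    show r: "g s \<in> {-d<..<d}" if "s \<in> {-t1<..<t1}" for s using g(3) sub(1)[OF that] by blast
    show "tt (g s) = s" if "s \<in> {-t1<..<t1}" for s using g(2) sub(2)[OF that] by blast
    show "(g has_real_derivative 1 / EE (g s)) (at s)" if "s \<in> {-t1<..<t1}" for s
      using g(4) sub(1)[OF that] by (simp add: inverse_eq_divide)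
    show "Ck_on k {-t1<..<t1} g" for k
    proof (rule Ck_on_inverse_function[where S="{-d<..<d}" and f'=EE])
      show "g ` {-t1<..<t1} \<subseteq> {-d<..<d}" using r by blast
      show "(g has_real_derivative inverse (EE (g y))) (at y)" if "y \<in> {-t1<..<t1}" for y
        using g(4) sub(1)[OF that] by blast
      show "EE x \<noteq> 0" if "x \<in> {-d<..<d}" for x using EE_pos[of x] that by auto
    qed (auto intro: Ck_EE)
  qed
qed

end

lemma Ck_on_real_deriv:
  fixes f :: "real \<Rightarrow> real"
  assumes "Ck_on (Suc k) S f"
  obtains f' where "\<And>x. x \<in> S \<Longrightarrow> (f has_real_derivative f' x) (at x)" "Ck_on k S f'"
proof -
  obtain D where D: "\<And>x. x \<in> S \<Longrightarrow> (f has_derivative D x) (at x)" "\<And>v. Ck_on k S (\<lambda>x. D x v)"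
    using Ck_on_SucD[OF assms] by blast
  have "(f has_real_derivative D x 1) (at x)" if "x \<in> S" for x
  proof -
    have "linear (D x)" by (rule has_derivative_linear[OF D(1)[OF that]])
    then have "D x h = D x 1 * h" for h
      using linear_scale[of "D x" h 1] by (metis mult.commute mult.right_neutral real_scaleR_def)
    then have "D x = (\<lambda>h. D x 1 * h)" by (rule ext)
    then show ?thesis unfolding has_field_derivative_def using D(1)[OF that] by metis
  qed
  then show ?thesis using that[of "\<lambda>x. D x 1"] D(2)[of 1] by blast
qed

context adss_collar begin

text \<open>With \<open>s = tt\<close> as coordinate, \<open>E = sinh s / U\<close> satisfies \<open>dE/ds = (cosh s - V) / U\<close>;
  since \<open>V\<^sup>2 = 1 + U\<^sup>2 - M U\<^sup>3\<close> this is \<open>U (E\<^sup>2 - 1 + M U) / (cosh s + V)\<close>, and inserting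
  \<open>E - 1 = O(s)\<close>, then \<open>E - 1 = O(s\<^sup>3)\<close>, gives \<open>E = 1 + M s\<^sup>3 / 6 + O(s\<^sup>4)\<close>.\<close>

lemma EE_expansion:
  assumes eta: "\<And>s. s \<in> {-t1<..<t1} \<Longrightarrow> \<eta> s \<in> {-d<..<d}" "\<And>s. s \<in> {-t1<..<t1} \<Longrightarrow> tt (\<eta> s) = s"
    "\<And>s. s \<in> {-t1<..<t1} \<Longrightarrow> (\<eta> has_real_derivative 1 / EE (\<eta> s)) (at s)"
    and eta0: "\<eta> 0 = 0" and eta_pos: "\<And>s. s \<in> {0<..<t1} \<Longrightarrow> 0 < \<eta> s"
  shows "\<exists>t0 K. 0 < t0 \<and> t0 < t1 \<and> (\<forall>s\<in>{0<..<t0}. \<bar>(EE (\<eta> s))\<^sup>2 - (1 + s ^ 3 / 3 * M)\<bar> \<le> K * s ^ 4)"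
proof -
  \<comment> \<open>\<open>b \<le> 1\<close> allows surplus powers of s to be dropped from the error
    terms; \<open>b < t1\<close> keeps the closed interval inside the domain of the inverse.\<close>
  define b where "b = min (t1 / 2) 1"
  have b: "0 < b" "b < t1" "b \<le> 1" using t1_pos by (auto simp: b_def)
  define e where "e s = EE (\<eta> s)" for s
  define u where "u s = UU (\<eta> s)" for s
  define v where "v s = VV (\<eta> s)" for s
  have in1: "s \<in> {-t1<..<t1}" if "s \<in> {0..b}" for s using that b by auto
  have ind: "\<eta> s \<in> {-d<..<d}" "\<eta> s \<in> {-d..d}" if "s \<in> {0..b}" for s using eta(1)[OF in1[OF that]] by auto
  have ep: "0 < e s" if "s \<in> {0..b}" for s unfolding e_def by (rule EE_pos[OF ind(2)[OF that]])
  have vp: "0 < v s" if "s \<in> {0..b}" for s unfolding v_def by (rule goodD(6)[OF ind(2)[OF that]])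
  have ed: "(\<eta> has_real_derivative 1 / e s) (at s)" if "s \<in> {0..b}" for s
    using eta(3)[OF in1[OF that]] by (simp add: e_def)
  obtain E' where E': "\<And>h. h \<in> {-d<..<d} \<Longrightarrow> (EE has_real_derivative E' h) (at h)" "continuous_on {-d<..<d} E'"
  proof -
    have "Ck_on (Suc 0) {-d<..<d} EE" by (rule Ck_EE)
    then show ?thesis using Ck_on_real_deriv that by (metis Ck_on.simps(1))
  qed
  have etac: "continuous_on {0..b} \<eta>"
    by (intro continuous_at_imp_continuous_on ballI DERIV_isCont[OF ed])
  have ec: "continuous_on {0..b} e"
    unfolding e_def using ind(2)
    by (intro continuous_on_compose2[OF Ck_on_imp_continuous_on[OF Ck_EE[of 0]] etac]) (use ind(1) in auto)
  have vc: "continuous_on {0..b} v"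
    unfolding v_def
    by (intro continuous_on_compose2[OF Ck_on_imp_continuous_on[OF Ck_UU_VV[of 0, THEN conjunct2]] etac])
       (use goodD(1)[OF ind(2)] in auto)
  have uc: "continuous_on {0..b} u"
    unfolding u_def
    by (intro continuous_on_compose2[OF Ck_on_imp_continuous_on[OF Ck_UU_VV[of 0, THEN conjunct1]] etac])
       (use goodD(1)[OF ind(2)] in auto)
  have ud: "(u has_real_derivative v s / e s) (at s)" if "s \<in> {0..b}" for s
    using DERIV_chain2[OF UU_deriv[OF goodD(1)[OF ind(2)[OF that]]] ed[OF that]]
    unfolding u_def v_def by simp
  have vd: "(v has_real_derivative (u s - 3/2 * M * (u s)\<^sup>2) / e s) (at s)" if "s \<in> {0..b}" for s
    using DERIV_chain2[OF VV_deriv[OF goodD(1)[OF ind(2)[OF that]]] ed[OF that]]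
    unfolding u_def v_def by simp
  have ede: "(e has_real_derivative E' (\<eta> s) / e s) (at s)" if "s \<in> {0..b}" for s
    using DERIV_chain2[OF E'(1)[OF ind(1)[OF that]] ed[OF that]] unfolding e_def by simp
  have e0: "e 0 = 1" "u 0 = 0" "v 0 = 1" by (simp_all add: e_def u_def v_def eta0 at_0)
  have enz: "\<forall>s\<in>{0..b}. e s \<noteq> 0" using ep by force
  have E'c: "continuous_on {0..b} (\<lambda>s. E' (\<eta> s))"
    by (rule continuous_on_compose2[OF E'(2) etac]) (use ind(1) in auto)
  obtain C1 where C1: "0 \<le> C1" "\<And>s. s \<in> {0..b} \<Longrightarrow> \<bar>e s - e 0\<bar> \<le> C1 * s"
    using C1_lipschitz[OF ede continuous_on_divide[OF E'c ec enz]] by blast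
  obtain C2 where C2: "0 \<le> C2" "\<And>s. s \<in> {0..b} \<Longrightarrow> \<bar>u s - u 0\<bar> \<le> C2 * s"
    using C1_lipschitz[OF ud continuous_on_divide[OF vc ec enz]] by blast
  have "((\<lambda>s. v s / e s) has_real_derivative ((u s - 3/2 * M * (u s)\<^sup>2) / e s * e s - v s * (E' (\<eta> s) / e s)) / (e s * e s)) (at s)"
    if "s \<in> {0..b}" for s by (rule DERIV_divide[OF vd[OF that] ede[OF that]]) (use ep[OF that] in simp)
  moreover have "continuous_on {0..b} (\<lambda>s. ((u s - 3/2 * M * (u s)\<^sup>2) / e s * e s - v s * (E' (\<eta> s) / e s)) / (e s * e s))"
    using enz by (intro continuous_intros uc vc ec E'c) auto
  ultimately have "\<exists>C\<ge>0. \<forall>s\<in>{0..b}. \<bar>v s / e s - v 0 / e 0\<bar> \<le> C * s" by (rule C1_lipschitz)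
  then obtain C3 where C3: "0 \<le> C3" "\<And>s. s \<in> {0..b} \<Longrightarrow> \<bar>v s / e s - v 0 / e 0\<bar> \<le> C3 * s" by blast
  have "((\<lambda>s. cosh s + v s) has_real_derivative sinh s + (u s - 3/2 * M * (u s)\<^sup>2) / e s) (at s)"
    if "s \<in> {0..b}" for s by (intro DERIV_add vd[OF that]) (auto intro!: derivative_eq_intros)
  moreover have "continuous_on {0..b} (\<lambda>s. sinh s + (u s - 3/2 * M * (u s)\<^sup>2) / e s)"
    using enz by (intro continuous_intros uc ec) auto
  ultimately have "\<exists>C\<ge>0. \<forall>s\<in>{0..b}. \<bar>(cosh s + v s) - (cosh 0 + v 0)\<bar> \<le> C * s" by (rule C1_lipschitz)
  then obtain C4 where C4: "0 \<le> C4" "\<And>s. s \<in> {0..b} \<Longrightarrow> \<bar>(cosh s + v s) - (cosh 0 + v 0)\<bar> \<le> C4 * s" by blast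
  define q where "q s = cosh s + v s" for s
  have q1: "1 \<le> q s" if "s \<in> {0..b}" for s using vp[OF that] cosh_real_ge_1[of s] by (simp add: q_def)
  have b1: "\<bar>e s - 1\<bar> \<le> C1 * s" "\<bar>u s\<bar> \<le> C2 * s" "\<bar>q s - 2\<bar> \<le> C4 * s" "\<bar>e s + 1\<bar> \<le> C1 + 2" if s: "s \<in> {0..b}" for s
  proof -
    show a: "\<bar>e s - 1\<bar> \<le> C1 * s" "\<bar>u s\<bar> \<le> C2 * s" using C1(2)[OF s] C2(2)[OF s] e0 by auto
    show "\<bar>q s - 2\<bar> \<le> C4 * s" using C4(2)[OF s] e0 by (simp add: q_def)
    have "C1 * s \<le> C1 * 1" using C1(1) s b by (intro mult_left_mono) auto
    then show "\<bar>e s + 1\<bar> \<le> C1 + 2" using a(1) by linarith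
  qed
  have us: "\<bar>u s - s\<bar> \<le> C3 * s ^ Suc 1" if s: "s \<in> {0<..b}" for s
  proof (rule integrate_bound[where f="\<lambda>s. u s - s" and f'="\<lambda>s. v s / e s - 1"])
    show "continuous_on {0..s} (\<lambda>s. u s - s)"
      using s by (intro continuous_intros continuous_on_subset[OF uc]) auto
    show "((\<lambda>s. u s - s) has_real_derivative v z / e z - 1) (at z)" if "z \<in> {0<..<s}" for z
      by (intro DERIV_diff ud DERIV_ident) (use that s in auto)
    show "\<bar>v z / e z - 1\<bar> \<le> C3 * z ^ 1" if "z \<in> {0<..<s}" for z
      using C3(2)[of z] that s e0 by auto
  qed (use s e0 C3 in auto)
  define e' where "e' s = u s * ((e s)\<^sup>2 - 1 + M * u s) / q s" for s
  have de: "(e has_real_derivative e' s) (at s)" if sc: "s \<in> {0<..b}" for s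
  proof -
    have s: "s \<in> {0..b}" and s0: "0 < s" "s < t1" using sc b by auto
    have up: "0 < u y" if "0 < y" "y < t1" for y
      using UU_pos[of "\<eta> y"] eta_pos[of y] goodD(5)[of "\<eta> y"] eta(1)[of y] that hm_pos by (auto simp: u_def)
    have sh: "sinh y = u y * e y" if "0 < y" "y < t1" for y
      using sinh_tt[of "\<eta> y"] eta(1,2)[of y] eta_pos[of y] that by (auto simp: e_def u_def)
    have "((\<lambda>y. sinh y / u y) has_real_derivative (cosh s * u s - sinh s * (v s / e s)) / (u s * u s)) (at s)"
      by (rule DERIV_divide[OF _ ud[OF s]]) (use up[OF s0] in \<open>auto intro!: derivative_eq_intros\<close>)
    then have "(e has_real_derivative (cosh s * u s - sinh s * (v s / e s)) / (u s * u s)) (at s)"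
      by (rule has_field_derivative_transform_within_open[where S="{0<..<t1}"]) (use s0 sh up in force)+
    moreover have "(cosh s * u s - sinh s * (v s / e s)) / (u s * u s) = e' s"
    proof -
      have v2: "(v s)\<^sup>2 = 1 + (u s)\<^sup>2 - M * u s ^ 3" unfolding v_def u_def by (rule UU_energy)
      have c2: "(cosh s)\<^sup>2 = 1 + (u s * e s)\<^sup>2" using cosh_square_eq[of s] sh[OF s0] by simp
      have "(cosh s - v s) * q s = u s * (u s * ((e s)\<^sup>2 - 1 + M * u s))"
        unfolding q_def using v2 c2 by (simp add: algebra_simps power2_eq_square power3_eq_cube)
      then have "(cosh s - v s) / u s = e' s"
        unfolding e'_def using up[OF s0] q1[OF s] by (simp add: field_simps)
      moreover have "(cosh s * u s - sinh s * (v s / e s)) / (u s * u s) = (cosh s - v s) / u s"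
        unfolding sh[OF s0] using up[OF s0] ep[OF s] by (simp add: field_simps)
      ultimately show ?thesis by simp
    qed
    ultimately show ?thesis by simp
  qed
  have dq: "\<bar>x / q s\<bar> \<le> \<bar>x\<bar>" if "s \<in> {0..b}" for x s
    using q1[OF that] by (simp add: divide_le_eq mult_le_cancel_left1 abs_mult)
  define C6 where "C6 = C2 * (C1 * (C1 + 2) + M * C2)"
  have C6: "0 \<le> C6" unfolding C6_def using C1 C2 M_pos by auto
  have e2: "\<bar>(e s)\<^sup>2 - 1\<bar> \<le> \<bar>e s - 1\<bar> * (C1 + 2)" if s: "s \<in> {0..b}" for s
  proof -
    have "(e s)\<^sup>2 - 1 = (e s - 1) * (e s + 1)" by (simp add: algebra_simps power2_eq_square)
    then show ?thesis using b1(4)[OF s] by (simp add: abs_mult mult_left_mono)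
  qed
  have e3: "\<bar>e s - 1\<bar> \<le> C6 * s ^ Suc 2" if s: "s \<in> {0<..b}" for s
  proof (rule integrate_bound[where f="\<lambda>s. e s - 1" and f'=e'])
    show "continuous_on {0..s} (\<lambda>s. e s - 1)"
      using s by (intro continuous_intros continuous_on_subset[OF ec]) auto
    show "((\<lambda>s. e s - 1) has_real_derivative e' z) (at z)" if "z \<in> {0<..<s}" for z
      using DERIV_diff[OF de[of z] DERIV_const[of 1]] that s by auto
    show "\<bar>e' z\<bar> \<le> C6 * z\<^sup>2" if z: "z \<in> {0<..<s}" for z
    proof -
      have zb: "z \<in> {0..b}" using z s by auto
      have "\<bar>(e z)\<^sup>2 - 1\<bar> \<le> C1 * z * (C1 + 2)"
        using e2[OF zb] mult_right_mono[OF b1(1)[OF zb], of "C1 + 2"] C1 by linarith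
      moreover have "\<bar>M * u z\<bar> \<le> M * (C2 * z)" using b1(2)[OF zb] M_pos by (simp add: abs_mult)
      ultimately have "\<bar>(e z)\<^sup>2 - 1 + M * u z\<bar> \<le> (C1 * (C1 + 2) + M * C2) * z" by (simp add: algebra_simps)
      then have "\<bar>u z\<bar> * \<bar>(e z)\<^sup>2 - 1 + M * u z\<bar> \<le> (C2 * z) * ((C1 * (C1 + 2) + M * C2) * z)"
        using b1(2)[OF zb] C2 z by (intro mult_mono) auto
      then show ?thesis using dq[OF zb, of "u z * ((e z)\<^sup>2 - 1 + M * u z)"]
        unfolding e'_def C6_def abs_mult by (simp add: power2_eq_square mult_ac)
    qed
  qed (use s e0 C6 in auto)
  define C8 where "C8 = C2 * (C6 * (C1 + 2)) + M * (2 * (C3 * (C2 + 1)) + C4)"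
  have C8: "0 \<le> C8" unfolding C8_def using C1 C2 C3 C4 C6 M_pos by auto
  have e4: "\<bar>e s - 1 - M * s ^ 3 / 6\<bar> \<le> C8 * s ^ Suc 3" if s: "s \<in> {0<..b}" for s
  proof (rule integrate_bound[where f="\<lambda>s. e s - 1 - M * s ^ 3 / 6" and f'="\<lambda>s. e' s - M * s\<^sup>2 / 2"])
    show "continuous_on {0..s} (\<lambda>s. e s - 1 - M * s ^ 3 / 6)"
      using s by (intro continuous_intros continuous_on_subset[OF ec]) auto
    show "((\<lambda>s. e s - 1 - M * s ^ 3 / 6) has_real_derivative e' z - M * z\<^sup>2 / 2) (at z)" if "z \<in> {0<..<s}" for z
      using de[of z] that s by (auto intro!: derivative_eq_intros)
    show "\<bar>e' z - M * z\<^sup>2 / 2\<bar> \<le> C8 * z ^ 3" if z: "z \<in> {0<..<s}" for z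
    proof -
      have zb: "z \<in> {0..b}" and zc: "z \<in> {0<..b}" and z1: "0 < z" "z \<le> 1" using z s b by auto
      have q0: "q z \<noteq> 0" using q1[OF zb] by auto
      \<comment> \<open>The leading term is M u^2 / q, where u = z + O(z^2) and q = 2 + O(z). The
        first summand is of order z^4, because e^2 - 1 is already known to be of order z^3.\<close>
      have eq: "e' z - M * z\<^sup>2 / 2 = (u z * ((e z)\<^sup>2 - 1)) / q z + M * (((u z - z) * (u z + z)) - (q z - 2) * z\<^sup>2 / 2) / q z"
        unfolding e'_def using q0 by (simp add: field_simps power2_eq_square)
      have "\<bar>(e z)\<^sup>2 - 1\<bar> \<le> C6 * z ^ 3 * (C1 + 2)"
      proof -
        have "\<bar>e z - 1\<bar> * (C1 + 2) \<le> C6 * z ^ 3 * (C1 + 2)"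
          using e3[OF zc] C1(1) by (intro mult_right_mono) auto
        then show ?thesis using e2[OF zb] by linarith
      qed
      then have "\<bar>u z\<bar> * \<bar>(e z)\<^sup>2 - 1\<bar> \<le> (C2 * z) * (C6 * z ^ 3 * (C1 + 2))"
        using b1(2)[OF zb] C2 z by (intro mult_mono) auto
      also have "\<dots> = C2 * (C6 * (C1 + 2)) * z ^ 3 * z" by simp
      also have "\<dots> \<le> C2 * (C6 * (C1 + 2)) * z ^ 3 * 1" using z1 C1 C2 C6 by (intro mult_left_mono) auto
      finally have p1: "\<bar>(u z * ((e z)\<^sup>2 - 1)) / q z\<bar> \<le> C2 * (C6 * (C1 + 2)) * z ^ 3"
        using dq[OF zb, of "u z * ((e z)\<^sup>2 - 1)"] by (simp add: abs_mult)
      have "\<bar>u z + z\<bar> \<le> (C2 + 1) * z" using b1(2)[OF zb] z1 by (simp add: algebra_simps)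
      moreover have "\<bar>u z - z\<bar> \<le> C3 * z\<^sup>2" using us[OF zc] by (simp add: power2_eq_square)
      ultimately have "\<bar>u z - z\<bar> * \<bar>u z + z\<bar> \<le> (C3 * z\<^sup>2) * ((C2 + 1) * z)"
        using C3 z1 by (intro mult_mono) auto
      then have a1: "\<bar>(u z - z) * (u z + z)\<bar> \<le> C3 * (C2 + 1) * z ^ 3"
        unfolding abs_mult by (simp add: power2_eq_square power3_eq_cube mult_ac)
      have "\<bar>q z - 2\<bar> * (z\<^sup>2 / 2) \<le> (C4 * z) * (z\<^sup>2 / 2)" using b1(3)[OF zb] by (intro mult_right_mono) auto
      also have "\<dots> \<le> C4 * z ^ 3" using C4(1) z1 by (simp add: power2_eq_square power3_eq_cube)
      finally have a2: "\<bar>(q z - 2) * z\<^sup>2 / 2\<bar> \<le> C4 * z ^ 3" by (simp add: abs_mult)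
      have "\<bar>((u z - z) * (u z + z)) - (q z - 2) * z\<^sup>2 / 2\<bar> \<le> (C3 * (C2 + 1) + C4) * z ^ 3"
        using a1 a2 by (simp add: distrib_right)
      also have "\<dots> \<le> (2 * (C3 * (C2 + 1)) + C4) * z ^ 3" using C3 C2 z1 by (intro mult_right_mono) auto
      finally have "\<bar>M * (((u z - z) * (u z + z)) - (q z - 2) * z\<^sup>2 / 2)\<bar> \<le> M * (2 * (C3 * (C2 + 1)) + C4) * z ^ 3"
        unfolding abs_mult using M_pos by simp
      then have p2: "\<bar>M * (((u z - z) * (u z + z)) - (q z - 2) * z\<^sup>2 / 2) / q z\<bar> \<le> M * (2 * (C3 * (C2 + 1)) + C4) * z ^ 3"
        using dq[OF zb] order_trans by blast
      show ?thesis unfolding eq C8_def distrib_right[of _ _ "z ^ 3"] by (rule order_trans[OF abs_triangle_ineq add_mono[OF p1 p2]])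
    qed
  qed (use s e0 C8 in auto)
  have sum_bound: "\<bar>x\<^sup>2 + 2 * y\<bar> \<le> p + 2 * q" if "x\<^sup>2 \<le> p'" "p' \<le> p" "\<bar>y\<bar> \<le> q" for x y p p' q :: real
    using that zero_le_power2[of x] by linarith
  have fin: "\<bar>(e s)\<^sup>2 - (1 + s ^ 3 / 3 * M)\<bar> \<le> (C6\<^sup>2 + 2 * C8) * s ^ 4" if s: "s \<in> {0<..<b}" for s
  proof -
    have sc: "s \<in> {0<..b}" and s1: "0 < s" "s \<le> 1" using s b by auto
    have "(e s)\<^sup>2 - (1 + s ^ 3 / 3 * M) = (e s - 1)\<^sup>2 + 2 * (e s - 1 - M * s ^ 3 / 6)"
      by (simp add: power2_eq_square algebra_simps)
    moreover have "(e s - 1)\<^sup>2 \<le> (C6 * s ^ 3)\<^sup>2"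
      by (rule power2_le_iff_abs_le[THEN iffD2]) (use e3[OF sc] C6 s1 in auto)
    moreover have "(C6 * s ^ 3)\<^sup>2 \<le> C6\<^sup>2 * s ^ 4"
      unfolding power_mult_distrib power_mult[symmetric] using s1 by (intro mult_left_mono power_decreasing) auto
    moreover have "\<bar>e s - 1 - M * s ^ 3 / 6\<bar> \<le> C8 * s ^ 4" using e4[OF sc] by simp
    moreover have "0 \<le> (e s - 1)\<^sup>2" by simp
    ultimately have "\<bar>(e s)\<^sup>2 - (1 + s ^ 3 / 3 * M)\<bar> \<le> C6\<^sup>2 * s ^ 4 + 2 * (C8 * s ^ 4)"
      using sum_bound by metis
    then show ?thesis by (simp add: algebra_simps)
  qed
  show ?thesis
    by (intro exI[of _ b] exI[of _ "C6\<^sup>2 + 2 * C8"]) (use b fin in \<open>auto simp: e_def\<close>)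
qed

end

section \<open>Asymptotic hyperbolicity\<close>

text \<open>The given cutoff already falls smoothly from 1 to 0; extended by 1 to negative arguments
  and reparametrized by an affine map, it yields a cutoff for any other interval.\<close>

lemma cutoff_exists:
  fixes c :: "real \<Rightarrow> real"
  assumes sm: "smooth_on {0..} c" and range: "\<And>s. 0 \<le> s \<Longrightarrow> 0 \<le> c s \<and> c s \<le> 1"
    and one: "\<And>s. 0 \<le> s \<Longrightarrow> s < A \<Longrightarrow> c s = 1" and zero: "\<And>s. B \<le> s \<Longrightarrow> c s = 0"
    and A: "0 < A" and \<alpha>\<beta>: "\<alpha> < \<beta>"
  shows "\<exists>\<kappa> :: real \<Rightarrow> real. (\<forall>k. Ck_on k UNIV \<kappa>) \<and> (\<forall>r. 0 \<le> \<kappa> r \<and> \<kappa> r \<le> 1) \<and> (\<forall>r\<le>\<alpha>. \<kappa> r = (1::real)) \<and> (\<forall>r\<ge>\<beta>. \<kappa> r = 0)"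
proof -
  define d where "d s = (if s < A then 1 else c s)" for s
  have Cd: "Ck_on k UNIV d" for k
  proof (rule Ck_on_local)
    fix s :: real
    show "\<exists>W. open W \<and> s \<in> W \<and> Ck_on k W d"
    proof (cases "s < A")
      case True
      have "Ck_on k {..<A} d"
        by (subst Ck_on_cong[where g="\<lambda>_. 1"]) (auto simp: d_def Ck_on_const)
      then show ?thesis using True by (intro exI[of _ "{..<A}"]) auto
    next
      case False
      then have s: "s \<in> {0..}" using A by simp
      obtain W F where W: "open W" "s \<in> W" "\<And>k. Ck_on k W F" "\<And>y. y \<in> {0..} \<inter> W \<Longrightarrow> F y = c y"
        using bspec[OF sm[unfolded smooth_on_def] s] by (elim exE conjE) auto
      have "Ck_on k (W \<inter> {0<..}) d"
        by (subst Ck_on_cong[where g=F])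
           (use W one in \<open>auto simp: d_def intro: Ck_on_subset\<close>)
      then show ?thesis using W False A by (intro exI[of _ "W \<inter> {0<..}"]) auto
    qed
  qed
  have AB: "A / 2 < B"
  proof (rule ccontr)
    assume "\<not> ?thesis"
    then show False using one[of "A / 2"] zero[of "A / 2"] A by simp
  qed
  have d0: "d s = 0" if "B \<le> s" for s
  proof (cases "s < A")
    case True
    then show ?thesis using one[of s] zero[OF that] AB A that by simp
  qed (use zero[OF that] in \<open>simp add: d_def\<close>)
  \<comment> \<open>The increasing affine map from \<alpha> to A / 2 and from \<beta> to B. The
    value A / 2 rather than A is certain to lie below B.\<close>
  define m where "m r = A / 2 + (r - \<alpha>) * ((B - A / 2) / (\<beta> - \<alpha>))" for r
  have sl: "0 < (B - A / 2) / (\<beta> - \<alpha>)" using AB \<alpha>\<beta> by simp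
  have "Ck_on k UNIV (\<lambda>r. d (m r))" for k
    unfolding m_def
    by (rule Ck_on_compose[OF open_UNIV open_UNIV subset_UNIV Cd])
       (intro Ck_on_add Ck_on_mult Ck_on_diff Ck_on_const Ck_on_ident open_UNIV)
  moreover have "0 \<le> d s \<and> d s \<le> 1" for s using range[of s] A by (auto simp: d_def)
  moreover have "d (m r) = 1" if "r \<le> \<alpha>" for r
  proof -
    have "(r - \<alpha>) * ((B - A / 2) / (\<beta> - \<alpha>)) \<le> 0" using that sl by (intro mult_nonpos_nonneg) auto
    then show ?thesis using A by (simp add: d_def m_def)
  qed
  moreover have "d (m r) = 0" if "\<beta> \<le> r" for r
  proof (rule d0)
    have "(\<beta> - \<alpha>) * ((B - A / 2) / (\<beta> - \<alpha>)) \<le> (r - \<alpha>) * ((B - A / 2) / (\<beta> - \<alpha>))"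
      using that sl by (intro mult_right_mono) auto
    then show "B \<le> m r" using \<alpha>\<beta> by (simp add: m_def)
  qed
  ultimately show ?thesis by (intro exI[of _ "\<lambda>r. d (m r)"]) auto
qed

lemma Basis_3_nonneg: "i \<in> Basis \<Longrightarrow> 0 \<le> (i :: real^3) $ 1"
  by (auto simp: Basis_vec_def axis_def)

text \<open>A metric that is anti-de Sitter-Schwarzschild outside a ball and dominates the
  hyperbolic one everywhere. The assumption on cutoffs is later supplied by
  \<open>cutoff_exists\<close>, applied to the given \<open>chi\<close>.\<close>

locale adss_filling = adss_collar +
  fixes \<phi> :: "real^3 \<Rightarrow> real" and t0 :: real
  assumes phi_C2: "Ck_on 2 hyp_space \<phi>" and phi_gt: "\<And>x. x \<in> hyp_space \<Longrightarrow> 1 < \<phi> x"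
    and t0: "dom t0" and phi_ext: "\<And>x. x \<in> hyp_space \<Longrightarrow> t0 \<le> hyp_rho x \<Longrightarrow> \<phi> x = adss_phi M (hyp_rho x)"
    and cutoff: "\<And>\<alpha> \<beta>. \<alpha> < \<beta> \<Longrightarrow>
      \<exists>\<kappa> :: real \<Rightarrow> real. (\<forall>k. Ck_on k UNIV \<kappa>) \<and> (\<forall>r. 0 \<le> \<kappa> r \<and> \<kappa> r \<le> 1) \<and> (\<forall>r\<le>\<alpha>. \<kappa> r = (1::real)) \<and> (\<forall>r\<ge>\<beta>. \<kappa> r = 0)"
begin

abbreviation g where "g \<equiv> conformal \<phi> hyp_metric"

definition F where "F x = \<phi> x ^ 4 * (4 / (1 - x \<bullet> x)\<^sup>2)"

lemma g_eq: "g x = F x *\<^sub>R mat 1"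
  by (simp add: conformal_def hyp_metric_def F_def power2_norm_eq_inner)

lemma Ck_F: "Ck_on 2 hyp_space F"
  unfolding F_def[abs_def]
  by (intro Ck_on_mult Ck_on_power Ck_on_divide Ck_on_diff Ck_on_inner Ck_on_const Ck_on_ident open_hyp_space phi_C2)
     (auto simp: hyp_space_iff)

lemma F_ge: assumes "x \<in> hyp_space" shows "4 / (1 - x \<bullet> x)\<^sup>2 \<le> F x"
proof -
  have "1 \<le> \<phi> x ^ 4" using phi_gt[OF assms] by (intro one_le_power) auto
  then have "1 * (4 / (1 - x \<bullet> x)\<^sup>2) \<le> \<phi> x ^ 4 * (4 / (1 - x \<bullet> x)\<^sup>2)" by (intro mult_right_mono) auto
  then show ?thesis by (simp add: F_def)
qed

lemma F_pos: assumes "x \<in> hyp_space" shows "0 < F x"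
proof -
  have "0 < 4 / (1 - x \<bullet> x)\<^sup>2" using assms by (simp add: hyp_space_iff)
  then show ?thesis using F_ge[OF assms] by linarith
qed

lemma g_complete: "riem_complete hyp_space g"
proof -
  interpret conf_complete g F
    by unfold_locales (use g_eq F_ge Ck_on_imp_continuous_on[OF Ck_F] in auto)
  show ?thesis by (rule complete)
qed

lemma g_C2: "Ck_on 2 hyp_space g"
proof -
  have "Ck_on 2 hyp_space (\<lambda>x. F x *\<^sub>R (mat 1 :: real^3^3))"
    by (intro Ck_on_scaleR open_hyp_space Ck_F Ck_on_const)
  then show ?thesis using Ck_on_cong[where f=g and g="\<lambda>x. F x *\<^sub>R mat 1", OF open_hyp_space g_eq] by blast
qed

lemma pos_def_mat: "0 < c \<Longrightarrow> pos_def_sym (c *\<^sub>R mat 1 :: real^3^3)"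
  unfolding pos_def_sym_def by (simp add: transpose_scalar mat_1_mult)

text \<open>Beyond this Euclidean radius two things hold: h = - ln r is below \<open>d\<close>, so
  the collar coordinate is defined, and the metric is the model.\<close>

definition r0 where "r0 = max (exp (- d)) (tau_of_rho t0)"

lemma d_pos: "0 < d" using good by (simp add: good_def)

lemma r0: "0 < r0" "r0 < 1" "exp (- d) \<le> r0" "tau_of_rho t0 \<le> r0"
  using d_pos tau_of_rho_less_1[of t0] by (auto simp: r0_def less_max_iff_disj)

definition \<beta> where "\<beta> = (1 + r0) / 2"
definition \<alpha> where "\<alpha> = (r0 + \<beta>) / 2"

lemma ab: "r0 < \<alpha>" "\<alpha> < \<beta>" "\<beta> < 1" "0 < \<alpha>" "0 < \<beta>"
  using r0(1,2) by (simp_all add: \<alpha>_def \<beta>_def field_simps add_pos_pos)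

definition \<kappa> where "\<kappa> = (SOME \<kappa>. (\<forall>k. Ck_on k UNIV \<kappa>) \<and> (\<forall>r. 0 \<le> \<kappa> r \<and> \<kappa> r \<le> 1) \<and>
   (\<forall>r\<le>\<alpha>. \<kappa> r = (1::real)) \<and> (\<forall>r\<ge>\<beta>. \<kappa> r = 0))"

lemma kappa: "Ck_on k UNIV \<kappa>" "0 \<le> \<kappa> r" "\<kappa> r \<le> 1" "r \<le> \<alpha> \<Longrightarrow> \<kappa> r = 1" "\<beta> \<le> r \<Longrightarrow> \<kappa> r = 0"
  using someI_ex[OF cutoff[OF ab(2)], folded \<kappa>_def] by blast+

text \<open>The geodesic defining function in terms of the Euclidean radius. It is blended into the
  constant 1 between \<alpha> and \<beta>, which also avoids the singularity of the norm at the
  centre.\<close>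

definition \<theta> where "\<theta> r = tt (- ln r)"
definition \<Theta> where "\<Theta> r = \<kappa> r + (1 - \<kappa> r) * \<theta> r"
definition tf :: "real^3 \<Rightarrow> real" where "tf x = \<Theta> (norm x)"

lemma ln_range: assumes "r0 < r" "r < exp d" shows "- ln r \<in> {-d<..<d}" "- ln r \<in> {-d..d}" "0 < r"
proof -
  have r: "exp (- d) < r" "0 < r" using assms r0 by auto
  have "ln (exp (- d)) < ln r" "ln r < ln (exp d)" using r assms by (auto intro: ln_less_cancel_iff[THEN iffD2] simp del: ln_exp)
  then show "- ln r \<in> {-d<..<d}" "- ln r \<in> {-d..d}" "0 < r" using r by auto
qed

lemma exp_d: "1 < exp d" using d_pos by simp

lemma Ck_mln: "Ck_on k {0<..} (\<lambda>r::real. - ln r)"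
  by (intro Ck_on_minus Ck_on_ln open_greaterThan)

text \<open>The range reaches beyond the unit sphere because the profile continues to negative h;
  smoothness up to the boundary is thereby smoothness on an open set.\<close>

lemma Ck_theta: "Ck_on k {r0<..<exp d} \<theta>"
  unfolding \<theta>_def[abs_def]
  by (rule Ck_on_compose[OF _ _ _ Ck_tt Ck_on_subset[OF Ck_mln]]) (use ln_range r0 in auto)

lemma theta_pos: assumes "r0 < r" "r < 1" shows "0 < \<theta> r"
  using tt_0_iff(1)[of "- ln r"] ln_range[of r] assms exp_d by (simp add: \<theta>_def)

lemma theta_1: "\<theta> 1 = 0" by (simp add: \<theta>_def at_0)

lemma theta_deriv: assumes "r0 < r" "r < exp d"
  shows "(\<theta> has_real_derivative - EE (- ln r) / r) (at r)"
proof -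
  have "((\<lambda>r. - ln r) has_real_derivative - (1 / r)) (at r)"
    using ln_range(3)[OF assms] by (auto intro!: derivative_eq_intros)
  from DERIV_chain2[where f=tt and g="\<lambda>r. - ln r", OF tt_deriv[OF ln_range(2)[OF assms]] this]
  show ?thesis by (simp add: \<theta>_def[abs_def])
qed

lemma Theta_eq: "\<beta> \<le> r \<Longrightarrow> \<Theta> r = \<theta> r" "r \<le> \<alpha> \<Longrightarrow> \<Theta> r = 1"
  by (simp_all add: \<Theta>_def kappa)

lemma Theta_pos: assumes "r < 1" shows "0 < \<Theta> r"
proof (cases "r \<le> \<alpha>")
  case True
  then show ?thesis by (simp add: Theta_eq)
next
  case False
  then have t: "0 < \<theta> r" using theta_pos assms ab by simp
  show ?thesis
  proof (cases "\<kappa> r = 0")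
    case True
    then show ?thesis using t by (simp add: \<Theta>_def)
  next
    case False
    then have "0 < \<kappa> r" using kappa(2)[of r] by simp
    then show ?thesis unfolding \<Theta>_def using kappa(3)[of r] t by (intro add_pos_nonneg mult_nonneg_nonneg) auto
  qed
qed

lemma Ck_Theta: "Ck_on k {r0<..<exp d} \<Theta>"
  unfolding \<Theta>_def[abs_def]
  by (intro Ck_on_add Ck_on_mult Ck_on_diff Ck_on_const Ck_theta Ck_on_subset[OF kappa(1)]) auto

lemma open_norm: "open T \<Longrightarrow> open {x::real^3. norm x \<in> T}"
  using open_vimage[of T "norm :: real^3 \<Rightarrow> real"] by (simp add: vimage_def continuous_on_norm_id)

lemma open_annulus: "open {x::real^3. p < norm x \<and> norm x < q}"
  using open_norm[of "{p<..<q}"] by simp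

lemma Ck_tf: "Ck_on k (ball 0 (exp d)) tf"
proof (rule Ck_on_local)
  fix x :: "real^3" assume x: "x \<in> ball 0 (exp d)"
  show "\<exists>W. open W \<and> x \<in> W \<and> Ck_on k W tf"
  proof (cases "norm x < \<alpha>")
    case True
    have "Ck_on k (ball 0 \<alpha>) tf"
      by (subst Ck_on_cong[where g="\<lambda>_. 1"]) (auto simp: tf_def Theta_eq Ck_on_const)
    then show ?thesis using True by (intro exI[of _ "ball 0 \<alpha>"]) auto
  next
    case False
    have "Ck_on k {x. norm x \<in> {r0<..<exp d}} tf"
      unfolding tf_def[abs_def]
      by (rule Ck_on_compose[OF _ _ _ Ck_Theta Ck_on_subset[OF Ck_on_norm]]) (use r0 in \<open>auto intro!: open_annulus\<close>)
    then show ?thesis using False x ab by (intro exI[of _ "{x. norm x \<in> {r0<..<exp d}}"]) (auto intro!: open_annulus)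
  qed
qed

lemma tf_smooth: "\<forall>(U, c)\<in>ball_atlas. smooth_on (c ` U) (tf \<circ> inv_into U c)"
  unfolding atlas_iff
proof
  fix b
  show "smooth_on (chart b ` chart_dom b) (tf \<circ> inv_into (chart_dom b) (chart b))"
  proof (rule smooth_onI)
    let ?W = "- {pole} \<inter> param b -` ball 0 (exp d)"
    show W: "open ?W"
      by (rule continuous_open_preimage[OF Ck_on_imp_continuous_on[OF Ck_param[of 0]]]) auto
    show "chart b ` chart_dom b \<subseteq> ?W"
    proof
      fix y assume "y \<in> chart b ` chart_dom b"
      then have y: "y \<in> half_space" by (simp add: chart_image)
      then have "norm (param b y) \<le> 1" using param_dom[OF y, of b] chart_dom_cball[of b] by auto
      then have "norm (param b y) < exp d" using exp_d by linarith
      then show "y \<in> ?W" using half_space_neq_pole[OF y] by auto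
    qed
    show "Ck_on k ?W (\<lambda>y. tf (param b y))" for k
      by (rule Ck_on_compose[OF W _ _ Ck_tf Ck_on_subset[OF Ck_param]]) auto
    show "tf (param b y) = (tf \<circ> inv_into (chart_dom b) (chart b)) y" if "y \<in> chart b ` chart_dom b" for y
      using inv_chart[of y b] that by (simp add: chart_image)
  qed
qed

lemma tf_pos: "x \<in> hyp_space \<Longrightarrow> 0 < tf x"
  by (simp add: tf_def hyp_space_norm Theta_pos)

lemma tf_boundary: "x \<in> sphere 0 1 \<Longrightarrow> tf x = 0"
  using ab by (simp add: tf_def Theta_eq theta_1)

lemma F_ext: assumes x: "x \<in> hyp_space" "r0 < norm x"
  shows "F x = 1 / (UU (- ln (norm x)) * norm x)\<^sup>2"
proof -
  have n: "0 < norm x" "norm x < 1" using x r0 by (auto simp: hyp_space_norm)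
  have "tau_of_rho t0 < tau_of_rho (hyp_rho x)"
    unfolding hyp_rho_def using tau_rho[of "norm x"] n x r0 by simp
  then have t: "t0 \<le> hyp_rho x" using tau_of_rho_mono[of "hyp_rho x" t0] by force
  show ?thesis unfolding F_def phi_ext[OF x(1) t]
    using phi4[OF n] dom_mono[OF t0 t] by (simp add: hyp_rho_def power2_norm_eq_inner)
qed

text \<open>In the chart the rescaled metric is (tt / UU)^2 / |x|^2 times the conformal factor
  \<open>m\<close> of the parametrization, and each factor extends across the boundary. On the
  boundary only \<open>m\<close> remains, and the gradient of \<open>tf\<close> is - p, so |dt| = 1
  reduces to the sum formula of \<open>param_deriv\<close>.\<close>

lemma boundary_chart:
  assumes p: "p \<in> chart_dom b" "norm p = 1"
  defines "k \<equiv> inv_into (chart_dom b) (chart b)"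
  shows "\<exists>W Gbar. open W \<and> chart b p \<in> W \<and> Ck_on 3 W Gbar \<and>
     (\<forall>y\<in>W \<inter> chart b ` chart_dom b. 0 < y $ 1 \<longrightarrow> Gbar y = (tf (k y))\<^sup>2 *\<^sub>R pullback k g y) \<and>
     pos_def_sym (Gbar (chart b p)) \<and>
     (\<Sum>i\<in>UNIV. \<Sum>j\<in>UNIV. ginv Gbar (chart b p) $ i $ j *
       frechet_derivative (tf \<circ> k) (at (chart b p) within half_space) (axis i 1) *
       frechet_derivative (tf \<circ> k) (at (chart b p) within half_space) (axis j 1)) = 1"
proof -
  obtain D where D: "\<And>k. Ck_on k {-d<..<d} D" "D 0 = 1" "\<And>h. h \<in> {-d<..<d} \<Longrightarrow> tt h = UU h * D h"
    using quotient by blast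
  define m where "m y = (2 / ((y - pole) \<bullet> (y - pole)))\<^sup>2" for y :: "real^3"
  define G where "G y = (D (- ln (norm (param b y))) / norm (param b y))\<^sup>2 * m y" for y
  define W where "W = - {pole} \<inter> param b -` {x. norm x \<in> {\<beta><..<exp d}}"
  have W: "open W" unfolding W_def
    by (rule continuous_open_preimage[OF Ck_on_imp_continuous_on[OF Ck_param[of 0]]]) (auto intro!: open_annulus)
  have cp: "chart b p \<in> half_space" by (rule chart_half_space[OF p(1)])
  have cp0: "chart b p $ 1 = 0" using chart_1[OF p(1)] p(2) by simp
  have cpn: "chart b p \<noteq> pole" by (rule half_space_neq_pole[OF cp])
  have pc: "param b (chart b p) = p" by (rule param_chart[OF p(1)])
  have kp: "k y = param b y" if "y \<in> half_space" for y unfolding k_def by (rule inv_chart[OF that])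
  have mpos: "0 < m y" if "y \<noteq> pole" for y using that by (simp add: m_def)
  have CG: "Ck_on k W G" for k
  proof -
    have P: "Ck_on k W (param b)" by (rule Ck_on_subset[OF Ck_param]) (auto simp: W_def)
    have N: "Ck_on k W (\<lambda>y. norm (param b y))"
      by (rule Ck_on_compose[OF W _ _ Ck_on_norm P]) (use ab in \<open>auto simp: W_def\<close>)
    have L: "Ck_on k W (\<lambda>y. - ln (norm (param b y)))"
      by (rule Ck_on_compose[OF W _ _ Ck_mln N]) (use ab in \<open>auto simp: W_def\<close>)
    have "Ck_on k W (\<lambda>y. D (- ln (norm (param b y))))"
    proof (rule Ck_on_compose[OF W _ _ D(1) L])
      show "(\<lambda>y. - ln (norm (param b y))) ` W \<subseteq> {-d<..<d}"
        using ln_range(1) ab by (force simp: W_def)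
    qed auto
    moreover have "Ck_on k W m" unfolding m_def[abs_def]
      by (intro Ck_on_power Ck_on_divide Ck_on_inner Ck_on_diff Ck_on_const Ck_on_ident W) (auto simp: W_def)
    ultimately show ?thesis unfolding G_def[abs_def]
      by (intro Ck_on_mult Ck_on_power Ck_on_divide N W) (use ab in \<open>auto simp: W_def\<close>)
  qed
  define Gbar where "Gbar y = G y *\<^sub>R (mat 1 :: real^3^3)" for y
  have Gcp: "G (chart b p) = m (chart b p)" by (simp add: G_def pc p D)
  have cW: "chart b p \<in> W" using cpn pc p ab exp_d by (simp add: W_def)
  have metric: "Gbar y = (tf (k y))\<^sup>2 *\<^sub>R pullback k g y" if y: "y \<in> W" "0 < y $ 1" for y
  proof -
    have yh: "y \<in> half_space" using y by (simp add: half_space_def)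
    have yn: "y \<noteq> pole" by (rule half_space_neq_pole[OF yh])
    obtain E where E: "(param b has_derivative E) (at y)" "\<And>v v'. E v \<bullet> E v' = m y * (v \<bullet> v')"
      using param_deriv[OF yn, of b] unfolding m_def by metis
    have op: "open {y::real^3. 0 < y $ 1}" by (intro open_Collect_less continuous_intros)
    have kd: "(k has_derivative E) (at y)"
      by (rule has_derivative_transform_within_open[OF E(1) op]) (use y kp in \<open>auto simp: half_space_def\<close>)
    define r where "r = norm (param b y)"
    have r: "\<beta> < r" "r < 1" using y(1) param_norm_less(1)[OF yn, of b] y(2) by (auto simp: W_def r_def)
    have lr: "- ln r \<in> {-d<..<d}" "0 < - ln r" using ln_range(1)[of r] r ab exp_d by auto
    have gk: "g (k y) = F (k y) *\<^sub>R mat 1" by (rule g_eq)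
    have "pullback k g y = (F (k y) * m y) *\<^sub>R mat 1"
      by (rule pullback_conf(2)[where \<Phi>=k and g=g, OF kd gk E(2)])
    moreover have "F (k y) = 1 / (UU (- ln r) * r)\<^sup>2"
      unfolding kp[OF yh] r_def by (rule F_ext) (use r ab in \<open>auto simp: r_def hyp_space_norm\<close>)
    moreover have "tf (k y) = UU (- ln r) * D (- ln r)"
      unfolding kp[OF yh] tf_def r_def[symmetric] using r D(3)[OF lr(1)] by (simp add: Theta_eq \<theta>_def)
    moreover have "UU (- ln r) > 0"
      using UU_pos[of "- ln r"] lr good hm_pos by (auto simp: good_def)
    ultimately show ?thesis unfolding Gbar_def G_def r_def[symmetric]
      by (simp add: power_mult_distrib power_divide)
  qed
  have gi: "ginv Gbar (chart b p) $ i $ j = (if i = j then 1 / m (chart b p) else 0)" for i j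
    unfolding ginv_def Gbar_def Gcp using mpos[OF cpn] by (simp add: matrix_inv_scaleR_mat) (simp add: mat_def)
  obtain E where E: "(param b has_derivative E) (at (chart b p))"
    "\<And>z. norm z = 1 \<Longrightarrow> (\<Sum>i\<in>UNIV. (z \<bullet> E (axis i 1))\<^sup>2) = m (chart b p)"
    using param_deriv[OF cpn, of b] unfolding m_def by metis
  have p0: "p \<noteq> 0" using p by auto
  \<comment> \<open>The value -1 is - EE 0 / 1: the normalization of \<open>YY\<close> makes the
    defining function have unit slope at the boundary.\<close>
  have Td: "(\<Theta> has_real_derivative - 1) (at (norm p))"
  proof -
    have "(\<theta> has_real_derivative - 1) (at (norm p))"
      using theta_deriv[of 1] r0 exp_d p by (simp add: at_0)
    then show ?thesis
      by (rule has_field_derivative_transform_within_open[where S="{\<beta><..}"]) (use p ab in \<open>auto simp: Theta_eq\<close>)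
  qed
  have "(tf has_derivative (\<lambda>v. - 1 * ((p \<bullet> v) / norm p))) (at p)"
    using has_derivative_compose[OF norm_has_derivative_real[OF p0] Td[unfolded has_field_derivative_def]]
    unfolding tf_def[abs_def] .
  then have "(tf has_derivative (\<lambda>v. - (p \<bullet> v))) (at (param b (chart b p)))" unfolding pc by (simp add: p)
  from has_derivative_compose[OF E(1) this]
  have f1: "((\<lambda>y. tf (param b y)) has_derivative (\<lambda>v. - (p \<bullet> E v))) (at (chart b p) within half_space)"
    by (rule has_derivative_at_withinI)
  have f2: "((tf \<circ> k) has_derivative (\<lambda>v. - (p \<bullet> E v))) (at (chart b p) within half_space)"
    by (rule has_derivative_transform[OF cp _ f1]) (simp add: kp)
  then have f3: "((tf \<circ> k) has_derivative frechet_derivative (tf \<circ> k) (at (chart b p) within half_space)) (at (chart b p) within half_space)"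
    using frechet_derivative_works differentiable_def by blast
  \<comment> \<open>A derivative within the half-space is unique because from a boundary point every
    positive basis direction stays in the half-space.\<close>
  have dt: "frechet_derivative (tf \<circ> k) (at (chart b p) within half_space) = (\<lambda>v. - (p \<bullet> E v))"
  proof (rule frechet_derivative_unique_within[OF f3 f2])
    fix i :: "real^3" and e :: real assume "i \<in> Basis" "0 < e"
    then show "\<exists>d. 0 < \<bar>d\<bar> \<and> \<bar>d\<bar> < e \<and> chart b p + d *\<^sub>R i \<in> half_space"
      using Basis_3_nonneg[of i] cp0 by (intro exI[of _ "e / 2"]) (auto simp: half_space_def)
  qed
  have "(\<Sum>i\<in>UNIV. \<Sum>j\<in>UNIV. ginv Gbar (chart b p) $ i $ j * (- (p \<bullet> E (axis i 1))) * (- (p \<bullet> E (axis j 1))))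
     = (\<Sum>i\<in>UNIV. (1 / m (chart b p)) * (p \<bullet> E (axis i 1))\<^sup>2)"
    unfolding gi by (intro sum.cong refl) (simp add: if_distrib[of "\<lambda>x. x * _"] power2_eq_square cong: if_cong)
  also have "\<dots> = 1" unfolding sum_distrib_left[symmetric] E(2)[OF p(2)] using mpos[OF cpn] by simp
  finally have sum1: "(\<Sum>i\<in>UNIV. \<Sum>j\<in>UNIV. ginv Gbar (chart b p) $ i $ j * (- (p \<bullet> E (axis i 1))) * (- (p \<bullet> E (axis j 1)))) = 1" .
  have "Ck_on 3 W Gbar" unfolding Gbar_def[abs_def] by (intro Ck_on_scaleR W CG Ck_on_const)
  moreover have "pos_def_sym (Gbar (chart b p))"
    unfolding Gbar_def Gcp by (rule pos_def_mat[OF mpos[OF cpn]])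
  ultimately show ?thesis
    using W cW metric sum1 unfolding dt by (intro exI[of _ W] exI[of _ Gbar]) blast
qed

text \<open>The collar map keeps the direction and sends radius 1 + s to the radius where the
  defining function equals s. The induced spheres carry EE^2 times the round metric, so by
  \<open>EE_expansion\<close> the tensor in the normal form is M times the identity.\<close>

lemma collar_exists:
  "\<exists>t0>0. \<exists>\<Phi>. collar_diffeo ball_top ball_atlas (sphere 0 1) t0 \<Phi> \<and>
     (\<forall>x\<in>shell t0. tf (\<Phi> x) = norm x - 1) \<and> collar_normal_form t0 (pullback \<Phi> g)"
proof -
  obtain \<eta> where \<eta>: "\<And>h. h \<in> {-d..d} \<Longrightarrow> \<eta> (tt h) = h"
    "\<And>s. s \<in> {-t1<..<t1} \<Longrightarrow> \<eta> s \<in> {-d<..<d}" "\<And>s. s \<in> {-t1<..<t1} \<Longrightarrow> tt (\<eta> s) = s"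
    "\<And>s. s \<in> {-t1<..<t1} \<Longrightarrow> (\<eta> has_real_derivative 1 / EE (\<eta> s)) (at s)"
    "\<And>k. Ck_on k {-t1<..<t1} \<eta>"
    using inverse by blast
  have \<eta>0: "\<eta> 0 = 0" using \<eta>(1)[of 0] d_pos by (simp add: at_0)
  have \<eta>pos: "0 < \<eta> s" if "s \<in> {0<..<t1}" for s
    using tt_0_iff(1)[of "\<eta> s"] \<eta>(2)[of s] \<eta>(3)[of s] that by auto
  have \<eta>nn: "0 \<le> \<eta> s" if "s \<in> {0..<t1}" for s
    using \<eta>pos[of s] that \<eta>0 by (cases "s = 0") auto
  obtain t2 K where t2: "0 < t2" "t2 < t1" "\<And>s. s \<in> {0<..<t2} \<Longrightarrow> \<bar>(EE (\<eta> s))\<^sup>2 - (1 + s ^ 3 / 3 * M)\<bar> \<le> K * s ^ 4"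
    using EE_expansion[OF \<eta>(2-4) \<eta>0 \<eta>pos] by blast
  have "isCont \<eta> 0" using DERIV_isCont[OF \<eta>(4)[of 0]] t1_pos by auto
  moreover have lnb: "0 < - ln \<beta>" using ab by simp
  ultimately obtain e where e: "0 < e" "\<And>s. \<bar>s\<bar> < e \<Longrightarrow> \<bar>\<eta> s\<bar> < - ln \<beta>"
    unfolding continuous_at_eps_delta by (metis \<eta>0 diff_zero dist_real_def)
  \<comment> \<open>Below \<open>e\<close> the image lies outside radius \<beta>, where
    \<open>tf\<close> is the geodesic defining function; below \<open>t2\<close> the expansion of
    \<open>EE\<close> is available.\<close>
  define s0 where "s0 = min t2 e"
  have s0: "0 < s0" "s0 \<le> t2" "s0 < t1" "s0 \<le> e" using t2 e by (auto simp: s0_def)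
  define \<Phi> :: "real^3 \<Rightarrow> real^3" where "\<Phi> x = (exp (- \<eta> (norm x - 1)) / norm x) *\<^sub>R x" for x
  define \<Psi> :: "real^3 \<Rightarrow> real^3" where "\<Psi> x = ((1 + \<theta> (norm x)) / norm x) *\<^sub>R x" for x
  \<comment> \<open>Radii below 1 are included so that smoothness on the shell, which contains its
    inner boundary, comes from an open set.\<close>
  define S where "S = {x::real^3. norm x - 1 \<in> {-t1<..<t1} \<inter> {-1<..}}"
  have S: "open S" "\<And>x. x \<in> S \<Longrightarrow> x \<noteq> 0"
  proof -
    have "S = {x. max (1 - t1) 0 < norm x \<and> norm x < 1 + t1}" by (auto simp: S_def)
    then show "open S" by (simp only: open_annulus)
    show "x \<noteq> 0" if "x \<in> S" for x using that by (auto simp: S_def)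
  qed
  have shS: "shell s0 \<subseteq> S" using s0 t1_pos by (auto simp: S_def shell_def)
  define O1 where "O1 = {x::real^3. norm x \<in> {\<beta><..<exp d}}"
  have O1: "open O1" unfolding O1_def by (rule open_norm) auto
  have O1n: "x \<noteq> 0" if "x \<in> O1" for x using that ab by (auto simp: O1_def)
  have C\<Phi>: "Ck_on k S \<Phi>" for k
  proof -
    have N: "Ck_on k S norm" by (rule Ck_on_subset[OF Ck_on_norm]) (use S in auto)
    have "Ck_on k S (\<lambda>x. \<eta> (norm x - 1))"
      by (rule Ck_on_compose[OF S(1) _ _ \<eta>(5)]) (auto simp: S_def[symmetric] intro!: Ck_on_diff S N Ck_on_const, auto simp: S_def)
    then show ?thesis unfolding \<Phi>_def[abs_def] using S(2)
      by (intro Ck_on_scaleR Ck_on_divide S(1) N Ck_on_ident Ck_on_compose[OF S(1) _ _ Ck_on_exp] Ck_on_minus) auto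
  qed
  have C\<Psi>: "Ck_on k O1 \<Psi>" for k
  proof -
    have N: "Ck_on k O1 norm" by (rule Ck_on_subset[OF Ck_on_norm]) (use O1n in auto)
    have "Ck_on k O1 (\<lambda>x. \<theta> (norm x))"
      by (rule Ck_on_compose[OF O1 _ _ Ck_theta N]) (use ab in \<open>auto simp: O1_def\<close>)
    then show ?thesis unfolding \<Psi>_def[abs_def] using O1n
      by (intro Ck_on_scaleR Ck_on_divide O1 N Ck_on_ident Ck_on_add Ck_on_const) auto
  qed
  define I where "I = {x \<in> cball (0::real^3) 1. \<beta> < norm x \<and> \<theta> (norm x) < s0}"
  have IO1: "I \<subseteq> O1" using le_less_trans[OF _ exp_d] by (auto simp: I_def O1_def)
  have shell: "\<Phi> x \<in> I" "\<Psi> (\<Phi> x) = x" "tf (\<Phi> x) = norm x - 1" "norm (\<Phi> x) = exp (- \<eta> (norm x - 1))"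
    if x: "x \<in> shell s0" for x
  proof -
    define s where "s = norm x - 1"
    have s: "s \<in> {0..<s0}" "s \<in> {-t1<..<t1}" using x s0 t1_pos by (auto simp: s_def shell_def)
    have x0: "x \<noteq> 0" using x by (auto simp: shell_def)
    show n: "norm (\<Phi> x) = exp (- \<eta> (norm x - 1))" using x0 by (simp add: \<Phi>_def)
    have "\<bar>\<eta> s\<bar> < - ln \<beta>" using e(2)[of s] s s0 by auto
    then have nb: "\<beta> < norm (\<Phi> x)"
      using exp_less_mono[of "ln \<beta>" "- \<eta> s"] ab unfolding n s_def[symmetric] by simp
    have th: "\<theta> (norm (\<Phi> x)) = s" unfolding n s_def[symmetric] using \<eta>(3)[OF s(2)] by (simp add: \<theta>_def)
    show "\<Phi> x \<in> I" using nb th s \<eta>nn[of s] s0 by (auto simp: I_def n s_def[symmetric])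
    show "tf (\<Phi> x) = norm x - 1" using nb th by (simp add: tf_def Theta_eq s_def)
    have "\<Psi> (\<Phi> x) = ((1 + s) / norm (\<Phi> x)) *\<^sub>R \<Phi> x" by (simp only: \<Psi>_def th)
    then show "\<Psi> (\<Phi> x) = x" unfolding n using x0 by (simp add: \<Phi>_def s_def)
  qed
  have inner: "\<Psi> x \<in> shell s0" "\<Phi> (\<Psi> x) = x" if x: "x \<in> I" for x
  proof -
    have r: "\<beta> < norm x" "norm x \<le> 1" "r0 < norm x" "norm x < exp d"
      using x ab le_less_trans[OF _ exp_d] by (auto simp: I_def)
    have lr: "- ln (norm x) \<in> {-d..d}" "0 < norm x" using ln_range[OF r(3,4)] by auto
    have th0: "0 \<le> \<theta> (norm x)" unfolding \<theta>_def using tt_0_iff(2)[OF lr(1)] r(2) lr(2) by simp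
    have n: "norm (\<Psi> x) = 1 + \<theta> (norm x)" using lr(2) th0 by (simp add: \<Psi>_def)
    show "\<Psi> x \<in> shell s0" using n th0 x by (simp add: shell_def I_def)
    have "\<eta> (\<theta> (norm x)) = - ln (norm x)" unfolding \<theta>_def by (rule \<eta>(1)[OF lr(1)])
    then show "\<Phi> (\<Psi> x) = x" unfolding \<Phi>_def n using lr(2) th0
      by (simp add: \<Psi>_def add_pos_nonneg less_imp_neq[symmetric])
  qed
  have img: "\<Phi> ` shell s0 = I" using shell(1) inner by (metis image_subset_iff imageI subsetI subset_antisym)
  have inj: "inj_on \<Phi> (shell s0)" by (rule inj_on_inverseI[where g=\<Psi>]) (rule shell(2))
  have inv: "inv_into (shell s0) \<Phi> x = \<Psi> x" if "x \<in> I" for x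
    by (rule inv_into_f_eq[OF inj inner[OF that]])
  have c\<Phi>: "continuous_on (shell s0) \<Phi>"
    by (rule continuous_on_subset[OF Ck_on_imp_continuous_on[OF C\<Phi>[of 0]] shS])
  have c\<Psi>: "continuous_on I \<Psi>"
    by (rule continuous_on_subset[OF Ck_on_imp_continuous_on[OF C\<Psi>[of 0]] IO1])
  have "collar_diffeo ball_top ball_atlas (sphere 0 1) s0 \<Phi>"
    unfolding collar_diffeo_def
  proof (intro conjI)
    have "\<Phi> x = x" if "norm x = 1" for x using that by (simp add: \<Phi>_def \<eta>0)
    then show "\<Phi> ` sphere 0 1 = sphere 0 1" by (auto simp: image_iff)
    show "openin ball_top (\<Phi> ` shell s0)"
      unfolding img openin_open
    proof (intro exI conjI)
      show "open (O1 \<inter> (\<lambda>x. \<theta> (norm x)) -` {..<s0})"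
      proof (rule continuous_open_preimage[OF _ O1])
        show "continuous_on O1 (\<lambda>x. \<theta> (norm x))"
          by (rule continuous_on_compose2[OF Ck_on_imp_continuous_on[OF Ck_theta[of 0]]])
             (use ab in \<open>auto simp: O1_def intro!: continuous_intros\<close>)
      qed simp
      show "I = cball 0 1 \<inter> (O1 \<inter> (\<lambda>x. \<theta> (norm x)) -` {..<s0})" using le_less_trans[OF _ exp_d] by (auto simp: I_def O1_def)
    qed
    have "cball 0 1 \<inter> I = I" by (auto simp: I_def)
    then have "subtopology ball_top I = top_of_set I" by (simp add: subtopology_subtopology)
    then show "homeomorphic_map (top_of_set (shell s0)) (subtopology ball_top (\<Phi> ` shell s0)) \<Phi>"
      using homeomorphic_map_top_of_set[OF c\<Phi> c\<Psi> img shell(2)] by (simp add: img)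
    show "\<forall>(U, c)\<in>ball_atlas. smooth_on {x \<in> shell s0. \<Phi> x \<in> U} (c \<circ> \<Phi>) \<and>
        smooth_on (c ` (U \<inter> \<Phi> ` shell s0)) (inv_into (shell s0) \<Phi> \<circ> inv_into U c)"
      unfolding atlas_iff
    proof (intro allI conjI)
      fix b
      show "smooth_on {x \<in> shell s0. \<Phi> x \<in> chart_dom b} (chart b \<circ> \<Phi>)"
      proof (rule smooth_onI)
        let ?W = "S \<inter> \<Phi> -` (- {mirror b pole})"
        show W: "open ?W" by (rule continuous_open_preimage[OF Ck_on_imp_continuous_on[OF C\<Phi>[of 0]] S(1)]) auto
        show "{x \<in> shell s0. \<Phi> x \<in> chart_dom b} \<subseteq> ?W" using shS by (auto simp: chart_dom_def)
        show "Ck_on k ?W (\<lambda>x. chart b (\<Phi> x))" for k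
          by (rule Ck_on_compose[OF W _ _ Ck_chart Ck_on_subset[OF C\<Phi>]]) auto
      qed auto
      show "smooth_on (chart b ` (chart_dom b \<inter> \<Phi> ` shell s0)) (inv_into (shell s0) \<Phi> \<circ> inv_into (chart_dom b) (chart b))"
      proof (rule smooth_onI)
        let ?W = "- {pole} \<inter> param b -` O1"
        show W: "open ?W"
          by (rule continuous_open_preimage[OF Ck_on_imp_continuous_on[OF Ck_param[of 0]] _ O1]) auto
        have y: "y \<in> half_space \<and> param b y \<in> I" if "y \<in> chart b ` (chart_dom b \<inter> \<Phi> ` shell s0)" for y
          using that chart_half_space param_chart unfolding img by auto
        show "chart b ` (chart_dom b \<inter> \<Phi> ` shell s0) \<subseteq> ?W"
          using y half_space_neq_pole IO1 by blast
        show "Ck_on k ?W (\<lambda>y. \<Psi> (param b y))" for k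
          by (rule Ck_on_compose[OF W O1 _ C\<Psi> Ck_on_subset[OF Ck_param]]) auto
        show "\<Psi> (param b y) = (inv_into (shell s0) \<Phi> \<circ> inv_into (chart_dom b) (chart b)) y"
          if "y \<in> chart b ` (chart_dom b \<inter> \<Phi> ` shell s0)" for y
          using y[OF that] inv inv_chart by simp
      qed
    qed
  qed
  moreover have "collar_normal_form s0 (pullback \<Phi> g)"
    unfolding collar_normal_form_def
  proof (intro exI conjI ballI)
    show "Ck_on 2 (- {0}) (\<lambda>_::real^3. M *\<^sub>R (mat 1 :: real^3^3))" by (rule Ck_on_const)
    show "\<forall>w::real^3. transpose (M *\<^sub>R (mat 1 :: real^3^3)) = M *\<^sub>R mat 1" by (simp add: transpose_scalar)
    fix s and w :: "real^3"
    assume s: "s \<in> {0<..<s0}" and w: "w \<in> sphere 0 1"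
    define x where "x = (1 + s) *\<^sub>R w"
    have ww: "w \<bullet> w = 1" using w by (simp add: dot_square_norm)
    have nx: "norm x = 1 + s" using w s by (simp add: x_def)
    have x0: "x \<noteq> 0" using nx s by auto
    have s1: "s \<in> {-t1<..<t1}" "s \<in> {0<..<t1}" "s \<in> {0<..<t2}" using s s0 t1_pos by auto
    define \<tau> where "\<tau> = exp (- \<eta> s)"
    define E where "E = EE (\<eta> s)"
    have \<eta>s: "\<eta> s \<in> {-d<..<d}" "\<eta> s \<in> {-d..d}" "\<eta> s \<in> {0<..d}" using \<eta>(2)[OF s1(1)] \<eta>pos[OF s1(2)] by auto
    have E: "0 < E" unfolding E_def by (rule EE_pos[OF \<eta>s(2)])
    have U: "0 < UU (\<eta> s)"
      using UU_pos[of "\<eta> s"] \<eta>s good hm_pos by (auto simp: good_def)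
    have sh: "sinh s = UU (\<eta> s) * E" using sinh_tt[OF \<eta>s(3)] \<eta>(3)[OF s1(1)] by (simp add: E_def)
    define \<zeta> where "\<zeta> r = exp (- \<eta> (r - 1)) / r" for r
    have \<zeta>d: "(\<zeta> has_real_derivative (- \<tau> / E * (1 + s) - \<tau>) / (1 + s)\<^sup>2) (at (norm x))"
    proof -
      have "((\<lambda>r. \<eta> (r - 1)) has_real_derivative 1 / E * 1) (at (1 + s))"
        by (rule DERIV_chain2[where f=\<eta>]) (use \<eta>(4)[OF s1(1)] in \<open>auto simp: E_def intro!: derivative_eq_intros\<close>)
      then show ?thesis unfolding \<zeta>_def[abs_def] nx using s
        by (auto intro!: derivative_eq_intros simp: \<tau>_def power2_eq_square)
    qed
    define \<zeta>' where "\<zeta>' = (- \<tau> / E * (1 + s) - \<tau>) / (1 + s)\<^sup>2"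
    define DD where "DD v = \<zeta> (norm x) *\<^sub>R v + (\<zeta>' * ((x \<bullet> v) / norm x)) *\<^sub>R x" for v
    have \<Phi>d: "(\<Phi> has_derivative DD) (at x)"
    proof -
      have "((\<lambda>x::real^3. \<zeta> (norm x)) has_derivative (\<lambda>v. \<zeta>' * ((x \<bullet> v) / norm x))) (at x)"
        using has_derivative_compose[OF norm_has_derivative_real[OF x0] \<zeta>d[unfolded has_field_derivative_def]]
        unfolding \<zeta>'_def .
      from has_derivative_scaleR[OF this has_derivative_ident]
      show ?thesis unfolding \<Phi>_def[abs_def] DD_def[abs_def] \<zeta>_def .
    qed
    \<comment> \<open>Tangential vectors are scaled by \<tau> / (1 + s), the radial one by - \<tau>
      / E since the inverse of \<open>tt\<close> has slope 1 / E. With the factor 1 / (UU \<tau>)^2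
      and sinh s = UU E, the radial part of the pullback becomes 1 / sinh^2 s and the tangential
      part E^2 / sinh^2 s.\<close>
    have DDt: "DD v = (\<tau> / (1 + s)) *\<^sub>R v" if "v \<bullet> w = 0" for v
    proof -
      have "x \<bullet> v = 0" using that by (simp add: x_def inner_commute)
      then show ?thesis by (simp add: DD_def nx \<zeta>_def \<tau>_def)
    qed
    have DDw: "DD w = (- \<tau> / E) *\<^sub>R w"
    proof -
      have "DD w = (\<zeta> (1 + s) + \<zeta>' * (1 + s)) *\<^sub>R w"
      proof -
        have "x \<bullet> w = 1 + s" by (simp add: x_def ww)
        then have "DD w = \<zeta> (1 + s) *\<^sub>R w + \<zeta>' *\<^sub>R x" using s by (simp add: DD_def nx)
        then show ?thesis by (simp add: x_def distrib_left scaleR_add_left scaleR_add_right)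
      qed
      moreover have "\<zeta> (1 + s) + \<zeta>' * (1 + s) = - \<tau> / E"
      proof -
        have "\<tau> / c + (- \<tau> / E * c - \<tau>) / c\<^sup>2 * c = - \<tau> / E" if "c \<noteq> 0" for c
          using that E by (simp add: field_simps power2_eq_square)
        from this[of "1 + s"] show ?thesis unfolding \<zeta>_def \<zeta>'_def using s by (simp add: \<tau>_def)
      qed
      ultimately show ?thesis by simp
    qed
    have xs: "x \<in> shell s0" using nx s by (simp add: shell_def)
    have n\<Phi>: "norm (\<Phi> x) = \<tau>" using shell(4)[OF xs] by (simp add: nx \<tau>_def)
    have "\<Phi> x \<in> hyp_space" using n\<Phi> \<eta>s by (simp add: hyp_space_norm \<tau>_def)
    moreover have "r0 < norm (\<Phi> x)" using shell(1)[OF xs] ab by (auto simp: I_def)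
    ultimately have "F (\<Phi> x) = 1 / (UU (\<eta> s) * \<tau>)\<^sup>2" using F_ext[of "\<Phi> x"] by (simp add: n\<Phi>) (simp add: \<tau>_def)
    then have gx: "g (\<Phi> x) = (1 / (UU (\<eta> s) * \<tau>)\<^sup>2) *\<^sub>R mat 1" by (simp add: g_eq)
    note pb = pullback_conf(1)[where \<Phi>=\<Phi> and g=g, OF \<Phi>d gx]
    have \<tau>: "0 < \<tau>" by (simp add: \<tau>_def)
    have c1: "w \<bullet> (pullback \<Phi> g x *v w) = 1 / (sinh s)\<^sup>2"
      unfolding pb DDw sh using \<tau> U E by (simp add: ww power2_eq_square)
    have c2: "w \<bullet> (pullback \<Phi> g x *v v) = 0 \<and> v \<bullet> (pullback \<Phi> g x *v w) = 0" if "v \<bullet> w = 0" for v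
      unfolding pb DDw DDt[OF that] using that by (simp add: inner_commute)
    have c3: "\<bar>(sinh s)\<^sup>2 * (((1 + s) *\<^sub>R v) \<bullet> (pullback \<Phi> g x *v ((1 + s) *\<^sub>R v')))
        - (v \<bullet> v' + s ^ 3 / 3 * (v \<bullet> ((M *\<^sub>R mat 1) *v v')))\<bar> \<le> K * s ^ 4 * norm v * norm v'"
      if v: "v \<bullet> w = 0" "v' \<bullet> w = 0" for v v'
    proof -
      have t: "((1 + s) *\<^sub>R v) \<bullet> w = 0" "((1 + s) *\<^sub>R v') \<bullet> w = 0" using v by simp_all
      have "(sinh s)\<^sup>2 * (((1 + s) *\<^sub>R v) \<bullet> (pullback \<Phi> g x *v ((1 + s) *\<^sub>R v'))) = E\<^sup>2 * (v \<bullet> v')"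
        unfolding pb DDt[OF t(1)] DDt[OF t(2)] sh using \<tau> U E s
        by (simp add: power2_eq_square)
      then have "(sinh s)\<^sup>2 * (((1 + s) *\<^sub>R v) \<bullet> (pullback \<Phi> g x *v ((1 + s) *\<^sub>R v')))
        - (v \<bullet> v' + s ^ 3 / 3 * (v \<bullet> ((M *\<^sub>R mat 1) *v v'))) = (E\<^sup>2 - (1 + s ^ 3 / 3 * M)) * (v \<bullet> v')"
        by (simp add: mat_1_mult algebra_simps)
      moreover have "\<bar>E\<^sup>2 - (1 + s ^ 3 / 3 * M)\<bar> * \<bar>v \<bullet> v'\<bar> \<le> K * s ^ 4 * (norm v * norm v')"
        using t2(3)[OF s1(3)] Cauchy_Schwarz_ineq2[of v v'] by (intro mult_mono) (auto simp: E_def intro: order_trans[OF abs_ge_zero])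
      ultimately show ?thesis by (simp add: abs_mult mult.assoc)
    qed
    show "let B = pullback \<Phi> g ((1 + s) *\<^sub>R w);
            gs = (\<lambda>v v'. (sinh s)\<^sup>2 * (((1 + s) *\<^sub>R v) \<bullet> (B *v ((1 + s) *\<^sub>R v'))))
        in w \<bullet> (B *v w) = 1 / (sinh s)\<^sup>2 \<and>
           (\<forall>v. v \<bullet> w = 0 \<longrightarrow> w \<bullet> (B *v v) = 0 \<and> v \<bullet> (B *v w) = 0) \<and>
           (\<forall>v v'. v \<bullet> w = 0 \<and> v' \<bullet> w = 0 \<longrightarrow>
              \<bar>gs v v' - (v \<bullet> v' + s ^ 3 / 3 * (v \<bullet> ((M *\<^sub>R mat 1) *v v')))\<bar> \<le> K * s ^ 4 * norm v * norm v')"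
      unfolding Let_def x_def[symmetric] using c1 c2 c3 by blast
  qed
  ultimately show ?thesis using s0(1) shell(3) by blast
qed

lemma asymptotically_hyperbolic: "asymptotically_hyperbolic hyp_space g"
  unfolding asymptotically_hyperbolic_def
proof (intro conjI)
  show "open hyp_space" by (rule open_hyp_space)
  show "connected hyp_space" "hyp_space \<noteq> {}" by (simp_all add: hyp_space_def)
  show "\<not> compact hyp_space"
  proof
    assume "compact hyp_space"
    then have "closure (ball (0::real^3) 1) = ball 0 1"
      using compact_imp_closed closure_closed unfolding hyp_space_def by blast
    moreover have "axis 1 1 \<in> cball (0::real^3) 1" "axis 1 1 \<notin> ball (0::real^3) 1" by simp_all
    ultimately show False by simp
  qed
  show "Ck_on 2 hyp_space g" by (rule g_C2)
  show "\<forall>x\<in>hyp_space. pos_def_sym (g x)" using F_pos pos_def_mat by (simp add: g_eq)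
  show "riem_complete hyp_space g" by (rule g_complete)
  show "\<exists>T A (t :: real^3 \<Rightarrow> real).
        smooth_compactification hyp_space T A \<and>
        (\<forall>(U, c)\<in>A. smooth_on (c ` U) (t \<circ> inv_into U c)) \<and>
        (\<forall>p\<in>manifold_boundary A. t p = 0) \<and> (\<forall>p\<in>hyp_space. t p > 0) \<and>
        (\<forall>(U, c)\<in>A. \<forall>p\<in>U \<inter> manifold_boundary A. \<exists>W Gbar.
           let k = inv_into U c;
               dt = frechet_derivative (t \<circ> k) (at (c p) within half_space)
           in open W \<and> c p \<in> W \<and> Ck_on 3 W Gbar \<and>
              (\<forall>y\<in>W \<inter> c ` U. 0 < y $ 1 \<longrightarrow> Gbar y = (t (k y))\<^sup>2 *\<^sub>R pullback k g y) \<and>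
              pos_def_sym (Gbar (c p)) \<and>
              (\<Sum>i\<in>UNIV. \<Sum>j\<in>UNIV. ginv Gbar (c p) $ i $ j * dt (axis i 1) * dt (axis j 1)) = 1) \<and>
        (\<forall>\<Sigma>\<in>connected_components_of (subtopology T (manifold_boundary A)).
           \<exists>t0>0. \<exists>\<Phi>. collar_diffeo T A \<Sigma> t0 \<Phi> \<and>
             (\<forall>x\<in>shell t0. t (\<Phi> x) = norm x - 1) \<and>
             collar_normal_form t0 (pullback \<Phi> g))"
  proof (rule exI[of _ ball_top], rule exI[of _ ball_atlas], rule exI[of _ tf], intro conjI)
    show "smooth_compactification hyp_space ball_top ball_atlas" by (rule smooth_compactification_ball)
    show "\<forall>(U, c)\<in>ball_atlas. smooth_on (c ` U) (tf \<circ> inv_into U c)" by (rule tf_smooth)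
    show "\<forall>p\<in>manifold_boundary ball_atlas. tf p = 0" using tf_boundary by (simp add: manifold_boundary_ball)
    show "\<forall>p\<in>hyp_space. tf p > 0" using tf_pos by simp
    show "\<forall>(U, c)\<in>ball_atlas. \<forall>p\<in>U \<inter> manifold_boundary ball_atlas. \<exists>W Gbar.
           let k = inv_into U c;
               dt = frechet_derivative (tf \<circ> k) (at (c p) within half_space)
           in open W \<and> c p \<in> W \<and> Ck_on 3 W Gbar \<and>
              (\<forall>y\<in>W \<inter> c ` U. 0 < y $ 1 \<longrightarrow> Gbar y = (tf (k y))\<^sup>2 *\<^sub>R pullback k g y) \<and>
              pos_def_sym (Gbar (c p)) \<and>
              (\<Sum>i\<in>UNIV. \<Sum>j\<in>UNIV. ginv Gbar (c p) $ i $ j * dt (axis i 1) * dt (axis j 1)) = 1"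
      unfolding atlas_iff manifold_boundary_ball Let_def
    proof (intro allI ballI)
      fix b p assume "p \<in> chart_dom b \<inter> sphere 0 1"
      then show "\<exists>W Gbar. open W \<and> chart b p \<in> W \<and> Ck_on 3 W Gbar \<and>
         (\<forall>y\<in>W \<inter> chart b ` chart_dom b. 0 < y $ 1 \<longrightarrow>
            Gbar y = (tf (inv_into (chart_dom b) (chart b) y))\<^sup>2 *\<^sub>R pullback (inv_into (chart_dom b) (chart b)) g y) \<and>
         pos_def_sym (Gbar (chart b p)) \<and>
         (\<Sum>i\<in>UNIV. \<Sum>j\<in>UNIV. ginv Gbar (chart b p) $ i $ j *
           frechet_derivative (tf \<circ> inv_into (chart_dom b) (chart b)) (at (chart b p) within half_space) (axis i 1) *
           frechet_derivative (tf \<circ> inv_into (chart_dom b) (chart b)) (at (chart b p) within half_space) (axis j 1)) = 1"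
        by (intro boundary_chart) auto
    qed
    have sub: "subtopology ball_top (sphere 0 1) = top_of_set (sphere (0::real^3) 1)"
      by (simp add: subtopology_subtopology inf.absorb2 sphere_cball)
    have "connected_space (top_of_set (sphere (0::real^3) 1))"
      by (simp add: connected_space_subtopology connected_sphere)
    \<comment> \<open>The sphere is connected, so the boundary has a single component and one collar
      suffices.\<close>
    then have "connected_components_of (subtopology ball_top (sphere 0 1)) \<subseteq> {sphere (0::real^3) 1}"
      unfolding sub by (auto simp: connected_components_of_connected_space split: if_splits)
    then show "\<forall>\<Sigma>\<in>connected_components_of (subtopology ball_top (manifold_boundary ball_atlas)).
           \<exists>t0>0. \<exists>\<Phi>. collar_diffeo ball_top ball_atlas \<Sigma> t0 \<Phi> \<and>
             (\<forall>x\<in>shell t0. tf (\<Phi> x) = norm x - 1) \<and> collar_normal_form t0 (pullback \<Phi> g)"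
      unfolding manifold_boundary_ball using collar_exists by blast
  qed
qed

end

section \<open>Regularity at the origin and uniqueness\<close>

lemma filterlim_norm_at_0: "filterlim (norm :: real^3 \<Rightarrow> real) (at_right 0) (at 0)"
  unfolding filterlim_at using tendsto_norm_zero[OF tendsto_ident_at[of "0::real^3" UNIV]]
  by (auto simp: eventually_at_filter)

text \<open>The differential at x is Q x times the inner product with x, and the second derivative
  is \<open>Q x * (w \<bullet> v) + R x * (x \<bullet> w) * (x \<bullet> v)\<close>. The factor
  \<open>R\<close> may be unbounded at the origin, but the second term is at most |P2 - P1 / r| |w|
  |v| and tends to 0 because both quantities have the same limit \<open>k\<close>.\<close>

lemma radial_Ck_2:
  fixes P P1 P2 :: "real \<Rightarrow> real"
  assumes l0: "(P \<longlongrightarrow> P 0) (at_right 0)"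
    and d1: "\<And>r. 0 < r \<Longrightarrow> r < 1 \<Longrightarrow> (P has_real_derivative P1 r) (at r)"
    and d2: "\<And>r. 0 < r \<Longrightarrow> r < 1 \<Longrightarrow> (P1 has_real_derivative P2 r) (at r)"
    and c2: "continuous_on {0<..<1} P2"
    and l1: "((\<lambda>r. P1 r / r) \<longlongrightarrow> k) (at_right 0)" and l2: "(P2 \<longlongrightarrow> k) (at_right 0)"
  shows "Ck_on 2 (ball 0 1) (\<lambda>x::real^3. P (norm x))"
proof -
  define Q where "Q x = (if x = 0 then k else P1 (norm x) / norm x)" for x :: "real^3"
  define R where "R x = (if x = 0 then 0 else (P2 (norm x) - P1 (norm x) / norm x) / (norm x)\<^sup>2)" for x :: "real^3"
  have pos: "\<forall>\<^sub>F r::real in at_right 0. 0 < r" by (simp add: eventually_at_filter)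
  have pos1: "\<forall>\<^sub>F r::real in at_right 0. 0 < r \<and> r < 1"
    unfolding eventually_at_right[OF zero_less_one] by (intro exI[of _ 1]) auto
  have P1_0: "(P1 \<longlongrightarrow> 0) (at_right 0)"
  proof -
    have "((\<lambda>r. P1 r / r * r) \<longlongrightarrow> k * 0) (at_right 0)" by (intro tendsto_mult l1 tendsto_ident_at)
    moreover have "\<forall>\<^sub>F r in at_right 0. P1 r / r * r = P1 r" using pos by eventually_elim simp
    ultimately have "(P1 \<longlongrightarrow> k * 0) (at_right 0)" by (rule Lim_transform_eventually)
    then show ?thesis by simp
  qed
  have quot: "((\<lambda>r. (P r - P 0) / r) \<longlongrightarrow> 0) (at_right 0)"
  proof (rule lhopital_right_0[where f'=P1 and g'="\<lambda>_. 1"])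
    show "((\<lambda>r. P r - P 0) \<longlongrightarrow> 0) (at_right 0)" using l0 by (simp add: LIM_zero_iff)
    show "\<forall>\<^sub>F r in at_right 0. ((\<lambda>r. P r - P 0) has_real_derivative P1 r) (at r)"
      using pos1 by eventually_elim (auto intro!: derivative_eq_intros d1)
  qed (use pos P1_0 in \<open>auto elim!: eventually_mono intro: tendsto_ident_at\<close>)
  have Q0: "(Q \<longlongrightarrow> k) (at 0)"
    by (rule Lim_transform_eventually[OF filterlim_compose[OF l1 filterlim_norm_at_0]])
       (auto simp: eventually_at_filter Q_def)
  have D1: "((\<lambda>x. P (norm x)) has_derivative (\<lambda>v. Q x * (x \<bullet> v))) (at x)" if x: "x \<in> ball 0 1" for x
  proof (cases "x = 0")
    case True
    have "((\<lambda>x. \<bar>(P (norm x) - P 0) / norm x\<bar>) \<longlongrightarrow> 0) (at (0::real^3))"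
      by (rule tendsto_rabs_zero[OF filterlim_compose[OF quot filterlim_norm_at_0]])
    then show ?thesis unfolding has_derivative_iff_norm using True by (simp add: abs_divide)
  next
    case False
    then have "(P has_real_derivative P1 (norm x)) (at (norm x))" using x by (intro d1) auto
    from has_derivative_compose[OF norm_has_derivative_real[OF False] this[unfolded has_field_derivative_def]]
    show ?thesis using False by (simp add: Q_def mult_ac)
  qed
  have D2: "((\<lambda>x. Q x * (x \<bullet> v)) has_derivative (\<lambda>w. Q x * (w \<bullet> v) + R x * (x \<bullet> w) * (x \<bullet> v))) (at x)"
    if x: "x \<in> ball 0 1" for x v
  proof (cases "x = 0")
    case True
    have "((\<lambda>y. \<bar>Q y - k\<bar> * norm v) \<longlongrightarrow> 0 * norm v) (at 0)"
      by (intro tendsto_mult_right tendsto_rabs_zero) (use Q0 in \<open>simp add: LIM_zero_iff\<close>)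
    then have l: "((\<lambda>y. \<bar>Q y - k\<bar> * norm v) \<longlongrightarrow> 0) (at 0)" by simp
    have "((\<lambda>y. \<bar>Q y * (y \<bullet> v) - k * (y \<bullet> v)\<bar> / norm y) \<longlongrightarrow> 0) (at 0)"
    proof (rule tendsto_sandwich[OF _ _ tendsto_const l])
      have "\<bar>Q y * (y \<bullet> v) - k * (y \<bullet> v)\<bar> / norm y \<le> \<bar>Q y - k\<bar> * norm v" if "y \<noteq> 0" for y
      proof -
        have "\<bar>Q y * (y \<bullet> v) - k * (y \<bullet> v)\<bar> = \<bar>Q y - k\<bar> * \<bar>y \<bullet> v\<bar>"
          by (simp add: abs_mult[symmetric] algebra_simps)
        also have "\<dots> \<le> \<bar>Q y - k\<bar> * (norm y * norm v)" by (intro mult_left_mono Cauchy_Schwarz_ineq2) auto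
        finally show ?thesis using that by (simp add: divide_le_eq mult_ac)
      qed
      then show "\<forall>\<^sub>F y in at 0. \<bar>Q y * (y \<bullet> v) - k * (y \<bullet> v)\<bar> / norm y \<le> \<bar>Q y - k\<bar> * norm v"
        by (simp add: eventually_at_filter)
    qed simp
    then show ?thesis unfolding has_derivative_iff_norm using True
      by (auto simp: Q_def[of 0] R_def[of 0] intro: bounded_linear_const_mult bounded_linear_inner_left)
  next
    case False
    have "norm x \<in> {0<..<1}" using x False by auto
    then have "((\<lambda>r. P1 r / r) has_real_derivative (P2 (norm x) * norm x - P1 (norm x)) / (norm x * norm x)) (at (norm x))"
      by (auto intro!: derivative_eq_intros d2)
    from has_derivative_compose[OF norm_has_derivative_real[OF False] this[unfolded has_field_derivative_def]]
    have "((\<lambda>x. P1 (norm x) / norm x) has_derivative (\<lambda>w. R x * (x \<bullet> w))) (at x)"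
      using False by (simp add: R_def field_simps power2_eq_square)
    moreover have "((\<lambda>x. x \<bullet> v) has_derivative (\<lambda>w. w \<bullet> v)) (at x)"
      by (intro bounded_linear_imp_has_derivative bounded_linear_inner_left)
    ultimately have "((\<lambda>x. P1 (norm x) / norm x * (x \<bullet> v)) has_derivative
      (\<lambda>w. P1 (norm x) / norm x * (w \<bullet> v) + R x * (x \<bullet> w) * (x \<bullet> v))) (at x)"
      by (rule has_derivative_mult)
    then have "((\<lambda>x. P1 (norm x) / norm x * (x \<bullet> v)) has_derivative
      (\<lambda>w. Q x * (w \<bullet> v) + R x * (x \<bullet> w) * (x \<bullet> v))) (at x)" using False by (simp add: Q_def)
    from has_derivative_transform_within_open[OF this open_Compl[OF closed_singleton[of 0]]]
    show ?thesis using False by (auto simp: Q_def)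
  qed
  have "continuous_on (ball 0 1) (\<lambda>x. Q x * (w \<bullet> v) + R x * (x \<bullet> w) * (x \<bullet> v))" for v w
  proof (rule continuous_at_imp_continuous_on, rule ballI)
    fix x :: "real^3" assume x: "x \<in> ball 0 1"
    show "isCont (\<lambda>x. Q x * (w \<bullet> v) + R x * (x \<bullet> w) * (x \<bullet> v)) x"
    proof (cases "x = 0")
      case True
      have "((\<lambda>r. P2 r - P1 r / r) \<longlongrightarrow> k - k) (at_right 0)" by (intro tendsto_diff l1 l2)
      from filterlim_compose[OF this filterlim_norm_at_0]
      have l: "((\<lambda>x::real^3. \<bar>P2 (norm x) - P1 (norm x) / norm x\<bar> * (norm w * norm v)) \<longlongrightarrow> 0) (at 0)"
        by (intro tendsto_mult_left_zero tendsto_rabs_zero) simp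
      have "((\<lambda>x. R x * (x \<bullet> w) * (x \<bullet> v)) \<longlongrightarrow> 0) (at 0)"
      proof (rule tendsto_rabs_zero_cancel, rule tendsto_sandwich[OF _ _ tendsto_const l])
        have "\<bar>R x * (x \<bullet> w) * (x \<bullet> v)\<bar> \<le> \<bar>P2 (norm x) - P1 (norm x) / norm x\<bar> * (norm w * norm v)"
          if "x \<noteq> 0" for x
        proof -
          have "\<bar>x \<bullet> w\<bar> * \<bar>x \<bullet> v\<bar> \<le> (norm x * norm w) * (norm x * norm v)"
            by (intro mult_mono Cauchy_Schwarz_ineq2) auto
          then have "\<bar>R x\<bar> * (\<bar>x \<bullet> w\<bar> * \<bar>x \<bullet> v\<bar>) \<le> \<bar>R x\<bar> * ((norm x * norm w) * (norm x * norm v))"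
            by (rule mult_left_mono) simp
          also have "\<dots> = (\<bar>R x\<bar> * (norm x)\<^sup>2) * (norm w * norm v)" by (simp add: power2_eq_square)
          also have "\<bar>R x\<bar> * (norm x)\<^sup>2 = \<bar>P2 (norm x) - P1 (norm x) / norm x\<bar>"
            using that by (simp add: R_def abs_divide)
          finally show ?thesis by (simp add: abs_mult mult.assoc)
        qed
        then show "\<forall>\<^sub>F x in at 0. \<bar>R x * (x \<bullet> w) * (x \<bullet> v)\<bar> \<le> \<bar>P2 (norm x) - P1 (norm x) / norm x\<bar> * (norm w * norm v)"
          by (simp add: eventually_at_filter)
      qed simp
      from tendsto_add[OF tendsto_mult_right[OF Q0, of "w \<bullet> v"] this]
      show ?thesis using True by (simp add: isCont_def Q_def[of 0])
    next
      case False
      have n: "norm x \<in> {0<..<1}" using x False by auto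
      have "isCont P2 (norm x)" using c2 n by (simp add: continuous_on_eq_continuous_at)
      then have c2: "isCont (\<lambda>x. P2 (norm x)) x"
        using isCont_o2[where f=norm and g=P2 and a=x] by (simp add: continuous_norm)
      have "isCont P1 (norm x)" using DERIV_isCont[OF d2[of "norm x"]] n by simp
      then have c1: "isCont (\<lambda>x. P1 (norm x)) x"
        using isCont_o2[where f=norm and g=P1 and a=x] by (simp add: continuous_norm)
      have "isCont (\<lambda>x. (P1 (norm x) / norm x) * (w \<bullet> v) +
        ((P2 (norm x) - P1 (norm x) / norm x) / (norm x)\<^sup>2) * (x \<bullet> w) * (x \<bullet> v)) x"
        using False by (intro continuous_intros c1 c2) auto
      moreover have "\<forall>\<^sub>F x in nhds x. (P1 (norm x) / norm x) * (w \<bullet> v) +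
        ((P2 (norm x) - P1 (norm x) / norm x) / (norm x)\<^sup>2) * (x \<bullet> w) * (x \<bullet> v) =
        Q x * (w \<bullet> v) + R x * (x \<bullet> w) * (x \<bullet> v)"
        by (rule eventually_mono[OF eventually_nhds_in_open[OF open_Compl[OF closed_singleton[of 0]]]])
           (use False in \<open>auto simp: Q_def R_def\<close>)
      ultimately show ?thesis by (subst isCont_cong[symmetric])
    qed
  qed
  then have C0: "Ck_on 0 (ball 0 1) (\<lambda>x. Q x * (w \<bullet> v) + R x * (x \<bullet> w) * (x \<bullet> v))" for v w by simp
  have "Ck_on (Suc 0) (ball 0 1) (\<lambda>x. Q x * (x \<bullet> v))" for v
    by (rule Ck_on_SucI[OF open_ball D2 C0])
  note C1 = this
  have "Ck_on (Suc (Suc 0)) (ball 0 1) (\<lambda>x::real^3. P (norm x))"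
    by (rule Ck_on_SucI[OF open_ball D1 C1])
  then show ?thesis by (simp only: numeral_2_eq_2)
qed

text \<open>Transfers the criterion from rho to the Euclidean radius. As rho is 2 r to first order,
  second derivatives at the centre are multiplied by 4.\<close>

lemma hyp_radial_Ck_2:
  fixes \<phi> \<phi>1 \<phi>2 :: "real \<Rightarrow> real"
  assumes l0: "(\<phi> \<longlongrightarrow> \<phi> 0) (at_right 0)"
    and d1: "\<And>s. 0 < s \<Longrightarrow> (\<phi> has_real_derivative \<phi>1 s) (at s)"
    and d2: "\<And>s. 0 < s \<Longrightarrow> (\<phi>1 has_real_derivative \<phi>2 s) (at s)"
    and c2: "continuous_on {0<..} \<phi>2"
    and l1: "((\<lambda>s. \<phi>1 s / s) \<longlongrightarrow> c) (at_right 0)" and l2: "(\<phi>2 \<longlongrightarrow> c) (at_right 0)"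
  shows "Ck_on 2 hyp_space (\<phi> \<circ> hyp_rho)"
proof -
  define q where "q r = 2 / (1 - r\<^sup>2)" for r :: real
  have lim: "filterlim rho_of_tau (at_right 0) (at_right 0)" unfolding rho_of_tau_def by real_asymp
  have ratio: "((\<lambda>r. rho_of_tau r / r) \<longlongrightarrow> 2) (at_right 0)" unfolding rho_of_tau_def by real_asymp
  have q0: "(q \<longlongrightarrow> 2) (at_right 0)" unfolding q_def by real_asymp
  have pos1: "\<forall>\<^sub>F r::real in at_right 0. 0 < r \<and> r < 1"
    unfolding eventually_at_right[OF zero_less_one] by (intro exI[of _ 1]) auto
  have sq: "r\<^sup>2 < 1" if "0 < r" "r < 1" for r :: real using that by (simp add: power_less_one_iff)
  have "((\<lambda>r. (\<phi>1 (rho_of_tau r) / rho_of_tau r) * (rho_of_tau r / r) * q r) \<longlongrightarrow> c * 2 * 2) (at_right 0)"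
    by (intro tendsto_mult ratio q0 filterlim_compose[OF l1 lim])
  then have L1: "((\<lambda>r. \<phi>1 (rho_of_tau r) * q r / r) \<longlongrightarrow> 4 * c) (at_right 0)"
  proof (rule Lim_transform_eventually[THEN back_subst[where P="\<lambda>c. (_ \<longlongrightarrow> c) _"]])
    show "\<forall>\<^sub>F r in at_right 0. \<phi>1 (rho_of_tau r) / rho_of_tau r * (rho_of_tau r / r) * q r = \<phi>1 (rho_of_tau r) * q r / r"
      using pos1 by eventually_elim (use rho_of_tau_pos in fastforce)
  qed simp
  have "((\<lambda>r. \<phi>1 (rho_of_tau r) * q r / r * (r * (r / (1 - r\<^sup>2) * 2))) \<longlongrightarrow> 4 * c * 0) (at_right 0)"
    by (intro tendsto_mult L1) real_asymp
  from tendsto_add[OF tendsto_mult[OF filterlim_compose[OF l2 lim] tendsto_power[OF q0, of 2]] this]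
  have L2: "((\<lambda>r. \<phi>2 (rho_of_tau r) * (q r)\<^sup>2 + \<phi>1 (rho_of_tau r) * q r / r * (r * (r / (1 - r\<^sup>2) * 2))) \<longlongrightarrow> 4 * c) (at_right 0)"
    by (simp add: mult.commute[of 4 c])
  have "Ck_on 2 (ball 0 1) (\<lambda>x::real^3. \<phi> (rho_of_tau (norm x)))"
  proof (rule radial_Ck_2[where P="\<lambda>r. \<phi> (rho_of_tau r)" and k="4 * c"])
    show "((\<lambda>r. \<phi> (rho_of_tau r)) \<longlongrightarrow> \<phi> (rho_of_tau 0)) (at_right 0)"
      using filterlim_compose[OF l0 lim] by simp
    fix r :: real assume r: "0 < r" "r < 1"
    have rp: "0 < rho_of_tau r" by (rule rho_of_tau_pos[OF r])
    have dr: "(rho_of_tau has_real_derivative q r) (at r)"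
      unfolding q_def by (rule rho_of_tau_deriv) (use r in auto)
    have dq: "(q has_real_derivative 4 * r / (1 - r\<^sup>2)\<^sup>2) (at r)"
      unfolding q_def[abs_def] using sq[OF r] by (auto intro!: derivative_eq_intros simp: power2_eq_square)
    show "((\<lambda>r. \<phi> (rho_of_tau r)) has_real_derivative \<phi>1 (rho_of_tau r) * q r) (at r)"
      by (rule DERIV_chain2[OF d1[OF rp] dr])
    have e: "4 * r / (1 - r\<^sup>2)\<^sup>2 * \<phi>1 (rho_of_tau r) = \<phi>1 (rho_of_tau r) * q r / r * (r * (r / (1 - r\<^sup>2) * 2))"
      using r sq[OF r] by (simp add: q_def power2_eq_square)
    show "((\<lambda>r. \<phi>1 (rho_of_tau r) * q r) has_real_derivative
       \<phi>2 (rho_of_tau r) * (q r)\<^sup>2 + \<phi>1 (rho_of_tau r) * q r / r * (r * (r / (1 - r\<^sup>2) * 2))) (at r)"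
      using DERIV_mult[OF DERIV_chain2[OF d2[OF rp] dr] dq] unfolding e power2_eq_square[of "q r"] mult.assoc .
  next
    have cr: "continuous_on {0<..<1} rho_of_tau"
      by (intro continuous_at_imp_continuous_on ballI DERIV_isCont[OF rho_of_tau_deriv]) auto
    have c1: "continuous_on {0<..} \<phi>1"
      by (intro continuous_at_imp_continuous_on ballI DERIV_isCont[OF d2]) auto
    have im: "rho_of_tau ` {0<..<1} \<subseteq> {0<..}" using rho_of_tau_pos by auto
    have "r\<^sup>2 \<noteq> 1" if "0 < r" "r < 1" for r :: real using sq[OF that] by simp
    then show "continuous_on {0<..<1} (\<lambda>r. \<phi>2 (rho_of_tau r) * (q r)\<^sup>2 + \<phi>1 (rho_of_tau r) * q r / r * (r * (r / (1 - r\<^sup>2) * 2)))"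
      unfolding q_def
      by (intro continuous_intros continuous_on_compose2[OF c2 cr im] continuous_on_compose2[OF c1 cr im]) auto
  qed (fact L1 L2)+
  then show ?thesis by (simp add: hyp_space_def hyp_rho_def[abs_def] comp_def)
qed

section \<open>The equation for radial functions and its comparison principle\<close>

lemma continuous_on_hyp_rho: "continuous_on hyp_space hyp_rho"
  unfolding hyp_rho_def rho_of_tau_def
  by (intro continuous_intros) (auto simp: hyp_space_norm add_pos_nonneg intro!: divide_pos_pos less_imp_neq[symmetric])

lemma continuous_on_conformal_op:
  assumes "Ck_on 2 hyp_space u" shows "continuous_on hyp_space (conformal_op u)"
proof -
  have C: "Ck_on (Suc (Suc 0)) hyp_space u" using assms by (simp add: numeral_2_eq_2)
  have c: "continuous_on hyp_space u" "continuous_on hyp_space (pd i u)" "continuous_on hyp_space (pd i (pd i u))" for i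
    using Ck_on_imp_continuous_on[OF C] Ck_on_imp_continuous_on[OF Ck_on_pd[OF C]]
      Ck_on_imp_continuous_on[OF Ck_on_pd[OF Ck_on_pd[OF C]]] by auto
  have "continuous_on hyp_space (\<lambda>x. (1 - x \<bullet> x)\<^sup>2 / 4 *
      (\<Sum>i\<in>UNIV. pd i (pd i u) x + 2 * x $ i * pd i u x / (1 - x \<bullet> x)) + 3/4 * u x * (1 - u x ^ 4))"
    by (intro continuous_intros c) (auto simp: hyp_space_iff)
  then show ?thesis
    by (subst continuous_on_cong[OF refl, where g="\<lambda>x. (1 - x \<bullet> x)\<^sup>2 / 4 *
      (\<Sum>i\<in>UNIV. pd i (pd i u) x + 2 * x $ i * pd i u x / (1 - x \<bullet> x)) + 3/4 * u x * (1 - u x ^ 4)"])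
       (simp_all add: conformal_op_def hyp_laplacian)
qed

text \<open>The radial formula for the Laplacian holds away from the origin; both sides are
  continuous, so the equation extends to it.\<close>

lemma conformal_op_radial:
  fixes \<phi> \<phi>1 \<phi>2 F :: "real \<Rightarrow> real"
  assumes C: "Ck_on 2 hyp_space (\<phi> \<circ> hyp_rho)"
    and d1: "\<And>s. 0 < s \<Longrightarrow> (\<phi> has_real_derivative \<phi>1 s) (at s)"
    and d2: "\<And>s. 0 < s \<Longrightarrow> (\<phi>1 has_real_derivative \<phi>2 s) (at s)"
    and F: "\<And>s. 0 < s \<Longrightarrow> F s = \<phi>2 s + 2 * (cosh s / sinh s) * \<phi>1 s - GG (\<phi> s)"
    and cont: "continuous_on {0..} F" and x: "x \<in> hyp_space"
  shows "conformal_op (\<phi> \<circ> hyp_rho) x = F (hyp_rho x)"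
proof -
  have nz: "conformal_op (\<phi> \<circ> hyp_rho) y = F (hyp_rho y)" if y: "y \<in> hyp_space" "y \<noteq> 0" for y
  proof -
    have s: "0 < hyp_rho y" by (rule hyp_rho_pos[OF y])
    have "laplacian hyp_metric (\<phi> \<circ> hyp_rho) y = \<phi>2 (hyp_rho y) + 2 * (cosh (hyp_rho y) / sinh (hyp_rho y)) * \<phi>1 (hyp_rho y)"
      by (rule radial_laplacian[where S="{0<..}"]) (use y s d1 d2 in auto)
    then show ?thesis by (simp add: conformal_op_def F[OF s] GG_def field_simps)
  qed
  show ?thesis
  proof (cases "x = 0")
    case True
    have z: "(0::real^3) \<in> hyp_space" by (simp add: hyp_space_norm)
    have "isCont (conformal_op (\<phi> \<circ> hyp_rho)) 0"
      using continuous_on_conformal_op[OF C] z open_hyp_space by (simp add: continuous_on_eq_continuous_at)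
    then have a: "(conformal_op (\<phi> \<circ> hyp_rho) \<longlongrightarrow> conformal_op (\<phi> \<circ> hyp_rho) 0) (at 0)" by (simp add: isCont_def)
    have "continuous_on hyp_space (\<lambda>x. F (hyp_rho x))"
      by (rule continuous_on_compose2[OF cont continuous_on_hyp_rho]) (use hyp_rho_nonneg in auto)
    then have "isCont (\<lambda>x. F (hyp_rho x)) 0"
      using z open_hyp_space by (simp add: continuous_on_eq_continuous_at)
    then have b: "((\<lambda>x. F (hyp_rho x)) \<longlongrightarrow> F (hyp_rho 0)) (at 0)" by (simp add: isCont_def)
    have "\<forall>\<^sub>F y in at 0. conformal_op (\<phi> \<circ> hyp_rho) y = F (hyp_rho y)"
      using eventually_at_in_open[OF open_hyp_space z] by eventually_elim (auto intro: nz)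
    from Lim_transform_eventually[OF a this] show ?thesis
      unfolding True using tendsto_unique[OF _ _ b] by (metis at_neq_bot)
  qed (rule nz[OF x])
qed

text \<open>Where p exceeds q > 1 both lie in the range in which \<open>GG\<close> has slope at
  least 3, so p - q satisfies the strict inequality of the maximum principle exactly where it is
  positive. Used in both directions it gives uniqueness.\<close>

lemma radial_comparison:
  fixes p q p1 q1 F :: "real \<Rightarrow> real"
  assumes p: "continuous_on {0..} p" "\<And>s. 0 < s \<Longrightarrow> (p has_real_derivative p1 s) (at s)"
      "\<And>s. 0 < s \<Longrightarrow> (p1 has_real_derivative GG (p s) + F s - 2 * (cosh s / sinh s) * p1 s) (at s)"
      "((\<lambda>s. (sinh s)\<^sup>2 * p1 s) \<longlongrightarrow> 0) (at_right 0)" "(p \<longlongrightarrow> 1) at_top"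
    and q: "continuous_on {0..} q" "\<And>s. 0 < s \<Longrightarrow> (q has_real_derivative q1 s) (at s)"
      "\<And>s. 0 < s \<Longrightarrow> (q1 has_real_derivative GG (q s) + F s - 2 * (cosh s / sinh s) * q1 s) (at s)"
      "((\<lambda>s. (sinh s)\<^sup>2 * q1 s) \<longlongrightarrow> 0) (at_right 0)" "(q \<longlongrightarrow> 1) at_top"
      "\<And>s. 0 \<le> s \<Longrightarrow> 1 < q s"
    and s: "0 \<le> s"
  shows "p s \<le> q s"
proof -
  have "p s - q s \<le> 0"
  proof (rule radial_max_principle[of 0 "\<lambda>s. p s - q s" "\<lambda>s. p1 s - q1 s"])
    fix t :: real assume t: "0 < t"
    show "((\<lambda>s. p s - q s) has_real_derivative p1 t - q1 t) (at t)" by (intro DERIV_diff p q t)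
    show "((\<lambda>s. p1 s - q1 s) has_real_derivative (GG (p t) + F t - 2 * (cosh t / sinh t) * p1 t)
      - (GG (q t) + F t - 2 * (cosh t / sinh t) * q1 t)) (at t)" by (intro DERIV_diff p q t)
    assume "0 < p t - q t"
    then have "3 * (p t - q t) \<le> GG (p t) - GG (q t)"
      using GG_bounds(1)[of "q t" "p t" "p t"] q(6)[of t] t by simp
    then show "0 < (GG (p t) + F t - 2 * (cosh t / sinh t) * p1 t)
      - (GG (q t) + F t - 2 * (cosh t / sinh t) * q1 t) + 2 * (cosh t / sinh t) * (p1 t - q1 t)"
      using \<open>0 < p t - q t\<close> by (simp add: right_diff_distrib)
  next
    fix e :: real assume "0 < e"
    have "((\<lambda>s. p s - q s) \<longlongrightarrow> 1 - 1) at_top" by (intro tendsto_diff p q)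
    then show "\<forall>\<^sub>F s in at_top. p s - q s < e" using \<open>0 < e\<close> by (intro order_tendstoD(2)) auto
  next
    have "((\<lambda>s. (sinh s)\<^sup>2 * p1 s - (sinh s)\<^sup>2 * q1 s) \<longlongrightarrow> 0 - 0) (at_right 0)" by (intro tendsto_diff p q)
    then show "p 0 - q 0 \<le> 0 \<or> 0 = (0::real) \<and> ((\<lambda>s. (sinh s)\<^sup>2 * (p1 s - q1 s)) \<longlongrightarrow> 0) (at_right 0)"
      by (simp add: right_diff_distrib)
  qed (use s p(1) q(1) in \<open>auto intro!: continuous_intros\<close>)
  then show ?thesis by simp
qed

lemma tau_of_rho_deriv: "(tau_of_rho has_real_derivative 2 * exp s / (exp s + 1)\<^sup>2) (at s)"
  unfolding tau_of_rho_def using exp_gt_zero[of s]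
  by (auto intro!: derivative_eq_intros simp: power2_eq_square algebra_simps add_pos_pos less_imp_neq[symmetric])

text \<open>The unit speed geodesic through the origin. Negative s gives the opposite ray, so
  restrictions of functions to it have two-sided derivatives at s = 0.\<close>

definition axis_point :: "real \<Rightarrow> real^3" where
  "axis_point s = tau_of_rho s *\<^sub>R axis 1 1"

lemma axis_point: "axis_point s \<in> hyp_space" "0 \<le> s \<Longrightarrow> hyp_rho (axis_point s) = s"
proof -
  have "- 1 < tau_of_rho s" by (simp add: tau_of_rho_def pos_less_divide_eq add_pos_pos)
  then show "axis_point s \<in> hyp_space"
    using tau_of_rho_less_1[of s] by (simp add: axis_point_def hyp_space_norm abs_less_iff)
  show "hyp_rho (axis_point s) = s" if "0 \<le> s"
  proof -
    have "0 \<le> tau_of_rho s" using that tau_of_rho_pos[of s] by (cases "s = 0") auto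
    then show ?thesis by (simp add: axis_point_def hyp_rho_def)
  qed
qed

text \<open>Restriction to a geodesic through the centre turns the equation on hyperbolic space into
  the radial one. Differentiability across the centre makes \<open>p1\<close> continuous at 0, which
  gives the vanishing flux that the maximum principle asks for there.\<close>

lemma radial_profile:
  assumes dep: "depends_only_on_rho u" and C: "Ck_on 2 hyp_space u"
    and op: "\<And>x. x \<in> hyp_space \<Longrightarrow> conformal_op u x = F (hyp_rho x)"
  defines "p \<equiv> \<lambda>s. u (axis_point s)"
  shows "\<And>x. x \<in> hyp_space \<Longrightarrow> u x = p (hyp_rho x)"
    and "\<exists>p1. continuous_on {0..} p \<and> (\<forall>s>0. (p has_real_derivative p1 s) (at s)) \<and>
      (\<forall>s>0. (p1 has_real_derivative GG (p s) + F s - 2 * (cosh s / sinh s) * p1 s) (at s)) \<and>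
      ((\<lambda>s. (sinh s)\<^sup>2 * p1 s) \<longlongrightarrow> 0) (at_right 0)"
proof -
  show u: "u x = p (hyp_rho x)" if x: "x \<in> hyp_space" for x
    using dep axis_point[of "hyp_rho x"] hyp_rho_nonneg[OF x] x unfolding depends_only_on_rho_def p_def by metis
  define T1 :: "real \<Rightarrow> real" where "T1 s = 2 * exp s / (exp s + 1)\<^sup>2" for s
  obtain T2 where T2: "\<And>s. (T1 has_real_derivative T2 s) (at s)"
  proof
    show "(T1 has_real_derivative (2 * exp s * (exp s + 1)\<^sup>2 - 2 * exp s * (2 * (exp s + 1) * exp s))
      / ((exp s + 1)\<^sup>2 * (exp s + 1)\<^sup>2)) (at s)" for s
      unfolding T1_def[abs_def] using exp_gt_zero[of s]
      by (auto intro!: derivative_eq_intros simp: add_pos_pos less_imp_neq[symmetric])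
  qed
  have C2: "Ck_on (Suc (Suc 0)) hyp_space u" using C by (simp add: numeral_2_eq_2)
  obtain D where D: "\<And>x. x \<in> hyp_space \<Longrightarrow> (u has_derivative D x) (at x)"
    "\<And>v. Ck_on (Suc 0) hyp_space (\<lambda>x. D x v)" by (rule Ck_on_SucD[OF C2]) (rule that)
  obtain E where E: "\<And>x. x \<in> hyp_space \<Longrightarrow> ((\<lambda>x. D x (axis 1 1)) has_derivative E x) (at x)"
    by (rule Ck_on_SucD[OF D(2)[of "axis 1 1"]]) (rule that)
  have ad: "(axis_point has_derivative (\<lambda>h. (T1 s * h) *\<^sub>R axis 1 1)) (at s)" for s
    unfolding axis_point_def[abs_def] T1_def
    by (rule has_derivative_scaleR_left[OF tau_of_rho_deriv[unfolded has_field_derivative_def]])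
  have lin: "bounded_linear B \<Longrightarrow> B ((c::real) *\<^sub>R v) = c * (B v :: real)" for B c and v :: "real^3"
    by (simp add: linear_cmul bounded_linear.linear)
  define p1 where "p1 s = T1 s * D (axis_point s) (axis 1 1)" for s
  have d1: "(p has_real_derivative p1 s) (at s)" for s
  proof -
    have "(p has_derivative (\<lambda>h. D (axis_point s) ((T1 s * h) *\<^sub>R axis 1 1))) (at s)"
      unfolding p_def by (rule has_derivative_compose[OF ad D(1)[OF axis_point(1)]])
    then show ?thesis unfolding has_field_derivative_def p1_def
      using lin[OF has_derivative_bounded_linear[OF D(1)[OF axis_point(1)]]] by (simp add: mult_ac mult_commute_abs)
  qed
  have d2: "\<exists>p2. (p1 has_real_derivative p2) (at s)" for s
  proof -
    have "((\<lambda>s. D (axis_point s) (axis 1 1)) has_derivative (\<lambda>h. E (axis_point s) ((T1 s * h) *\<^sub>R axis 1 1))) (at s)"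
      by (rule has_derivative_compose[OF ad E[OF axis_point(1)]])
    then have "((\<lambda>s. D (axis_point s) (axis 1 1)) has_real_derivative T1 s * E (axis_point s) (axis 1 1)) (at s)"
      unfolding has_field_derivative_def
      using lin[OF has_derivative_bounded_linear[OF E[OF axis_point(1)]]] by (simp add: mult_ac mult_commute_abs)
    from DERIV_mult[OF T2 this] show ?thesis unfolding p1_def[abs_def] by blast
  qed
  have ode: "(p1 has_real_derivative GG (p s) + F s - 2 * (cosh s / sinh s) * p1 s) (at s)" if s: "0 < s" for s
  proof -
    obtain p2 where p2: "(p1 has_real_derivative p2) (at s)" using d2 by blast
    define x where "x = axis_point s"
    have x: "x \<in> hyp_space" "hyp_rho x = s" using axis_point s by (auto simp: x_def)
    have "x \<noteq> 0" using x(2) s by (auto simp: hyp_rho_def)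
    have "laplacian hyp_metric (p \<circ> hyp_rho) x = p2 + 2 * (cosh s / sinh s) * p1 s"
      using radial_laplacian[OF x(1) \<open>x \<noteq> 0\<close> open_UNIV UNIV_I d1, of p2] p2 x(2) by simp
    moreover have "pd i u y = pd i (p \<circ> hyp_rho) y" if "y \<in> hyp_space" for i y
      by (rule pd_cong[OF open_hyp_space that]) (simp add: u)
    then have "pd i (pd i u) x = pd i (pd i (p \<circ> hyp_rho)) x" "pd i u x = pd i (p \<circ> hyp_rho) x" for i
      using pd_cong[OF open_hyp_space x(1)] x(1) by blast+
    then have "laplacian hyp_metric u x = laplacian hyp_metric (p \<circ> hyp_rho) x"
      by (simp add: hyp_laplacian[OF x(1)])
    ultimately have "p2 = GG (p s) + F s - 2 * (cosh s / sinh s) * p1 s"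
      using op[OF x(1)] u[OF x(1)] x(2) by (simp add: conformal_op_def GG_def field_simps)
    then show ?thesis using p2 by simp
  qed
  have "isCont p1 0" using d2[of 0] DERIV_isCont by blast
  then have "isCont (\<lambda>s. (sinh s)\<^sup>2 * p1 s) 0" by (intro continuous_intros) auto
  then have "((\<lambda>s. (sinh s)\<^sup>2 * p1 s) \<longlongrightarrow> 0) (at 0)" by (simp add: isCont_def)
  then have "((\<lambda>s. (sinh s)\<^sup>2 * p1 s) \<longlongrightarrow> 0) (at_right 0)" by (simp add: filterlim_at_split)
  moreover have "continuous_on {0..} p"
    by (intro continuous_at_imp_continuous_on ballI DERIV_isCont[OF d1])
  ultimately show "\<exists>p1. continuous_on {0..} p \<and> (\<forall>s>0. (p has_real_derivative p1 s) (at s)) \<and>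
      (\<forall>s>0. (p1 has_real_derivative GG (p s) + F s - 2 * (cosh s / sinh s) * p1 s) (at s)) \<and>
      ((\<lambda>s. (sinh s)\<^sup>2 * p1 s) \<longlongrightarrow> 0) (at_right 0)"
    using d1 ode by blast
qed

lemma filterlim_hyp_rho: "filterlim hyp_rho at_top hyp_infinity"
  unfolding hyp_infinity_def by (rule filterlim_mono[OF filterlim_filtercomap order_refl]) simp

lemma filterlim_axis_point: "filterlim axis_point hyp_infinity at_top"
  unfolding hyp_infinity_def filterlim_inf filterlim_principal filterlim_filtercomap_iff
proof
  have "\<forall>\<^sub>F s in at_top. s = hyp_rho (axis_point s)"
    using eventually_ge_at_top[of 0] by eventually_elim (simp add: axis_point)
  then show "filterlim (hyp_rho \<circ> axis_point) at_top at_top"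
    using filterlim_cong[OF refl refl] filterlim_ident unfolding comp_def by fast
qed (simp add: axis_point)

section \<open>The filling profile and the solutions\<close>

lemma halfline_at_neq_bot: assumes "0 \<le> s" shows "at (s::real) within {0..} \<noteq> bot"
proof -
  have "s islimpt {0..}"
    by (rule islimpt_subset[OF islimpt_greaterThanLessThan1[of s "s + 1"]]) (use assms in auto)
  then show ?thesis by (simp add: trivial_limit_within)
qed

lemma isCont_eq_limit_right:
  fixes f g :: "real \<Rightarrow> real"
  assumes "isCont f t" "isCont g t" "\<And>s. t < s \<Longrightarrow> f s = g s"
  shows "f t = g t"
proof -
  have "(f \<longlongrightarrow> f t) (at_right t)" "(g \<longlongrightarrow> g t) (at_right t)"
    using assms(1,2) by (simp_all add: isCont_def filterlim_at_split)
  note lims = this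
  have "\<forall>\<^sub>F s in at_right t. f s = g s" using assms(3) by (simp add: eventually_at_filter)
  from tendsto_unique[OF trivial_limit_at_right_real Lim_transform_eventually[OF lims(1) this] lims(2)]
  show ?thesis .
qed

lemma smooth_on_imp_continuous_on:
  fixes f :: "'a::euclidean_space \<Rightarrow> 'b::real_normed_vector"
  assumes "smooth_on S f" shows "continuous_on S f"
  unfolding continuous_on_def
proof
  fix x assume x: "x \<in> S"
  obtain W F where W: "open W" "x \<in> W" "\<forall>k. Ck_on k W F" "\<forall>y\<in>S \<inter> W. F y = f y"
    using bspec[OF assms[unfolded smooth_on_def] x] by (elim exE conjE) auto
  have "continuous_on W F" using W(3) Ck_on_imp_continuous_on by blast
  then have "isCont F x" using W by (simp add: continuous_on_eq_continuous_at)
  then have "(F \<longlongrightarrow> F x) (at x within S)" using continuous_within continuous_at_imp_continuous_at_within by blast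
  moreover have "\<forall>\<^sub>F y in at x within S. F y = f y"
    using eventually_nhds_in_open[OF W(1,2)] W(4) by (auto simp: eventually_at_filter elim!: eventually_mono)
  moreover have "F x = f x" using W x by blast
  ultimately show "(f \<longlongrightarrow> f x) (at x within S)" using Lim_transform_eventually by force
qed

locale filling_profile = adss +
  fixes \<tau>1 \<tau>2 :: real and \<psi> \<psi>1 \<psi>2 :: "real \<Rightarrow> real"
  assumes taus: "adss_rho0 M < \<tau>1" "\<tau>1 < \<tau>2"
    and psi1: "\<And>s. 0 \<le> s \<Longrightarrow> (\<psi> has_real_derivative \<psi>1 s) (at s within {0..})"
    and psi2: "\<And>s. 0 \<le> s \<Longrightarrow> (\<psi>1 has_real_derivative \<psi>2 s) (at s within {0..})"
    and psi2_cont: "continuous_on {0..} \<psi>2"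
    and psi_gt: "\<And>s. 0 \<le> s \<Longrightarrow> 1 < \<psi> s"
    and psi_const: "\<And>s. 0 \<le> s \<Longrightarrow> s \<le> \<tau>1 \<Longrightarrow> \<psi> s = \<psi> 0"
    and psi_outside: "\<And>s. \<tau>2 \<le> s \<Longrightarrow> \<psi> s = adss_phi M s"
    and psi_scal: "\<And>x. x \<in> hyp_ball \<tau>2 \<Longrightarrow> - 6 < scalar_curvature (conformal (\<psi> \<circ> hyp_rho) hyp_metric) x"
begin

lemma tau_pos: "0 < \<tau>1" "0 < \<tau>2" using taus adss_rho0_pos by auto

lemma dom_tau: "\<tau>1 \<le> s \<Longrightarrow> dom s"
  using adss_rho0_less[of s] taus tau_pos by (simp add: dom_def)

lemma psi_derivs: assumes "0 < s"
  shows "(\<psi> has_real_derivative \<psi>1 s) (at s)" "(\<psi>1 has_real_derivative \<psi>2 s) (at s)"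
  using psi1[of s] psi2[of s] assms by (simp_all add: at_within_interior[of s "{0..}"])

lemma psi_continuous: "continuous_on {0..} \<psi>" "continuous_on {0..} \<psi>1"
  using DERIV_continuous[OF psi1] DERIV_continuous[OF psi2] by (auto simp: continuous_on_eq_continuous_within)

lemma psi_center: assumes "0 \<le> s" "s < \<tau>1" shows "\<psi>1 s = 0" "\<psi>2 s = 0"
proof -
  have zero: "D = 0" if f: "(f has_real_derivative D) (at s within {0..})" and c: "\<And>s. 0 \<le> s \<Longrightarrow> s < \<tau>1 \<Longrightarrow> f s = c"
    and s: "0 \<le> s" "s < \<tau>1" for f D c s
  proof -
    have "((\<lambda>y. (f y - f s) / (y - s)) \<longlongrightarrow> D) (at s within {0..})"
      using f by (simp add: has_field_derivative_iff)
    moreover have "\<forall>\<^sub>F y in at s within {0..}. (f y - f s) / (y - s) = 0"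
      using eventually_nhds_in_open[of "{..<\<tau>1}" s] s c
      by (auto simp: eventually_at_filter elim!: eventually_mono)
    ultimately have "((\<lambda>y. 0) \<longlongrightarrow> D) (at s within {0..})" by (rule Lim_transform_eventually)
    then show "D = 0" using tendsto_unique[OF halfline_at_neq_bot[OF s(1)]] tendsto_const by metis
  qed
  have 1: "\<psi>1 s = 0" if "0 \<le> s" "s < \<tau>1" for s
    by (rule zero[OF psi1[OF that(1)] psi_const]) (use that in auto)
  show "\<psi>1 s = 0" by (rule 1[OF assms])
  show "\<psi>2 s = 0" by (rule zero[OF psi2[OF assms(1)] 1]) (use assms in auto)
qed

lemma psi1_outside: assumes s: "\<tau>2 \<le> s" shows "\<psi>1 s = PP1 s"
proof -
  have eq: "\<psi>1 s = PP1 s" if s: "\<tau>2 < s" for s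
  proof (rule DERIV_unique)
    show "(\<psi> has_real_derivative \<psi>1 s) (at s)" using s tau_pos by (intro psi_derivs) auto
    have "(adss_phi M has_real_derivative PP1 s) (at s)" using s taus by (intro phi_deriv dom_tau) auto
    then show "(\<psi> has_real_derivative PP1 s) (at s)"
      by (rule has_field_derivative_transform_within_open[where S="{\<tau>2<..}"]) (use s psi_outside in auto)
  qed
  show ?thesis
  \<comment> \<open>At \<tau>2 itself the two functions agree on one side only, so the equality is a
    limit from the right.\<close>
  proof (rule isCont_eq_limit_right[where f=\<psi>1 and g=PP1 and t=s])
    show "isCont \<psi>1 s" using s tau_pos by (intro DERIV_isCont[OF psi_derivs(2)]) auto
    show "isCont PP1 s" using s taus by (intro DERIV_isCont[OF phi_deriv2] dom_tau) auto
  qed (use eq s in auto)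
qed

text \<open>The cutoff of the radius makes \<open>f0\<close> manifestly continuous at the origin; it is harmless
  since \<open>\<psi>1\<close> vanishes near the origin.\<close>

definition f0 :: "real \<Rightarrow> real" where
  "f0 s = \<psi>2 s + 2 * (cosh (max s (\<tau>1 / 2)) / sinh (max s (\<tau>1 / 2))) * \<psi>1 s - GG (\<psi> s)"

lemma f0_cont: "continuous_on {0..} f0"
  unfolding f0_def using tau_pos
  by (intro continuous_intros psi_continuous psi2_cont) (auto simp: max_def)

lemma f0_eq: assumes "0 < s" shows "f0 s = \<psi>2 s + 2 * (cosh s / sinh s) * \<psi>1 s - GG (\<psi> s)"
proof (cases "s < \<tau>1")
  case True
  then show ?thesis using psi_center[of s] assms by (simp add: f0_def)
next
  case False
  then have "max s (\<tau>1 / 2) = s" using tau_pos by simp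
  then show ?thesis by (simp add: f0_def)
qed

lemma near_0: "\<forall>\<^sub>F s in at_right 0. 0 < s \<and> s < \<tau>1"
  unfolding eventually_at_right[OF tau_pos(1)] using tau_pos by (intro exI[of _ \<tau>1]) auto

lemma Ck_psi: "Ck_on 2 hyp_space (\<psi> \<circ> hyp_rho)"
proof (rule hyp_radial_Ck_2[where c=0])
  have "\<forall>\<^sub>F s in at_right 0. \<psi> 0 = \<psi> s" using near_0 by eventually_elim (rule psi_const[symmetric], auto)
  then show "(\<psi> \<longlongrightarrow> \<psi> 0) (at_right 0)" by (rule Lim_transform_eventually[OF tendsto_const])
  have "\<forall>\<^sub>F s in at_right 0. 0 = \<psi>1 s / s" using near_0 by eventually_elim (simp add: psi_center)
  then show "((\<lambda>s. \<psi>1 s / s) \<longlongrightarrow> 0) (at_right 0)" by (rule Lim_transform_eventually[OF tendsto_const])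
  have "\<forall>\<^sub>F s in at_right 0. 0 = \<psi>2 s" using near_0 by eventually_elim (simp add: psi_center)
  then show "(\<psi>2 \<longlongrightarrow> 0) (at_right 0)" by (rule Lim_transform_eventually[OF tendsto_const])
  show "continuous_on {0<..} \<psi>2" by (rule continuous_on_subset[OF psi2_cont]) auto
qed (fact psi_derivs)+

lemma conformal_op_psi: "x \<in> hyp_space \<Longrightarrow> conformal_op (\<psi> \<circ> hyp_rho) x = f0 (hyp_rho x)"
  by (rule conformal_op_radial[OF Ck_psi psi_derivs f0_eq f0_cont])

text \<open>The transformation law turns scalar curvature above -6 into a negative right-hand side,
  by positivity of the conformal factor.\<close>

lemma f0_neg: assumes "0 \<le> s" "s < \<tau>2" shows "f0 s < 0"
proof -
  define x where "x = axis_point s"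
  have x: "x \<in> hyp_space" "hyp_rho x = s" using axis_point assms by (auto simp: x_def)
  have g: "0 < (\<psi> \<circ> hyp_rho) y" if "y \<in> hyp_space" for y
    using psi_gt[OF hyp_rho_nonneg[OF that]] by simp
  have e: "scalar_curvature (conformal (\<psi> \<circ> hyp_rho) hyp_metric) x =
      - 6 - 8 * conformal_op (\<psi> \<circ> hyp_rho) x / (\<psi> \<circ> hyp_rho) x ^ 5"
    by (rule scalar_curvature_conformal[OF Ck_psi g x(1)])
  have "- 6 < - 6 - 8 * f0 s / \<psi> s ^ 5"
    using psi_scal[of x] x assms unfolding e conformal_op_psi[OF x(1)] by (simp add: hyp_ball_def)
  moreover have "0 < \<psi> s ^ 5" using g[OF x(1)] x(2) by simp
  ultimately show ?thesis by (simp add: divide_less_0_iff)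
qed

lemma f0_outside: assumes "\<tau>2 \<le> s" shows "f0 s = 0"
proof -
  have eq: "f0 s = 0" if s: "\<tau>2 < s" for s
  proof -
    have "\<psi>2 s = GG (adss_phi M s) - 2 * (cosh s / sinh s) * PP1 s"
    proof (rule DERIV_unique)
      show "(\<psi>1 has_real_derivative \<psi>2 s) (at s)" using s tau_pos by (intro psi_derivs) auto
      have "(PP1 has_real_derivative GG (adss_phi M s) - 2 * (cosh s / sinh s) * PP1 s) (at s)"
        using s taus by (intro phi_deriv2 dom_tau) auto
      then show "(\<psi>1 has_real_derivative GG (adss_phi M s) - 2 * (cosh s / sinh s) * PP1 s) (at s)"
        by (rule has_field_derivative_transform_within_open[where S="{\<tau>2<..}"]) (use s psi1_outside in auto)
    qed
    then show ?thesis using f0_eq[of s] s tau_pos psi_outside[of s] psi1_outside[of s] by simp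
  qed
  have "isCont f0 s" using f0_cont assms tau_pos
    by (intro continuous_on_interior[OF f0_cont]) auto
  then show ?thesis using isCont_eq_limit_right[where f=f0 and t=s and g="\<lambda>_. 0"] eq assms by auto
qed

lemma f0_nonpos: "0 \<le> s \<Longrightarrow> f0 s \<le> 0"
  using f0_neg[of s] f0_outside[of s] by fastforce

lemma psi_lim: "(\<psi> \<longlongrightarrow> 1) at_top" "(\<psi>1 \<longlongrightarrow> 0) at_top" "(f0 \<longlongrightarrow> 0) at_top"
proof -
  have "\<forall>\<^sub>F s in at_top. adss_phi M s = \<psi> s"
    using eventually_ge_at_top[of \<tau>2] by eventually_elim (simp add: psi_outside)
  then show "(\<psi> \<longlongrightarrow> 1) at_top" by (rule Lim_transform_eventually[OF phi_lim])
  have "\<forall>\<^sub>F s in at_top. PP1 s = \<psi>1 s"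
    using eventually_ge_at_top[of \<tau>2] by eventually_elim (simp add: psi1_outside)
  then show "(\<psi>1 \<longlongrightarrow> 0) at_top" by (rule Lim_transform_eventually[OF PP1_lim])
  have "\<forall>\<^sub>F s in at_top. 0 = f0 s"
    using eventually_ge_at_top[of \<tau>2] by eventually_elim (simp add: f0_outside)
  then show "(f0 \<longlongrightarrow> 0) at_top" by (rule Lim_transform_eventually[OF tendsto_const])
qed

section \<open>Solutions of the perturbed equation: existence, uniqueness and curvature\<close>

definition is_solution :: "(real \<Rightarrow> real) \<Rightarrow> (real \<Rightarrow> real) \<Rightarrow> (real \<Rightarrow> real) \<Rightarrow> bool" where
  "is_solution F \<phi> \<phi>1 \<longleftrightarrow> continuous_on {0..} \<phi> \<and> (\<forall>s>0. (\<phi> has_real_derivative \<phi>1 s) (at s)) \<and>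
     (\<forall>s>0. (\<phi>1 has_real_derivative GG (\<phi> s) + F s - 2 * (cosh s / sinh s) * \<phi>1 s) (at s)) \<and>
     (\<forall>s\<ge>0. 1 < \<phi> s \<and> \<phi> s < \<psi> s) \<and> ((\<lambda>s. (sinh s)\<^sup>2 * \<phi>1 s) \<longlongrightarrow> 0) (at_right 0) \<and>
     Ck_on 2 hyp_space (\<phi> \<circ> hyp_rho) \<and> (\<forall>x\<in>hyp_space. conformal_op (\<phi> \<circ> hyp_rho) x = F (hyp_rho x))"

lemma is_solutionD:
  assumes "is_solution F \<phi> \<phi>1"
  shows "continuous_on {0..} \<phi>" "0 < s \<Longrightarrow> (\<phi> has_real_derivative \<phi>1 s) (at s)"
    "0 < s \<Longrightarrow> (\<phi>1 has_real_derivative GG (\<phi> s) + F s - 2 * (cosh s / sinh s) * \<phi>1 s) (at s)"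
    "0 \<le> s \<Longrightarrow> 1 < \<phi> s" "0 \<le> s \<Longrightarrow> \<phi> s < \<psi> s" "((\<lambda>s. (sinh s)\<^sup>2 * \<phi>1 s) \<longlongrightarrow> 0) (at_right 0)"
    "Ck_on 2 hyp_space (\<phi> \<circ> hyp_rho)" "x \<in> hyp_space \<Longrightarrow> conformal_op (\<phi> \<circ> hyp_rho) x = F (hyp_rho x)"
  using assms unfolding is_solution_def by blast+

lemma solution_lim: assumes "is_solution F \<phi> \<phi>1" shows "(\<phi> \<longlongrightarrow> 1) at_top"
proof (rule tendsto_sandwich[OF _ _ tendsto_const psi_lim(1)])
  show "\<forall>\<^sub>F s in at_top. 1 \<le> \<phi> s" "\<forall>\<^sub>F s in at_top. \<phi> s \<le> \<psi> s"
    by (rule eventually_mono[OF eventually_ge_at_top[of 0]],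
        use is_solutionD(4,5)[OF assms] in \<open>auto intro: less_imp_le\<close>)+
qed

lemma solution_exists:
  assumes cont: "continuous_on {0..} F" and F: "\<And>s. 0 \<le> s \<Longrightarrow> f0 s \<le> F s" "\<And>s. 0 \<le> s \<Longrightarrow> F s \<le> 0"
    and strict: "0 < s1" "F s1 < 0" "0 < s2" "f0 s2 < F s2"
  shows "\<exists>\<phi> \<phi>1. is_solution F \<phi> \<phi>1"
proof -
  obtain \<phi> \<phi>1 c where s: "continuous_on {0..} \<phi>" "\<And>s. 0 < s \<Longrightarrow> (\<phi> has_real_derivative \<phi>1 s) (at s)"
     "\<And>s. 0 < s \<Longrightarrow> (\<phi>1 has_real_derivative GG (\<phi> s) + F s - 2 * (cosh s / sinh s) * \<phi>1 s) (at s)"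
     "\<And>s. 0 \<le> s \<Longrightarrow> 1 < \<phi> s \<and> \<phi> s < \<psi> s" "((\<lambda>s. (sinh s)\<^sup>2 * \<phi>1 s) \<longlongrightarrow> 0) (at_right 0)"
     "((\<lambda>s. \<phi>1 s / s) \<longlongrightarrow> c) (at_right 0)"
     "((\<lambda>s. GG (\<phi> s) + F s - 2 * (cosh s / sinh s) * \<phi>1 s) \<longlongrightarrow> c) (at_right 0)"
    using radial_exists[OF psi1 psi2 _ psi_gt psi_lim(1,2) f0_cont psi_lim(3) f0_eq cont F strict]
      psi_center(1)[of 0] tau_pos by auto
  have C: "Ck_on 2 hyp_space (\<phi> \<circ> hyp_rho)"
  proof (rule hyp_radial_Ck_2[OF _ s(2,3) _ s(6,7)])
    have "(\<phi> \<longlongrightarrow> \<phi> 0) (at 0 within {0..})" using s(1) by (simp add: continuous_on_def)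
    then show "(\<phi> \<longlongrightarrow> \<phi> 0) (at_right 0)" by (rule tendsto_within_subset) auto
    have c: "continuous_on {0<..} F" "continuous_on {0<..} \<phi>" using cont s(1) by (auto elim: continuous_on_subset)
    have "continuous_on {0<..} \<phi>1" by (intro continuous_at_imp_continuous_on ballI DERIV_isCont[OF s(3)]) auto
    then show "continuous_on {0<..} (\<lambda>s. GG (\<phi> s) + F s - 2 * (cosh s / sinh s) * \<phi>1 s)"
      by (intro continuous_intros c) auto
  qed
  have "conformal_op (\<phi> \<circ> hyp_rho) x = F (hyp_rho x)" if "x \<in> hyp_space" for x
    by (rule conformal_op_radial[OF C s(2,3) _ cont that]) auto
  then have "is_solution F \<phi> \<phi>1" unfolding is_solution_def using s C by blast
  then show ?thesis by blast
qed

lemma solution_radial: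
  assumes "is_solution F \<phi> \<phi>1"
  shows "radial_solution (\<psi> \<circ> hyp_rho) (\<lambda>x. F (hyp_rho x)) (\<phi> \<circ> hyp_rho)"
  unfolding radial_solution_def depends_only_on_rho_def
proof (intro conjI ballI impI)
  note s = is_solutionD[OF assms]
  show "Ck_on 2 hyp_space (\<phi> \<circ> hyp_rho)" by (rule s)
  show "((\<phi> \<circ> hyp_rho) \<longlongrightarrow> 1) hyp_infinity"
    unfolding comp_def by (rule filterlim_compose[OF solution_lim[OF assms] filterlim_hyp_rho])
  fix x :: "real^3" assume x: "x \<in> hyp_space"
  show "conformal_op (\<phi> \<circ> hyp_rho) x = F (hyp_rho x)" by (rule s(8)[OF x])
  show "(\<phi> \<circ> hyp_rho) x < (\<psi> \<circ> hyp_rho) x" "1 < (\<phi> \<circ> hyp_rho) x" using s(4,5) hyp_rho_nonneg[OF x] by auto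
qed simp

lemma solution_unique:
  assumes sol: "is_solution F \<phi> \<phi>1" and u: "radial_solution (\<psi> \<circ> hyp_rho) (\<lambda>x. F (hyp_rho x)) u"
    and x: "x \<in> hyp_space"
  shows "u x = \<phi> (hyp_rho x)"
proof -
  note s = is_solutionD[OF sol]
  note R = u[unfolded radial_solution_def]
  have dep: "depends_only_on_rho u" and C: "Ck_on 2 hyp_space u"
    and op: "\<And>x. x \<in> hyp_space \<Longrightarrow> conformal_op u x = F (hyp_rho x)" and gt: "\<And>x. x \<in> hyp_space \<Longrightarrow> 1 < u x"
    and lim: "(u \<longlongrightarrow> 1) hyp_infinity" using R by auto
  define p where "p s = u (axis_point s)" for s
  obtain p1 where p: "continuous_on {0..} p" "\<And>s. 0 < s \<Longrightarrow> (p has_real_derivative p1 s) (at s)"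
      "\<And>s. 0 < s \<Longrightarrow> (p1 has_real_derivative GG (p s) + F s - 2 * (cosh s / sinh s) * p1 s) (at s)"
      "((\<lambda>s. (sinh s)\<^sup>2 * p1 s) \<longlongrightarrow> 0) (at_right 0)"
    using radial_profile(2)[OF dep C op] unfolding p_def[abs_def] by blast
  have pl: "(p \<longlongrightarrow> 1) at_top" unfolding p_def by (rule filterlim_compose[OF lim filterlim_axis_point])
  have pg: "1 < p s" for s unfolding p_def by (rule gt[OF axis_point(1)])
  have h: "0 \<le> hyp_rho x" by (rule hyp_rho_nonneg[OF x])
  have "p (hyp_rho x) \<le> \<phi> (hyp_rho x)"
    by (rule radial_comparison[OF p pl s(1-3,6) solution_lim[OF sol] s(4) h])
  moreover have "\<phi> (hyp_rho x) \<le> p (hyp_rho x)"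
    by (rule radial_comparison[OF s(1-3,6) solution_lim[OF sol] p pl pg h])
  ultimately show ?thesis using radial_profile(1)[OF dep C op x] by (simp add: p_def)
qed

lemma scalar_curvature_solution:
  assumes sol: "is_solution F \<phi> \<phi>1" and x: "x \<in> hyp_space"
  shows "F (hyp_rho x) \<le> 0 \<Longrightarrow> - 6 \<le> scalar_curvature (conformal (\<phi> \<circ> hyp_rho) hyp_metric) x"
    and "F (hyp_rho x) = 0 \<Longrightarrow> scalar_curvature (conformal (\<phi> \<circ> hyp_rho) hyp_metric) x = - 6"
proof -
  note s = is_solutionD[OF sol]
  have g: "0 < (\<phi> \<circ> hyp_rho) y" if "y \<in> hyp_space" for y
    using s(4)[OF hyp_rho_nonneg[OF that]] by simp
  have "scalar_curvature (conformal (\<phi> \<circ> hyp_rho) hyp_metric) x =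
      - 6 - 8 * conformal_op (\<phi> \<circ> hyp_rho) x / (\<phi> \<circ> hyp_rho) x ^ 5"
    by (rule scalar_curvature_conformal[OF s(7) g x])
  then have e: "scalar_curvature (conformal (\<phi> \<circ> hyp_rho) hyp_metric) x = - 6 - 8 * F (hyp_rho x) / (\<phi> (hyp_rho x)) ^ 5"
    unfolding s(8)[OF x] by simp
  show "- 6 \<le> scalar_curvature (conformal (\<phi> \<circ> hyp_rho) hyp_metric) x" if "F (hyp_rho x) \<le> 0"
    unfolding e using that g[OF x] by (simp add: divide_nonpos_pos)
  show "scalar_curvature (conformal (\<phi> \<circ> hyp_rho) hyp_metric) x = - 6" if "F (hyp_rho x) = 0"
    unfolding e using that by simp
qed

section \<open>Quantitative closeness of the solution to the filling profile\<close>

context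
  fixes F \<phi> \<phi>1 :: "real \<Rightarrow> real" and \<delta> :: real
  assumes sol: "is_solution F \<phi> \<phi>1"
    and F_le: "\<And>s. 0 < s \<Longrightarrow> F s - f0 s \<le> \<delta>" and F_ge: "\<And>s. 0 < s \<Longrightarrow> f0 s \<le> F s"
    and F_out: "\<And>s. \<tau>2 \<le> s \<Longrightarrow> F s = 0"
begin

private definition "dd s = \<psi> s - \<phi> s"
private definition "dd1 s = \<psi>1 s - \<phi>1 s"
private definition "dd2 s = GG (\<psi> s) - GG (\<phi> s) - (F s - f0 s) - 2 * (cosh s / sinh s) * dd1 s"

private lemma dd:
  "continuous_on {0..} dd" "0 < s \<Longrightarrow> (dd has_real_derivative dd1 s) (at s)"
  "0 < s \<Longrightarrow> (dd1 has_real_derivative dd2 s) (at s)" "0 \<le> s \<Longrightarrow> 0 < dd s"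
  "0 \<le> s \<Longrightarrow> 3 * dd s \<le> GG (\<psi> s) - GG (\<phi> s)" "((\<lambda>s. (sinh s)\<^sup>2 * dd1 s) \<longlongrightarrow> 0) (at_right 0)"
  "(dd \<longlongrightarrow> 0) at_top"
proof -
  note s = is_solutionD[OF sol]
  show "continuous_on {0..} dd" unfolding dd_def by (intro continuous_intros psi_continuous s)
  show "(dd has_real_derivative dd1 s) (at s)" if "0 < s"
    unfolding dd_def[abs_def] dd1_def by (intro DERIV_diff psi_derivs s that)
  have "dd2 s = \<psi>2 s - (GG (\<phi> s) + F s - 2 * (cosh s / sinh s) * \<phi>1 s)" if "0 < s"
    unfolding dd2_def dd1_def f0_eq[OF that] by (simp add: right_diff_distrib diff_divide_distrib)
  then show "(dd1 has_real_derivative dd2 s) (at s)" if "0 < s"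
    unfolding dd1_def[abs_def] using DERIV_diff[OF psi_derivs(2) s(3), OF that that] that by simp
  show "0 < dd s" if "0 \<le> s" using s(5)[OF that] by (simp add: dd_def)
  show "3 * dd s \<le> GG (\<psi> s) - GG (\<phi> s)" if "0 \<le> s"
    using GG_bounds(1)[of "\<phi> s" "\<psi> s" "\<psi> s"] s(4,5)[OF that] by (simp add: dd_def)
  have "((\<lambda>s. (sinh s)\<^sup>2 * \<psi>1 s) \<longlongrightarrow> 0) (at_right 0)"
  proof (rule Lim_transform_eventually[OF tendsto_const])
    show "\<forall>\<^sub>F s in at_right 0. 0 = (sinh s)\<^sup>2 * \<psi>1 s" using near_0 by eventually_elim (simp add: psi_center)
  qed
  from tendsto_diff[OF this s(6)] show "((\<lambda>s. (sinh s)\<^sup>2 * dd1 s) \<longlongrightarrow> 0) (at_right 0)"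
    by (simp add: dd1_def right_diff_distrib)
  show "(dd \<longlongrightarrow> 0) at_top" unfolding dd_def using tendsto_diff[OF psi_lim(1) solution_lim[OF sol]] by simp
qed

private lemma delta_nonneg: "0 \<le> \<delta>" using F_le[of 1] F_ge[of 1] by simp

private lemma coth_ge_1: "1 \<le> cosh s / sinh s" if "0 < s" for s :: real
  using that by (simp add: cosh_def sinh_def scaleR_conv_of_real)

text \<open>Comparison with a constant: the slope 3 of \<open>GG\<close> outweighs the source F - f0
  \<le> \<delta> once the difference exceeds \<delta> / 3.\<close>

lemma solution_close: assumes "0 \<le> s" shows "\<psi> s - \<phi> s \<le> \<delta> / 3"
proof -
  have "dd s - \<delta> / 3 \<le> 0"
  proof (rule radial_max_principle[of 0 "\<lambda>s. dd s - \<delta> / 3" dd1 dd2])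
    fix t :: real assume t: "0 < t"
    show "((\<lambda>s. dd s - \<delta> / 3) has_real_derivative dd1 t) (at t)"
      using dd(2)[OF t] by (auto intro!: derivative_eq_intros)
    show "(dd1 has_real_derivative dd2 t) (at t)" by (rule dd(3)[OF t])
    assume "0 < dd t - \<delta> / 3"
    then show "0 < dd2 t + 2 * (cosh t / sinh t) * dd1 t"
      using dd(5)[of t] F_le[OF t] t by (simp add: dd2_def)
  next
    fix e :: real assume "0 < e"
    then show "\<forall>\<^sub>F s in at_top. dd s - \<delta> / 3 < e"
      using order_tendstoD(2)[OF dd(7), of e] delta_nonneg by (auto elim!: eventually_mono)
  qed (use assms dd(1,6) in \<open>auto intro!: continuous_intros\<close>)
  then show ?thesis by (simp add: dd_def)
qed

text \<open>For b = K exp (- 3 s) the Laplacian is 9 b - 6 coth s b, which is at most 3 b because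
  coth s is at least 1. The exponent 3 thus matches the minimal slope 3 of \<open>GG\<close>. The
  value of K makes b = \<delta> / 3 at \<tau>2, the bound from
  \<open>solution_close\<close>.\<close>

lemma solution_decay: assumes "\<tau>2 \<le> s" shows "\<psi> s - \<phi> s \<le> \<delta> / 3 * exp (3 * \<tau>2) * exp (- 3 * s)"
proof -
  define K where "K = \<delta> / 3 * exp (3 * \<tau>2)"
  have K: "0 \<le> K" using delta_nonneg by (simp add: K_def)
  define b where "b s = K * exp (- 3 * s)" for s
  have b: "0 \<le> b s" for s using K by (simp add: b_def)
  have "dd s - b s \<le> 0"
  proof (rule radial_max_principle[of \<tau>2 "\<lambda>s. dd s - b s" "\<lambda>s. dd1 s + 3 * b s" "\<lambda>s. dd2 s - 9 * b s"])
    fix t :: real assume t: "\<tau>2 < t"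
    then have t0: "0 < t" using tau_pos by simp
    show "((\<lambda>s. dd s - b s) has_real_derivative dd1 t + 3 * b t) (at t)"
      unfolding b_def using dd(2)[OF t0] by (auto intro!: derivative_eq_intros)
    show "((\<lambda>s. dd1 s + 3 * b s) has_real_derivative dd2 t - 9 * b t) (at t)"
      unfolding b_def using dd(3)[OF t0] by (auto intro!: derivative_eq_intros)
    assume p: "0 < dd t - b t"
    have "1 * b t \<le> (cosh t / sinh t) * b t" by (rule mult_right_mono[OF coth_ge_1[OF t0] b])
    moreover have "2 * (cosh t / sinh t) * (dd1 t + 3 * b t) = 2 * (cosh t / sinh t) * dd1 t + 6 * ((cosh t / sinh t) * b t)"
      by (simp add: algebra_simps)
    moreover have "dd2 t + 2 * (cosh t / sinh t) * dd1 t = GG (\<psi> t) - GG (\<phi> t)"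
      using t F_out[of t] f0_outside[of t] by (simp add: dd2_def)
    ultimately show "0 < dd2 t - 9 * b t + 2 * (cosh t / sinh t) * (dd1 t + 3 * b t)"
      using p dd(5)[of t] t0 by linarith
  next
    fix e :: real assume "0 < e"
    show "\<forall>\<^sub>F s in at_top. dd s - b s < e"
    proof (rule eventually_mono[OF order_tendstoD(2)[OF dd(7) \<open>0 < e\<close>]])
      show "dd s - b s < e" if "dd s < e" for s using that b[of s] by linarith
    qed
  next
    have "K * exp (- 3 * \<tau>2) = \<delta> / 3" by (simp add: K_def exp_add[symmetric])
    then have "dd \<tau>2 - b \<tau>2 \<le> 0" using solution_close[of \<tau>2] tau_pos by (simp add: dd_def b_def)
    then show "dd \<tau>2 - b \<tau>2 \<le> 0 \<or> \<tau>2 = 0 \<and> ((\<lambda>s. (sinh s)\<^sup>2 * (dd1 s + 3 * b s)) \<longlongrightarrow> 0) (at_right 0)" by blast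
    show "continuous_on {\<tau>2..} (\<lambda>s. dd s - b s)"
      unfolding b_def using tau_pos by (intro continuous_intros continuous_on_subset[OF dd(1)]) auto
  qed (use assms tau_pos in auto)
  then show ?thesis by (simp add: dd_def b_def K_def)
qed

text \<open>Two different reasons for the two signs. From the centre, where the flux vanishes, its
  derivative is at least - \<delta> sinh^2, which bounds the derivative of the difference from
  below. From above it is at most 0: outside B(\<tau>2) the flux is nondecreasing, so a positive
  derivative at \<tau>2 would persist and keep the positive difference from tending to 0.\<close>

lemma solution_deriv_close: "\<bar>\<psi>1 \<tau>2 - \<phi>1 \<tau>2\<bar> \<le> \<delta> * \<tau>2"
proof -
  have flux: "((\<lambda>s. (sinh s)\<^sup>2 * dd1 s) has_real_derivative (sinh s)\<^sup>2 * (GG (\<psi> s) - GG (\<phi> s) - (F s - f0 s))) (at s)"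
    if s: "0 < s" for s
  proof -
    have "((\<lambda>s. (sinh s)\<^sup>2 * dd1 s) has_real_derivative
      2 * sinh s * cosh s * dd1 s + (sinh s)\<^sup>2 * dd2 s) (at s)"
      using dd(3)[OF s] by (auto intro!: derivative_eq_intros)
    moreover have "2 * sinh s * cosh s * dd1 s + (sinh s)\<^sup>2 * dd2 s = (sinh s)\<^sup>2 * (GG (\<psi> s) - GG (\<phi> s) - (F s - f0 s))"
      using s by (simp add: dd2_def field_simps power2_eq_square)
    ultimately show ?thesis by simp
  qed
  have GGd: "0 \<le> GG (\<psi> s) - GG (\<phi> s)" if "0 \<le> s" for s using dd(4,5)[OF that] by simp
  have S: "0 < (sinh \<tau>2)\<^sup>2" using tau_pos by simp
  have lower: "- (\<delta> * \<tau>2) \<le> dd1 \<tau>2"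
  proof -
    \<comment> \<open>The linear term compensates the most negative slope of the flux on this
      interval, sinh being largest at \<tau>2.\<close>
    define m where "m s = (sinh s)\<^sup>2 * dd1 s + \<delta> * (sinh \<tau>2)\<^sup>2 * s" for s
    have mono: "m s \<le> m \<tau>2" if s: "0 < s" "s < \<tau>2" for s
    proof (rule DERIV_nonneg_imp_nondecreasing[of s \<tau>2 m])
      fix x assume x: "s \<le> x" "x \<le> \<tau>2"
      then have x0: "0 < x" using s by simp
      have "(m has_real_derivative (sinh x)\<^sup>2 * (GG (\<psi> x) - GG (\<phi> x) - (F x - f0 x)) + \<delta> * (sinh \<tau>2)\<^sup>2) (at x)"
        unfolding m_def[abs_def]
        using DERIV_add[OF flux[OF x0] DERIV_cmult[OF DERIV_ident, of "\<delta> * (sinh \<tau>2)\<^sup>2"]] by simp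
      moreover have "0 \<le> (sinh x)\<^sup>2 * (GG (\<psi> x) - GG (\<phi> x) - (F x - f0 x)) + \<delta> * (sinh \<tau>2)\<^sup>2"
      proof -
        have "(sinh x)\<^sup>2 * (- \<delta>) \<le> (sinh x)\<^sup>2 * (GG (\<psi> x) - GG (\<phi> x) - (F x - f0 x))"
          using GGd[of x] F_le[OF x0] x0 by (intro mult_left_mono) auto
        moreover have "(sinh x)\<^sup>2 * \<delta> \<le> (sinh \<tau>2)\<^sup>2 * \<delta>"
          using x x0 delta_nonneg by (intro mult_right_mono power_mono) auto
        ultimately show ?thesis by (simp add: mult.commute)
      qed
      ultimately show "\<exists>y. (m has_real_derivative y) (at x) \<and> 0 \<le> y" by blast
    qed (use s in simp)
    have l: "(m \<longlongrightarrow> 0 + \<delta> * (sinh \<tau>2)\<^sup>2 * 0) (at_right 0)"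
      unfolding m_def[abs_def] by (intro tendsto_intros dd(6))
    have "0 + \<delta> * (sinh \<tau>2)\<^sup>2 * 0 \<le> m \<tau>2"
    proof (rule tendsto_upperbound[OF l])
      show "\<forall>\<^sub>F s in at_right 0. m s \<le> m \<tau>2" using near_0 by eventually_elim (use mono taus in auto)
    qed simp
    then have "0 \<le> (sinh \<tau>2)\<^sup>2 * (dd1 \<tau>2 + \<delta> * \<tau>2)" by (simp add: m_def algebra_simps)
    then show ?thesis using S by (simp add: zero_le_mult_iff)
  qed
  have upper: "dd1 \<tau>2 \<le> 0"
  proof (rule ccontr)
    assume "\<not> ?thesis"
    then have p: "0 < dd1 \<tau>2" by simp
    have pos: "0 < dd1 s" if s: "\<tau>2 \<le> s" for s
    proof -
      have "(sinh \<tau>2)\<^sup>2 * dd1 \<tau>2 \<le> (sinh s)\<^sup>2 * dd1 s"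
      proof (rule DERIV_nonneg_imp_nondecreasing[OF s])
        fix x assume x: "\<tau>2 \<le> x" "x \<le> s"
        then have x0: "0 < x" using tau_pos by simp
        have "0 \<le> (sinh x)\<^sup>2 * (GG (\<psi> x) - GG (\<phi> x) - (F x - f0 x))"
          using GGd[of x] x0 F_out[OF x(1)] f0_outside[OF x(1)] by simp
        then show "\<exists>y. ((\<lambda>s. (sinh s)\<^sup>2 * dd1 s) has_real_derivative y) (at x) \<and> 0 \<le> y"
          using flux[OF x0] by blast
      qed
      moreover have "0 < (sinh \<tau>2)\<^sup>2 * dd1 \<tau>2" using S p by simp
      ultimately have "0 < (sinh s)\<^sup>2 * dd1 s" by linarith
      then show ?thesis by (simp add: zero_less_mult_iff)
    qed
    have inc: "dd \<tau>2 \<le> dd s" if s: "\<tau>2 \<le> s" for s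
    proof (rule DERIV_nonneg_imp_nondecreasing[OF s])
      fix x assume "\<tau>2 \<le> x" "x \<le> s"
      then show "\<exists>y. (dd has_real_derivative y) (at x) \<and> 0 \<le> y"
        using dd(2)[of x] pos[of x] tau_pos by (intro exI[of _ "dd1 x"]) auto
    qed
    have "dd \<tau>2 \<le> 0"
      by (rule tendsto_lowerbound[OF dd(7) eventually_mono[OF eventually_ge_at_top inc] trivial_limit_at_top_linorder])
    then show False using dd(4)[of \<tau>2] tau_pos by simp
  qed
  show ?thesis using lower upper delta_nonneg tau_pos unfolding dd1_def[symmetric] abs_le_iff by auto
qed

end

end

section \<open>The family of solutions, their masses and the limit of vanishing cutoff width\<close>

theorem theorem3p2:
  fixes M \<tau>1 \<tau>2 :: real
    and \<psi> :: "real \<Rightarrow> real"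
    and chi :: "real \<Rightarrow> real \<Rightarrow> real"
    and f :: "real^3 \<Rightarrow> real"
    and f\<epsilon> :: "real \<Rightarrow> real^3 \<Rightarrow> real"
  assumes M_pos: "M > 0"
    and taus: "adss_rho0 M < \<tau>1" "\<tau>1 < \<tau>2" "\<tau>2 < adss_rho2' M"
    and psi_C21: "C21_halfline \<psi>"
    and psi_gt: "\<forall>s\<ge>0. \<psi> s > 1"
    and psi_const: "\<forall>s\<in>{0..\<tau>1}. \<psi> s = \<psi> 0"
    and psi_outside: "\<forall>s\<ge>\<tau>2. \<psi> s = adss_phi M s"
    and psi_scal: "\<forall>x\<in>hyp_ball \<tau>2. scalar_curvature (conformal (\<psi> \<circ> hyp_rho) hyp_metric) x > - 6"
    and f_eq: "f = conformal_op (\<psi> \<circ> hyp_rho)"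
    and chi_smooth: "\<forall>\<epsilon>. 0 < \<epsilon> \<and> \<epsilon> < \<tau>2 \<longrightarrow> smooth_on {0..} (chi \<epsilon>)"
    and chi_range: "\<forall>\<epsilon>. 0 < \<epsilon> \<and> \<epsilon> < \<tau>2 \<longrightarrow> (\<forall>s\<ge>0. 0 \<le> chi \<epsilon> s \<and> chi \<epsilon> s \<le> 1)"
    and chi_one: "\<forall>\<epsilon>. 0 < \<epsilon> \<and> \<epsilon> < \<tau>2 \<longrightarrow> (\<forall>s\<in>{0..<\<tau>2 - \<epsilon>}. chi \<epsilon> s = 1)"
    and chi_zero: "\<forall>\<epsilon>. 0 < \<epsilon> \<and> \<epsilon> < \<tau>2 \<longrightarrow> (\<forall>s\<ge>\<tau>2 - \<epsilon> / 2. chi \<epsilon> s = 0)"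
    and f\<epsilon>_eq: "\<And>\<epsilon> x. f\<epsilon> \<epsilon> x = f x * chi \<epsilon> (hyp_rho x)"
  shows "\<exists>(\<phi> :: real \<Rightarrow> real^3 \<Rightarrow> real) (M\<epsilon> :: real \<Rightarrow> real).
     (\<forall>\<epsilon>. 0 < \<epsilon> \<and> \<epsilon> < \<tau>2 \<longrightarrow>
        radial_solution (\<psi> \<circ> hyp_rho) (f\<epsilon> \<epsilon>) (\<phi> \<epsilon>) \<and>
        (\<forall>u. radial_solution (\<psi> \<circ> hyp_rho) (f\<epsilon> \<epsilon>) u \<longrightarrow> (\<forall>x\<in>hyp_space. u x = \<phi> \<epsilon> x)) \<and>
        (\<forall>x\<in>hyp_ball \<tau>2. scalar_curvature (conformal (\<phi> \<epsilon>) hyp_metric) x \<ge> - 6) \<and>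
        (\<forall>x\<in>hyp_space - hyp_ball \<tau>2. scalar_curvature (conformal (\<phi> \<epsilon>) hyp_metric) x = - 6) \<and>
        M\<epsilon> \<epsilon> > 0 \<and> adss_rho0 (M\<epsilon> \<epsilon>) < \<tau>2 \<and>
        (\<forall>x\<in>hyp_space - hyp_ball \<tau>2. conformal (\<phi> \<epsilon>) hyp_metric x = adss_metric (M\<epsilon> \<epsilon>) x) \<and>
        asymptotically_hyperbolic hyp_space (conformal (\<phi> \<epsilon>) hyp_metric)) \<and>
     (\<exists>C. (C \<longlongrightarrow> 0) (at_right 0) \<and>
        (\<forall>\<epsilon>. 0 < \<epsilon> \<and> \<epsilon> < \<tau>2 \<longrightarrow>
           (\<forall>x\<in>hyp_space - hyp_ball \<tau>2.
              \<psi> (hyp_rho x) - \<phi> \<epsilon> x \<le> C \<epsilon> * exp (- 3 * hyp_rho x)))) \<and>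
     (\<exists>\<epsilon>0>0. \<forall>\<epsilon>. 0 < \<epsilon> \<and> \<epsilon> < \<tau>2 \<and> \<epsilon> < \<epsilon>0 \<longrightarrow> \<tau>2 < adss_rho2' (M\<epsilon> \<epsilon>)) \<and>
     (\<exists>C. (C \<longlongrightarrow> 0) (at_right 0) \<and>
        (\<forall>\<epsilon>. 0 < \<epsilon> \<and> \<epsilon> < \<tau>2 \<longrightarrow> M - M\<epsilon> \<epsilon> \<le> C \<epsilon>))"
proof -
  obtain a where a: "adss a" "adss.M a = M" using mass_radius_exists[OF M_pos] by blast
  interpret A: adss a by (rule a(1))
  have AM: "A.M = M" by (rule a(2))
  obtain \<psi>1 \<psi>2 L where d1: "\<And>s. 0 \<le> s \<Longrightarrow> (\<psi> has_real_derivative \<psi>1 s) (at s within {0..})"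
    and d2: "\<And>s. 0 \<le> s \<Longrightarrow> (\<psi>1 has_real_derivative \<psi>2 s) (at s within {0..})"
    and lip: "L-lipschitz_on {0..} \<psi>2"
    using psi_C21 unfolding C21_halfline_def by blast
  interpret filling_profile a \<tau>1 \<tau>2 \<psi> \<psi>1 \<psi>2
  proof
    show "continuous_on {0..} \<psi>2" by (rule lipschitz_on_continuous_on[OF lip])
    show "\<psi> s = \<psi> 0" if "0 \<le> s" "s \<le> \<tau>1" for s using psi_const that by (meson atLeastAtMost_iff)
  qed (use taus d1 d2 psi_gt psi_outside psi_scal AM in auto)
  define F where "F \<epsilon> s = f0 s * chi \<epsilon> s" for \<epsilon> s
  \<comment> \<open>The removed part of f0 lives on this interval, and f0 is continuous and vanishes
    at \<tau>2, so its supremum there tends to 0 with the width.\<close>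
  define \<delta> where "\<delta> \<epsilon> = (SUP s\<in>{\<tau>2 - \<epsilon>..\<tau>2}. \<bar>f0 s\<bar>)" for \<epsilon>
  have f\<epsilon>: "f\<epsilon> \<epsilon> x = F \<epsilon> (hyp_rho x)" if "x \<in> hyp_space" for \<epsilon> x
    using f\<epsilon>_eq conformal_op_psi[OF that] by (simp add: f_eq F_def)
  have F_out: "F \<epsilon> s = 0" if "0 < \<epsilon>" "\<epsilon> < \<tau>2" "\<tau>2 - \<epsilon> / 2 \<le> s" for \<epsilon> s
    using chi_zero that by (simp add: F_def)
  have chi01: "0 \<le> chi \<epsilon> s" "chi \<epsilon> s \<le> 1" if "0 < \<epsilon>" "\<epsilon> < \<tau>2" "0 \<le> s" for \<epsilon> s
    using chi_range that by blast+
  have F_bounds: "f0 s \<le> F \<epsilon> s" "F \<epsilon> s \<le> 0" if e: "0 < \<epsilon>" "\<epsilon> < \<tau>2" "0 \<le> s" for \<epsilon> s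
  proof -
    have "f0 s * 1 \<le> f0 s * chi \<epsilon> s" by (rule mult_left_mono_neg[OF chi01(2)[OF e] f0_nonpos[OF e(3)]])
    then show "f0 s \<le> F \<epsilon> s" by (simp add: F_def)
    show "F \<epsilon> s \<le> 0" unfolding F_def by (rule mult_nonpos_nonneg[OF f0_nonpos[OF e(3)] chi01(1)[OF e]])
  qed
  have bdd: "bdd_above ((\<lambda>s. \<bar>f0 s\<bar>) ` {\<tau>2 - \<epsilon>..\<tau>2})" if "0 < \<epsilon>" "\<epsilon> < \<tau>2" for \<epsilon>
  proof -
    have "continuous_on {\<tau>2 - \<epsilon>..\<tau>2} (\<lambda>s. \<bar>f0 s\<bar>)"
      using that by (intro continuous_intros continuous_on_subset[OF f0_cont]) auto
    then have "compact ((\<lambda>s. \<bar>f0 s\<bar>) ` {\<tau>2 - \<epsilon>..\<tau>2})" by (rule compact_continuous_image) simp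
    then show ?thesis by (rule bounded_imp_bdd_above[OF compact_imp_bounded])
  qed
  have \<delta>0: "0 \<le> \<delta> \<epsilon>" if "0 < \<epsilon>" "\<epsilon> < \<tau>2" for \<epsilon>
    unfolding \<delta>_def by (rule cSUP_upper2[OF bdd[OF that], of \<tau>2]) (use that in auto)
  have F_diff: "F \<epsilon> s - f0 s \<le> \<delta> \<epsilon>" if e: "0 < \<epsilon>" "\<epsilon> < \<tau>2" "0 < s" for \<epsilon> s
  proof (cases "s \<in> {\<tau>2 - \<epsilon>..\<tau>2}")
    case True
    then have "\<bar>f0 s\<bar> \<le> \<delta> \<epsilon>" unfolding \<delta>_def by (intro cSUP_upper bdd e)
    then show ?thesis using F_bounds(2)[of \<epsilon> s] e by simp
  next
    case False
    then have "chi \<epsilon> s = 1 \<or> f0 s = 0" using chi_one e f0_outside[of s] by auto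
    then show ?thesis using \<delta>0[OF e(1,2)] by (auto simp: F_def)
  qed
  have \<delta>_lim: "(\<delta> \<longlongrightarrow> 0) (at_right 0)"
  proof (rule tendstoI)
    fix r :: real assume r: "0 < r"
    have "isCont f0 \<tau>2" using tau_pos by (intro continuous_on_interior[OF f0_cont]) auto
    then obtain k where k: "0 < k" "\<And>s. \<bar>s - \<tau>2\<bar> < k \<Longrightarrow> \<bar>f0 s\<bar> < r / 2"
      using r f0_outside[of \<tau>2] unfolding continuous_at_eps_delta dist_real_def
      by (metis diff_zero half_gt_zero order_refl)
    have "dist (\<delta> \<epsilon>) 0 < r" if e: "0 < \<epsilon>" "\<epsilon> < min k \<tau>2" for \<epsilon>
    proof -
      have "\<delta> \<epsilon> \<le> r / 2" unfolding \<delta>_def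
        by (rule cSUP_least) (use e k(2) in \<open>auto intro!: less_imp_le\<close>)
      then show ?thesis using \<delta>0[of \<epsilon>] e r by simp
    qed
    then show "\<forall>\<^sub>F \<epsilon> in at_right 0. dist (\<delta> \<epsilon>) 0 < r"
      unfolding eventually_at_right[OF tau_pos(2)] using k(1) tau_pos by (intro exI[of _ "min k \<tau>2"]) auto
  qed
  have F_cont: "continuous_on {0..} (F \<epsilon>)" if "0 < \<epsilon>" "\<epsilon> < \<tau>2" for \<epsilon>
    unfolding F_def[abs_def] using chi_smooth that
    by (intro continuous_on_mult f0_cont smooth_on_imp_continuous_on) auto
  have "\<exists>\<phi> \<phi>1. is_solution (F \<epsilon>) \<phi> \<phi>1" if e: "0 < \<epsilon>" "\<epsilon> < \<tau>2" for \<epsilon>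
  proof (rule solution_exists[OF F_cont[OF e] F_bounds[OF e]])
    \<comment> \<open>The first point lies where \<open>chi\<close> is 1, the second where
      \<open>chi\<close> is 0; f0 is negative at both, so neither barrier is itself a
      solution.\<close>
    show "0 < (\<tau>2 - \<epsilon>) / 2" "0 < \<tau>2 - \<epsilon> / 4" using e by auto
    show "F \<epsilon> ((\<tau>2 - \<epsilon>) / 2) < 0" using chi_one e f0_neg[of "(\<tau>2 - \<epsilon>) / 2"] by (simp add: F_def)
    show "f0 (\<tau>2 - \<epsilon> / 4) < F \<epsilon> (\<tau>2 - \<epsilon> / 4)"
      using F_out[OF e, of "\<tau>2 - \<epsilon> / 4"] f0_neg[of "\<tau>2 - \<epsilon> / 4"] e by simp
  qed
  then obtain \<Phi> \<Phi>1 where sol: "\<And>\<epsilon>. 0 < \<epsilon> \<Longrightarrow> \<epsilon> < \<tau>2 \<Longrightarrow> is_solution (F \<epsilon>) (\<Phi> \<epsilon>) (\<Phi>1 \<epsilon>)" by metis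
  define m where "m \<epsilon> = ext_mass (\<Phi> \<epsilon>) (\<Phi>1 \<epsilon>) \<tau>2" for \<epsilon>
  have out: "\<exists>b. adss b \<and> adss.M b = m \<epsilon> \<and> adss.dom b \<tau>2 \<and> (\<forall>s\<ge>\<tau>2. \<Phi> \<epsilon> s = adss_phi (m \<epsilon>) s) \<and>
      adss.VV b (cyl \<tau>2) = ext_v (\<Phi> \<epsilon>) (\<Phi>1 \<epsilon>) \<tau>2" if e: "0 < \<epsilon>" "\<epsilon> < \<tau>2" for \<epsilon>
  proof -
    note s = is_solutionD[OF sol[OF e]]
    have "\<exists>b. adss b \<and> adss.M b = ext_mass (\<Phi> \<epsilon>) (\<Phi>1 \<epsilon>) \<tau>2 \<and> adss.dom b \<tau>2 \<and>
      (\<forall>s\<ge>\<tau>2. \<Phi> \<epsilon> s = adss_phi (adss.M b) s) \<and> adss.VV b (cyl \<tau>2) = ext_v (\<Phi> \<epsilon>) (\<Phi>1 \<epsilon>) \<tau>2"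
    \<comment> \<open>The source vanishes already from \<tau>2 - \<epsilon> / 2 on. This margin
      makes \<tau>2 an interior point, at which value and derivative may be read off.\<close>
    proof (rule exterior[of "\<tau>2 - \<epsilon> / 2"])
      fix t assume t: "\<tau>2 - \<epsilon> / 2 < t"
      then have t0: "0 < t" using e by simp
      show "(\<Phi> \<epsilon> has_real_derivative \<Phi>1 \<epsilon> t) (at t)" "1 < \<Phi> \<epsilon> t" using s(2,4)[of t] t0 by auto
      show "(\<Phi>1 \<epsilon> has_real_derivative GG (\<Phi> \<epsilon> t) - 2 * (cosh t / sinh t) * \<Phi>1 \<epsilon> t) (at t)"
        using s(3)[OF t0] F_out[OF e, of t] t by simp
    qed (use e in auto)
    then show ?thesis unfolding m_def by metis
  qed
  have comp: "x \<in> hyp_space - hyp_ball \<tau>2 \<longleftrightarrow> x \<in> hyp_space \<and> \<tau>2 \<le> hyp_rho x" for x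
    by (auto simp: hyp_ball_def)
  have main: "radial_solution (\<psi> \<circ> hyp_rho) (f\<epsilon> \<epsilon>) (\<Phi> \<epsilon> \<circ> hyp_rho)"
    "\<forall>u. radial_solution (\<psi> \<circ> hyp_rho) (f\<epsilon> \<epsilon>) u \<longrightarrow> (\<forall>x\<in>hyp_space. u x = (\<Phi> \<epsilon> \<circ> hyp_rho) x)"
    "\<forall>x\<in>hyp_ball \<tau>2. - 6 \<le> scalar_curvature (conformal (\<Phi> \<epsilon> \<circ> hyp_rho) hyp_metric) x"
    "\<forall>x\<in>hyp_space - hyp_ball \<tau>2. scalar_curvature (conformal (\<Phi> \<epsilon> \<circ> hyp_rho) hyp_metric) x = - 6"
    "0 < m \<epsilon>" "adss_rho0 (m \<epsilon>) < \<tau>2"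
    "\<forall>x\<in>hyp_space - hyp_ball \<tau>2. conformal (\<Phi> \<epsilon> \<circ> hyp_rho) hyp_metric x = adss_metric (m \<epsilon>) x"
    "asymptotically_hyperbolic hyp_space (conformal (\<Phi> \<epsilon> \<circ> hyp_rho) hyp_metric)"
    if e: "0 < \<epsilon>" "\<epsilon> < \<tau>2" for \<epsilon>
  proof -
    have same: "radial_solution (\<psi> \<circ> hyp_rho) (f\<epsilon> \<epsilon>) u \<longleftrightarrow> radial_solution (\<psi> \<circ> hyp_rho) (\<lambda>x. F \<epsilon> (hyp_rho x)) u" for u
      unfolding radial_solution_def using f\<epsilon> by auto
    show "radial_solution (\<psi> \<circ> hyp_rho) (f\<epsilon> \<epsilon>) (\<Phi> \<epsilon> \<circ> hyp_rho)"
      unfolding same by (rule solution_radial[OF sol[OF e]])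
    show "\<forall>u. radial_solution (\<psi> \<circ> hyp_rho) (f\<epsilon> \<epsilon>) u \<longrightarrow> (\<forall>x\<in>hyp_space. u x = (\<Phi> \<epsilon> \<circ> hyp_rho) x)"
    proof (intro allI impI ballI)
      fix u and x :: "real^3" assume u: "radial_solution (\<psi> \<circ> hyp_rho) (f\<epsilon> \<epsilon>) u" and x: "x \<in> hyp_space"
      show "u x = (\<Phi> \<epsilon> \<circ> hyp_rho) x"
        unfolding comp_apply[of "\<Phi> \<epsilon>"] by (rule solution_unique[OF sol[OF e] same[THEN iffD1, OF u] x])
    qed
    show "\<forall>x\<in>hyp_ball \<tau>2. - 6 \<le> scalar_curvature (conformal (\<Phi> \<epsilon> \<circ> hyp_rho) hyp_metric) x"
      using scalar_curvature_solution(1)[OF sol[OF e] _ F_bounds(2)[OF e hyp_rho_nonneg]] by (auto simp: hyp_ball_def)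
    show "\<forall>x\<in>hyp_space - hyp_ball \<tau>2. scalar_curvature (conformal (\<Phi> \<epsilon> \<circ> hyp_rho) hyp_metric) x = - 6"
      unfolding Ball_def comp using scalar_curvature_solution(2)[OF sol[OF e] _ F_out[OF e]] e by auto
    obtain b where b: "adss b" "adss.M b = m \<epsilon>" "adss.dom b \<tau>2" "\<And>s. \<tau>2 \<le> s \<Longrightarrow> \<Phi> \<epsilon> s = adss_phi (m \<epsilon>) s"
      using out[OF e] by blast
    interpret B: adss b by (rule b(1))
    show "0 < m \<epsilon>" using B.M_pos b(2) by simp
    show "adss_rho0 (m \<epsilon>) < \<tau>2" using B.adss_rho0_less[OF tau_pos(2)] b(2,3) by (simp add: B.dom_def)
    show "\<forall>x\<in>hyp_space - hyp_ball \<tau>2. conformal (\<Phi> \<epsilon> \<circ> hyp_rho) hyp_metric x = adss_metric (m \<epsilon>) x"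
      unfolding Ball_def comp using b(4) by (simp add: adss_metric_def conformal_def)
    obtain d where d: "B.good d" using B.good_exists by blast
    have "adss_filling b d (\<Phi> \<epsilon> \<circ> hyp_rho) \<tau>2"
    proof (intro adss_filling.intro adss_collar.intro adss_collar_axioms.intro adss_filling_axioms.intro b(1) d b(3))
      show "Ck_on 2 hyp_space (\<Phi> \<epsilon> \<circ> hyp_rho)" by (rule is_solutionD(7)[OF sol[OF e]])
      show "1 < (\<Phi> \<epsilon> \<circ> hyp_rho) x" if "x \<in> hyp_space" for x
        using is_solutionD(4)[OF sol[OF e] hyp_rho_nonneg[OF that]] by simp
      show "(\<Phi> \<epsilon> \<circ> hyp_rho) x = adss_phi B.M (hyp_rho x)" if "\<tau>2 \<le> hyp_rho x" for x
        using b(2,4) that by simp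
      show "\<exists>\<kappa> :: real \<Rightarrow> real. (\<forall>k. Ck_on k UNIV \<kappa>) \<and> (\<forall>r. 0 \<le> \<kappa> r \<and> \<kappa> r \<le> 1) \<and>
          (\<forall>r\<le>\<alpha>. \<kappa> r = 1) \<and> (\<forall>r\<ge>\<beta>. \<kappa> r = 0)" if "\<alpha> < \<beta>" for \<alpha> \<beta>
        by (rule cutoff_exists[where c="chi \<epsilon>" and A="\<tau>2 - \<epsilon>" and B="\<tau>2 - \<epsilon> / 2"])
           (use e that chi_smooth chi_range chi_one chi_zero in auto)
    qed
    then show "asymptotically_hyperbolic hyp_space (conformal (\<Phi> \<epsilon> \<circ> hyp_rho) hyp_metric)"
      by (rule adss_filling.asymptotically_hyperbolic)
  qed
  have est: "\<psi> s - \<Phi> \<epsilon> s \<le> \<delta> \<epsilon> / 3 * exp (3 * \<tau>2) * exp (- 3 * s)" "\<bar>\<Phi> \<epsilon> \<tau>2 - \<psi> \<tau>2\<bar> \<le> \<delta> \<epsilon> / 3"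
    "\<bar>\<Phi>1 \<epsilon> \<tau>2 - \<psi>1 \<tau>2\<bar> \<le> \<delta> \<epsilon> * \<tau>2" if e: "0 < \<epsilon>" "\<epsilon> < \<tau>2" and s: "\<tau>2 \<le> s" for \<epsilon> s
  proof -
    have Fo: "F \<epsilon> t = 0" if "\<tau>2 \<le> t" for t using F_out[OF e] that e by simp
    have lo: "f0 t \<le> F \<epsilon> t" if "0 < t" for t using F_bounds(1)[OF e] that by simp
    note H = sol[OF e] F_diff[OF e] lo Fo
    show "\<psi> s - \<Phi> \<epsilon> s \<le> \<delta> \<epsilon> / 3 * exp (3 * \<tau>2) * exp (- 3 * s)" by (rule solution_decay[OF H s])
    show "\<bar>\<Phi> \<epsilon> \<tau>2 - \<psi> \<tau>2\<bar> \<le> \<delta> \<epsilon> / 3"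
      using solution_close[OF H, of \<tau>2] is_solutionD(5)[OF sol[OF e], of \<tau>2] tau_pos by simp
    show "\<bar>\<Phi>1 \<epsilon> \<tau>2 - \<psi>1 \<tau>2\<bar> \<le> \<delta> \<epsilon> * \<tau>2"
      using solution_deriv_close[OF H] by (simp add: abs_minus_commute)
  qed
  have small: "\<forall>\<^sub>F \<epsilon> in at_right 0. 0 < \<epsilon> \<and> \<epsilon> < \<tau>2"
    unfolding eventually_at_right[OF tau_pos(2)] using tau_pos by (intro exI[of _ \<tau>2]) auto
  have lim: "((\<lambda>\<epsilon>. \<Phi> \<epsilon> \<tau>2) \<longlongrightarrow> \<psi> \<tau>2) (at_right 0)" "((\<lambda>\<epsilon>. \<Phi>1 \<epsilon> \<tau>2) \<longlongrightarrow> \<psi>1 \<tau>2) (at_right 0)"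
  proof -
    have "((\<lambda>\<epsilon>. \<Phi> \<epsilon> \<tau>2 - \<psi> \<tau>2) \<longlongrightarrow> 0) (at_right 0)"
    proof (rule Lim_null_comparison)
      show "\<forall>\<^sub>F \<epsilon> in at_right 0. norm (\<Phi> \<epsilon> \<tau>2 - \<psi> \<tau>2) \<le> \<delta> \<epsilon> / 3" using small by eventually_elim (use est(2) in auto)
      show "((\<lambda>\<epsilon>. \<delta> \<epsilon> / 3) \<longlongrightarrow> 0) (at_right 0)" using tendsto_divide[OF \<delta>_lim tendsto_const, of 3] by simp
    qed
    then show "((\<lambda>\<epsilon>. \<Phi> \<epsilon> \<tau>2) \<longlongrightarrow> \<psi> \<tau>2) (at_right 0)" by (simp add: LIM_zero_iff)
    have "((\<lambda>\<epsilon>. \<Phi>1 \<epsilon> \<tau>2 - \<psi>1 \<tau>2) \<longlongrightarrow> 0) (at_right 0)"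
    proof (rule Lim_null_comparison)
      show "\<forall>\<^sub>F \<epsilon> in at_right 0. norm (\<Phi>1 \<epsilon> \<tau>2 - \<psi>1 \<tau>2) \<le> \<delta> \<epsilon> * \<tau>2" using small by eventually_elim (use est(3) in auto)
      show "((\<lambda>\<epsilon>. \<delta> \<epsilon> * \<tau>2) \<longlongrightarrow> 0) (at_right 0)" by (rule tendsto_mult_left_zero[OF \<delta>_lim])
    qed
    then show "((\<lambda>\<epsilon>. \<Phi>1 \<epsilon> \<tau>2) \<longlongrightarrow> \<psi>1 \<tau>2) (at_right 0)" by (simp add: LIM_zero_iff)
  qed
  have pt: "0 < \<psi> \<tau>2" "0 < sinh \<tau>2" using psi_gt[rule_format, of \<tau>2] tau_pos by auto
  have dt: "A.dom \<tau>2" using taus by (intro dom_tau) auto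
  have at: "\<psi> \<tau>2 = adss_phi A.M \<tau>2" "\<psi>1 \<tau>2 = A.PP1 \<tau>2" using psi_outside psi1_outside AM by auto
  \<comment> \<open>Mass and mean curvature at \<tau>2 are continuous functions of the value and
    first derivative of the conformal factor there, so the two estimates at \<tau>2 carry over to
    them.\<close>
  have w_lim: "((\<lambda>\<epsilon>. ext_w (\<Phi> \<epsilon>) \<tau>2) \<longlongrightarrow> ext_w \<psi> \<tau>2) (at_right 0)"
    unfolding ext_w_def using pt by (intro tendsto_intros lim) auto
  have v_lim: "((\<lambda>\<epsilon>. ext_v (\<Phi> \<epsilon>) (\<Phi>1 \<epsilon>) \<tau>2) \<longlongrightarrow> ext_v \<psi> \<psi>1 \<tau>2) (at_right 0)"
    unfolding ext_v_def using pt by (intro tendsto_intros lim) auto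
  have "(m \<longlongrightarrow> ext_mass \<psi> \<psi>1 \<tau>2) (at_right 0)"
    unfolding m_def[abs_def] ext_mass_def using pt by (intro tendsto_intros w_lim v_lim) (auto simp: ext_w_def)
  moreover have "ext_mass \<psi> \<psi>1 \<tau>2 = M"
    using A.ext_phi(3)[OF dt] at AM by (simp add: ext_mass_def ext_w_def ext_v_def)
  ultimately have m_lim: "(m \<longlongrightarrow> M) (at_right 0)" by simp
  have "ext_v \<psi> \<psi>1 \<tau>2 = A.VV (cyl \<tau>2)" using A.ext_phi(2)[OF dt] at by (simp add: ext_v_def)
  \<comment> \<open>The assumption \<tau>2 < \<open>adss_rho2' M\<close> is by \<open>rho2'\<close>
    an open condition on the derivative of the profile at \<tau>2, hence inherited for small
    \<epsilon>.\<close>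
  then have "ext_v \<psi> \<psi>1 \<tau>2 < - 1" using A.rho2'[OF dt] assms(4) AM by simp
  from order_tendstoD(2)[OF v_lim this] obtain \<epsilon>0 where \<epsilon>0: "0 < \<epsilon>0"
    "\<And>\<epsilon>. 0 < \<epsilon> \<Longrightarrow> \<epsilon> < \<epsilon>0 \<Longrightarrow> ext_v (\<Phi> \<epsilon>) (\<Phi>1 \<epsilon>) \<tau>2 < - 1"
    unfolding eventually_at_right[OF tau_pos(2)] by auto
  have rho2: "\<tau>2 < adss_rho2' (m \<epsilon>)" if e: "0 < \<epsilon>" "\<epsilon> < \<tau>2" "\<epsilon> < \<epsilon>0" for \<epsilon>
  proof -
    obtain b where b: "adss b" "adss.M b = m \<epsilon>" "adss.dom b \<tau>2" "adss.VV b (cyl \<tau>2) = ext_v (\<Phi> \<epsilon>) (\<Phi>1 \<epsilon>) \<tau>2"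
      using out[OF e(1,2)] by blast
    then show ?thesis using adss.rho2'[OF b(1,3)] \<epsilon>0(2)[OF e(1,3)] by simp
  qed
  show ?thesis
  proof (rule exI[of _ "\<lambda>\<epsilon>. \<Phi> \<epsilon> \<circ> hyp_rho"], rule exI[of _ m], intro conjI)
    show "\<exists>C. (C \<longlongrightarrow> 0) (at_right 0) \<and> (\<forall>\<epsilon>. 0 < \<epsilon> \<and> \<epsilon> < \<tau>2 \<longrightarrow> (\<forall>x\<in>hyp_space - hyp_ball \<tau>2.
        \<psi> (hyp_rho x) - (\<Phi> \<epsilon> \<circ> hyp_rho) x \<le> C \<epsilon> * exp (- 3 * hyp_rho x)))"
    proof (intro exI[of _ "\<lambda>\<epsilon>. \<delta> \<epsilon> / 3 * exp (3 * \<tau>2)"] conjI allI impI)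
      show "((\<lambda>\<epsilon>. \<delta> \<epsilon> / 3 * exp (3 * \<tau>2)) \<longlongrightarrow> 0) (at_right 0)"
        using tendsto_mult_left_zero[OF \<delta>_lim, of "exp (3 * \<tau>2) / 3"] by simp
    qed (use est(1) comp in auto)
    show "\<exists>\<epsilon>0>0. \<forall>\<epsilon>. 0 < \<epsilon> \<and> \<epsilon> < \<tau>2 \<and> \<epsilon> < \<epsilon>0 \<longrightarrow> \<tau>2 < adss_rho2' (m \<epsilon>)" using \<epsilon>0(1) rho2 by blast
    show "\<exists>C. (C \<longlongrightarrow> 0) (at_right 0) \<and> (\<forall>\<epsilon>. 0 < \<epsilon> \<and> \<epsilon> < \<tau>2 \<longrightarrow> M - m \<epsilon> \<le> C \<epsilon>)"
      \<comment> \<open>The masses converge to \<open>M\<close>, so their difference is itself an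
        admissible bound.\<close>
      using tendsto_diff[OF tendsto_const m_lim, of M] by (intro exI[of _ "\<lambda>\<epsilon>. M - m \<epsilon>"]) auto
  qed (rule allI, rule impI, elim conjE, intro conjI main; assumption)
qed

end
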